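(* (1) For $\Delta_n^{+} = n^2 - 4$ (with $n \ge 3$) and for $\Delta_n^{-} = n^2 + 4$ (with $n \ge 1$), the class groups satisfy, for each sign separately, $$\log |\mathrm{Cl}(\mathcal{O}_{\Delta_n^{\pm}})| = \log n + o(\log n) \quad \text{as } n \to \infty.$$ (2) Let $\{\mathcal{O}^{(i)} : i \ge 1\}$ be a family of unit-generated real quadratic orders with discriminants $\Delta(\mathcal{O}^{(i)}) = n_i^2 \pm 4$, where $n_i \to \infty$ as $i \to \infty$, and suppose the associated fundamental discriminants satisfy $(\Delta(\mathcal{O}^{(i)}))_0 \le N$ for a fixed $N < \infty$. Then $$\log |\mathrm{Cl}(\mathcal{O}^{(i)})| = \log n_i + O_N(\log\log(n_i + 20)),$$ valid for all $n_i \ge 1$, where the implied constant depends only on $N$ and is effectively computable.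
   Context: For a quadratic discriminant $\Delta$ (nonsquare integer $\equiv 0,1\pmod 4$), $\mathcal{O}_\Delta = \mathbb{Z}[\frac{\Delta+\sqrt\Delta}{2}]$ is the quadratic order of discriminant $\Delta$. Writing $\Delta = f^2 \Delta_0$ with $\Delta_0$ a fundamental discriminant, $\Delta_0$ is the associated fundamental discriminant. An order is unit-generated if it is additively generated as a $\mathbb{Z}$-module by its unit group; the unit-generated real quadratic orders are exactly the $\mathcal{O}_\Delta$ with $\Delta = n^2-4$, $n\ge 3$, or $\Delta = n^2+4$, $n \ge 1$. $\mathrm{Cl}(\mathcal{O})$ denotes the (wide) class group: invertible fractional ideals modulo principal fractional ideals. *)

theory Defs
  imports
    Complex_Main
    "HOL-Algebra.Coset"
    "HOL-Library.Landau_Symbols"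
    "HOL-Computational_Algebra.Squarefree"
    "HOL-Computational_Algebra.Nth_Powers"
    "HOL-Computational_Algebra.Polynomial"
begin

section \<open>Quadratic discriminants and quadratic orders\<close>

definition quadratic_discriminant :: "int \<Rightarrow> bool" where
  "quadratic_discriminant \<Delta> \<longleftrightarrow> \<not> is_square \<Delta> \<and> (\<Delta> mod 4 = 0 \<or> \<Delta> mod 4 = 1)"

text \<open>Orders live inside the complex numbers; for \<open>\<Delta> > 0\<close> the value \<open>csqrt \<Delta>\<close> is the
  positive real square root.\<close>

definition quadratic_generator :: "int \<Rightarrow> complex" where
  "quadratic_generator \<Delta> = (of_int \<Delta> + csqrt (of_int \<Delta>)) / 2"

definition quadratic_order :: "int \<Rightarrow> complex set" where
  "quadratic_order \<Delta> = {poly (map_poly of_int p) (quadratic_generator \<Delta>) | p :: int poly. True}"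

definition fundamental_discriminant :: "int \<Rightarrow> bool" where
  "fundamental_discriminant D \<longleftrightarrow>
     D \<noteq> 1 \<and>
     (D mod 4 = 1 \<and> squarefree D \<or>
      D mod 4 = 0 \<and> ((D div 4) mod 4 = 2 \<or> (D div 4) mod 4 = 3) \<and> squarefree (D div 4))"

text \<open>This description is meaningful when \<open>\<Delta>\<close> is a quadratic discriminant; see
  \<open>ex1_associated_fundamental_discriminant\<close> below.\<close>

definition associated_fundamental_discriminant :: "int \<Rightarrow> int" where
  "associated_fundamental_discriminant \<Delta> =
     (THE D. fundamental_discriminant D \<and> (\<exists>f. f > 0 \<and> \<Delta> = f\<^sup>2 * D))"

lemma fundamental_square_factor:
  assumes "fundamental_discriminant (b\<^sup>2 * k)"
  shows "b\<^sup>2 = 1 \<or> b\<^sup>2 = 4 \<and> (k mod 4 = 2 \<or> k mod 4 = 3)"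
proof (cases "squarefree (b\<^sup>2 * k)")
  case True
  then have "b dvd 1" unfolding squarefree_def by simp
  then show ?thesis by (auto simp: zdvd1_eq abs_if power2_eq_square split: if_splits)
next
  case False
  then have D: "(b\<^sup>2 * k) mod 4 = 0"
    "((b\<^sup>2 * k) div 4) mod 4 = 2 \<or> ((b\<^sup>2 * k) div 4) mod 4 = 3"
    "squarefree ((b\<^sup>2 * k) div 4)"
    using assms unfolding fundamental_discriminant_def by auto
  show ?thesis
  proof (cases "even b")
    case True
    then obtain c where c: "b = 2 * c" by blast
    have e: "(b\<^sup>2 * k) div 4 = c\<^sup>2 * k" unfolding c by (simp add: power_mult_distrib)
    have "c dvd 1" using D(3) unfolding e squarefree_def by simp
    then have "c = 1 \<or> c = -1" by (auto simp: zdvd1_eq abs_if split: if_splits)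
    then have "c\<^sup>2 = 1" by auto
    then show ?thesis using D(2) unfolding e c by (simp add: power_mult_distrib)
  next
    case False
    have "coprime 4 (b\<^sup>2)"
    proof -
      have "coprime 2 b" using False by simp
      then have "coprime (2\<^sup>2) (b\<^sup>2)"
        by (simp only: coprime_power_left_iff coprime_power_right_iff simp_thms)
      then show ?thesis by simp
    qed
    moreover have "4 dvd b\<^sup>2 * k" using D(1) by presburger
    ultimately have "4 dvd k" by (simp add: coprime_dvd_mult_right_iff)
    then obtain m where m: "k = 4 * m" by blast
    have e: "(b\<^sup>2 * k) div 4 = b\<^sup>2 * m" unfolding m by simp
    have "b dvd 1" using D(3) unfolding e squarefree_def by simp
    then show ?thesis by (auto simp: zdvd1_eq abs_if power2_eq_square split: if_splits)
  qed
qed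

lemma odd_square_times_mod_4:
  fixes a k :: int
  assumes "odd a" shows "(a\<^sup>2 * k) mod 4 = k mod 4"
proof -
  obtain c where "a = 2 * c + 1" using assms by (rule oddE)
  then have "a\<^sup>2 * k = k + 4 * ((c\<^sup>2 + c) * k)" by (simp add: power2_eq_square algebra_simps)
  then show ?thesis by simp
qed

lemma fundamental_coprime_square_factors:
  assumes "fundamental_discriminant (b\<^sup>2 * k)" "fundamental_discriminant (a\<^sup>2 * k)" "coprime a b"
  shows "b\<^sup>2 = 1"
proof (rule ccontr)
  assume "b\<^sup>2 \<noteq> 1"
  with fundamental_square_factor[OF assms(1)]
  have b: "b\<^sup>2 = 4" and k: "k mod 4 = 2 \<or> k mod 4 = 3" by auto
  from b have "even (b\<^sup>2)" by simp
  then have "even b" by simp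
  with assms(3) have "odd a" using coprime_common_divisor[of a b 2] by auto
  from odd_square_times_mod_4[OF this, of k] k assms(2)
  show False unfolding fundamental_discriminant_def
    by (elim conjE disjE; linarith)
qed

lemma ex1_associated_fundamental_discriminant:
  assumes "quadratic_discriminant \<Delta>"
  shows "\<exists>!D. fundamental_discriminant D \<and> (\<exists>f. f > 0 \<and> \<Delta> = f\<^sup>2 * D)"
proof -
  have nz: "\<Delta> \<noteq> 0" using assms unfolding quadratic_discriminant_def by auto
  define P where "P m \<longleftrightarrow> m > 0 \<and> (\<exists>D. \<Delta> = (int m)\<^sup>2 * D \<and> (D mod 4 = 0 \<or> D mod 4 = 1))" for m
  have P1: "P 1" using assms unfolding P_def quadratic_discriminant_def by auto
  have bound: "m \<le> nat \<bar>\<Delta>\<bar>" if "P m" for m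
  proof -
    have "int m dvd \<Delta>" using that unfolding P_def by (auto simp: power2_eq_square)
    then have "\<bar>int m\<bar> \<le> \<bar>\<Delta>\<bar>" using nz by (intro dvd_imp_le_int)
    then show ?thesis by linarith
  qed
  define m where "m = (GREATEST m. P m)"
  have Pm: "P m" unfolding m_def using P1 bound by (rule GreatestI_nat)
  have max: "m' \<le> m" if "P m'" for m' unfolding m_def using that bound by (rule Greatest_le_nat)
  from Pm obtain D where D: "\<Delta> = (int m)\<^sup>2 * D" "D mod 4 = 0 \<or> D mod 4 = 1" and m0: "m > 0"
    unfolding P_def by auto
  have unit: "x\<^sup>2 = 1" if "D = x\<^sup>2 * E" "E mod 4 = 0 \<or> E mod 4 = 1" for x E
  proof -
    have "x \<noteq> 0" using that nz D by auto
    then have "P (m * nat \<bar>x\<bar>)" unfolding P_def using that D(1) m0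
      by (auto intro!: exI[of _ E] simp: power_mult_distrib)
    then have "m * nat \<bar>x\<bar> \<le> m * 1" using max by simp
    then have "nat \<bar>x\<bar> \<le> 1" using m0 by (simp only: mult_le_cancel1)
    then have "\<bar>x\<bar> = 1" using \<open>x \<noteq> 0\<close> by linarith
    then show ?thesis by (metis one_power2 power2_abs)
  qed
  have fD: "fundamental_discriminant D"
  proof (cases "D mod 4 = 1")
    case True
    have "x dvd 1" if "x\<^sup>2 dvd D" for x
    proof -
      from that obtain E where E: "D = x\<^sup>2 * E" by blast
      have "odd D" using True by presburger
      then have "odd x" using E by simp
      then have "E mod 4 = 1" using odd_square_times_mod_4 E True by metis
      then have "x\<^sup>2 = 1" using unit E by blast
      then show ?thesis by (metis dvd_triv_left power2_eq_square)
    qed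
    moreover have "D \<noteq> 1" using assms D(1) unfolding quadratic_discriminant_def by auto
    ultimately show ?thesis using True unfolding fundamental_discriminant_def squarefree_def by auto
  next
    case False
    then have D0: "D mod 4 = 0" using D by auto
    then obtain k where k: "D = 4 * k" by (metis mod_0_imp_dvd dvdE)
    have "\<not> (k mod 4 = 0 \<or> k mod 4 = 1)" using unit[of 2 k] k by auto
    then have k4: "k mod 4 = 2 \<or> k mod 4 = 3" by presburger
    have "x dvd 1" if "x\<^sup>2 dvd k" for x
    proof -
      from that obtain E where E: "k = x\<^sup>2 * E" by blast
      have "x\<^sup>2 = 1" using unit[of x "4 * E"] E k by simp
      then show ?thesis by (metis dvd_triv_left power2_eq_square)
    qed
    then have "squarefree k" unfolding squarefree_def by auto
    with k k4 show ?thesis unfolding fundamental_discriminant_def by auto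
  qed
  have uniq: "D1 = D2" if 1: "fundamental_discriminant D1" "f > 0" "\<Delta> = f\<^sup>2 * D1"
    and 2: "fundamental_discriminant D2" "g > 0" "\<Delta> = g\<^sup>2 * D2" for D1 D2 f g
  proof -
    define d where "d = gcd f g"
    have d0: "d \<noteq> 0" using 1 unfolding d_def by auto
    obtain a b where ab: "f = a * d" "g = b * d" "coprime a b"
      using gcd_coprime_exists[of f g] d0 unfolding d_def by auto
    have eq: "a\<^sup>2 * D1 = b\<^sup>2 * D2"
      using 1(3) 2(3) d0 unfolding ab by (simp add: power_mult_distrib)
    have cop: "coprime (b\<^sup>2) (a\<^sup>2)" using ab(3) by (simp add: coprime_commute)
    have "b\<^sup>2 dvd a\<^sup>2 * D1" using eq by simp
    then have "b\<^sup>2 dvd D1" using cop by (simp add: coprime_dvd_mult_right_iff)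
    then obtain k where k1: "D1 = b\<^sup>2 * k" by blast
    have "b \<noteq> 0" using ab 2 by auto
    then have k2: "D2 = a\<^sup>2 * k" using eq k1 by (simp add: algebra_simps)
    have "b\<^sup>2 = 1" using fundamental_coprime_square_factors 1(1) 2(1) ab(3) k1 k2 by blast
    moreover have "a\<^sup>2 = 1"
      using fundamental_coprime_square_factors[of a k b] 1(1) 2(1) ab(3) k1 k2
      by (simp add: coprime_commute)
    ultimately show ?thesis using k1 k2 by simp
  qed
  show ?thesis
  proof (rule ex1I[of _ D])
    show "fundamental_discriminant D \<and> (\<exists>f. f > 0 \<and> \<Delta> = f\<^sup>2 * D)"
      using fD D(1) m0 by (intro conjI exI[of _ "int m"]) auto
    show "D' = D" if "fundamental_discriminant D' \<and> (\<exists>f. f > 0 \<and> \<Delta> = f\<^sup>2 * D')" for D'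
      using that uniq[of D' _ D "int m"] fD D(1) m0 by auto
  qed
qed


section \<open>Unit-generated rings and class groups\<close>

text \<open>The ring \<open>R\<close> is always a subring of an ambient field, given by its underlying set.\<close>

definition int_span :: "'a::comm_ring_1 set \<Rightarrow> 'a set" where
  "int_span S = module.span (\<lambda>(n::int) x. of_int n * x) S"

definition ring_units :: "'a::field set \<Rightarrow> 'a set" where
  "ring_units R = {u \<in> R. \<exists>v\<in>R. u * v = 1}"

definition unit_generated :: "'a::field set \<Rightarrow> bool" where
  "unit_generated R \<longleftrightarrow> int_span (ring_units R) = R"

definition quotient_field :: "'a::field set \<Rightarrow> 'a set" where
  "quotient_field R = {a / b | a b. a \<in> R \<and> b \<in> R \<and> b \<noteq> 0}"

definition fractional_ideal :: "'a::field set \<Rightarrow> 'a set \<Rightarrow> bool" where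
  "fractional_ideal R I \<longleftrightarrow>
     I \<subseteq> quotient_field R \<and> I \<noteq> {0} \<and> 0 \<in> I \<and>
     (\<forall>x\<in>I. \<forall>y\<in>I. x + y \<in> I) \<and> (\<forall>r\<in>R. \<forall>x\<in>I. r * x \<in> I) \<and>
     (\<exists>d\<in>R. d \<noteq> 0 \<and> (\<forall>x\<in>I. d * x \<in> R))"

definition ideal_product :: "'a::field set \<Rightarrow> 'a set \<Rightarrow> 'a set" where
  "ideal_product I J = int_span {x * y | x y. x \<in> I \<and> y \<in> J}"

definition invertible_ideal :: "'a::field set \<Rightarrow> 'a set \<Rightarrow> bool" where
  "invertible_ideal R I \<longleftrightarrow>
     fractional_ideal R I \<and> (\<exists>J. fractional_ideal R J \<and> ideal_product I J = R)"

definition ideal_group :: "'a::field set \<Rightarrow> 'a set monoid" where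
  "ideal_group R = \<lparr>carrier = {I. invertible_ideal R I}, monoid.mult = ideal_product, one = R\<rparr>"

definition principal_ideals :: "'a::field set \<Rightarrow> 'a set set" where
  "principal_ideals R = {(\<lambda>r. a * r) ` R | a. a \<in> quotient_field R \<and> a \<noteq> 0}"

definition class_group :: "'a::field set \<Rightarrow> 'a set set monoid" where
  "class_group R = ideal_group R Mod principal_ideals R"


section \<open>Computable functions\<close>

text \<open>Kleene's partial recursive functions.  \<open>rec_eval e xs y\<close> means that the program \<open>e\<close>
  halts on the arguments \<open>xs\<close> with value \<open>y\<close>.\<close>

datatype recf =
    Rec_Zero | Rec_Succ | Rec_Proj nat | Rec_Comp recf "recf list" | Rec_Prim recf recf | Rec_Mu recf

inductive rec_eval :: "recf \<Rightarrow> nat list \<Rightarrow> nat \<Rightarrow> bool" where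
  "rec_eval Rec_Zero xs 0"
| "rec_eval Rec_Succ [x] (Suc x)"
| "i < length xs \<Longrightarrow> rec_eval (Rec_Proj i) xs (xs ! i)"
| "list_all2 (\<lambda>g y. rec_eval g xs y) gs ys \<Longrightarrow> rec_eval f ys z \<Longrightarrow>
     rec_eval (Rec_Comp f gs) xs z"
| "rec_eval f xs y \<Longrightarrow> rec_eval (Rec_Prim f g) (0 # xs) y"
| "rec_eval (Rec_Prim f g) (k # xs) y \<Longrightarrow> rec_eval g (k # y # xs) z \<Longrightarrow>
     rec_eval (Rec_Prim f g) (Suc k # xs) z"
| "rec_eval f (k # xs) 0 \<Longrightarrow> (\<forall>j<k. \<exists>y. rec_eval f (j # xs) (Suc y)) \<Longrightarrow>
     rec_eval (Rec_Mu f) xs k"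
monos list_all2_mono

definition computable :: "(nat \<Rightarrow> nat) \<Rightarrow> bool" where
  "computable f \<longleftrightarrow> (\<exists>e. \<forall>x. rec_eval e [x] (f x))"

end

theory Submission
  imports Defs
    "HOL-Number_Theory.Number_Theory"
    "HOL-Library.Product_Plus"
    "HOL-Analysis.Uniform_Limit"
    "HOL-Real_Asymp.Real_Asymp"
begin

text \<open>The order of discriminant \<open>\<Delta> = n\<^sup>2 \<plusminus> 4\<close> contains the unit \<open>(n + \<surd>\<Delta>) / 2\<close>, so its regulator is only
  \<open>O(log n)\<close> and its class number \<open>h\<close> should be as large as \<open>\<surd>\<Delta>\<close>.

  Upper bound: dividing an ideal by an element of minimal norm shows that every class contains a
  lattice spanned by \<open>1\<close> and \<open>(b + \<surd>\<Delta>) / (2 a)\<close> with \<open>a \<le> \<surd>\<Delta> / 2\<close> and \<open>b\<close> one of the roots modulo \<open>2 a\<close>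
  of \<open>b\<^sup>2 \<equiv> \<Delta>\<close> modulo \<open>4 a\<close>. Counting these roots gives \<open>h = O(n log\<^sup>2 n)\<close>.

  Lower bound: the number of integral ideals of norm at most \<open>X\<close> and prime to \<open>2 \<Delta>\<close> is at least about
  \<open>X L(1, \<chi>) / log \<Delta>\<close>, where \<open>\<chi>\<close> is the Jacobi symbol of \<open>\<Delta>\<close>. The ideals in one class correspond to
  points of a lattice in the plane; normalising them by powers of the unit confines these points to a
  region that contains only \<open>O(X log n / \<surd>\<Delta>)\<close> of them. Hence \<open>h\<close> is at least a constant times
  \<open>L(1, \<chi>) n / log\<^sup>2 n\<close>.

  Part (1) then follows from Siegel's theorem that \<open>L(1, \<chi>)\<close> exceeds every fixed negative power of \<open>\<Delta>\<close>,
  obtained by applying the hyperbola method to the coefficients of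
  \<open>\<zeta>(s) L(s, \<chi>1) L(s, \<chi>2) L(s, \<chi>1 \<chi>2)\<close>. In part (2) one has \<open>\<Delta> = f\<^sup>2 \<Delta>0\<close> with \<open>\<Delta>0 \<le> N\<close>, and \<open>L(1, \<chi>)\<close>
  differs from the \<open>L\<close>-value of \<open>\<Delta>0\<close> by a factor of size \<open>O(log f)\<close>.\<close>


section \<open>The Jacobi symbol\<close>

text \<open>Both bounds for h lose powers of log n, which taking logarithms makes harmless, so L(1,
  \<chi>) matters only up to such factors. The two parts differ in the lower bound for L(1, \<chi>)
  that is fed in. Siegel's constant depends on a possible real zero of some unknown character and is
  not effective, so it serves part (1) alone. Part (2) asks for a computable constant; there
  \<Delta>0 is bounded, and the explicit bound exp(-23 B), with B = 8 \<Delta>0 bounding the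
  character sums, is affordable.

  The character is the Jacobi symbol of the whole, possibly imprimitive discriminant, set to 0 at
  even arguments: reciprocity then gives one uniform period, and passing from \<Delta>0 to f^2
  \<Delta>0 just removes finitely many Euler factors. L-functions occur at real s > 0, as limits of
  partial sums, and real zeros come from a change of sign.

  Norms are taken prime to 2 \<Delta> because the primitive ideals of such norms are invertible and
  are described by square roots of \<Delta>; the restriction costs the totient ratio of 2 \<Delta>,
  at most another logarithm.\<close>

lemma Legendre_values: "Legendre a p \<in> {-1, 0, 1}"
  by (auto simp: Legendre_def)

lemma Legendre_cong:
  assumes "[a = b] (mod p)"
  shows "Legendre a p = Legendre b p"
proof -
  have "[a = 0] (mod p) \<longleftrightarrow> [b = 0] (mod p)" "QuadRes p a \<longleftrightarrow> QuadRes p b"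
    using assms cong_trans cong_sym unfolding QuadRes_def by blast+
  then show ?thesis by (simp add: Legendre_def)
qed

text \<open>Upgrades the congruences of Euler's criterion to equalities: two elements of {-1, 0, 1}
  differ by at most 2, so a modulus above 2 separates them.\<close>

lemma small_cong_imp_eq:
  fixes x y p :: int
  assumes "[x = y] (mod p)" "2 < p" "x \<in> {-1, 0, 1}" "y \<in> {-1, 0, 1}"
  shows "x = y"
proof -
  have "p dvd x - y" using assms(1) by (simp add: cong_iff_dvd_diff)
  moreover have "\<bar>x - y\<bar> < \<bar>p\<bar>" using assms by auto
  ultimately show ?thesis using zdvd_imp_le[of p "\<bar>x - y\<bar>"] assms(2) by (cases "x = y") auto
qed

lemma Legendre_mult:
  assumes "prime p" "2 < p"
  shows "Legendre (a * b) (int p) = Legendre a (int p) * Legendre b (int p)"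
proof (rule small_cong_imp_eq)
  let ?k = "(p - 1) div 2"
  have "[Legendre (a * b) (int p) = a ^ ?k * b ^ ?k] (mod int p)"
    using euler_criterion[OF assms, of "a * b"] by (simp add: power_mult_distrib)
  moreover have "[Legendre a (int p) * Legendre b (int p) = a ^ ?k * b ^ ?k] (mod int p)"
    using euler_criterion[OF assms] by (intro cong_mult) auto
  ultimately show "[Legendre (a * b) (int p) = Legendre a (int p) * Legendre b (int p)] (mod int p)"
    using cong_sym cong_trans by blast
  show "2 < int p" using assms by simp
  show "Legendre (a * b) (int p) \<in> {-1, 0, 1}" by (rule Legendre_values)
  show "Legendre a (int p) * Legendre b (int p) \<in> {-1, 0, 1}"
    using Legendre_values[of a "int p"] Legendre_values[of b "int p"] by auto
qed

lemma Legendre_1: "prime p \<Longrightarrow> Legendre 1 (int p) = 1"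
proof -
  assume p: "prime p"
  have "QuadRes (int p) 1" unfolding QuadRes_def by (intro exI[of _ 1]) simp
  moreover have "\<not> [1 = 0] (mod int p)"
    using prime_gt_1_nat[OF p] by (simp add: unique_euclidean_semiring_class.cong_def)
  ultimately show ?thesis by (simp add: Legendre_def)
qed

lemma Legendre_eq_0_iff: "Legendre a (int p) = 0 \<longleftrightarrow> int p dvd a"
  by (auto simp: Legendre_def cong_0_iff)

text \<open>The value 0 at even \<open>n\<close>, in place of Kronecker's extension, makes the
  symbol completely multiplicative in \<open>n\<close> with period \<open>8 * D\<close> for every
  positive \<open>a = D\<close>, at the price of the Euler factor at 2.\<close>

definition jacobi :: "int \<Rightarrow> nat \<Rightarrow> int" where
  "jacobi a n = (if odd n then \<Prod>p\<in>#prime_factorization n. Legendre a (int p) else 0)"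

lemma jacobi_even [simp]: "even n \<Longrightarrow> jacobi a n = 0"
  by (simp add: jacobi_def)

lemma jacobi_1_right [simp]: "jacobi a 1 = 1" "jacobi a (Suc 0) = 1"
  by (simp_all add: jacobi_def)

lemma jacobi_mult_right: "jacobi a (m * n) = jacobi a m * jacobi a n"
proof (cases "odd m \<and> odd n")
  case True
  then have "m \<noteq> 0" "n \<noteq> 0" by (auto intro!: Nat.gr0I)
  then show ?thesis using True by (simp add: jacobi_def prime_factorization_mult)
qed (auto simp: jacobi_def)

lemma odd_prime_gt_2: "prime (p :: nat) \<Longrightarrow> odd p \<Longrightarrow> 2 < p"
  using prime_ge_2_nat[of p] by (cases "p = 2") auto

lemma jacobi_prime: "prime p \<Longrightarrow> odd p \<Longrightarrow> jacobi a p = Legendre a (int p)"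
  by (simp add: jacobi_def prime_factorization_prime)

lemma odd_prime_induct [consumes 1, case_names one mult]:
  assumes "odd (n :: nat)" "P 1"
    "\<And>p m. prime p \<Longrightarrow> odd p \<Longrightarrow> odd m \<Longrightarrow> P m \<Longrightarrow> P (p * m)"
  shows "P n"
  using assms(1)
proof (induction n rule: less_induct)
  case (less n)
  show ?case
  proof (cases "n = 1")
    case False
    then obtain p where p: "prime p" "p dvd n" using prime_factor_nat by blast
    then obtain m where m: "n = p * m" by blast
    have "odd p" "odd m" using less.prems m by auto
    moreover have "m > 0" using m less.prems by (auto intro!: Nat.gr0I)
    then have "m < n" using m prime_gt_1_nat[OF p(1)] by simp
    ultimately show ?thesis using assms(3)[OF p(1)] less.IH m by blast
  qed (use assms(2) in simp)
qed

lemma jacobi_mult_left: "jacobi (a * b) n = jacobi a n * jacobi b n"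
proof (cases "odd n")
  case True
  then show ?thesis
    by (induction n rule: odd_prime_induct)
      (auto simp: jacobi_mult_right jacobi_prime Legendre_mult odd_prime_gt_2)
qed simp

lemma jacobi_1_left: "odd n \<Longrightarrow> jacobi 1 n = 1"
  by (induction n rule: odd_prime_induct) (auto simp: jacobi_mult_right jacobi_prime Legendre_1)

lemma jacobi_values: "jacobi a n \<in> {-1, 0, 1}"
proof (cases "odd n")
  case True
  then show ?thesis
  proof (induction n rule: odd_prime_induct)
    case (mult p m)
    then show ?case using Legendre_values[of a "int p"] by (auto simp: jacobi_mult_right jacobi_prime)
  qed simp
qed simp

lemma jacobi_eq_0_iff: "jacobi a n = 0 \<longleftrightarrow> even n \<or> \<not> coprime a (int n)"
proof (cases "odd n")
  case True
  then show ?thesis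
  proof (induction n rule: odd_prime_induct)
    case (mult p m)
    have "coprime a (int p) \<longleftrightarrow> \<not> int p dvd a"
      using mult(1) prime_imp_coprime_int[of "int p" a] coprime_common_divisor[of a "int p" "int p"]
      by (auto simp: coprime_commute not_prime_unit)
    then have "coprime a (int (p * m)) \<longleftrightarrow> \<not> int p dvd a \<and> coprime a (int m)"
      by (simp only: of_nat_mult coprime_mult_right_iff)
    then show ?case using mult by (simp add: jacobi_mult_right jacobi_prime Legendre_eq_0_iff)
  qed simp
qed simp

lemma jacobi_cong:
  assumes "[a = b] (mod int n)"
  shows "jacobi a n = jacobi b n"
proof (cases "odd n")
  case True
  then show ?thesis using assms
  proof (induction n rule: odd_prime_induct)
    case (mult p m)
    then have "[a = b] (mod int p)" "[a = b] (mod int m)"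
      using cong_modulus_mult[of a b "int p" "int m"] cong_modulus_mult[of a b "int m" "int p"]
      by (simp_all add: mult.commute)
    then show ?case using mult by (simp add: jacobi_mult_right jacobi_prime Legendre_cong)
  qed simp
qed simp

section \<open>Reciprocity and the supplementary laws for the Jacobi symbol\<close>

lemma coprime_odd_mult_mod4:
  assumes "odd (p :: nat)" "odd m"
  shows "(p * m) mod 4 = 3 \<longleftrightarrow> (p mod 4 = 3) \<noteq> (m mod 4 = 3)"
proof -
  have "p mod 4 = 1 \<or> p mod 4 = 3" "m mod 4 = 1 \<or> m mod 4 = 3" using assms by presburger+
  then show ?thesis by (auto simp: mod_mult_eq[symmetric, of p m])
qed

lemma neg_one_power_half:
  assumes "odd (p :: nat)"
  shows "(-1 :: int) ^ ((p - 1) div 2) = (if p mod 4 = 3 then -1 else 1)"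
proof -
  have "odd ((p - 1) div 2) \<longleftrightarrow> p mod 4 = 3" using assms by presburger
  then show ?thesis by (auto simp: uminus_power_if)
qed

text \<open>Peels off the prime factors of \<open>m\<close>, starting from the law for two primes.
  The sign is multiplicative in \<open>m\<close> because a product of two odd numbers is 3 modulo 4
  exactly when one and only one factor is. \<open>jacobi_reciprocity\<close> repeats the induction
  in the other argument.\<close>

lemma jacobi_reciprocity_prime:
  assumes "prime p" "odd p" "odd m" "\<not> p dvd m"
  shows "jacobi (int p) m * jacobi (int m) p = (if p mod 4 = 3 \<and> m mod 4 = 3 then -1 else 1)"
  using assms(3,4)
proof (induction m rule: odd_prime_induct)
  case one
  then show ?case using assms by (simp add: jacobi_1_left)
next
  case (mult q m)
  have "p \<noteq> q" using mult by auto
  have "Legendre (int p) (int q) * Legendre (int q) (int p)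
        = (-1) ^ ((p - 1) div 2 * ((q - 1) div 2))"
    using \<open>p \<noteq> q\<close> mult(1,2) assms(1,2)
    by (intro Quadratic_Reciprocity) (auto intro: odd_prime_gt_2)
  also have "\<dots> = (if p mod 4 = 3 \<and> q mod 4 = 3 then -1 else 1)"
    using neg_one_power_half[OF assms(2)] neg_one_power_half[OF mult(2)]
    by (auto simp: power_mult)
  finally have *: "jacobi (int p) q * jacobi (int q) p = (if p mod 4 = 3 \<and> q mod 4 = 3 then -1 else 1)"
    using mult(1,2) assms(1,2) by (simp add: jacobi_prime)
  have "jacobi (int p) (q * m) * jacobi (int (q * m)) p =
     (jacobi (int p) q * jacobi (int q) p) * (jacobi (int p) m * jacobi (int m) p)"
    by (simp add: jacobi_mult_right jacobi_mult_left)
  also have "\<not> p dvd m" using mult.prems by auto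
  then have "jacobi (int p) m * jacobi (int m) p = (if p mod 4 = 3 \<and> m mod 4 = 3 then -1 else 1)"
    by (rule mult.IH)
  finally show ?case using coprime_odd_mult_mod4[of q m] mult(2,3) unfolding * by auto
qed

theorem jacobi_reciprocity:
  assumes "odd n" "odd m" "coprime m n"
  shows "jacobi (int m) n * jacobi (int n) m = (if m mod 4 = 3 \<and> n mod 4 = 3 then -1 else 1)"
  using assms(1,3)
proof (induction n rule: odd_prime_induct)
  case one
  then show ?case using assms by (simp add: jacobi_1_left)
next
  case (mult p n)
  have "coprime m n" "coprime m p" using mult by auto
  have "\<not> p dvd m" using \<open>coprime m p\<close> mult(1)
    by (metis coprime_common_divisor dvd_refl not_prime_unit)
  have "jacobi (int m) (p * n) * jacobi (int (p * n)) m =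
     (jacobi (int p) m * jacobi (int m) p) * (jacobi (int m) n * jacobi (int n) m)"
    by (simp add: jacobi_mult_right jacobi_mult_left)
  also have "\<dots> = (if p mod 4 = 3 \<and> m mod 4 = 3 then -1 else 1) * (if m mod 4 = 3 \<and> n mod 4 = 3 then -1 else 1)"
    using jacobi_reciprocity_prime[OF mult(1,2) assms(2) \<open>\<not> p dvd m\<close>] mult.IH \<open>coprime m n\<close> by simp
  finally show ?case using coprime_odd_mult_mod4[of p n] mult(2,3) by auto
qed

lemma jacobi_minus_1:
  assumes "odd n"
  shows "jacobi (-1) n = (if n mod 4 = 3 then -1 else 1)"
  using assms
proof (induction n rule: odd_prime_induct)
  case (mult p m)
  have "Legendre (-1) (int p) = (-1) ^ ((p - 1) div 2)"
    using euler_criterion[OF mult(1) odd_prime_gt_2[OF mult(1,2)], of "-1"] Legendre_values odd_prime_gt_2[OF mult(1,2)]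
    by (intro small_cong_imp_eq[where p = "int p"]) (auto simp: uminus_power_if)
  then show ?case using mult coprime_odd_mult_mod4[of p m] neg_one_power_half[of p]
    by (auto simp: jacobi_mult_right jacobi_prime)
qed simp

text \<open>Modulo each other, \<open>n\<close> and \<open>n + 2\<close> are -2 and 2, and they are
  not both 3 modulo 4, so reciprocity relates their symbols with sign +1. This yields the second
  supplementary law by a recursion in steps of 2.\<close>

lemma jacobi_2_step:
  assumes "odd n"
  shows "jacobi 2 (n + 2) = jacobi (-1) (n + 2) * jacobi 2 n"
proof -
  have odd: "odd (n + 2)" using assms by simp
  have cop: "coprime n (n + 2)"
  proof (rule coprimeI)
    fix d assume d: "d dvd n" "d dvd n + 2"
    then have "d dvd 2" using dvd_add_right_iff[of d n 2] by blast
    then have "d \<le> 2" "d \<noteq> 0" by (auto intro: dvd_imp_le intro!: Nat.gr0I)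
    moreover have "d \<noteq> 2" using d(1) assms by auto
    ultimately have "d = 1" by linarith
    then show "is_unit d" by simp
  qed
  have "jacobi (-2) (n + 2) = jacobi (int n) (n + 2)"
    by (rule jacobi_cong) (simp add: cong_iff_dvd_diff dvd_def, rule exI[of _ "-1"], simp)
  moreover have "jacobi (int (n + 2)) n = jacobi 2 n"
    by (rule jacobi_cong) (simp add: cong_iff_dvd_diff)
  moreover have "jacobi (int n) (n + 2) * jacobi (int (n + 2)) n = 1"
  proof -
    have "\<not> (n mod 4 = 3 \<and> (n + 2) mod 4 = 3)" by presburger
    then show ?thesis using jacobi_reciprocity[OF odd assms cop] by simp
  qed
  ultimately have "jacobi (-2) (n + 2) = jacobi 2 n"
    using jacobi_values[of 2 n] jacobi_values[of "-2" "n + 2"] by auto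
  moreover have "jacobi (-2) (n + 2) = jacobi (-1) (n + 2) * jacobi 2 (n + 2)"
    using jacobi_mult_left[of "-1" 2 "n + 2"] by simp
  moreover have "jacobi (-1) (n + 2) * jacobi (-1) (n + 2) = 1" using jacobi_minus_1[OF odd] by simp
  ultimately show ?thesis by (metis mult.assoc mult_1)
qed

text \<open>Four steps multiply the symbol by that of -1 at \<open>n + 2\<close>,
  \<open>n + 4\<close>, \<open>n + 6\<close>, \<open>n + 8\<close>; for odd \<open>n\<close> exactly
  two of these are 3 modulo 4, so the signs cancel.\<close>

lemma jacobi_2_add_8: "jacobi 2 (n + 8) = jacobi 2 n"
proof (cases "odd n")
  case True
  have "jacobi 2 (n + 8) = jacobi (-1) (n + 8) * jacobi 2 (n + 6)"
    "jacobi 2 (n + 6) = jacobi (-1) (n + 6) * jacobi 2 (n + 4)"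
    "jacobi 2 (n + 4) = jacobi (-1) (n + 4) * jacobi 2 (n + 2)"
    using jacobi_2_step[of "n + 2"] jacobi_2_step[of "n + 4"] jacobi_2_step[of "n + 6"] True
    by (simp_all only: add.assoc even_add arith_simps even_numeral simp_thms)
  then have "jacobi 2 (n + 8) = jacobi (-1) (n + 8) * (jacobi (-1) (n + 6) * (jacobi (-1) (n + 4) * (jacobi (-1) (n + 2) * jacobi 2 n)))"
    using jacobi_2_step[OF True] by (simp only:)
  moreover have "n mod 4 = 1 \<or> n mod 4 = 3" using True by presburger
  then have "(n + 8) mod 4 = 3 \<longleftrightarrow> n mod 4 = 3" "(n + 4) mod 4 = 3 \<longleftrightarrow> n mod 4 = 3"
    "(n + 6) mod 4 = 3 \<longleftrightarrow> n mod 4 \<noteq> 3" "(n + 2) mod 4 = 3 \<longleftrightarrow> n mod 4 \<noteq> 3" by presburger+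
  ultimately show ?thesis using True jacobi_minus_1[of "n+2"] jacobi_minus_1[of "n+4"] jacobi_minus_1[of "n+6"] jacobi_minus_1[of "n+8"]
    by auto
qed simp

section \<open>Periodicity in the lower argument, and nontriviality\<close>

lemma jacobi_2_periodic: "jacobi 2 (n + 8 * k) = jacobi 2 n"
proof (induction k)
  case (Suc k)
  then show ?case using jacobi_2_add_8[of "n + 8 * k"] by (simp add: algebra_simps)
qed simp

text \<open>Factors 2 of \<open>D\<close> are removed one at a time, using the period 8 of the
  symbol of 2. For odd \<open>D\<close>, reciprocity moves \<open>n\<close> to the upper argument,
  where a multiple of \<open>D\<close> changes nothing; the reciprocity signs agree because the
  shift is also a multiple of 4.\<close>

lemma jacobi_periodic_mult:
  assumes "D > 0"
  shows "jacobi (int D) (n + 8 * D * k) = jacobi (int D) n"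
  using assms
proof (induction D arbitrary: k rule: less_induct)
  case (less D)
  show ?case
  proof (cases "even D")
    case True
    then obtain E where E: "D = 2 * E" by blast
    have "jacobi (int E) (n + 8 * E * (2 * k)) = jacobi (int E) n"
      using less E by (intro less.IH) auto
    moreover have "jacobi 2 (n + 8 * (D * k)) = jacobi 2 n" by (rule jacobi_2_periodic)
    ultimately show ?thesis
      using jacobi_mult_left[of 2 "int E"] unfolding E by (simp add: algebra_simps)
  next
    case oD: False
    let ?n = "n + 8 * D * k"
    have cop: "coprime D ?n \<longleftrightarrow> coprime D n"
    proof -
      have "gcd D ?n = gcd D n"
        using gcd_add_mult[of D "8 * k" n] by (simp add: algebra_simps)
      then show ?thesis by (simp only: coprime_iff_gcd_eq_1)
    qed
    show ?thesis
    proof (cases "odd n \<and> coprime D n")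
      case False
      have "odd ?n \<longleftrightarrow> odd n" by simp
      then have "jacobi (int D) n = 0" "jacobi (int D) ?n = 0"
        using False cop by (simp_all only: jacobi_eq_0_iff coprime_int_iff) blast+
      then show ?thesis by simp
    next
      case True
      then have n: "odd n" "coprime D n" by auto
      have n': "odd ?n" "coprime D ?n" using n cop by auto
      have "jacobi (int ?n) D = jacobi (int n) D"
        by (rule jacobi_cong) (simp add: cong_iff_dvd_diff)
      moreover have "?n mod 4 = n mod 4"
        using mod_mult_self2[of n 4 "2 * D * k"] by (simp add: mult.assoc)
      ultimately have "jacobi (int D) ?n * jacobi (int n) D = jacobi (int D) n * jacobi (int n) D"
        using jacobi_reciprocity[OF n(1) _ n(2)] jacobi_reciprocity[OF n'(1) _ n'(2)] oD by simp
      moreover have "jacobi (int n) D \<noteq> 0"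
        using n oD by (auto simp: jacobi_eq_0_iff coprime_commute)
      ultimately show ?thesis by simp
    qed
  qed
qed


lemma jacobi_power_left: "odd n \<Longrightarrow> jacobi (a ^ k) n = jacobi a n ^ k"
  by (induction k) (auto simp: jacobi_mult_left jacobi_1_left)

lemma jacobi_power_right: "jacobi a (n ^ k) = jacobi a n ^ k"
  by (induction k) (auto simp: jacobi_mult_right)

text \<open>If every residue were a square, squaring would map a finite set onto itself and so be
  injective, against the equality of the squares of 1 and p - 1.\<close>

lemma exists_nonresidue:
  assumes "prime p" "odd p"
  obtains a :: nat where "jacobi (int a) p = -1"
proof -
  have p: "2 < p" using odd_prime_gt_2 assms by blast
  have "\<exists>a::nat. jacobi (int a) p = -1"
  proof (rule ccontr)
    assume *: "\<nexists>a::nat. jacobi (int a) p = -1"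
    have "{..<p} \<subseteq> (\<lambda>y. y\<^sup>2 mod p) ` {..<p}"
    proof
      fix a assume a: "a \<in> {..<p}"
      have "jacobi (int a) p \<noteq> -1" using * by blast
      then have "[int a = 0] (mod int p) \<or> QuadRes (int p) (int a)"
        using assms by (auto simp: jacobi_prime Legendre_def split: if_splits)
      then have "\<exists>y. [y\<^sup>2 = int a] (mod int p)"
        unfolding QuadRes_def by (metis cong_sym zero_power2)
      then obtain y where y: "[y\<^sup>2 = int a] (mod int p)" by blast
      define z where "z = nat (y mod int p)"
      have z: "int z = y mod int p" "z < p"
        using p unfolding z_def by (auto simp: nat_less_iff)
      have "int (z\<^sup>2 mod p) = y\<^sup>2 mod int p" using z(1) by (simp add: zmod_int power_mod)
      also have "\<dots> = int a mod int p" using y by (simp add: unique_euclidean_semiring_class.cong_def)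
      also have "\<dots> = int (a mod p)" by (simp add: zmod_int)
      finally have "z\<^sup>2 mod p = a" using a by simp
      then show "a \<in> (\<lambda>y. y\<^sup>2 mod p) ` {..<p}" using z(2) by auto
    qed
    then have "inj_on (\<lambda>y. y\<^sup>2 mod p) {..<p}"
      using p by (intro finite_surj_inj) auto
    moreover have "1\<^sup>2 mod p = (p - 1)\<^sup>2 mod p"
    proof -
      have "(p - 1)\<^sup>2 = 1 + p * (p - 2)"
      proof -
        obtain r where "p = r + 2" using p by (metis add.commute le_Suc_ex less_imp_le)
        then show ?thesis by (simp add: power2_eq_square algebra_simps)
      qed
      then have "(p - 1)\<^sup>2 mod p = 1 mod p" by (metis mod_mult_self2)
      then show ?thesis by simp
    qed
    ultimately have "1 = p - 1"
      using p inj_onD[of "\<lambda>y. y\<^sup>2 mod p" "{..<p}" 1 "p - 1"] by simp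
    then show False using p by simp
  qed
  then show ?thesis using that by blast
qed

lemma jacobi_2_cases: "jacobi 2 (5 + 8 * k) = -1" "jacobi 2 (1 + 8 * k) = 1"
proof -
  have e: "(1 :: nat) + 2 = 3" "(3 :: nat) + 2 = 5" by simp_all
  have "jacobi 2 3 = -1" using jacobi_2_step[of 1] jacobi_minus_1[of 3] unfolding e by simp
  then have "jacobi 2 5 = -1" using jacobi_2_step[of 3] jacobi_minus_1[of 5] unfolding e by simp
  then show "jacobi 2 (5 + 8 * k) = -1" using jacobi_2_periodic[of 5 k] by simp
  show "jacobi 2 (1 + 8 * k) = 1" using jacobi_2_periodic[of 1 k] by simp
qed

lemma coprime_8_odd: "odd (m :: nat) \<Longrightarrow> coprime 8 m"
  using coprime_power_left_iff[of 2 3 m] by simp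

text \<open>Write D = 2^e m with m odd. If m is not a square, some prime p divides it to an odd
  power; take n to be a nonresidue modulo p and 1 modulo 8 and modulo the rest of m, so that the
  symbol of 2 and the reciprocity sign are trivial. If m is a square then e is odd, and n = 5 modulo
  8, n = 1 modulo m works because the symbol of 2 is -1 there.\<close>

lemma jacobi_nontrivial:
  assumes "D > 0" "\<not> is_square (D :: nat)"
  obtains n where "jacobi (int D) n = -1"
proof -
  obtain e m where D: "D = 2 ^ e * m" "odd m"
  proof (rule multiplicity_decompose'[of D 2])
    show "D \<noteq> 0" "\<not> is_unit (2 :: nat)" using assms(1) by auto
  qed (use that in auto)
  have split: "jacobi (int D) n = jacobi 2 n ^ e * jacobi (int m) n" if "odd n" for n
    using that unfolding D by (simp add: jacobi_mult_left jacobi_power_left)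
  show ?thesis
  proof (cases "is_square m")
    case False
    then obtain p where p: "prime p" "odd (multiplicity p m)"
      by (auto simp: is_nth_power_conv_multiplicity_nat)
    define k where "k = multiplicity p m"
    have m0: "m \<noteq> 0" using D(2) by (auto intro!: Nat.gr0I)
    obtain m' where m': "m = p ^ k * m'" "\<not> p dvd m'"
    proof (rule multiplicity_decompose'[of m p])
      show "m \<noteq> 0" "\<not> is_unit p" using m0 p(1) not_prime_unit by auto
    qed (use that k_def in auto)
    have "k \<noteq> 0" using p(2) unfolding k_def by (intro notI) simp
    then have "p dvd m" unfolding m'(1) by simp
    then have op: "odd p" using D(2) by auto
    have "odd m'" using D(2) m' by auto
    obtain a where a: "jacobi (int a) p = -1" using exists_nonresidue[OF p(1) op] by blast
    have "coprime p (8 * m')"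
    proof -
      have "coprime p m'" using p(1) m'(2) by (simp add: prime_imp_coprime)
      moreover have "coprime p 8" using coprime_8_odd[OF op] by (simp add: coprime_commute)
      ultimately show ?thesis by simp
    qed
    then obtain n where n: "[n = a] (mod p)" "[n = 1] (mod 8 * m')"
      using binary_chinese_remainder_nat by blast
    have n8: "[n = 1] (mod 8)" and nm: "[n = 1] (mod m')"
      using n(2) cong_modulus_mult_nat[of n 1 8 m'] cong_modulus_mult_nat[of n 1 m' 8] by (simp_all add: mult.commute)
    then have "n mod 8 = 1" by (simp add: unique_euclidean_semiring_class.cong_def)
    then have n1: "n = 1 + 8 * (n div 8)" by presburger
    then have n4: "odd n" "n mod 4 \<noteq> 3" by presburger+
    have "jacobi (int n) p = jacobi (int a) p" "jacobi (int n) m' = jacobi 1 m'"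
      using n(1) nm by (auto intro!: jacobi_cong simp flip: cong_int_iff)
    moreover have "odd k" using p(2) by (simp add: k_def)
    ultimately have *: "jacobi (int n) m = -1"
      using a \<open>odd m'\<close> unfolding m'(1) by (simp add: jacobi_mult_right jacobi_power_right jacobi_1_left)
    then have "coprime m n" using jacobi_eq_0_iff[of "int n" m] by (auto simp: coprime_commute)
    then have "jacobi (int m) n = -1"
      using jacobi_reciprocity[OF n4(1) D(2)] n4(2) * by simp
    moreover have "jacobi 2 n = 1" using jacobi_2_cases(2) n1 by metis
    ultimately show ?thesis using split[OF n4(1)] that by simp
  next
    case True
    then obtain r where r: "m = r\<^sup>2" by (auto elim: is_nth_powerE)
    have oe: "odd e"
    proof
      assume "even e"
      then obtain i where "e = 2 * i" by blast
      then have "D = (2 ^ i * r)\<^sup>2" using D r by (simp add: power_mult power_mult_distrib power2_eq_square mult.commute)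
      then show False using assms(2) by (auto intro: is_nth_powerI)
    qed
    have "coprime 8 m" using D(2) by (rule coprime_8_odd)
    then obtain n where n: "[n = 5] (mod 8)" "[n = 1] (mod m)"
      using binary_chinese_remainder_nat by blast
    have "n mod 8 = 5" using n(1) by (simp add: unique_euclidean_semiring_class.cong_def)
    then have n1: "n = 5 + 8 * (n div 8)" by presburger
    then have "odd n" by presburger
    have "coprime n m" using cong_imp_coprime[OF cong_sym[OF n(2)]] by simp
    then have "coprime (int r) (int n)" unfolding r by (simp add: coprime_commute)
    then have "jacobi (int r) n \<noteq> 0" using \<open>odd n\<close> by (simp add: jacobi_eq_0_iff)
    then have "jacobi (int r) n ^ 2 = 1" using jacobi_values[of "int r" n] by auto
    then have "jacobi (int m) n = 1" unfolding r by (simp add: jacobi_mult_left power2_eq_square)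
    moreover have "jacobi 2 n = -1" using jacobi_2_cases(1) n1 by metis
    ultimately show ?thesis using split[OF \<open>odd n\<close>] oe that by simp
  qed
qed

section \<open>Sums of the symbol over intervals\<close>

lemma sum_periodic:
  fixes f :: "nat \<Rightarrow> 'a :: comm_ring_1"
  assumes "\<And>n. f (n + q) = f n"
  shows "sum f {..<q * k + r} = of_nat k * sum f {..<q} + sum f {..<r}"
proof -
  have per: "f (n + q * k) = f n" for n k
  proof (induction k)
    case (Suc k)
    then show ?case using assms[of "n + q * k"] by (simp add: algebra_simps)
  qed simp
  have shift: "sum f {..<a + b} = sum f {..<a} + (\<Sum>i<b. f (i + a))" for a b
    by (induction b) (auto simp: algebra_simps)
  have "sum f {..<q * k} = of_nat k * sum f {..<q}"
  proof (induction k)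
    case (Suc k)
    have "sum f {..<q * Suc k} = sum f {..<q * k + q}" by (simp add: algebra_simps)
    also have "\<dots> = of_nat k * sum f {..<q} + sum f {..<q}" by (simp only: shift per Suc)
    finally show ?case by (simp add: algebra_simps)
  qed simp
  then show ?thesis by (simp add: shift per)
qed

text \<open>Multiplication by an \<open>n\<close> of symbol -1 permutes the residues modulo
  \<open>8 * D\<close> and reverses the sign of the sum.\<close>

lemma sum_jacobi_period:
  assumes "D > 0" "\<not> is_square (D :: nat)"
  shows "(\<Sum>i<8 * D. jacobi (int D) i) = 0"
proof -
  let ?q = "8 * D" and ?f = "jacobi (int D)"
  obtain n where n: "?f n = -1" using jacobi_nontrivial[OF assms] by blast
  have "\<not> (even n \<or> \<not> coprime (int D) (int n))" using n jacobi_eq_0_iff[of "int D" n] by simp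
  then have "coprime 8 n" "coprime n D" using coprime_8_odd[of n] by (simp_all add: coprime_commute)
  then have cop: "coprime n ?q" by (simp add: coprime_commute)
  have mod: "?f (i mod ?q) = ?f i" for i
    using jacobi_periodic_mult[OF assms(1), of "i mod ?q" "i div ?q"] by simp
  have inj: "inj_on (\<lambda>i. n * i mod ?q) {..<?q}"
  proof
    fix i j assume ij: "i \<in> {..<?q}" "j \<in> {..<?q}" "n * i mod ?q = n * j mod ?q"
    then have "[n * i = n * j] (mod ?q)" by (simp add: unique_euclidean_semiring_class.cong_def)
    then have "[i = j] (mod ?q)" using cop by (simp add: cong_mult_lcancel_nat)
    then show "i = j" using ij by (simp add: unique_euclidean_semiring_class.cong_def)
  qed
  moreover have "(\<lambda>i. n * i mod ?q) ` {..<?q} \<subseteq> {..<?q}" using assms by auto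
  ultimately have "bij_betw (\<lambda>i. n * i mod ?q) {..<?q} {..<?q}"
    unfolding bij_betw_def using endo_inj_surj by blast
  then have "sum ?f {..<?q} = (\<Sum>i<?q. ?f (n * i mod ?q))"
    by (intro sum.reindex_bij_betw[symmetric])
  also have "\<dots> = - sum ?f {..<?q}"
    by (simp only: mod jacobi_mult_right n sum_negf mult_minus1)
  finally show ?thesis by simp
qed

text \<open>Full periods cancel and the rest is bounded by its length. So weak a bound suffices:
  \<open>8 * D\<close> later enters through a logarithm, a small power, or a constant attached to a
  fixed or bounded discriminant.\<close>

lemma sum_jacobi_bounded:
  assumes "D > 0" "\<not> is_square (D :: nat)"
  shows "\<bar>\<Sum>i<N. jacobi (int D) i\<bar> \<le> 8 * int D"
proof -
  let ?q = "8 * D" and ?f = "jacobi (int D)"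
  have "sum ?f {..<?q * (N div ?q) + N mod ?q} = sum ?f {..<N mod ?q}"
    using sum_periodic[of ?f ?q "N div ?q" "N mod ?q"] jacobi_periodic_mult[OF assms(1), of _ 1]
      sum_jacobi_period[OF assms] by simp
  then have "\<bar>sum ?f {..<N}\<bar> = \<bar>sum ?f {..<N mod ?q}\<bar>" by simp
  also have "\<dots> \<le> (\<Sum>i<N mod ?q. \<bar>?f i\<bar>)" by (rule sum_abs)
  also have "\<dots> \<le> (\<Sum>i<N mod ?q. 1)"
  proof (rule sum_mono)
    show "\<bar>?f i\<bar> \<le> 1" for i using jacobi_values[of "int D" i] by auto
  qed
  also have "\<dots> \<le> int ?q"
    using mod_less_divisor[of ?q N] assms(1) by (simp only: sum_constant card_lessThan mult_1_right of_nat_id) linarith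
  finally show ?thesis by simp
qed

section \<open>Dirichlet convolution and the hyperbola method\<close>

text \<open>Dirichlet convolution. At \<open>n = 0\<close> the index set is infinite, so the value
  is 0 by convention.\<close>

definition dconv :: "(nat \<Rightarrow> real) \<Rightarrow> (nat \<Rightarrow> real) \<Rightarrow> nat \<Rightarrow> real" where
  "dconv u v n = (\<Sum>d | d dvd n. u d * v (n div d))"

definition hyp_pairs :: "nat \<Rightarrow> (nat \<times> nat) set" where
  "hyp_pairs x = {(a, b). 1 \<le> a \<and> 1 \<le> b \<and> a * b \<le> x}"

lemma finite_hyp_pairs [simp]: "finite (hyp_pairs x)"
proof (rule finite_subset)
  have "a \<le> x \<and> b \<le> x" if "1 \<le> a" "1 \<le> b" "a * b \<le> x" for a b :: nat
  proof -
    have "a * 1 \<le> a * b" "1 * b \<le> a * b" using that by (intro mult_le_mono; simp)+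
    then show ?thesis using that(3) by linarith
  qed
  then show "hyp_pairs x \<subseteq> {..x} \<times> {..x}"
    unfolding hyp_pairs_def by blast
qed simp

lemma sum_divisors_eq_sum_hyp_pairs:
  fixes h :: "nat \<Rightarrow> nat \<Rightarrow> 'a :: comm_monoid_add"
  shows "(\<Sum>n=1..x. \<Sum>d | d dvd n. h d (n div d)) = (\<Sum>(a, b)\<in>hyp_pairs x. h a b)"
proof -
  have "(\<Sum>n=1..x. \<Sum>d | d dvd n. h d (n div d)) = (\<Sum>(n, d)\<in>(SIGMA n:{1..x}. {d. d dvd n}). h d (n div d))"
    by (rule sum.Sigma) auto
  also have "\<dots> = (\<Sum>(a, b)\<in>hyp_pairs x. h a b)"
  proof (rule sum.reindex_bij_witness[of _ "\<lambda>(a, b). (a * b, a)" "\<lambda>(n, d). (d, n div d)"])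
    fix p assume p: "p \<in> (SIGMA n:{1..x}. {d. d dvd n})"
    obtain n d where nd: "p = (n, d)" by fastforce
    with p have "1 \<le> n" "n \<le> x" "d dvd n" by auto
    moreover from this have "d > 0" "d \<le> n" by (auto intro: dvd_imp_le Nat.gr0I)
    ultimately show "(case p of (n, d) \<Rightarrow> (d, n div d)) \<in> hyp_pairs x"
      unfolding nd hyp_pairs_def by (auto simp: Suc_le_eq div_greater_zero_iff)
  qed (auto simp: hyp_pairs_def Suc_le_eq)
  finally show ?thesis .
qed

lemma sum_dconv: "(\<Sum>n=1..x. dconv u v n) = (\<Sum>(a, b)\<in>hyp_pairs x. u a * v b)"
  unfolding dconv_def by (rule sum_divisors_eq_sum_hyp_pairs)

text \<open>Pairs with \<open>b \<le> y\<close> are summed over \<open>a\<close> first; the others,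
  for which \<open>a \<le> x div Suc y\<close>, over \<open>b\<close> first. In the applications
  sums of \<open>F\<close> have a main term, while \<open>G\<close> oscillates, so that differences
  of its partial sums are small. With \<open>y = 0\<close> this is plain summation over
  \<open>a\<close>.\<close>

lemma hyperbola:
  "(\<Sum>(a, b)\<in>hyp_pairs x. F a * (G b :: real)) =
     (\<Sum>b=1..y. G b * (\<Sum>a=1..x div b. F a)) +
     (\<Sum>a=1..x div Suc y. F a * ((\<Sum>b=1..x div a. G b) - (\<Sum>b=1..y. G b)))"
proof -
  let ?P = "{(a, b) \<in> hyp_pairs x. b \<le> y}" and ?Q = "{(a, b) \<in> hyp_pairs x. y < b}"
  have fin: "finite ?P" "finite ?Q" by (rule finite_subset[OF _ finite_hyp_pairs], auto)+
  have le_div: "a \<le> x div b \<longleftrightarrow> a * b \<le> x" if "1 \<le> b" for a b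
    using that by (simp add: less_eq_div_iff_mult_less_eq)
  have "(\<Sum>(a, b)\<in>?P. F a * G b) = (\<Sum>(b, a)\<in>(SIGMA b:{1..y}. {1..x div b}). G b * F a)"
    by (rule sum.reindex_bij_witness[of _ "\<lambda>(b, a). (a, b)" "\<lambda>(a, b). (b, a)"])
      (auto simp: hyp_pairs_def le_div)
  also have "\<dots> = (\<Sum>b=1..y. \<Sum>a=1..x div b. G b * F a)"
    by (rule sum.Sigma[symmetric]) auto
  finally have P: "(\<Sum>(a, b)\<in>?P. F a * G b) = (\<Sum>b=1..y. G b * (\<Sum>a=1..x div b. F a))"
    by (simp add: sum_distrib_left)
  have "(\<Sum>(a, b)\<in>?Q. F a * G b) = (\<Sum>(a, b)\<in>(SIGMA a:{1..x div Suc y}. {Suc y..x div a}). F a * G b)"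
  proof (rule sum.cong)
    have "a \<le> x div Suc y" if "1 \<le> a" "y < b" "a * b \<le> x" for a b
    proof -
      have "a * Suc y \<le> a * b" using that by (intro mult_left_mono) auto
      then show ?thesis using that le_div[of "Suc y" a] by simp
    qed
    moreover have "b \<le> x div a \<longleftrightarrow> a * b \<le> x" if "1 \<le> a" for a b
      using le_div[of a b] that by (simp add: mult.commute)
    ultimately show "?Q = (SIGMA a:{1..x div Suc y}. {Suc y..x div a})"
      unfolding hyp_pairs_def by fastforce
  qed auto
  also have "\<dots> = (\<Sum>a=1..x div Suc y. \<Sum>b=Suc y..x div a. F a * G b)"
    by (rule sum.Sigma[symmetric]) auto
  also have "\<dots> = (\<Sum>a=1..x div Suc y. F a * ((\<Sum>b=1..x div a. G b) - (\<Sum>b=1..y. G b)))"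
  proof (rule sum.cong)
    fix a assume a: "a \<in> {1..x div Suc y}"
    then have "a * Suc y \<le> x" using le_div[of "Suc y" a] by simp
    then have "Suc y \<le> x div a" using a le_div[of a "Suc y"] by (simp add: mult.commute)
    then have "{1..x div a} = {1..y} \<union> {Suc y..x div a}" by auto
    then have "(\<Sum>b=1..x div a. G b) = (\<Sum>b=1..y. G b) + (\<Sum>b=Suc y..x div a. G b)"
      by (simp add: sum.union_disjoint)
    then show "(\<Sum>b=Suc y..x div a. F a * G b) = F a * ((\<Sum>b=1..x div a. G b) - (\<Sum>b=1..y. G b))"
      by (simp add: sum_distrib_left)
  qed simp
  finally have Q: "(\<Sum>(a, b)\<in>?Q. F a * G b) = (\<Sum>a=1..x div Suc y. F a * ((\<Sum>b=1..x div a. G b) - (\<Sum>b=1..y. G b)))" .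
  have "hyp_pairs x = ?P \<union> ?Q" "?P \<inter> ?Q = {}" by auto
  then have "(\<Sum>(a, b)\<in>hyp_pairs x. F a * G b) = (\<Sum>(a, b)\<in>?P. F a * G b) + (\<Sum>(a, b)\<in>?Q. F a * G b)"
    using sum.union_disjoint[OF fin] by simp
  then show ?thesis unfolding P Q .
qed

lemma dconv_powr:
  "dconv u v n * real n powr -s = dconv (\<lambda>n. u n * real n powr -s) (\<lambda>n. v n * real n powr -s) n"
proof (cases "n = 0")
  case False
  have "u d * v (n div d) * real n powr -s = u d * real d powr -s * (v (n div d) * real (n div d) powr -s)"
    if "d dvd n" for d
  proof -
    from that obtain e where "n = d * e" by blast
    then show ?thesis using False by (simp add: powr_mult)
  qed
  then show ?thesis unfolding dconv_def sum_distrib_right by (intro sum.cong) auto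
qed (simp add: dconv_def)

section \<open>Partial summation and Dirichlet series of bounded characters\<close>

lemma abel_summation:
  fixes w g :: "nat \<Rightarrow> real"
  assumes "m \<le> N"
  shows "(\<Sum>n=Suc m..N. w n * g n) = (\<Sum>i=Suc m..N. w i) * g N
           + (\<Sum>n=Suc m..<N. (\<Sum>i=Suc m..n. w i) * (g n - g (Suc n)))"
  using assms
proof (induction N rule: dec_induct)
  case (step N)
  show ?case
  proof (cases "m = N")
    case False
    then have "Suc m \<le> N" using step by simp
    then show ?thesis using step by (simp add: algebra_simps)
  qed simp
qed simp

lemma sum_telescope_desc:
  fixes g :: "nat \<Rightarrow> real"
  assumes "m < N"
  shows "(\<Sum>n=Suc m..<N. g n - g (Suc n)) = g (Suc m) - g N"
  using assms
proof (induction N)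
  case (Suc N)
  then show ?case by (cases "m = N") auto
qed simp

lemma abel_bound:
  fixes w g :: "nat \<Rightarrow> real"
  assumes "\<And>n. \<bar>\<Sum>i=Suc m..n. w i\<bar> \<le> C"
    and "\<And>n. Suc m \<le> n \<Longrightarrow> g (Suc n) \<le> g n" and "\<And>n. Suc m \<le> n \<Longrightarrow> 0 \<le> g n"
  shows "\<bar>\<Sum>n=Suc m..N. w n * g n\<bar> \<le> C * g (Suc m)"
proof (cases "m < N")
  case True
  have "C \<ge> 0" using assms(1)[of m] by simp
  have "\<bar>\<Sum>n=Suc m..N. w n * g n\<bar> \<le> \<bar>(\<Sum>i=Suc m..N. w i) * g N\<bar>
           + \<bar>\<Sum>n=Suc m..<N. (\<Sum>i=Suc m..n. w i) * (g n - g (Suc n))\<bar>"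
    using True by (subst abel_summation) auto
  also have "\<dots> \<le> C * g N + (\<Sum>n=Suc m..<N. C * (g n - g (Suc n)))"
  proof (rule add_mono)
    show "\<bar>(\<Sum>i=Suc m..N. w i) * g N\<bar> \<le> C * g N"
      using assms(1)[of N] assms(3)[of N] True by (simp add: abs_mult mult_right_mono)
    have "\<bar>(\<Sum>i=Suc m..n. w i) * (g n - g (Suc n))\<bar> \<le> C * (g n - g (Suc n))" if "Suc m \<le> n" for n
      using assms(1)[of n] assms(2)[of n] that by (simp add: abs_mult mult_right_mono)
    then show "\<bar>\<Sum>n=Suc m..<N. (\<Sum>i=Suc m..n. w i) * (g n - g (Suc n))\<bar> \<le> (\<Sum>n=Suc m..<N. C * (g n - g (Suc n)))"
      by (intro order_trans[OF sum_abs] sum_mono) auto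
  qed
  also have "\<dots> = C * g (Suc m)"
    unfolding sum_distrib_left[symmetric] sum_telescope_desc[OF True] by (simp add: algebra_simps)
  finally show ?thesis .
next
  case False
  then show ?thesis using assms(1)[of m] assms(3)[of "Suc m"] by simp
qed

text \<open>The analytic content of a nonprincipal character: bounded values and bounded partial
  sums. Multiplicativity is kept apart, in \<open>quad_char\<close>. The condition
  \<open>1 \<le> B\<close> is a normalisation that lets \<open>B\<close> absorb absolute
  constants.\<close>

definition bounded_char :: "(nat \<Rightarrow> real) \<Rightarrow> real \<Rightarrow> bool" where
  "bounded_char w B \<longleftrightarrow> (\<forall>n. \<bar>w n\<bar> \<le> 1) \<and> (\<forall>N. \<bar>\<Sum>n=1..N. w n\<bar> \<le> B) \<and> 1 \<le> B"

definition dirichlet_sum :: "(nat \<Rightarrow> real) \<Rightarrow> real \<Rightarrow> nat \<Rightarrow> real" where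
  "dirichlet_sum w s N = (\<Sum>n=1..N. w n * real n powr -s)"

text \<open>The value of the Dirichlet series as a limit of partial sums; for a bounded character it
  converges at every real \<open>s > 0\<close>, by \<open>dirichlet_sum_LIMSEQ\<close>.\<close>

definition lfun :: "(nat \<Rightarrow> real) \<Rightarrow> real \<Rightarrow> real" where
  "lfun w s = lim (dirichlet_sum w s)"

lemma sum_split:
  fixes f :: "nat \<Rightarrow> 'a :: ab_group_add"
  assumes "M \<le> N" shows "(\<Sum>n=Suc M..N. f n) = (\<Sum>n=1..N. f n) - (\<Sum>n=1..M. f n)"
proof -
  have "{1..N} = {1..M} \<union> {Suc M..N}" using assms by auto
  then have "sum f {1..N} = sum f {1..M} + sum f {Suc M..N}" by (simp add: sum.union_disjoint)
  then show ?thesis by simp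
qed

lemma dirichlet_sum_diff_bound:
  assumes w: "bounded_char w B" and "0 < s" "M \<le> N"
  shows "\<bar>dirichlet_sum w s N - dirichlet_sum w s M\<bar> \<le> 2 * B * real (Suc M) powr -s"
proof -
  have "\<bar>\<Sum>i=Suc M..n. w i\<bar> \<le> 2 * B" for n
  proof (cases "M \<le> n")
    case True
    have "\<bar>\<Sum>i=1..n. w i\<bar> \<le> B" "\<bar>\<Sum>i=1..M. w i\<bar> \<le> B" using w by (auto simp: bounded_char_def)
    then show ?thesis using sum_split[OF True, of w] by linarith
  qed (use w in \<open>simp add: bounded_char_def\<close>)
  then have "\<bar>\<Sum>n=Suc M..N. w n * real n powr -s\<bar> \<le> 2 * B * real (Suc M) powr -s"
    using \<open>0 < s\<close> by (intro abel_bound) (auto intro: powr_mono2')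
  then show ?thesis using sum_split[OF assms(3), of "\<lambda>n. w n * real n powr -s"] by (simp add: dirichlet_sum_def)
qed

lemma dirichlet_sum_LIMSEQ:
  assumes w: "bounded_char w B" and "0 < s"
  shows "dirichlet_sum w s \<longlonglongrightarrow> lfun w s"
proof -
  have "(\<lambda>M. 2 * B * real (Suc M) powr -s) \<longlonglongrightarrow> 2 * B * 0"
    using \<open>0 < s\<close> by (intro tendsto_mult tendsto_const tendsto_neg_powr filterlim_compose[OF filterlim_real_sequentially filterlim_Suc]) auto
  then have lim: "(\<lambda>M. 2 * B * real (Suc M) powr -s) \<longlonglongrightarrow> 0" by simp
  have "Cauchy (dirichlet_sum w s)"
  proof (rule metric_CauchyI)
    fix e :: real assume "0 < e"
    then have "\<forall>\<^sub>F M in sequentially. 2 * B * real (Suc M) powr -s < e / 2"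
      using order_tendstoD(2)[OF lim, of "e/2"] by simp
    then obtain M where M: "2 * B * real (Suc M) powr -s < e / 2"
      by (auto simp: eventually_sequentially)
    have "dist (dirichlet_sum w s m) (dirichlet_sum w s n) < e" if "M \<le> m" "M \<le> n" for m n
      using dirichlet_sum_diff_bound[OF w \<open>0 < s\<close> that(1)] dirichlet_sum_diff_bound[OF w \<open>0 < s\<close> that(2)] M
      unfolding dist_real_def by linarith
    then show "\<exists>M. \<forall>m\<ge>M. \<forall>n\<ge>M. dist (dirichlet_sum w s m) (dirichlet_sum w s n) < e" by blast
  qed
  then show ?thesis unfolding lfun_def by (simp add: Cauchy_convergent_iff convergent_LIMSEQ_iff)
qed

lemma lfun_tail:
  assumes w: "bounded_char w B" and "0 < s"
  shows "\<bar>lfun w s - dirichlet_sum w s M\<bar> \<le> 2 * B * real (Suc M) powr -s"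
proof (rule LIMSEQ_le_const2)
  show "(\<lambda>N. \<bar>dirichlet_sum w s N - dirichlet_sum w s M\<bar>) \<longlonglongrightarrow> \<bar>lfun w s - dirichlet_sum w s M\<bar>"
    by (intro tendsto_intros dirichlet_sum_LIMSEQ[OF assms])
  show "\<exists>N. \<forall>n\<ge>N. \<bar>dirichlet_sum w s n - dirichlet_sum w s M\<bar> \<le> 2 * B * real (Suc M) powr -s"
    using dirichlet_sum_diff_bound[OF assms] by blast
qed

lemma lfun_abs_le:
  assumes "bounded_char w B" and "0 < s"
  shows "\<bar>lfun w s\<bar> \<le> 2 * B"
  using lfun_tail[OF assms, of 0] by (simp add: dirichlet_sum_def)

lemma real_div_bounds:
  assumes "1 \<le> (b :: nat)"
  shows "real (x div b) \<le> real x / real b" "real x / real b \<le> real (x div b) + 1"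
proof -
  have "real (x div b) = of_int \<lfloor>real x / real b\<rfloor>" by (simp add: floor_divide_of_nat_eq)
  then show "real (x div b) \<le> real x / real b" "real x / real b \<le> real (x div b) + 1" by linarith+
qed

lemma abs_add3_le:
  fixes a b c :: real
  shows "\<bar>a\<bar> \<le> x \<Longrightarrow> \<bar>b\<bar> \<le> y \<Longrightarrow> \<bar>c\<bar> \<le> z \<Longrightarrow> \<bar>a + b + c\<bar> \<le> x + y + z"
  by linarith

text \<open>If \<open>v\<close> has mean value \<alpha>, then its convolution with \<open>w\<close>
  has mean value \<alpha> L(1, w). The range \<open>b \<le> y\<close> gives the truncated series,
  with an error for each \<open>b\<close> from the sum of \<open>v\<close> and from rounding x / b.
  Completing the series and the range \<open>b > y\<close> cost 2 B x / (y + 1) each, hence the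
  factor 4. The cut \<open>y\<close> stays free so that each use can balance the two errors.\<close>

lemma hyperbola_asymp:
  assumes w: "bounded_char w B" and v: "\<And>n. 0 \<le> v n"
    and \<alpha>: "0 \<le> \<alpha>" and E: "0 \<le> E" and \<theta>: "0 \<le> \<theta>" "\<theta> \<le> 1"
    and V: "\<And>z. 1 \<le> z \<Longrightarrow> \<bar>(\<Sum>n=1..z. v n) - \<alpha> * real z\<bar> \<le> E * real z powr \<theta>"
    and y: "1 \<le> y" "y \<le> x"
  shows "\<bar>(\<Sum>n=1..x. dconv v w n) - \<alpha> * lfun w 1 * real x\<bar>
      \<le> (\<alpha> + E) * (real y * real x powr \<theta> + 4 * B * real x / real (Suc y))"
proof -
  have B: "1 \<le> B" and w1: "\<And>n. \<bar>w n\<bar> \<le> 1" using w by (auto simp: bounded_char_def)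
  have x: "1 \<le> x" using y by simp
  define M where "M = x div Suc y"
  define T1 where "T1 = (\<Sum>b=1..y. w b * (\<Sum>a=1..x div b. v a))"
  define T2 where "T2 = (\<Sum>a=1..M. v a * ((\<Sum>b=1..x div a. w b) - (\<Sum>b=1..y. w b)))"
  have split: "(\<Sum>n=1..x. dconv v w n) = T1 + T2"
    unfolding sum_dconv T1_def T2_def M_def by (rule hyperbola)
  have xt: "1 \<le> real x powr \<theta>" using x \<theta> by (intro ge_one_powr_ge_zero) auto
  have step: "\<bar>w b * (\<Sum>a=1..x div b. v a) - \<alpha> * real x * (w b * real b powr -1)\<bar> \<le> (\<alpha> + E) * real x powr \<theta>"
    if b: "b \<in> {1..y}" for b
  proof -
    have b1: "1 \<le> b" "b \<le> x" using b y by auto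
    then have d1: "1 \<le> x div b" by (simp add: Suc_le_eq div_greater_zero_iff)
    have "\<bar>(\<Sum>a=1..x div b. v a) - \<alpha> * real (x div b)\<bar> \<le> E * real (x div b) powr \<theta>" using V[OF d1] .
    also have "\<dots> \<le> E * real x powr \<theta>" using E \<theta> by (intro mult_left_mono powr_mono2) auto
    finally have 1: "\<bar>(\<Sum>a=1..x div b. v a) - \<alpha> * real (x div b)\<bar> \<le> E * real x powr \<theta>" .
    have "\<bar>\<alpha> * real (x div b) - \<alpha> * (real x / real b)\<bar> = \<alpha> * \<bar>real (x div b) - real x / real b\<bar>"
      using \<alpha> by (simp only: abs_mult abs_of_nonneg flip: right_diff_distrib)
    also have "\<dots> \<le> \<alpha> * 1" using \<alpha> real_div_bounds[OF b1(1), of x] by (intro mult_left_mono) linarith+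
    also have "\<dots> \<le> \<alpha> * real x powr \<theta>" using \<alpha> xt by (intro mult_left_mono) auto
    finally have 2: "\<bar>\<alpha> * real (x div b) - \<alpha> * (real x / real b)\<bar> \<le> \<alpha> * real x powr \<theta>" .
    have "w b * (\<Sum>a=1..x div b. v a) - \<alpha> * real x * (w b * real b powr -1)
        = w b * ((\<Sum>a=1..x div b. v a) - \<alpha> * (real x / real b))"
      using b1 by (simp add: powr_minus field_simps)
    then have "\<bar>w b * (\<Sum>a=1..x div b. v a) - \<alpha> * real x * (w b * real b powr -1)\<bar>
        \<le> 1 * \<bar>(\<Sum>a=1..x div b. v a) - \<alpha> * (real x / real b)\<bar>"
      using w1[of b] by (simp only: abs_mult) (intro mult_right_mono, auto)
    then show ?thesis using 1 2 by (simp add: algebra_simps)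
  qed
  have "T1 - \<alpha> * real x * dirichlet_sum w 1 y = (\<Sum>b=1..y. w b * (\<Sum>a=1..x div b. v a) - \<alpha> * real x * (w b * real b powr -1))"
    unfolding T1_def dirichlet_sum_def by (simp add: sum_subtractf sum_distrib_left)
  also have "\<bar>\<dots>\<bar> \<le> (\<Sum>b=1..y. (\<alpha> + E) * real x powr \<theta>)"
    by (intro order_trans[OF sum_abs] sum_mono step)
  finally have T1: "\<bar>T1 - \<alpha> * real x * dirichlet_sum w 1 y\<bar> \<le> (\<alpha> + E) * (real y * real x powr \<theta>)"
    by (simp add: mult.left_commute)
  have "\<bar>\<alpha> * real x * dirichlet_sum w 1 y - \<alpha> * real x * lfun w 1\<bar> = \<alpha> * real x * \<bar>lfun w 1 - dirichlet_sum w 1 y\<bar>"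
    using \<alpha> by (simp only: abs_mult abs_of_nonneg abs_minus_commute of_nat_0_le_iff flip: right_diff_distrib)
  also have "\<dots> \<le> \<alpha> * real x * (2 * B * real (Suc y) powr -1)"
    using lfun_tail[OF w, of 1 y] \<alpha> by (intro mult_left_mono) auto
  also have "\<dots> = \<alpha> * (2 * B * real x / real (Suc y))" by (simp add: powr_minus field_simps)
  also have "\<dots> \<le> (\<alpha> + E) * (2 * B * real x / real (Suc y))"
    using E B by (intro mult_right_mono) auto
  finally have L: "\<bar>\<alpha> * real x * dirichlet_sum w 1 y - \<alpha> * real x * lfun w 1\<bar> \<le> (\<alpha> + E) * (2 * B * real x / real (Suc y))" .
  have sv: "(\<Sum>a=1..M. v a) \<le> (\<alpha> + E) * real M"
  proof (cases "M = 0")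
    case False
    then have M: "1 \<le> M" by simp
    have "real M powr \<theta> \<le> real M powr 1" using M \<theta> by (intro powr_mono) auto
    then have "E * real M powr \<theta> \<le> E * real M" using M E by (intro mult_left_mono) auto
    then show ?thesis using V[OF M] by (simp add: algebra_simps)
  qed simp
  have "\<bar>T2\<bar> \<le> (\<Sum>a=1..M. v a * (2 * B))"
    unfolding T2_def
  proof (intro order_trans[OF sum_abs] sum_mono)
    fix a
    have "\<bar>\<Sum>b=1..x div a. w b\<bar> \<le> B" "\<bar>\<Sum>b=1..y. w b\<bar> \<le> B" using w by (auto simp: bounded_char_def)
    then have "\<bar>(\<Sum>b=1..x div a. w b) - (\<Sum>b=1..y. w b)\<bar> \<le> 2 * B" by linarith
    then show "\<bar>v a * ((\<Sum>b=1..x div a. w b) - (\<Sum>b=1..y. w b))\<bar> \<le> v a * (2 * B)"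
      using v[of a] by (simp add: abs_mult mult_left_mono)
  qed
  also have "\<dots> = (\<Sum>a=1..M. v a) * (2 * B)" by (simp add: sum_distrib_right)
  also have "\<dots> \<le> (\<alpha> + E) * real M * (2 * B)" using sv B by (intro mult_right_mono) auto
  also have "\<dots> = (\<alpha> + E) * (2 * B * real M)" by simp
  also have "\<dots> \<le> (\<alpha> + E) * (2 * B * (real x / real (Suc y)))"
    using real_div_bounds(1)[of "Suc y" x] \<alpha> E B unfolding M_def by (intro mult_left_mono) auto
  finally have T2: "\<bar>T2\<bar> \<le> (\<alpha> + E) * (2 * B * real x / real (Suc y))" by simp
  have "(\<Sum>n=1..x. dconv v w n) - \<alpha> * lfun w 1 * real x
     = (T1 - \<alpha> * real x * dirichlet_sum w 1 y) + (\<alpha> * real x * dirichlet_sum w 1 y - \<alpha> * real x * lfun w 1) + T2"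
    unfolding split by simp
  also have "\<bar>\<dots>\<bar> \<le> (\<alpha> + E) * (real y * real x powr \<theta>) + (\<alpha> + E) * (2 * B * real x / real (Suc y)) + (\<alpha> + E) * (2 * B * real x / real (Suc y))"
    by (rule abs_add3_le[OF T1 L T2])
  also have "\<dots> = (\<alpha> + E) * (real y * real x powr \<theta> + 4 * B * real x / real (Suc y))"
    by (simp add: algebra_simps)
  finally show ?thesis .
qed

section \<open>Multiplicative functions\<close>

definition multiplicative :: "(nat \<Rightarrow> real) \<Rightarrow> bool" where
  "multiplicative f \<longleftrightarrow> f 1 = 1 \<and> (\<forall>m n. m > 0 \<longrightarrow> n > 0 \<longrightarrow> coprime m n \<longrightarrow> f (m * n) = f m * f n)"

lemma sum_divisors_coprime_mult:
  fixes g :: "nat \<Rightarrow> 'a :: comm_monoid_add"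
  assumes "m > 0" "n > 0" "coprime m n"
  shows "(\<Sum>d | d dvd m * n. g d) = (\<Sum>(a, b)\<in>{d. d dvd m} \<times> {d. d dvd n}. g (a * b))"
proof (rule sum.reindex_bij_witness[of _ "\<lambda>(a, b). a * b" "\<lambda>d. (gcd d m, gcd d n)"])
  have *: "gcd (a * b) m = a \<and> gcd (a * b) n = b" if "a dvd m" "b dvd n" for a b
  proof -
    have "coprime b m" "coprime a n"
      using that assms(3) coprime_divisors[of a m n n] coprime_divisors[of m m b n] by (auto simp: coprime_commute)
    then show ?thesis using that
      by (simp add: gcd_mult_left_right_cancel gcd_mult_left_left_cancel coprime_commute gcd_nat.absorb1)
  qed
  fix d assume "d \<in> {d. d dvd m * n}"
  then have "d dvd m * n" by simp
  then obtain a b where ab: "d = a * b" "a dvd m" "b dvd n" by (rule dvd_productE)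
  show "(case (gcd d m, gcd d n) of (a, b) \<Rightarrow> a * b) = d" "(gcd d m, gcd d n) \<in> {d. d dvd m} \<times> {d. d dvd n}"
    using *[OF ab(2,3)] ab by auto
  show "(case (gcd d m, gcd d n) of (a, b) \<Rightarrow> g (a * b)) = g d"
    using *[OF ab(2,3)] ab by auto
next
  fix p assume "p \<in> {d. d dvd m} \<times> {d. d dvd n}"
  then obtain a b where ab: "p = (a, b)" "a dvd m" "b dvd n" by auto
  have "coprime b m" "coprime a n"
    using ab assms(3) coprime_divisors[of a m n n] coprime_divisors[of m m b n] by (auto simp: coprime_commute)
  then show "(gcd (case p of (a, b) \<Rightarrow> a * b) m, gcd (case p of (a, b) \<Rightarrow> a * b) n) = p" using ab
    by (simp add: gcd_mult_left_right_cancel gcd_mult_left_left_cancel coprime_commute gcd_nat.absorb1)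
  show "(case p of (a, b) \<Rightarrow> a * b) \<in> {d. d dvd m * n}" using ab by (auto intro: mult_dvd_mono)
qed

lemma multiplicative_dconv:
  assumes "multiplicative u" "multiplicative v"
  shows "multiplicative (dconv u v)"
  unfolding multiplicative_def
proof (intro conjI allI impI)
  show "dconv u v 1 = 1" using assms by (simp add: dconv_def multiplicative_def)
  fix m n :: nat assume mn: "m > 0" "n > 0" "coprime m n"
  have "dconv u v (m * n) = (\<Sum>(a, b)\<in>{d. d dvd m} \<times> {d. d dvd n}. u (a * b) * v (m * n div (a * b)))"
    unfolding dconv_def by (rule sum_divisors_coprime_mult[OF mn])
  also have "\<dots> = (\<Sum>(a, b)\<in>{d. d dvd m} \<times> {d. d dvd n}. (u a * v (m div a)) * (u b * v (n div b)))"
  proof (rule sum.cong)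
    fix p assume "p \<in> {d. d dvd m} \<times> {d. d dvd n}"
    then obtain a b where ab: "p = (a, b)" "a dvd m" "b dvd n" by auto
    have "coprime a b" using ab mn(3) coprime_divisors by blast
    moreover have "coprime (m div a) (n div b)"
      using coprime_divisors[OF _ _ mn(3)] ab(2,3) div_dvd_iff_mult by (metis dvd_div_mult_self dvd_triv_left)
    moreover have "0 < a" "0 < b" "0 < m div a" "0 < n div b"
      using ab mn dvd_pos_nat by (auto simp: div_greater_zero_iff intro: dvd_imp_le)
    moreover have "m * n div (a * b) = (m div a) * (n div b)"
      using ab(2,3) by (simp add: div_mult_div_if_dvd)
    ultimately show "(case p of (a, b) \<Rightarrow> u (a * b) * v (m * n div (a * b))) = (case p of (a, b) \<Rightarrow> u a * v (m div a) * (u b * v (n div b)))"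
      using assms ab(1) by (simp add: multiplicative_def)
  qed simp
  also have "\<dots> = dconv u v m * dconv u v n"
    unfolding dconv_def by (simp add: sum_product sum.cartesian_product)
  finally show "dconv u v (m * n) = dconv u v m * dconv u v n" .
qed

lemma dconv_prime_power:
  assumes "prime p"
  shows "dconv u v (p ^ k) = (\<Sum>i\<le>k. u (p ^ i) * v (p ^ (k - i)))"
proof -
  have p: "1 < p" using assms prime_gt_1_nat by blast
  have "{d. d dvd p ^ k} = (\<lambda>i. p ^ i) ` {..k}"
    using divides_primepow_nat[OF assms] by auto
  moreover have "inj_on (\<lambda>i. p ^ i) {..k}" using p by (auto intro!: inj_onI)
  ultimately have "dconv u v (p ^ k) = (\<Sum>i\<le>k. u (p ^ i) * v (p ^ k div p ^ i))"
    unfolding dconv_def by (simp add: sum.reindex)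
  also have "\<dots> = (\<Sum>i\<le>k. u (p ^ i) * v (p ^ (k - i)))"
    using p by (intro sum.cong) (auto simp: power_diff)
  finally show ?thesis .
qed

lemma prime_power_induct [consumes 1, case_names one mult]:
  assumes "n > 0" "P 1"
    "\<And>p k m. prime p \<Longrightarrow> k > 0 \<Longrightarrow> m > 0 \<Longrightarrow> \<not> p dvd m \<Longrightarrow> P m \<Longrightarrow> P (p ^ k * m)"
  shows "P (n :: nat)"
  using assms(1)
proof (induction n rule: less_induct)
  case (less n)
  show ?case
  proof (cases "n = 1")
    case False
    then obtain p where p: "prime p" "p dvd n" using prime_factor_nat by blast
    define k where "k = multiplicity p n"
    have "n \<noteq> 0" "\<not> is_unit p" using less.prems p not_prime_unit by auto
    then obtain m where m: "n = p ^ k * m" "\<not> p dvd m"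
      using multiplicity_decompose'[of n p] unfolding k_def by blast
    have k: "k > 0" using p m by (intro Nat.gr0I) auto
    have "m > 0" using m less.prems by (intro Nat.gr0I) auto
    moreover have "1 < p ^ k" using k prime_gt_1_nat[OF p(1)] by (rule one_less_power[rotated])
    ultimately have "m < n" unfolding m(1) by simp
    then show ?thesis using assms(3)[OF p(1) k \<open>m > 0\<close> m(2)] less.IH[OF _ \<open>m > 0\<close>] m(1) by simp
  qed (use assms(2) in simp)
qed

lemma coprime_prime_power: "prime (p :: nat) \<Longrightarrow> \<not> p dvd m \<Longrightarrow> coprime (p ^ k) m"
  by (cases "k = 0") (simp_all add: prime_imp_coprime)

lemma multiplicative_ge:
  assumes f: "multiplicative f" and "n > 0"
    and "\<And>p k. prime p \<Longrightarrow> 0 \<le> f (p ^ k)"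
  shows "0 \<le> f n"
  using \<open>n > 0\<close>
proof (induction n rule: prime_power_induct)
  case (mult p k m)
  then have "f (p ^ k * m) = f (p ^ k) * f m"
    using f coprime_prime_power[of p m k] prime_gt_0_nat[of p] by (simp add: multiplicative_def)
  then show ?case using mult assms(3) by simp
qed (use f in \<open>simp add: multiplicative_def\<close>)

definition quad_char :: "(nat \<Rightarrow> real) \<Rightarrow> bool" where
  "quad_char w \<longleftrightarrow> w 1 = 1 \<and> (\<forall>m n. w (m * n) = w m * w n) \<and> (\<forall>n. w n \<in> {-1, 0, 1})"

lemma quad_char_multiplicative: "quad_char w \<Longrightarrow> multiplicative w"
  by (simp add: quad_char_def multiplicative_def)

lemma quad_char_power: "quad_char w \<Longrightarrow> w (n ^ k) = w n ^ k"
  by (induction k) (simp_all add: quad_char_def)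

lemma multiplicative_one: "multiplicative (\<lambda>_. 1)"
  by (simp add: multiplicative_def)

text \<open>The coefficients of \<zeta>(s) L(s, w). For a quadratic character they are nonnegative,
  which is what forces lower bounds for L(1, w).\<close>

abbreviation one_conv :: "(nat \<Rightarrow> real) \<Rightarrow> nat \<Rightarrow> real" where
  "one_conv \<equiv> dconv (\<lambda>_. 1)"

lemma one_conv_prime_power:
  assumes "quad_char w" "prime p"
  shows "one_conv w (p ^ k) = (\<Sum>i\<le>k. w p ^ i)"
proof -
  have "one_conv w (p ^ k) = (\<Sum>i\<le>k. w p ^ (k - i))"
    using assms by (simp add: dconv_prime_power quad_char_power)
  also have "\<dots> = (\<Sum>i\<le>k. w p ^ i)"
    by (rule sum.reindex_bij_witness[of _ "\<lambda>i. k - i" "\<lambda>i. k - i"]) auto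
  finally show ?thesis .
qed

lemma sum_neg_one_power: "(\<Sum>i\<le>k. (-1 :: real) ^ i) = (if even k then 1 else 0)"
  by (induction k) auto

lemma sum_zero_power: "(\<Sum>i\<le>k. (0 :: real) ^ i) = 1"
  by (induction k) auto

lemma one_conv_prime_power_cases:
  assumes "quad_char w" "prime p"
  shows "one_conv w (p ^ k) = (if w p = 1 then real k + 1 else if w p = 0 then 1 else if even k then 1 else 0)"
  using one_conv_prime_power[OF assms] assms(1)
  by (auto simp: quad_char_def sum_neg_one_power sum_zero_power) (metis insert_iff singletonD sum_neg_one_power)+

lemma one_conv_multiplicative: "quad_char w \<Longrightarrow> multiplicative (one_conv w)"
  by (intro multiplicative_dconv multiplicative_one quad_char_multiplicative)

lemma one_conv_nonneg:
  assumes "quad_char w"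
  shows "0 \<le> one_conv w n"
proof (cases "n = 0")
  case False
  then show ?thesis
    using multiplicative_ge[OF one_conv_multiplicative[OF assms], of n] one_conv_prime_power_cases[OF assms] by simp
qed (simp add: dconv_def)

text \<open>At an even power of a prime the alternating sum ends on a positive term, so every local
  factor is at least 1. This supplies the harmonic sum that makes L(1, w) positive in
  \<open>lfun_1_ge_exp\<close>.\<close>

lemma one_conv_square_ge_1:
  assumes "quad_char w" "n > 0"
  shows "1 \<le> one_conv w (n\<^sup>2)"
  using \<open>n > 0\<close>
proof (induction n rule: prime_power_induct)
  case (mult p k m)
  have "coprime (p ^ (2 * k)) (m\<^sup>2)"
    using coprime_prime_power[of p "m\<^sup>2" "2 * k"] mult prime_dvd_power_nat[of p m 2] by blast
  then have "one_conv w (p ^ (2 * k) * m\<^sup>2) = one_conv w (p ^ (2 * k)) * one_conv w (m\<^sup>2)"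
    using one_conv_multiplicative[OF assms(1)] mult prime_gt_0_nat[of p] by (simp add: multiplicative_def)
  moreover have "1 \<le> one_conv w (p ^ (2 * k))" using one_conv_prime_power_cases[OF assms(1) mult(1), of "2 * k"] by simp
  ultimately have "1 \<le> one_conv w (p ^ (2 * k) * m\<^sup>2)" using mult.IH
    by (metis mult_mono' mult_1 zero_le_one)
  then show ?case by (simp add: power_mult_distrib mult.commute flip: power_mult)
qed (use assms(1) in \<open>simp add: dconv_def quad_char_def\<close>)

section \<open>A lower bound of Hecke type for \<open>L(1)\<close>\<close>

lemma powr_diff_MVT:
  fixes x p :: real
  assumes "0 < x"
  obtains z where "x < z" "z < x + 1" "(x + 1) powr p - x powr p = p * z powr (p - 1)"
proof -
  have "\<exists>z>x. z < x + 1 \<and> (x + 1) powr p - x powr p = (x + 1 - x) * (p * z powr (p - 1))"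
    using assms by (intro MVT2) (auto intro!: has_real_derivative_powr)
  then show ?thesis using that by auto
qed

lemma powr_Suc_diff_bounds:
  fixes x p :: real
  assumes "0 < p" "p < 1" "0 < x"
  shows "p * (x + 1) powr (p - 1) \<le> (x + 1) powr p - x powr p" 
    and "(x + 1) powr p - x powr p \<le> p * x powr (p - 1)"
proof -
  obtain z where z: "x < z" "z < x + 1" "(x + 1) powr p - x powr p = p * z powr (p - 1)"
    using powr_diff_MVT[OF assms(3), of p] by metis
  have "(x + 1) powr (p - 1) \<le> z powr (p - 1)" "z powr (p - 1) \<le> x powr (p - 1)"
    using z assms by (auto intro!: powr_mono2')
  then show "p * (x + 1) powr (p - 1) \<le> (x + 1) powr p - x powr p"
    "(x + 1) powr p - x powr p \<le> p * x powr (p - 1)"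
    unfolding z(3) using assms by auto
qed

text \<open>The constant \<open>c\<close> is $-\zeta(\beta)$.\<close>

lemma zeta_partial_sums:
  assumes \<beta>: "0 < \<beta>" "\<beta> < 1"
  obtains c where "0 \<le> c" "c \<le> 1 / (1 - \<beta>)"
    "\<And>N z. 1 \<le> N \<Longrightarrow> real N \<le> z \<Longrightarrow> z \<le> real N + 1 \<Longrightarrow>
        \<bar>(\<Sum>n=1..N. real n powr -\<beta>) - z powr (1 - \<beta>) / (1 - \<beta>) + c\<bar> \<le> real N powr -\<beta>"
    "\<And>N. (\<Sum>n=1..N. real n powr -\<beta>) \<le> real N powr (1 - \<beta>) / (1 - \<beta>)"
proof -
  define Z where "Z N = (\<Sum>n=1..N. real n powr -\<beta>)" for N
  \<comment> \<open>\<open>a\<close> decreases, \<open>b\<close> increases, and from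
    \<open>N = 1\<close> on they differ by at most \<open>real N powr -\<beta>\<close>; their common
    limit, the value of the zeta function at \<beta>, is therefore enclosed with that
    precision.\<close>
  define a where "a N = Z N - real N powr (1 - \<beta>) / (1 - \<beta>)" for N
  define b where "b N = Z N - (real N + 1) powr (1 - \<beta>) / (1 - \<beta>)" for N
  have ZS: "Z (Suc N) = Z N + (real N + 1) powr -\<beta>" for N unfolding Z_def by (simp add: add.commute)
  have up: "(real N + 1) powr -\<beta> \<le> ((real N + 1) powr (1 - \<beta>) - real N powr (1 - \<beta>)) / (1 - \<beta>)" for N
  proof (cases "N = 0")
    case False
    then show ?thesis using powr_Suc_diff_bounds(1)[of "1 - \<beta>" "real N"] \<beta> by (simp add: field_simps)
  qed (use \<beta> in \<open>simp add: field_simps\<close>)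
  have lo: "((real N + 1) powr (1 - \<beta>) - real N powr (1 - \<beta>)) / (1 - \<beta>) \<le> real N powr -\<beta>" if "1 \<le> N" for N
    using powr_Suc_diff_bounds(2)[of "1 - \<beta>" "real N"] \<beta> that by (simp add: field_simps)
  have "a (Suc N) \<le> a N" for N
    using up[of N] unfolding a_def ZS by (simp add: diff_divide_distrib add.commute)
  then have a: "decseq a" by (rule decseq_SucI)
  have "b N \<le> b (Suc N)" for N
    using lo[of "Suc N"] unfolding b_def ZS by (simp add: diff_divide_distrib add.commute)
  then have b: "incseq b" by (rule incseq_SucI)
  have ba: "b N \<le> a N" for N
    unfolding a_def b_def using \<beta> by (auto intro!: divide_right_mono powr_mono2)
  have bM: "b N \<le> a M" for N M
    using ba[of "max N M"] incseqD[OF b, of N "max N M"] decseqD[OF a, of M "max N M"] by simp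
  define l where "l = (SUP N. b N)"
  have bdd: "bdd_above (range b)" using bM[of _ 0] by (auto intro!: bdd_aboveI2)
  have bl: "b N \<le> l" for N unfolding l_def by (rule cSUP_upper[OF UNIV_I bdd])
  have la: "l \<le> a N" for N unfolding l_def by (rule cSUP_least) (auto intro: bM)
  have a0: "a 0 = 0" "b 0 = - 1 / (1 - \<beta>)" unfolding a_def b_def Z_def by simp_all
  show ?thesis
  proof (rule that[of "-l"])
    show "0 \<le> - l" using la[of 0] a0 by simp
    show "- l \<le> 1 / (1 - \<beta>)" using bl[of 0] a0 by simp
    show "(\<Sum>n=1..N. real n powr -\<beta>) \<le> real N powr (1 - \<beta>) / (1 - \<beta>)" for N
      using decseqD[OF a, of 0 N] a0 unfolding a_def Z_def by simp
    fix N z assume N: "1 \<le> N" "real N \<le> z" "z \<le> real N + 1"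
    have "real N powr (1 - \<beta>) / (1 - \<beta>) \<le> z powr (1 - \<beta>) / (1 - \<beta>)"
      "z powr (1 - \<beta>) / (1 - \<beta>) \<le> (real N + 1) powr (1 - \<beta>) / (1 - \<beta>)"
      using N \<beta> by (auto intro!: divide_right_mono powr_mono2)
    moreover have "a N - b N \<le> real N powr -\<beta>"
      using lo[OF N(1)] unfolding a_def b_def by (simp add: diff_divide_distrib)
    ultimately show "\<bar>(\<Sum>n=1..N. real n powr -\<beta>) - z powr (1 - \<beta>) / (1 - \<beta>) + - l\<bar> \<le> real N powr -\<beta>"
      using bl[of N] la[of N] unfolding a_def b_def Z_def by linarith
  qed
qed

text \<open>The hyperbola method with a cut at the square root of \<open>x\<close>. The inner zeta
  sums consist of a growing main term, which collects L(1, w), and the constant -c, which collects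
  L(\<beta>, w). Four errors arise: from the zeta sums, from completing each of the two series, and
  from the range beyond the cut; each is at most 2 B / (1 - \<beta>) times
  \<open>real x powr (1/2 - \<beta>)\<close>, which gives the 8.\<close>

lemma hecke_bound:
  assumes w: "bounded_char w B" and \<beta>: "1 / 2 \<le> \<beta>" "\<beta> < 1"
  obtains c where "0 \<le> c" "c \<le> 1 / (1 - \<beta>)"
    "\<And>x. 1 \<le> x \<Longrightarrow> dirichlet_sum (one_conv w) \<beta> x \<le>
       real x powr (1 - \<beta>) / (1 - \<beta>) * lfun w 1 - c * lfun w \<beta> + 8 * B / (1 - \<beta>) * real x powr (1 / 2 - \<beta>)"
proof -
  have \<beta>0: "0 < \<beta>" using \<beta> by simp
  have B: "1 \<le> B" and w1: "\<And>n. \<bar>w n\<bar> \<le> 1" using w by (auto simp: bounded_char_def)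
  obtain c where c: "0 \<le> c" "c \<le> 1 / (1 - \<beta>)"
    "\<And>N z. 1 \<le> N \<Longrightarrow> real N \<le> z \<Longrightarrow> z \<le> real N + 1 \<Longrightarrow>
        \<bar>(\<Sum>n=1..N. real n powr -\<beta>) - z powr (1 - \<beta>) / (1 - \<beta>) + c\<bar> \<le> real N powr -\<beta>"
    "\<And>N. (\<Sum>n=1..N. real n powr -\<beta>) \<le> real N powr (1 - \<beta>) / (1 - \<beta>)"
    using zeta_partial_sums[OF \<beta>0 \<beta>(2)] by blast
  show ?thesis
  proof (rule that[OF c(1,2)])
    fix x :: nat assume x: "1 \<le> x"
    define X where "X = real x"
    have X: "1 \<le> X" using x by (simp add: X_def)
    define y where "y = nat \<lfloor>sqrt X\<rfloor>"
    have y: "real y \<le> sqrt X" "sqrt X \<le> real (Suc y)" unfolding y_def using X by (auto simp: of_nat_nat) linarith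
    define e where "e = X powr (1 / 2 - \<beta>)"
    define p where "p = 1 - \<beta>"
    have p: "0 < p" "p \<le> 1 / 2" using \<beta> by (auto simp: p_def)
    define Z where "Z N = (\<Sum>n=1..N. real n powr -\<beta>)" for N
    define T1 where "T1 = (\<Sum>b=1..y. (w b * real b powr -\<beta>) * Z (x div b))"
    define T2 where "T2 = (\<Sum>a=1..x div Suc y. real a powr -\<beta> * (dirichlet_sum w \<beta> (x div a) - dirichlet_sum w \<beta> y))"
    have split: "dirichlet_sum (one_conv w) \<beta> x = T1 + T2"
    proof -
      have "dirichlet_sum (one_conv w) \<beta> x = (\<Sum>n=1..x. dconv (\<lambda>n. real n powr -\<beta>) (\<lambda>n. w n * real n powr -\<beta>) n)"
        unfolding dirichlet_sum_def using dconv_powr[of "\<lambda>_. 1" w _ \<beta>] by simp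
      then show ?thesis unfolding sum_dconv T1_def T2_def Z_def dirichlet_sum_def by (simp only: hyperbola[where y = y])
    qed
    have sX: "sqrt X = X powr (1 / 2)" using X by (simp add: powr_half_sqrt)
    have Sy: "X powr (1/2) \<le> real (Suc y)" using y(2) sX by simp
    have e1: "real y * (2 * X powr -\<beta>) \<le> 2 * e"
    proof -
      have "real y * (2 * X powr -\<beta>) \<le> X powr (1/2) * (2 * X powr -\<beta>)"
        using y(1) sX by (intro mult_right_mono) auto
      also have "\<dots> = 2 * (X powr (1/2) * X powr -\<beta>)" by simp
      also have "\<dots> = 2 * e" unfolding e_def powr_add[symmetric] by simp
      finally show ?thesis .
    qed
    have e2: "X powr p * (1 / real (Suc y)) \<le> e"
    proof -
      have "X powr p * (1 / real (Suc y)) \<le> X powr p * (1 / X powr (1/2))"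
        using Sy X by (intro mult_left_mono divide_left_mono) auto
      also have "\<dots> = X powr p / X powr (1/2)" by simp
      also have "\<dots> = e" unfolding e_def p_def powr_diff[symmetric] by (simp add: algebra_simps)
      finally show ?thesis .
    qed
    have e3: "real (Suc y) powr -\<beta> \<le> X powr (-\<beta>/2)"
    proof -
      have "real (Suc y) powr -\<beta> \<le> (X powr (1/2)) powr -\<beta>"
        using Sy X \<beta>0 by (intro powr_mono2') auto
      then show ?thesis by (simp add: powr_powr)
    qed
    have e4: "X powr (-\<beta>/2) \<le> e" unfolding e_def using X \<beta> by (intro powr_mono) auto
    have T1b: "T1 \<le> X powr p / p * dirichlet_sum w 1 y - c * dirichlet_sum w \<beta> y + 2 * e"
    proof -
      have "T1 - (X powr p / p * dirichlet_sum w 1 y - c * dirichlet_sum w \<beta> y)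
        = (\<Sum>b=1..y. (w b * real b powr -\<beta>) * Z (x div b) - X powr p / p * (w b * real b powr -1) + c * (w b * real b powr -\<beta>))"
        unfolding T1_def dirichlet_sum_def by (simp add: sum_subtractf sum.distrib sum_distrib_left)
      also have "\<dots> \<le> (\<Sum>b=1..y. 2 * X powr -\<beta>)"
      proof (rule sum_mono)
        fix b assume b: "b \<in> {1..y}"
        have "real b \<le> sqrt X" using b y(1) by simp
        also have "\<dots> \<le> X" using X self_le_power[of X 2] by (intro real_le_lsqrt) auto
        finally have bx: "1 \<le> b" "b \<le> x" using b by (auto simp: X_def)
        then have d1: "1 \<le> x div b" by (simp add: Suc_le_eq div_greater_zero_iff)
        have zb: "\<bar>Z (x div b) - (X / real b) powr p / p + c\<bar> \<le> real (x div b) powr -\<beta>"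
          unfolding Z_def p_def X_def using c(3)[OF d1] real_div_bounds[OF bx(1), of x] by simp
        have "1 \<le> real (x div b)" using d1 by simp
        then have "X / real b \<le> 2 * real (x div b)"
          using real_div_bounds(2)[OF bx(1), of x] unfolding X_def by linarith
        then have "X / real b / 2 \<le> real (x div b)" by simp
        then have "real (x div b) powr -\<beta> \<le> (X / real b / 2) powr -\<beta>"
          using X bx \<beta>0 by (intro powr_mono2') auto
        also have "\<dots> = real b powr \<beta> * X powr -\<beta> * 2 powr \<beta>"
          using X bx by (simp add: powr_divide powr_mult powr_minus field_simps)
        also have "\<dots> \<le> real b powr \<beta> * X powr -\<beta> * 2 powr 1"
          using \<beta> by (intro mult_left_mono powr_mono) auto
        finally have zb': "\<bar>Z (x div b) - (X / real b) powr p / p + c\<bar> \<le> real b powr \<beta> * (2 * X powr -\<beta>)"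
          using zb by simp
        have eq: "(w b * real b powr -\<beta>) * Z (x div b) - X powr p / p * (w b * real b powr -1) + c * (w b * real b powr -\<beta>)
            = (w b * real b powr -\<beta>) * (Z (x div b) - (X / real b) powr p / p + c)"
        proof -
          have "real b powr -\<beta> * (X / real b) powr p = X powr p * real b powr -1"
            using bx X by (simp add: powr_divide p_def powr_diff powr_minus field_simps)
          then have "w b * (real b powr -\<beta> * (X / real b) powr p) / p = w b * (X powr p * real b powr -1) / p" by simp
          then show ?thesis by (simp add: algebra_simps)
        qed
        also have "\<dots> \<le> \<bar>w b * real b powr -\<beta>\<bar> * \<bar>Z (x div b) - (X / real b) powr p / p + c\<bar>"
          by (metis abs_ge_self abs_mult)
        also have "\<dots> \<le> real b powr -\<beta> * (real b powr \<beta> * (2 * X powr -\<beta>))"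
          using zb' w1[of b] by (intro mult_mono) (auto simp: abs_mult mult_left_le_one_le)
        also have "\<dots> = 2 * X powr -\<beta>" using bx by (simp add: powr_minus)
        finally show "(w b * real b powr -\<beta>) * Z (x div b) - X powr p / p * (w b * real b powr -1) + c * (w b * real b powr -\<beta>)
            \<le> 2 * X powr -\<beta>" .
      qed
      also have "\<dots> \<le> 2 * e" using e1 by simp
      finally show ?thesis by simp
    qed
    have L1: "X powr p / p * dirichlet_sum w 1 y \<le> X powr p / p * lfun w 1 + 2 * B / p * e"
    proof -
      have "dirichlet_sum w 1 y \<le> lfun w 1 + 2 * B * (1 / real (Suc y))"
      proof -
        have "real (Suc y) powr -1 = 1 / real (Suc y)" by (simp add: powr_minus_divide)
        then show ?thesis using lfun_tail[OF w, of 1 y] by simp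
      qed
      then have "X powr p / p * dirichlet_sum w 1 y \<le> X powr p / p * (lfun w 1 + 2 * B * (1 / real (Suc y)))"
        using p by (intro mult_left_mono) auto
      also have "\<dots> = X powr p / p * lfun w 1 + 2 * B / p * (X powr p * (1 / real (Suc y)))"
        by (simp add: algebra_simps)
      also have "\<dots> \<le> X powr p / p * lfun w 1 + 2 * B / p * e"
        using e2 B p by (intro add_left_mono mult_left_mono) auto
      finally show ?thesis .
    qed
    have L2: "- (c * dirichlet_sum w \<beta> y) \<le> - (c * lfun w \<beta>) + 2 * B / p * e"
    proof -
      have "lfun w \<beta> - dirichlet_sum w \<beta> y \<le> 2 * B * e"
      proof -
        have "lfun w \<beta> - dirichlet_sum w \<beta> y \<le> 2 * B * real (Suc y) powr -\<beta>"
          using lfun_tail[OF w \<beta>0, of y] by linarith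
        also have "\<dots> \<le> 2 * B * e" using e3 e4 B by (intro mult_left_mono) auto
        finally show ?thesis .
      qed
      then have "c * (lfun w \<beta> - dirichlet_sum w \<beta> y) \<le> c * (2 * B * e)" using c by (intro mult_left_mono)
      also have "\<dots> \<le> 1 / p * (2 * B * e)" using c B by (intro mult_right_mono) (auto simp: p_def e_def)
      finally show ?thesis by (simp add: algebra_simps)
    qed
    have T2b: "T2 \<le> 2 * B / p * e"
    proof -
      define M where "M = x div Suc y"
      have M: "real M \<le> X powr (1/2)"
      proof -
        have "real M \<le> X / real (Suc y)" unfolding M_def X_def by (rule real_div_bounds) simp
        also have "\<dots> \<le> X / X powr (1/2)" using Sy X by (intro divide_left_mono) auto
        also have "\<dots> = X powr (1/2)" using X by (simp add: powr_half_sqrt real_div_sqrt)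
        finally show ?thesis .
      qed
      have "T2 \<le> (\<Sum>a=1..M. real a powr -\<beta> * (2 * B * real (Suc y) powr -\<beta>))"
        unfolding T2_def M_def
      proof (intro sum_mono mult_left_mono)
        fix a assume "a \<in> {1..x div Suc y}"
        then have a: "1 \<le> a" "a \<le> x div Suc y" by auto
        then have "a * Suc y \<le> x" by (simp add: less_eq_div_iff_mult_less_eq del: mult_Suc_right)
        then have "y \<le> x div a" using a(1) by (simp add: less_eq_div_iff_mult_less_eq mult.commute)
        then show "dirichlet_sum w \<beta> (x div a) - dirichlet_sum w \<beta> y \<le> 2 * B * real (Suc y) powr -\<beta>"
          using dirichlet_sum_diff_bound[OF w \<beta>0, of y "x div a"] by linarith
      qed auto
      also have "\<dots> = Z M * (2 * B * real (Suc y) powr -\<beta>)" unfolding Z_def by (simp add: sum_distrib_right)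
      also have "\<dots> \<le> (X powr (p / 2) / p) * (2 * B * X powr (-\<beta>/2))"
      proof (intro mult_mono mult_left_mono e3)
        have "Z M \<le> real M powr p / p" unfolding Z_def p_def by (rule c(4))
        also have "\<dots> \<le> (X powr (1/2)) powr p / p" using M p by (intro divide_right_mono powr_mono2) auto
        finally show "Z M \<le> X powr (p / 2) / p" by (simp add: powr_powr)
      qed (use B p in auto)
      also have "\<dots> = 2 * B / p * (X powr (p / 2) * X powr (-\<beta>/2))" by simp
      also have "p / 2 + - \<beta> / 2 = 1 / 2 - \<beta>" by (simp add: p_def field_simps)
      then have "X powr (p / 2) * X powr (-\<beta>/2) = e"
        unfolding e_def powr_add[symmetric] by (simp only:)
      finally show ?thesis .
    qed
    have "2 * e \<le> 2 * B / p * e"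
    proof (rule mult_right_mono)
      show "2 \<le> 2 * B / p" using B p by (simp add: field_simps)
    qed (simp add: e_def)
    then have "dirichlet_sum (one_conv w) \<beta> x \<le> X powr p / p * lfun w 1 - c * lfun w \<beta> + 4 * (2 * B / p * e)"
      using split T1b T2b L1 L2 by linarith
    also have "4 * (2 * B / p * e) = 8 * B / p * e" by simp
    finally show "dirichlet_sum (one_conv w) \<beta> x \<le> real x powr (1 - \<beta>) / (1 - \<beta>) * lfun w 1 - c * lfun w \<beta>
        + 8 * B / (1 - \<beta>) * real x powr (1 / 2 - \<beta>)"
      unfolding p_def e_def X_def .
  qed
qed

section \<open>Siegel's theorem for pairs of characters\<close>

lemma floor_powr_bounds:
  assumes "1 \<le> (x :: nat)" "0 \<le> s" "s \<le> 1"
  defines "y \<equiv> nat \<lfloor>real x powr s\<rfloor>"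
  shows "1 \<le> y" "y \<le> x" "real y \<le> real x powr s" "real x powr s \<le> real (Suc y)"
proof -
  have "1 \<le> real x powr s" using assms by (intro ge_one_powr_ge_zero) auto
  moreover have "real x powr s \<le> real x powr 1" using assms by (intro powr_mono) auto
  ultimately show "1 \<le> y" "y \<le> x" "real y \<le> real x powr s" "real x powr s \<le> real (Suc y)"
    using assms(1) unfolding y_def by (simp_all add: le_nat_iff nat_le_iff floor_le_iff) linarith+
qed

lemma div_Suc_floor_powr:
  assumes "1 \<le> (x :: nat)" "real x powr s \<le> real (Suc y)"
  shows "real x / real (Suc y) \<le> real x powr (1 - s)"
proof -
  have "real x / real (Suc y) \<le> real x / real x powr s"
    using assms by (intro divide_left_mono) auto
  then show ?thesis using assms by (simp add: powr_diff)
qed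

text \<open>\<open>hyperbola_asymp\<close> for the constant function 1, with \<open>y\<close> near
  the square root of \<open>x\<close> so that y and x / y balance.\<close>

lemma one_conv_sum:
  assumes w: "bounded_char w B" and x: "1 \<le> x"
  shows "\<bar>(\<Sum>n=1..x. one_conv w n) - lfun w 1 * real x\<bar> \<le> 5 * B * real x powr (1/2)"
proof -
  define y where "y = nat \<lfloor>real x powr (1/2)\<rfloor>"
  note y = floor_powr_bounds[OF x, of "1/2", folded y_def, simplified]
  have B: "1 \<le> B" using w by (simp add: bounded_char_def)
  have "\<bar>(\<Sum>n=1..x. one_conv w n) - 1 * lfun w 1 * real x\<bar>
      \<le> (1 + 0) * (real y * real x powr 0 + 4 * B * real x / real (Suc y))"
    using y by (intro hyperbola_asymp[OF w]) auto
  also have "\<dots> = real y + 4 * B * (real x / real (Suc y))" using x by simp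
  also have "\<dots> \<le> real x powr (1/2) + 4 * B * real x powr (1/2)"
    using y div_Suc_floor_powr[OF x, of "1/2" y] B by (intro add_mono mult_left_mono) auto
  also have "\<dots> \<le> B * real x powr (1/2) + 4 * B * real x powr (1/2)"
    using mult_right_mono[OF B, of "real x powr (1/2)"] by simp
  finally show ?thesis by simp
qed

text \<open>L(1, w) is the mean value of the nonnegative function \<open>one_conv w\<close>.\<close>

lemma lfun_1_nonneg:
  assumes "quad_char w" and w: "bounded_char w B"
  shows "0 \<le> lfun w 1"
proof (rule LIMSEQ_le_const2)
  have "(\<lambda>x. - (5 * B * real x powr (-1/2))) \<longlonglongrightarrow> - (5 * B * 0)"
    by (intro tendsto_intros tendsto_neg_powr filterlim_real_sequentially) auto
  then show "(\<lambda>x. - (5 * B * real x powr (-1/2))) \<longlonglongrightarrow> 0" by simp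
  have "- (5 * B * real x powr (-1/2)) \<le> lfun w 1" if x: "1 \<le> x" for x
  proof -
    have "0 \<le> (\<Sum>n=1..x. one_conv w n)" by (intro sum_nonneg one_conv_nonneg assms)
    then have "- (5 * B * real x powr (1/2)) \<le> lfun w 1 * real x"
      using one_conv_sum[OF w x] by linarith
    moreover have "real x powr (1/2) = real x powr (-1/2) * real x"
      using x powr_add[of "real x" "-1/2" 1] by simp
    ultimately have "- (5 * B * real x powr (-1/2)) * real x \<le> lfun w 1 * real x" by (simp add: mult.assoc)
    then show ?thesis by (rule mult_right_le_imp_le) (use x in simp)
  qed
  then show "\<exists>N. \<forall>n\<ge>N. - (5 * B * real n powr (-1/2)) \<le> lfun w 1" by blast
qed

lemma dirichlet_sum_ge_1:
  assumes "f 1 = 1" "\<And>n. 0 < n \<Longrightarrow> 0 \<le> f n" "1 \<le> x"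
  shows "1 \<le> dirichlet_sum f s x"
proof -
  have "(\<Sum>n\<in>{1}. f n * real n powr -s) \<le> dirichlet_sum f s x"
    unfolding dirichlet_sum_def using assms by (intro sum_mono2) auto
  then show ?thesis using assms by simp
qed

lemma nat_ceiling_bounds:
  assumes "1 \<le> (t :: real)"
  obtains x :: nat where "1 \<le> x" "t \<le> real x" "real x \<le> 2 * t"
proof (rule that[of "nat \<lceil>t\<rceil>"])
  show "1 \<le> nat \<lceil>t\<rceil>" "t \<le> real (nat \<lceil>t\<rceil>)" using assms by linarith+
  have "real (nat \<lceil>t\<rceil>) \<le> t + 1" using assms by linarith
  then show "real (nat \<lceil>t\<rceil>) \<le> 2 * t" using assms by linarith
qed

lemma lfun_1_ge_of_nonneg:
  assumes q: "quad_char w" and w: "bounded_char w B" and \<beta>: "3 / 4 \<le> \<beta>" "\<beta> < 1" and L: "0 \<le> lfun w \<beta>"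
  shows "(1 - \<beta>) / 2 * (2 * (16 * B / (1 - \<beta>)) ^ 4) powr -(1 - \<beta>) \<le> lfun w 1"
proof -
  have B: "1 \<le> B" using w by (simp add: bounded_char_def)
  have p: "0 < 1 - \<beta>" using \<beta> by simp
  define t where "t = 16 * B / (1 - \<beta>)"
  have t: "1 \<le> t" using B p \<beta> by (simp add: t_def field_simps)
  obtain x where x: "1 \<le> x" "t ^ 4 \<le> real x" "real x \<le> 2 * t ^ 4"
    using nat_ceiling_bounds[of "t ^ 4"] t by (auto simp: one_le_power)
  have \<beta>': "1 / 2 \<le> \<beta>" using \<beta> by simp
  obtain c where c: "0 \<le> c" and hb': "\<And>x. 1 \<le> x \<Longrightarrow> dirichlet_sum (one_conv w) \<beta> x \<le>
       real x powr (1 - \<beta>) / (1 - \<beta>) * lfun w 1 - c * lfun w \<beta> + 8 * B / (1 - \<beta>) * real x powr (1 / 2 - \<beta>)"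
    by (rule hecke_bound[OF w \<beta>' \<beta>(2)]) blast
  note hb = hb'[OF x(1)]
  have "1 \<le> dirichlet_sum (one_conv w) \<beta> x"
    using x(1) q by (intro dirichlet_sum_ge_1 one_conv_nonneg) (auto simp: dconv_def quad_char_def)
  moreover have "8 * B / (1 - \<beta>) * real x powr (1 / 2 - \<beta>) \<le> 1 / 2"
  proof -
    have "real x powr (1 / 2 - \<beta>) \<le> real x powr (-1/4)" using x(1) \<beta> by (intro powr_mono) auto
    also have "\<dots> \<le> (t ^ 4) powr (-1/4)" using x t by (intro powr_mono2') auto
    also have "(t ^ 4) powr (-1/4) = (t powr 4) powr (-1/4)"
      using t by (simp add: powr_numeral)
    also have "\<dots> = t powr -1" unfolding powr_powr by simp
    also have "\<dots> = 1 / t" using t by (simp add: powr_minus_divide)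
    finally have "8 * B / (1 - \<beta>) * real x powr (1 / 2 - \<beta>) \<le> 8 * B / (1 - \<beta>) * (1 / t)"
      using B p by (intro mult_left_mono) auto
    also have "\<dots> = 1 / 2" using B p by (simp add: t_def field_simps)
    finally show ?thesis .
  qed
  moreover have "0 \<le> c * lfun w \<beta>" using c L by simp
  ultimately have "1 / 2 \<le> real x powr (1 - \<beta>) / (1 - \<beta>) * lfun w 1" using hb by linarith
  then have "(1 - \<beta>) / 2 \<le> real x powr (1 - \<beta>) * lfun w 1" using p by (simp add: field_simps)
  then have "(1 - \<beta>) / 2 * real x powr -(1 - \<beta>) \<le> real x powr (1 - \<beta>) * lfun w 1 * real x powr -(1 - \<beta>)"
    by (intro mult_right_mono) auto
  also have "\<dots> = lfun w 1 * (real x powr (1 - \<beta>) * real x powr -(1 - \<beta>))" by simp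
  also have "\<dots> = lfun w 1" unfolding powr_add[symmetric] using x(1) by simp
  finally have *: "(1 - \<beta>) / 2 * real x powr -(1 - \<beta>) \<le> lfun w 1" .
  have "(2 * t ^ 4) powr -(1 - \<beta>) \<le> real x powr -(1 - \<beta>)"
    using x p by (intro powr_mono2') auto
  then have "(1 - \<beta>) / 2 * (2 * t ^ 4) powr -(1 - \<beta>) \<le> (1 - \<beta>) / 2 * real x powr -(1 - \<beta>)"
    using p by (intro mult_left_mono) auto
  then show ?thesis using * by (simp add: t_def)
qed

section \<open>An explicit positive lower bound for L(1)\<close>

lemma harmonic_ge_ln: "ln (real (Suc y)) \<le> (\<Sum>m=1..y. 1 / real m)"
proof (induction y)
  case (Suc y)
  have "ln (real (Suc (Suc y)) / real (Suc y)) \<le> real (Suc (Suc y)) / real (Suc y) - 1"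
    by (intro ln_le_minus_one) simp
  also have "\<dots> = 1 / real (Suc y)" by (simp add: field_simps)
  finally have "ln (real (Suc (Suc y))) - ln (real (Suc y)) \<le> 1 / real (Suc y)" by (simp add: ln_div)
  then show ?case using Suc by simp
qed simp

lemma harmonic_le_ln:
  assumes "1 \<le> N"
  shows "(\<Sum>m=1..N. 1 / real m) \<le> 1 + ln (real N)"
  using assms
proof (induction N rule: dec_induct)
  case (step N)
  have "ln (real N / real (Suc N)) \<le> real N / real (Suc N) - 1"
    using step by (intro ln_le_minus_one) simp
  also have "\<dots> = - 1 / real (Suc N)" by (simp add: field_simps)
  finally have "1 / real (Suc N) \<le> ln (real (Suc N)) - ln (real N)" using step by (simp add: ln_div)
  then show ?case using step by simp
qed simp

text \<open>At \<beta> = 1/2 the squares m^2 up to y^2 alone contribute at least ln y to the sum,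
  while \<open>hecke_bound\<close> gives at most 2 y L(1, w) + 20 B. With ln y at least 21 B this
  leaves 2 y L(1, w) \<ge> 1. The bound is exponentially small in \<open>B\<close> but explicit; it
  provides the effective constant of part (2) and the strict positivity used in Siegel's argument.
  The passage from 21 to 23 absorbs a factor 4.\<close>

lemma lfun_1_ge_exp:
  assumes q: "quad_char w" and w: "bounded_char w B"
  shows "exp (- (23 * B)) \<le> lfun w 1"
proof -
  have B: "1 \<le> B" using w by (simp add: bounded_char_def)
  obtain y where y: "1 \<le> y" "exp (21 * B) \<le> real y" "real y \<le> 2 * exp (21 * B)"
    using nat_ceiling_bounds[of "exp (21 * B)"] B by auto
  obtain c where c: "0 \<le> c" "c \<le> 1 / (1 - 1 / 2)" and hb': "\<And>x. 1 \<le> x \<Longrightarrow> dirichlet_sum (one_conv w) (1/2) x \<le>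
       real x powr (1 - 1/2) / (1 - 1/2) * lfun w 1 - c * lfun w (1/2) + 8 * B / (1 - 1/2) * real x powr (1 / 2 - 1 / 2)"
    by (rule hecke_bound[OF w, of "1/2"]) (simp, simp, blast)
  have "1 \<le> y\<^sup>2" using y(1) by simp
  note hb = hb'[OF this]
  have sq: "real (y\<^sup>2) powr (1/2) = real y" using y(1) by (simp add: powr_half_sqrt)
  have "21 * B = ln (exp (21 * B))" by simp
  also have "\<dots> \<le> ln (real (Suc y))" using y by (intro ln_mono) auto
  also have "\<dots> \<le> (\<Sum>m=1..y. 1 / real m)" by (rule harmonic_ge_ln)
  also have "\<dots> \<le> (\<Sum>m=1..y. one_conv w (m\<^sup>2) * real (m\<^sup>2) powr -(1/2))"
  proof (rule sum_mono)
    fix m assume m: "m \<in> {1..y}"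
    then have "real (m\<^sup>2) powr -(1/2) = 1 / real m"
      by (simp add: powr_minus powr_half_sqrt field_simps)
    moreover have "1 \<le> one_conv w (m\<^sup>2)" using one_conv_square_ge_1[OF q, of m] m by simp
    ultimately show "1 / real m \<le> one_conv w (m\<^sup>2) * real (m\<^sup>2) powr -(1/2)"
      by (simp add: divide_right_mono)
  qed
  also have "\<dots> = (\<Sum>n\<in>(\<lambda>m. m\<^sup>2) ` {1..y}. one_conv w n * real n powr -(1/2))"
    by (subst sum.reindex) (auto intro!: inj_onI)
  also have "\<dots> \<le> dirichlet_sum (one_conv w) (1/2) (y\<^sup>2)"
    unfolding dirichlet_sum_def using one_conv_nonneg[OF q] by (intro sum_mono2) (auto intro!: mult_nonneg_nonneg)
  also have "\<dots> \<le> 2 * real y * lfun w 1 - c * lfun w (1/2) + 16 * B"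
    using hb y(1) sq by simp
  also have "\<dots> \<le> 2 * real y * lfun w 1 + 4 * B + 16 * B"
  proof -
    have "- (c * lfun w (1/2)) \<le> c * \<bar>lfun w (1/2)\<bar>" using c(1) by (metis abs_ge_minus_self abs_mult abs_of_nonneg)
    also have "\<dots> \<le> 2 * (2 * B)" using c lfun_abs_le[OF w, of "1/2"] by (intro mult_mono) auto
    finally show ?thesis by simp
  qed
  finally have "1 \<le> 2 * real y * lfun w 1" using B by linarith
  also have "\<dots> \<le> 2 * (2 * exp (21 * B)) * lfun w 1"
    using y lfun_1_nonneg[OF q w] by (intro mult_right_mono) auto
  finally have "1 \<le> 4 * exp (21 * B) * lfun w 1" by simp
  also have "\<dots> \<le> exp (2 * B) * exp (21 * B) * lfun w 1"
  proof -
    have "(4 :: real) \<le> exp 1 * exp 1" using mult_mono[of 2 "exp 1" 2 "exp (1::real)"] exp_ge_add_one_self[of 1] by simp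
    also have "\<dots> = exp 2" by (simp flip: exp_add)
    also have "\<dots> \<le> exp (2 * B)" using B by simp
    finally show ?thesis using lfun_1_nonneg[OF q w] by (intro mult_right_mono) auto
  qed
  also have "\<dots> = exp (23 * B) * lfun w 1" by (simp flip: exp_add)
  finally show ?thesis by (simp add: exp_minus field_simps)
qed

section \<open>The coefficients of the product of the zeta function and three L-functions\<close>

lemma geometric_conv_Suc:
  fixes s :: "nat \<Rightarrow> real"
  shows "(\<Sum>i\<le>Suc k. s i * c ^ (Suc k - i)) = s (Suc k) + c * (\<Sum>i\<le>k. s i * c ^ (k - i))"
proof -
  have "(\<Sum>i\<le>k. s i * c ^ (Suc k - i)) = c * (\<Sum>i\<le>k. s i * c ^ (k - i))"
    unfolding sum_distrib_left by (intro sum.cong) (auto simp: Suc_diff_le)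
  then show ?thesis by simp
qed

text \<open>The generating series at p is 1 / ((1 - X)(1 - a X)(1 - a b X)(1 - b X));
  \<open>s1\<close> covers the first two factors, and \<open>s2\<close> and \<open>s3\<close> add
  one factor each. Unless \<open>b\<close> and \<open>b * a\<close> are both nonnegative, the series
  is 1 / (1 - X^2)^2, or 1 / (1 - X^2) when \<open>a = 0\<close>, so the odd coefficients vanish and
  the even ones are positive.\<close>

lemma biquadratic_conv_prime_power_nonneg:
  assumes "quad_char u" "quad_char v" "prime p"
  shows "0 \<le> dconv (dconv (one_conv v) (\<lambda>n. u n * v n)) u (p ^ k)"
proof -
  define a b where "a = v p" and "b = u p"
  define s1 where "s1 i = one_conv v (p ^ i)" for i
  define s2 where "s2 k = (\<Sum>i\<le>k. s1 i * (b * a) ^ (k - i))" for k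
  define s3 where "s3 k = (\<Sum>i\<le>k. s2 i * b ^ (k - i))" for k
  have eq: "dconv (dconv (one_conv v) (\<lambda>n. u n * v n)) u (p ^ k) = s3 k" for k
    using assms by (simp add: dconv_prime_power s3_def s2_def s1_def a_def b_def quad_char_power power_mult_distrib)
  have ab: "a \<in> {-1, 0, 1}" "b \<in> {-1, 0, 1}" using assms by (auto simp: quad_char_def a_def b_def)
  have s1: "s1 i = (if a = 1 then real i + 1 else if a = 0 then 1 else if even i then 1 else 0)" for i
    unfolding s1_def a_def by (rule one_conv_prime_power_cases[OF assms(2,3)])
  have s2_0: "s2 0 = s1 0" and s3_0: "s3 0 = s2 0" by (simp_all add: s2_def s3_def)
  have s2_Suc: "s2 (Suc k) = s1 (Suc k) + b * a * s2 k" for k unfolding s2_def by (rule geometric_conv_Suc)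
  have s3_Suc: "s3 (Suc k) = s2 (Suc k) + b * s3 k" for k unfolding s3_def by (rule geometric_conv_Suc)
  have s1_nn: "0 \<le> s1 k" for k by (simp add: s1)
  have pos: "0 \<le> s3 k" if "0 \<le> b * a" "0 \<le> b" for k
    unfolding s3_def s2_def
    by (intro sum_nonneg mult_nonneg_nonneg[OF _ zero_le_power] mult_nonneg_nonneg[OF s1_nn zero_le_power] that)
  have parity: "0 \<le> s3 k" if "\<And>j. 0 \<le> s3 (2 * j) \<and> 0 \<le> s3 (Suc (2 * j))" for k
    using that[of "k div 2"] by (cases "even k") auto
  consider "0 \<le> b * a" "0 \<le> b" | "a = -1" "b = 1" | "a = 1" "b = -1" | "a = 0" "b = -1" | "a = -1" "b = -1"
    using ab by auto
  then have "0 \<le> s3 k"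
  proof cases
    case 2
    have s2: "s2 (2 * j) = real j + 1 \<and> s2 (Suc (2 * j)) = -(real j + 1)" for j
      by (induction j) (simp_all add: s2_0 s2_Suc s1 2)
    have "s3 (2 * j) = real j + 1 \<and> s3 (Suc (2 * j)) = 0" for j
    proof (induction j)
      case (Suc j)
      then show ?case using s2[of "Suc j"] by (simp add: s3_Suc 2)
    qed (use s2[of 0] in \<open>simp add: s3_0 s3_Suc 2\<close>)
    then show ?thesis by (intro parity) auto
  next
    case 3
    have s2: "s2 (2 * j) = real j + 1 \<and> s2 (Suc (2 * j)) = real j + 1" for j
      by (induction j) (simp_all add: s2_0 s2_Suc s1 3)
    have "s3 (2 * j) = real j + 1 \<and> s3 (Suc (2 * j)) = 0" for j
    proof (induction j)
      case (Suc j)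
      then show ?case using s2[of "Suc j"] by (simp add: s3_Suc 3)
    qed (use s2[of 0] in \<open>simp add: s3_0 s3_Suc 3\<close>)
    then show ?thesis by (intro parity) auto
  next
    case 4
    have s2: "s2 j = 1" for j by (induction j) (simp_all add: s2_0 s2_Suc s1 4)
    have "s3 (2 * j) = 1 \<and> s3 (Suc (2 * j)) = 0" for j
      by (induction j) (simp_all add: s3_0 s3_Suc s2 4)
    then show ?thesis by (intro parity) auto
  next
    case 5
    have s2: "s2 (2 * j) = real j + 1 \<and> s2 (Suc (2 * j)) = real j + 1" for j
      by (induction j) (simp_all add: s2_0 s2_Suc s1 5)
    have "s3 (2 * j) = real j + 1 \<and> s3 (Suc (2 * j)) = 0" for j
    proof (induction j)
      case (Suc j)
      then show ?case using s2[of "Suc j"] by (simp add: s3_Suc 5)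
    qed (use s2[of 0] in \<open>simp add: s3_0 s3_Suc 5\<close>)
    then show ?thesis by (intro parity) auto
  qed (rule pos)
  then show ?thesis by (simp add: eq)
qed

lemma quad_char_mult: "quad_char u \<Longrightarrow> quad_char v \<Longrightarrow> quad_char (\<lambda>n. u n * v n)"
proof -
  assume uv: "quad_char u" "quad_char v"
  have "u n * v n \<in> {-1, 0, 1}" for n
  proof -
    have "u n \<in> {-1, 0, 1}" "v n \<in> {-1, 0, 1}" using uv by (simp_all add: quad_char_def)
    then show ?thesis by auto
  qed
  then show ?thesis using uv by (simp add: quad_char_def)
qed

lemma biquadratic_conv_nonneg:
  assumes "quad_char u" "quad_char v" "n > 0"
  shows "0 \<le> dconv (dconv (one_conv v) (\<lambda>n. u n * v n)) u n"
proof (rule multiplicative_ge[OF _ assms(3)])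
  show "multiplicative (dconv (dconv (one_conv v) (\<lambda>n. u n * v n)) u)"
    using multiplicative_dconv[OF multiplicative_dconv[OF one_conv_multiplicative[OF assms(2)]
        quad_char_multiplicative[OF quad_char_mult[OF assms(1,2)]]] quad_char_multiplicative[OF assms(1)]] .
qed (rule biquadratic_conv_prime_power_nonneg[OF assms(1,2)])

text \<open>\<open>hyperbola_asymp\<close> applied to \<open>one_conv v\<close>, whose sums have
  error exponent 1/2. The cut near x^(1/4) balances y x^(1/2) with x / y at x^(3/4). The 35 is 7
  times 5, from L(1, v) + 5 B \<le> 7 B and 1 + 4 errors.\<close>

lemma biquadratic_partial_sums:
  assumes q: "quad_char v" and v: "bounded_char v B" and w: "bounded_char w B" and x: "1 \<le> x"
  shows "\<bar>(\<Sum>n=1..x. dconv (one_conv v) w n) - lfun v 1 * lfun w 1 * real x\<bar> \<le> 35 * B\<^sup>2 * real x powr (3/4)"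
proof -
  define y where "y = nat \<lfloor>real x powr (1/4)\<rfloor>"
  note y = floor_powr_bounds[OF x, of "1/4", folded y_def, simplified]
  have B: "1 \<le> B" using v by (simp add: bounded_char_def)
  have "\<bar>(\<Sum>n=1..x. dconv (one_conv v) w n) - lfun v 1 * lfun w 1 * real x\<bar>
      \<le> (lfun v 1 + 5 * B) * (real y * real x powr (1/2) + 4 * B * real x / real (Suc y))"
    using y B one_conv_sum[OF v]
    by (intro hyperbola_asymp[OF w one_conv_nonneg[OF q] lfun_1_nonneg[OF q v]]) auto
  also have "\<dots> \<le> (2 * B + 5 * B) * (B * real x powr (3/4) + 4 * B * real x powr (3/4))"
  proof (rule mult_mono)
    show "lfun v 1 + 5 * B \<le> 2 * B + 5 * B" using lfun_abs_le[OF v, of 1] by simp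
    have "real y * real x powr (1/2) \<le> real x powr (1/4) * real x powr (1/2)"
      using y by (intro mult_right_mono) auto
    also have "\<dots> = 1 * real x powr (3/4)" by (simp flip: powr_add)
    also have "\<dots> \<le> B * real x powr (3/4)" using B by (intro mult_right_mono) auto
    finally have 1: "real y * real x powr (1/2) \<le> B * real x powr (3/4)" .
    have "4 * B * (real x / real (Suc y)) \<le> 4 * B * real x powr (3/4)"
      using div_Suc_floor_powr[OF x, of "1/4" y] y B by (intro mult_left_mono) auto
    then have 2: "4 * B * real x / real (Suc y) \<le> 4 * B * real x powr (3/4)" by simp
    show "real y * real x powr (1/2) + 4 * B * real x / real (Suc y) \<le> B * real x powr (3/4) + 4 * B * real x powr (3/4)"
      by (rule add_mono[OF 1 2])
  qed (use B in auto)
  also have "\<dots> = 35 * B\<^sup>2 * real x powr (3/4)" by (simp add: power2_eq_square algebra_simps)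
  finally show ?thesis .
qed

text \<open>Partial summation when the sums of \<open>k\<close> grow like a power. An increment of
  the weight times such a sum is of order n^(-\<sigma> - 1), which is compared with a difference of
  consecutive values of n^(-\<sigma>) / \<sigma>; these telescope, whence the 2 / \<sigma>.\<close>

lemma abel_growth_bound:
  fixes k :: "nat \<Rightarrow> real"
  assumes k: "\<And>n. 1 \<le> n \<Longrightarrow> \<bar>\<Sum>i=1..n. k i\<bar> \<le> E * real n powr \<theta>" and \<theta>: "0 \<le> \<theta>"
    and \<sigma>: "\<sigma> = \<beta> - \<theta>" "0 < \<sigma>" and \<beta>: "0 < \<beta>" "\<beta> \<le> 1" and M: "1 \<le> M" "M \<le> N"
  shows "\<bar>\<Sum>n=Suc M..N. k n * real n powr -\<beta>\<bar> \<le> (2 + 2 / \<sigma>) * E * real M powr -\<sigma>"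
proof (cases "M = N")
  case True
  have "0 \<le> E" using k[of 1] by auto
  then show ?thesis using True \<sigma> by simp
next
  case False
  then have MN: "M < N" using M by simp
  have E: "0 \<le> E" using k[of 1] by auto
  define T where "T n = (\<Sum>i=Suc M..n. k i)" for n
  have T: "\<bar>T n\<bar> \<le> 2 * E * real n powr \<theta>" if "M \<le> n" for n
  proof -
    have "real M powr \<theta> \<le> real n powr \<theta>" using that \<theta> by (intro powr_mono2) auto
    then have "E * real M powr \<theta> \<le> E * real n powr \<theta>" using E by (intro mult_left_mono)
    then show ?thesis using k[of M] k[of n] M that sum_split[OF that, of k] unfolding T_def by simp
  qed
  have pos: "0 < n" if "M < n" for n using that by simp
  have step: "\<bar>T n * (real n powr -\<beta> - real (Suc n) powr -\<beta>)\<bar>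
      \<le> 2 * E / \<sigma> * (real (n - 1) powr -\<sigma> - real n powr -\<sigma>)" if n: "M < n" for n
  proof -
    have n0: "0 < real n" using n by simp
    obtain z where z: "real n < z" "z < real n + 1" "(real n + 1) powr -\<beta> - real n powr -\<beta> = -\<beta> * z powr (-\<beta> - 1)"
      using powr_diff_MVT[OF n0, of "-\<beta>"] by metis
    have "real n powr -\<beta> - real (Suc n) powr -\<beta> = \<beta> * z powr (-\<beta> - 1)" using z(3) by (simp add: add.commute)
    also have "\<dots> \<le> 1 * real n powr (-\<beta> - 1)" using z n0 \<beta> by (intro mult_mono powr_mono2') auto
    finally have 1: "real n powr -\<beta> - real (Suc n) powr -\<beta> \<le> real n powr (-\<beta> - 1)" by simp
    have 2: "0 \<le> real n powr -\<beta> - real (Suc n) powr -\<beta>" using n0 \<beta> by (simp add: powr_mono2')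
    have n1: "0 < real (n - 1)" "real (n - 1) + 1 = real n" using n M by auto
    obtain z' where z': "real (n - 1) < z'" "z' < real n" "real n powr -\<sigma> - real (n - 1) powr -\<sigma> = -\<sigma> * z' powr (-\<sigma> - 1)"
      using powr_diff_MVT[OF n1(1), of "-\<sigma>"] unfolding n1(2) by metis
    have "\<sigma> * real n powr (-\<sigma> - 1) \<le> \<sigma> * z' powr (-\<sigma> - 1)"
      using z' n1 \<sigma> by (intro mult_left_mono powr_mono2') auto
    then have "\<sigma> * real n powr (-\<sigma> - 1) \<le> real (n - 1) powr -\<sigma> - real n powr -\<sigma>"
      using z'(3) by simp
    then have 3: "real n powr (-\<sigma> - 1) \<le> (real (n - 1) powr -\<sigma> - real n powr -\<sigma>) / \<sigma>"
      using \<sigma>(2) by (simp add: pos_le_divide_eq mult.commute)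
    have "\<bar>T n * (real n powr -\<beta> - real (Suc n) powr -\<beta>)\<bar> \<le> (2 * E * real n powr \<theta>) * real n powr (-\<beta> - 1)"
      unfolding abs_mult using T[of n] n 1 2 E by (intro mult_mono) auto
    also have "\<dots> = 2 * E * real n powr (-\<sigma> - 1)" by (simp add: \<sigma>(1) algebra_simps flip: powr_add)
    also have "\<dots> \<le> 2 * E * ((real (n - 1) powr -\<sigma> - real n powr -\<sigma>) / \<sigma>)"
      using 3 E by (intro mult_left_mono) auto
    finally show ?thesis by simp
  qed
  have "\<bar>\<Sum>n=Suc M..N. k n * real n powr -\<beta>\<bar> \<le> \<bar>T N * real N powr -\<beta>\<bar>
      + \<bar>\<Sum>n=Suc M..<N. T n * (real n powr -\<beta> - real (Suc n) powr -\<beta>)\<bar>"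
    using M(2) unfolding T_def by (subst abel_summation) auto
  also have "\<dots> \<le> 2 * E * real M powr -\<sigma> + 2 * E / \<sigma> * real M powr -\<sigma>"
  proof (rule add_mono)
    have "\<bar>T N * real N powr -\<beta>\<bar> \<le> 2 * E * real N powr \<theta> * real N powr -\<beta>"
      unfolding abs_mult using T[OF M(2)] by (intro mult_mono) auto
    also have "\<dots> = 2 * E * real N powr -\<sigma>" by (simp add: \<sigma>(1) algebra_simps flip: powr_add)
    also have "\<dots> \<le> 2 * E * real M powr -\<sigma>"
      using E M \<sigma> by (intro mult_left_mono powr_mono2') auto
    finally show "\<bar>T N * real N powr -\<beta>\<bar> \<le> 2 * E * real M powr -\<sigma>" .
    have "\<bar>\<Sum>n=Suc M..<N. T n * (real n powr -\<beta> - real (Suc n) powr -\<beta>)\<bar>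
        \<le> (\<Sum>n=Suc M..<N. 2 * E / \<sigma> * (real (n - 1) powr -\<sigma> - real n powr -\<sigma>))"
      by (intro order_trans[OF sum_abs] sum_mono step) auto
    also have "\<dots> = 2 * E / \<sigma> * (real M powr -\<sigma> - real (N - 1) powr -\<sigma>)"
      unfolding sum_distrib_left[symmetric]
      using sum_telescope_desc[OF MN, of "\<lambda>n. real (n - 1) powr -\<sigma>"] by simp
    also have "\<dots> \<le> 2 * E / \<sigma> * real M powr -\<sigma>" using E \<sigma> by (intro mult_left_mono) auto
    finally show "\<bar>\<Sum>n=Suc M..<N. T n * (real n powr -\<beta> - real (Suc n) powr -\<beta>)\<bar> \<le> 2 * E / \<sigma> * real M powr -\<sigma>" .
  qed
  also have "\<dots> = (2 + 2 / \<sigma>) * E * real M powr -\<sigma>" by (simp add: algebra_simps)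
  finally show ?thesis .
qed

text \<open>At a zero \<open>\<beta>\<close> of \<open>L(\<cdot>, u)\<close> the partial sums of \<open>u(n) n\<^sup>-\<^sup>\<beta>\<close> decay, so the sum over the
  hyperbola picks up neither the constant term of the zeta function nor the values at \<open>\<beta>\<close> of the
  other two \<open>L\<close>-functions.\<close>

lemma zero_conv_error:
  assumes u: "bounded_char u B" and zero: "lfun u \<beta> = 0" and \<beta>: "31 / 32 \<le> \<beta>" "\<beta> < 1"
    and E: "0 \<le> E" and k: "\<And>n. 1 \<le> n \<Longrightarrow> \<bar>\<Sum>i=1..n. k i\<bar> \<le> E * real n powr (3/4)" and x: "1 \<le> x"
  shows "\<bar>\<Sum>(a, b)\<in>hyp_pairs x. (k a * real a powr -\<beta>) * (u b * real b powr -\<beta>)\<bar> \<le> 126 * E * B * real x powr (-1/32)"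
proof -
  have B: "1 \<le> B" and u1: "\<And>n. \<bar>u n\<bar> \<le> 1" using u by (auto simp: bounded_char_def)
  have \<beta>0: "0 < \<beta>" using \<beta> by simp
  define \<sigma> where "\<sigma> = \<beta> - 3 / 4"
  have \<sigma>: "7 / 32 \<le> \<sigma>" "\<sigma> \<le> 1 / 4" using \<beta> by (simp_all add: \<sigma>_def)
  define V where "V N = (\<Sum>a=1..N. k a * real a powr -\<beta>)" for N
  \<comment> \<open>The cut lies near x^(3/4). The worst error is then x^(3/16 - \<sigma>), and
    \<sigma> \<ge> 7/32 turns it into x^(-1/32).\<close>
  define y where "y = nat \<lfloor>real x powr (3/4)\<rfloor>"
  note y = floor_powr_bounds[OF x, of "3/4", folded y_def, simplified]
  define X where "X = real x"
  have X: "1 \<le> X" using x by (simp add: X_def)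
  define e where "e = X powr (-1/32)"
  have U: "\<bar>dirichlet_sum u \<beta> N\<bar> \<le> 2 * B * real (Suc N) powr -\<beta>" for N
    using lfun_tail[OF u \<beta>0, of N] zero by simp
  have Vdiff: "\<bar>V N - V M\<bar> \<le> 12 * E * real M powr -\<sigma>" if "1 \<le> M" "M \<le> N" for M N
  proof -
    have "\<bar>V N - V M\<bar> = \<bar>\<Sum>n=Suc M..N. k n * real n powr -\<beta>\<bar>"
      using sum_split[OF that(2), of "\<lambda>n. k n * real n powr -\<beta>"] by (simp add: V_def)
    also have "\<dots> \<le> (2 + 2 / \<sigma>) * E * real M powr -\<sigma>"
      using \<sigma> \<beta> that by (intro abel_growth_bound[OF k]) (auto simp: \<sigma>_def)
    also have "\<dots> \<le> 12 * E * real M powr -\<sigma>"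
      using \<sigma> E by (intro mult_right_mono) (auto simp: field_simps)
    finally show ?thesis .
  qed
  have Vx: "\<bar>V x\<bar> \<le> 13 * E"
  proof -
    have "\<bar>V 1\<bar> \<le> E" using k[of 1] by (simp add: V_def)
    then show ?thesis using Vdiff[OF order_refl x] by simp
  qed
  have Sy: "real (Suc y) powr -\<beta> \<le> X powr (-3/4 * \<beta>)"
  proof -
    have "real (Suc y) powr -\<beta> \<le> (X powr (3/4)) powr -\<beta>"
      using y X \<beta> by (intro powr_mono2') (auto simp: X_def)
    then show ?thesis unfolding powr_powr by simp
  qed
  have Sy_e: "real (Suc y) powr -\<beta> \<le> e"
  proof -
    have "X powr (-3/4 * \<beta>) \<le> e" unfolding e_def using X \<beta> by (intro powr_mono) auto
    then show ?thesis using Sy by simp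
  qed
  define T1 where "T1 = (\<Sum>b=1..y. (u b * real b powr -\<beta>) * V (x div b))"
  define T2 where "T2 = (\<Sum>a=1..x div Suc y. (k a * real a powr -\<beta>) * (dirichlet_sum u \<beta> (x div a) - dirichlet_sum u \<beta> y))"
  have split: "(\<Sum>(a, b)\<in>hyp_pairs x. (k a * real a powr -\<beta>) * (u b * real b powr -\<beta>)) = T1 + T2"
    unfolding T1_def T2_def V_def dirichlet_sum_def by (rule hyperbola)
  have T1: "\<bar>T1\<bar> \<le> 96 * E * e + 26 * E * B * e"
  proof -
    \<comment> \<open>Each inner sum is replaced by the full \<open>V x\<close>, the difference
      being a segment of the series in \<open>a\<close> beyond \<open>x div b\<close>. What
      multiplies \<open>V x\<close> is a truncation of L(\<beta>, u), small itself because the full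
      value is 0.\<close>
    have "T1 = (\<Sum>b=1..y. (u b * real b powr -\<beta>) * (V (x div b) - V x)) + V x * dirichlet_sum u \<beta> y"
      unfolding T1_def dirichlet_sum_def sum_distrib_left by (simp add: algebra_simps flip: sum.distrib)
    moreover have "\<bar>V x * dirichlet_sum u \<beta> y\<bar> \<le> (13 * E) * (2 * B * e)"
    proof -
      have "\<bar>dirichlet_sum u \<beta> y\<bar> \<le> 2 * B * e"
        using B by (intro order_trans[OF U[of y] mult_left_mono[OF Sy_e]]) simp
      then show ?thesis unfolding abs_mult using Vx E by (intro mult_mono) auto
    qed
    moreover have "\<bar>\<Sum>b=1..y. (u b * real b powr -\<beta>) * (V (x div b) - V x)\<bar> \<le> 96 * E * e"
    proof -
      have "\<bar>(u b * real b powr -\<beta>) * (V (x div b) - V x)\<bar> \<le> 24 * E * X powr -\<sigma> * real b powr -(3/4)"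
        if b: "b \<in> {1..y}" for b
      proof -
        have b: "1 \<le> b" "b \<le> x" using b y by auto
        then have d1: "1 \<le> x div b" by (simp add: Suc_le_eq div_greater_zero_iff)
        then have "1 \<le> real (x div b)" by simp
        then have "X / real b \<le> 2 * real (x div b)"
          using real_div_bounds(2)[OF b(1), of x] unfolding X_def by linarith
        then have "X / real b / 2 \<le> real (x div b)" by simp
        then have "real (x div b) powr -\<sigma> \<le> (X / real b / 2) powr -\<sigma>"
          using X b \<sigma> by (intro powr_mono2') auto
        also have "\<dots> = X powr -\<sigma> * real b powr \<sigma> * 2 powr \<sigma>"
          using X b by (simp add: powr_divide powr_mult powr_minus field_simps)
        also have "\<dots> \<le> X powr -\<sigma> * real b powr \<sigma> * 2 powr 1"
          using \<sigma> by (intro mult_left_mono powr_mono) auto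
        finally have *: "real (x div b) powr -\<sigma> \<le> 2 * (X powr -\<sigma> * real b powr \<sigma>)" by simp
        have "\<bar>V (x div b) - V x\<bar> \<le> 12 * E * real (x div b) powr -\<sigma>"
          using Vdiff[OF d1, of x] by (simp add: abs_minus_commute)
        also have "\<dots> \<le> 12 * E * (2 * (X powr -\<sigma> * real b powr \<sigma>))" using * E by (intro mult_left_mono) auto
        finally have "\<bar>(u b * real b powr -\<beta>) * (V (x div b) - V x)\<bar> \<le> (1 * real b powr -\<beta>) * (12 * E * (2 * (X powr -\<sigma> * real b powr \<sigma>)))"
          unfolding abs_mult using u1[of b] by (intro mult_mono mult_right_mono) auto
        also have "\<dots> = 24 * E * X powr -\<sigma> * (real b powr -\<beta> * real b powr \<sigma>)" by simp
        also have "real b powr -\<beta> * real b powr \<sigma> = real b powr -(3/4)"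
          unfolding powr_add[symmetric] by (simp add: \<sigma>_def)
        finally show ?thesis .
      qed
      then have "\<bar>\<Sum>b=1..y. (u b * real b powr -\<beta>) * (V (x div b) - V x)\<bar>
          \<le> (\<Sum>b=1..y. 24 * E * X powr -\<sigma> * real b powr -(3/4))"
        by (intro order_trans[OF sum_abs] sum_mono)
      also have "\<dots> = 24 * E * X powr -\<sigma> * (\<Sum>b=1..y. real b powr -(3/4))" by (simp add: sum_distrib_left)
      also have "\<dots> \<le> 24 * E * X powr -\<sigma> * (4 * X powr (3/16))"
      proof (rule mult_left_mono)
        obtain c where "\<And>N. (\<Sum>n=1..N. real n powr -(3/4)) \<le> real N powr (1 - 3/4) / (1 - 3/4)"
          by (rule zeta_partial_sums[of "3/4"]) auto
        then have "(\<Sum>b=1..y. real b powr -(3/4)) \<le> real y powr (1 - 3/4) / (1 - 3/4)" .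
        also have "\<dots> = 4 * real y powr (1/4)" by simp
        also have "\<dots> \<le> 4 * (X powr (3/4)) powr (1/4)"
          using y unfolding X_def by (intro mult_left_mono powr_mono2) auto
        finally show "(\<Sum>b=1..y. real b powr -(3/4)) \<le> 4 * X powr (3/16)" unfolding powr_powr by simp
      qed (use E in simp)
      also have "\<dots> = 96 * E * (X powr -\<sigma> * X powr (3/16))" by simp
      also have "\<dots> \<le> 96 * E * e"
      proof (rule mult_left_mono)
        show "X powr -\<sigma> * X powr (3/16) \<le> e"
          unfolding e_def powr_add[symmetric] using X \<sigma> by (intro powr_mono) auto
      qed (use E in simp)
      finally show ?thesis .
    qed
    ultimately show ?thesis by simp
  qed
  have T2: "\<bar>T2\<bar> \<le> 4 * E * B * e"
  proof -
    define M where "M = x div Suc y"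
    \<comment> \<open>A single coefficient is a difference of two consecutive partial sums.\<close>
    have kb: "\<bar>k a\<bar> \<le> 2 * E * real a powr (3/4)" if "1 \<le> a" for a
    proof (cases "a = 1")
      case True
      then show ?thesis using k[of 1] E by simp
    next
      case False
      then have a: "1 \<le> a - 1" using that by simp
      have "(\<Sum>i=1..a. k i) = (\<Sum>i=1..a - 1. k i) + k a"
        using that by (cases a) auto
      moreover have "E * real (a - 1) powr (3/4) \<le> E * real a powr (3/4)"
        using E by (intro mult_left_mono powr_mono2) auto
      ultimately show ?thesis using k[OF that] k[OF a] by linarith
    qed
    have "\<bar>T2\<bar> \<le> (\<Sum>a=1..M. 2 * E * (2 * B * real (Suc y) powr -\<beta>))"
      unfolding T2_def M_def
    proof (intro order_trans[OF sum_abs] sum_mono)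
      fix a assume "a \<in> {1..x div Suc y}"
      then have a: "1 \<le> a" "a \<le> x div Suc y" by auto
      then have "a * Suc y \<le> x" by (simp add: less_eq_div_iff_mult_less_eq del: mult_Suc_right)
      then have ya: "y \<le> x div a" using a(1) by (simp add: less_eq_div_iff_mult_less_eq mult.commute)
      have "\<bar>k a * real a powr -\<beta>\<bar> \<le> (2 * E * real a powr (3/4)) * real a powr -\<beta>"
        unfolding abs_mult using kb[OF a(1)] by (intro mult_mono) auto
      also have "\<dots> = 2 * E * real a powr -\<sigma>" by (simp add: \<sigma>_def flip: powr_add)
      also have "\<dots> \<le> 2 * E * real a powr 0" using E a \<sigma> by (intro mult_left_mono powr_mono) auto
      also have "\<dots> = 2 * E" using a by simp
      finally show "\<bar>k a * real a powr -\<beta> * (dirichlet_sum u \<beta> (x div a) - dirichlet_sum u \<beta> y)\<bar> \<le> 2 * E * (2 * B * real (Suc y) powr -\<beta>)"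
        unfolding abs_mult[of "k a * real a powr -\<beta>"]
        using dirichlet_sum_diff_bound[OF u \<beta>0 ya] E by (intro mult_mono) auto
    qed
    also have "\<dots> = 4 * E * B * (real M * real (Suc y) powr -\<beta>)" by simp
    also have "\<dots> \<le> 4 * E * B * e"
    proof (rule mult_left_mono)
      have "real M \<le> real x / real (Suc y)" unfolding M_def by (rule real_div_bounds) simp
      also have "\<dots> \<le> X powr (1/4)" using div_Suc_floor_powr[OF x, of "3/4" y] y by (simp add: X_def)
      finally have "real M * real (Suc y) powr -\<beta> \<le> X powr (1/4) * X powr (-3/4 * \<beta>)"
        using Sy by (intro mult_mono) auto
      also have "\<dots> \<le> e" unfolding e_def powr_add[symmetric] using X \<beta> by (intro powr_mono) auto
      finally show "real M * real (Suc y) powr -\<beta> \<le> e" .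
    qed (use E B in simp)
    finally show ?thesis .
  qed
  have "96 * E * e \<le> 96 * E * B * e"
    using B E by (intro mult_right_mono) (auto simp: e_def mult_le_cancel_left1)
  then show ?thesis using split T1 T2 unfolding e_def X_def by simp
qed

text \<open>The coefficients are nonnegative with first one 1, so their sum against n^(-\<beta>) is
  at least 1. Subtracting the mean value \<open>l = L(1, v) L(1, u v)\<close> from \<open>k\<close>
  leaves a part that is at most 1/2, thanks to the zero. The other part is \<open>l\<close> times a
  sum of truncations of L(\<beta>, u), each bounded by a tail, which gives 2 B1 x^(1 - \<beta>).
  Keeping \<open>B1\<close> apart from \<open>B\<close> makes the dependence on \<open>v\<close>
  enter only through a power with exponent proportional to 1 - \<beta>.\<close>

theorem siegel_pair:
  assumes q: "quad_char u" "quad_char v" and u: "bounded_char u B1" and v: "bounded_char v B"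
    and w: "bounded_char (\<lambda>n. u n * v n) B" and BB: "B1 \<le> B"
    and zero: "lfun u \<beta> = 0" and \<beta>: "31 / 32 \<le> \<beta>" "\<beta> < 1"
  shows "(2 * (8820 * B ^ 3) ^ 32) powr -(1 - \<beta>) / (4 * B1) \<le> lfun v 1 * lfun (\<lambda>n. u n * v n) 1"
proof -
  have B1: "1 \<le> B1" using u by (simp add: bounded_char_def)
  then have B: "1 \<le> B" using BB by simp
  have \<beta>0: "0 < \<beta>" using \<beta> by simp
  have uB: "bounded_char u B" using u BB unfolding bounded_char_def by (auto intro: order_trans)
  let ?w = "\<lambda>n. u n * v n"
  define l where "l = lfun v 1 * lfun ?w 1"
  have l0: "0 \<le> l" unfolding l_def
    using lfun_1_nonneg[OF q(2) v] lfun_1_nonneg[OF quad_char_mult[OF q] w] by simp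
  define k where "k = dconv (one_conv v) ?w"
  \<comment> \<open>8820 is twice 126 * 35, the constants of \<open>zero_conv_error\<close> and
    \<open>biquadratic_partial_sums\<close>; once \<open>x\<close> is at least
    \<open>t ^ 32\<close>, the combined error is at most 1/2.\<close>
  define t where "t = 8820 * B ^ 3"
  have t: "1 \<le> t" using one_le_power[OF B, of 3] by (simp add: t_def)
  obtain x where x: "1 \<le> x" "t ^ 32 \<le> real x" "real x \<le> 2 * t ^ 32"
    using nat_ceiling_bounds[of "t ^ 32"] t by (auto simp: one_le_power)
  have "1 \<le> dirichlet_sum (dconv k u) \<beta> x"
  proof (rule dirichlet_sum_ge_1[OF _ _ x(1)])
    show "dconv k u 1 = 1" using q by (simp add: k_def dconv_def quad_char_def)
    show "0 \<le> dconv k u n" if "0 < n" for n unfolding k_def by (rule biquadratic_conv_nonneg[OF q that])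
  qed
  also have "dirichlet_sum (dconv k u) \<beta> x = (\<Sum>(a, b)\<in>hyp_pairs x. (k a * real a powr -\<beta>) * (u b * real b powr -\<beta>))"
    unfolding dirichlet_sum_def dconv_powr by (rule sum_dconv)
  also have "\<dots> = (\<Sum>(a, b)\<in>hyp_pairs x. ((k a - l) * real a powr -\<beta>) * (u b * real b powr -\<beta>))
     + l * (\<Sum>(a, b)\<in>hyp_pairs x. real a powr -\<beta> * (u b * real b powr -\<beta>))"
    unfolding sum_distrib_left sum.distrib[symmetric] by (intro sum.cong) (auto simp: algebra_simps)
  also have "\<dots> \<le> 1 / 2 + l * (2 * B1 * real x powr (1 - \<beta>))"
  proof (intro add_mono mult_left_mono l0)
    have "\<bar>\<Sum>i=1..n. k i - l\<bar> \<le> 35 * B\<^sup>2 * real n powr (3/4)" if "1 \<le> n" for n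
      using biquadratic_partial_sums[OF q(2) v w that] unfolding k_def l_def by (simp add: sum_subtractf mult.commute)
    then have "\<bar>\<Sum>(a, b)\<in>hyp_pairs x. ((k a - l) * real a powr -\<beta>) * (u b * real b powr -\<beta>)\<bar>
        \<le> 126 * (35 * B\<^sup>2) * B * real x powr (-1/32)"
      using B x(1) by (intro zero_conv_error[OF uB zero \<beta>]) auto
    also have "\<dots> = t / 2 * real x powr (-1/32)" by (simp add: t_def power2_eq_square power3_eq_cube)
    also have "\<dots> \<le> t / 2 * (1 / t)"
    proof (rule mult_left_mono)
      have "real x powr (-1/32) \<le> (t ^ 32) powr (-1/32)" using x t by (intro powr_mono2') auto
      also have "t ^ 32 = t powr 32" using t by (simp add: powr_numeral)
      also have "(t powr 32) powr (-1/32) = t powr -1" unfolding powr_powr by simp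
      also have "\<dots> = 1 / t" using t by (simp add: powr_minus_divide)
      finally show "real x powr (-1/32) \<le> 1 / t" .
    qed (use t in simp)
    also have "\<dots> = 1 / 2" using t by simp
    finally show "(\<Sum>(a, b)\<in>hyp_pairs x. ((k a - l) * real a powr -\<beta>) * (u b * real b powr -\<beta>)) \<le> 1 / 2" by simp
    have "(\<Sum>(a, b)\<in>hyp_pairs x. real a powr -\<beta> * (u b * real b powr -\<beta>))
        = (\<Sum>a=1..x. real a powr -\<beta> * dirichlet_sum u \<beta> (x div a))"
      using hyperbola[where F = "\<lambda>a. real a powr -\<beta>" and G = "\<lambda>b. u b * real b powr -\<beta>" and y = 0]
      by (simp add: dirichlet_sum_def)
    also have "\<dots> \<le> (\<Sum>a=1..x. 2 * B1 * real x powr -\<beta>)"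
    proof (rule sum_mono)
      fix a assume "a \<in> {1..x}"
      then have a: "1 \<le> a" "a \<le> x" by auto
      have "dirichlet_sum u \<beta> (x div a) \<le> 2 * B1 * real (Suc (x div a)) powr -\<beta>"
        using lfun_tail[OF u \<beta>0, of "x div a"] zero by simp
      also have "\<dots> \<le> 2 * B1 * (real x / real a) powr -\<beta>"
        using real_div_bounds(2)[OF a(1), of x] a B1 \<beta> by (intro mult_left_mono powr_mono2') auto
      finally have "real a powr -\<beta> * dirichlet_sum u \<beta> (x div a) \<le> real a powr -\<beta> * (2 * B1 * (real x / real a) powr -\<beta>)"
        by (intro mult_left_mono) auto
      also have "\<dots> = 2 * B1 * real x powr -\<beta>" using a by (simp add: powr_divide)
      finally show "real a powr -\<beta> * dirichlet_sum u \<beta> (x div a) \<le> 2 * B1 * real x powr -\<beta>" .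
    qed
    also have "\<dots> = 2 * B1 * (real x powr 1 * real x powr -\<beta>)" by simp
    also have "real x powr 1 * real x powr -\<beta> = real x powr (1 - \<beta>)" unfolding powr_add[symmetric] by simp
    finally show "(\<Sum>(a, b)\<in>hyp_pairs x. real a powr -\<beta> * (u b * real b powr -\<beta>)) \<le> 2 * B1 * real x powr (1 - \<beta>)" .
  qed
  finally have "1 \<le> 2 * (l * (2 * B1 * real x powr (1 - \<beta>)))" by linarith
  also have "\<dots> = 4 * B1 * l * real x powr (1 - \<beta>)" by simp
  finally have "1 \<le> 4 * B1 * l * real x powr (1 - \<beta>)" .
  then have "real x powr -(1 - \<beta>) \<le> 4 * B1 * l"
    using x(1) by (simp only: powr_minus_divide) (simp add: divide_le_eq)
  moreover have "(2 * t ^ 32) powr -(1 - \<beta>) \<le> real x powr -(1 - \<beta>)"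
    using x \<beta> by (intro powr_mono2') auto
  ultimately have "(2 * t ^ 32) powr -(1 - \<beta>) \<le> 4 * B1 * l" by linarith
  then show ?thesis using B1 unfolding t_def l_def by (simp add: divide_le_eq mult.commute)
qed

section \<open>Siegel's theorem for Jacobi characters\<close>

definition chi :: "nat \<Rightarrow> nat \<Rightarrow> real" where
  "chi D n = of_int (jacobi (int D) n)"

lemma quad_char_chi: "quad_char (chi D)"
proof -
  have "chi D n \<in> {-1, 0, 1}" for n using jacobi_values[of "int D" n] by (auto simp: chi_def)
  then show ?thesis by (simp add: quad_char_def chi_def jacobi_mult_right)
qed

lemma bounded_char_mono:
  assumes "bounded_char w A" "A \<le> B"
  shows "bounded_char w B"
proof -
  have "\<bar>\<Sum>n=1..N. w n\<bar> \<le> A" for N using assms(1) by (simp add: bounded_char_def)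
  then have "\<bar>\<Sum>n=1..N. w n\<bar> \<le> B" for N using assms(2) order_trans by blast
  then show ?thesis using assms by (simp add: bounded_char_def)
qed

lemma bounded_char_chi:
  assumes "D > 0" "\<not> is_square D"
  shows "bounded_char (chi D) (8 * real D)"
  unfolding bounded_char_def
proof (intro conjI allI)
  show "\<bar>chi D n\<bar> \<le> 1" for n using quad_char_chi[of D] by (auto simp: quad_char_def elim!: allE[of _ n])
  show "\<bar>\<Sum>n=1..N. chi D n\<bar> \<le> 8 * real D" for N
  proof -
    have "(\<Sum>i<Suc N. jacobi (int D) i) = (\<Sum>n=1..N. jacobi (int D) n)"
      by (simp add: lessThan_Suc_atMost sum.atMost_shift sum.atLeast_Suc_atMost_Suc_shift atLeast0AtMost[symmetric] sum.atLeast_Suc_atMost)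
    then have "\<bar>\<Sum>n=1..N. jacobi (int D) n\<bar> \<le> 8 * int D" using sum_jacobi_bounded[OF assms, of "Suc N"] by simp
    then have "real_of_int \<bar>\<Sum>n=1..N. jacobi (int D) n\<bar> \<le> real_of_int (8 * int D)" by (simp only: of_int_le_iff)
    then show ?thesis by (simp add: chi_def)
  qed
  show "1 \<le> 8 * real D" using assms(1) by simp
qed

section \<open>Changing the discriminant by a square factor\<close>

lemma chi_mult_left: "chi (D * E) n = chi D n * chi E n"
  by (simp add: chi_def jacobi_mult_left)

lemma chi_square_mult: "chi (f\<^sup>2 * D) n = (if coprime f n then chi D n else 0)"
proof (cases "odd n \<and> coprime f n")
  case True
  then have "jacobi (int f) n \<noteq> 0" by (simp add: jacobi_eq_0_iff)
  then have "jacobi (int f) n * jacobi (int f) n = 1" using jacobi_values[of "int f" n] by auto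
  then have "chi f n * chi f n = 1" by (simp add: chi_def flip: of_int_mult)
  then show ?thesis using True by (simp add: chi_mult_left power2_eq_square)
next
  case False
  then have "chi f n = 0" by (auto simp: chi_def jacobi_eq_0_iff)
  moreover have "chi D n = 0" if "even n" using that by (simp add: chi_def)
  ultimately show ?thesis using False by (auto simp: chi_mult_left power2_eq_square)
qed

text \<open>By complete multiplicativity, the terms divisible by one more prime r sum to w(r) / r
  times the sum up to \<open>N div r\<close>. Letting N tend to infinity produces one Euler factor
  at a time, within conditionally convergent series.\<close>

lemma dirichlet_sum_remove_primes:
  assumes q: "quad_char w" and w: "bounded_char w B" and P: "finite P" "\<And>p. p \<in> P \<Longrightarrow> prime p"
  shows "dirichlet_sum (\<lambda>n. if \<exists>p\<in>P. p dvd n then 0 else w n) 1 \<longlonglongrightarrow> lfun w 1 * (\<Prod>p\<in>P. 1 - w p / real p)"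
  using P
proof (induction P rule: finite_induct)
  case empty
  then show ?case using dirichlet_sum_LIMSEQ[OF w, of 1] by simp
next
  case (insert r P)
  define v where "v n = (if \<exists>p\<in>P. p dvd n then 0 else w n)" for n
  define v' where "v' n = (if \<exists>p\<in>insert r P. p dvd n then 0 else w n)" for n
  have r: "prime r" "r > 0" using insert.prems prime_gt_0_nat by auto
  have IH: "dirichlet_sum v 1 \<longlonglongrightarrow> lfun w 1 * (\<Prod>p\<in>P. 1 - w p / real p)"
    using insert unfolding v_def by blast
  have vr: "v (r * m) = w r * v m" for m
  proof -
    have "p dvd r * m \<longleftrightarrow> p dvd m" if "p \<in> P" for p
    proof -
      have "prime p" "p \<noteq> r" using that insert by auto
      then show ?thesis using r(1) by (auto simp: prime_dvd_mult_iff primes_dvd_imp_eq)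
    qed
    then show ?thesis using q by (auto simp: v_def quad_char_def)
  qed
  have "dirichlet_sum v' 1 N = dirichlet_sum v 1 N - w r / real r * dirichlet_sum v 1 (N div r)" for N
  proof -
    have "(\<Sum>n | n \<in> {1..N} \<and> r dvd n. v n * real n powr -1) = (\<Sum>m=1..N div r. v (r * m) * real (r * m) powr -1)"
      by (rule sum.reindex_bij_witness[of _ "\<lambda>m. r * m" "\<lambda>n. n div r"])
        (use r(2) in \<open>auto simp: less_eq_div_iff_mult_less_eq mult.commute Suc_le_eq div_greater_zero_iff div_le_mono intro: dvd_imp_le\<close>)
    also have "\<dots> = (\<Sum>m=1..N div r. w r / real r * (v m * real m powr -1))"
      using r(2) by (intro sum.cong) (auto simp: vr powr_minus_divide)
    also have "\<dots> = w r / real r * dirichlet_sum v 1 (N div r)" by (simp add: dirichlet_sum_def sum_distrib_left)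
    finally have 1: "(\<Sum>n | n \<in> {1..N} \<and> r dvd n. v n * real n powr -1) = w r / real r * dirichlet_sum v 1 (N div r)" .
    have "dirichlet_sum v' 1 N = (\<Sum>n\<in>{1..N}. if \<not> r dvd n then v n * real n powr -1 else 0)"
      unfolding dirichlet_sum_def v'_def v_def by (intro sum.cong) auto
    also have "\<dots> = (\<Sum>n | n \<in> {1..N} \<and> \<not> r dvd n. v n * real n powr -1)"
      by (rule sum.inter_filter[symmetric]) simp
    also have "\<dots> = dirichlet_sum v 1 N - (\<Sum>n | n \<in> {1..N} \<and> r dvd n. v n * real n powr -1)"
    proof -
      have "{1..N} = {n. n \<in> {1..N} \<and> \<not> r dvd n} \<union> {n. n \<in> {1..N} \<and> r dvd n}" by auto
      then have "dirichlet_sum v 1 N = (\<Sum>n | n \<in> {1..N} \<and> \<not> r dvd n. v n * real n powr -1) + (\<Sum>n | n \<in> {1..N} \<and> r dvd n. v n * real n powr -1)"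
        unfolding dirichlet_sum_def by (metis (no_types, lifting) sum.union_disjoint finite_Un finite_atLeastAtMost disjoint_iff mem_Collect_eq)
      then show ?thesis by simp
    qed
    finally show ?thesis unfolding 1 .
  qed
  moreover have "(\<lambda>N. dirichlet_sum v 1 N - w r / real r * dirichlet_sum v 1 (N div r)) \<longlonglongrightarrow>
      lfun w 1 * (\<Prod>p\<in>P. 1 - w p / real p) - w r / real r * (lfun w 1 * (\<Prod>p\<in>P. 1 - w p / real p))"
    using IH filterlim_compose[OF IH filterlim_at_top_div_const_nat[OF r(2)]] by (intro tendsto_intros) auto
  ultimately have "dirichlet_sum v' 1 \<longlonglongrightarrow> lfun w 1 * (\<Prod>p\<in>P. 1 - w p / real p) - w r / real r * (lfun w 1 * (\<Prod>p\<in>P. 1 - w p / real p))"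
    by presburger
  then show ?case using insert.hyps unfolding v'_def by (simp add: algebra_simps)
qed

lemma lfun_chi_square_mult:
  assumes "D > 0" "\<not> is_square D" "f > 0"
  shows "lfun (chi (f\<^sup>2 * D)) 1 = lfun (chi D) 1 * (\<Prod>p\<in>prime_factors f. 1 - chi D p / real p)"
proof -
  have "chi (f\<^sup>2 * D) n = (if \<exists>p\<in>prime_factors f. p dvd n then 0 else chi D n)" for n
  proof -
    have "coprime f n \<longleftrightarrow> \<not> (\<exists>p\<in>prime_factors f. p dvd n)" if "n > 0"
    proof
      assume "coprime f n"
      then show "\<not> (\<exists>p\<in>prime_factors f. p dvd n)"
        using coprime_common_divisor[of f n] not_prime_unit by (auto simp: in_prime_factors_iff)
    next
      assume *: "\<not> (\<exists>p\<in>prime_factors f. p dvd n)"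
      show "coprime f n"
      proof (rule ccontr)
        assume "\<not> coprime f n"
        then have "gcd f n \<noteq> 1" using coprime_iff_gcd_eq_1 by blast
        then obtain p where "prime p" "p dvd gcd f n" using prime_factor_nat by blast
        then show False using * assms(3) by (auto simp: in_prime_factors_iff)
      qed
    qed
    moreover have "chi D 0 = 0" by (simp add: chi_def)
    ultimately show ?thesis unfolding chi_square_mult by (cases "n = 0") auto
  qed
  then have "chi (f\<^sup>2 * D) = (\<lambda>n. if \<exists>p\<in>prime_factors f. p dvd n then 0 else chi D n)" by blast
  moreover have "prime p" if "p \<in> prime_factors f" for p using that by auto
  ultimately have "dirichlet_sum (chi (f\<^sup>2 * D)) 1 \<longlonglongrightarrow> lfun (chi D) 1 * (\<Prod>p\<in>prime_factors f. 1 - chi D p / real p)"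
    using dirichlet_sum_remove_primes[OF quad_char_chi bounded_char_chi[OF assms(1,2)] finite_set_mset, of "prime_factorization f"] by metis
  then show ?thesis unfolding lfun_def[of "chi (f\<^sup>2 * D)"] by (rule limI)
qed

text \<open>In increasing order the elements are at least 2, 3, 4, ..., so the product dominates the
  telescoping product of 1 - 1/j. For the prime factors of a number this costs a logarithm, which
  turns into a log log when logarithms of class numbers are taken.\<close>

lemma prod_one_minus_inverse_ge:
  assumes "finite S" "\<And>p. p \<in> S \<Longrightarrow> 2 \<le> (p :: nat)"
  shows "1 / (real (card S) + 1) \<le> (\<Prod>p\<in>S. 1 - 1 / real p)"
  using assms
proof (induction S rule: finite_psubset_induct)
  case (psubset S)
  show ?case
  proof (cases "S = {}")
    case False
    define m where "m = Max S"
    have m: "m \<in> S" using False psubset by (simp add: m_def)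
    have "S \<subseteq> {2..m}" using psubset by (auto simp: m_def)
    then have "card S \<le> card {2..m}" by (rule card_mono[OF finite_atLeastAtMost])
    then have cm: "real (card S) + 1 \<le> real m" using psubset.prems[OF m] by simp
    have cS: "card S \<noteq> 0" using m psubset by auto
    have "1 / (real (card (S - {m})) + 1) \<le> (\<Prod>p\<in>S - {m}. 1 - 1 / real p)"
      using psubset.IH[of "S - {m}"] m psubset.prems by auto
    moreover have "real (card (S - {m})) + 1 = real (card S)" using card.remove[OF psubset(1) m] by simp
    ultimately have IH: "1 / real (card S) \<le> (\<Prod>p\<in>S - {m}. 1 - 1 / real p)" by simp
    have "1 / (real (card S) + 1) = (1 - 1 / (real (card S) + 1)) * (1 / real (card S))"
      using cS by (simp add: field_simps)
    also have "\<dots> \<le> (1 - 1 / real m) * (\<Prod>p\<in>S - {m}. 1 - 1 / real p)"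
    proof (rule mult_mono[OF _ IH])
      have "1 / real m \<le> 1 / (real (card S) + 1)" using cm by (intro divide_left_mono) auto
      then show "1 - 1 / (real (card S) + 1) \<le> 1 - 1 / real m" by simp
    qed (use cm in \<open>auto simp: field_simps\<close>)
    also have "\<dots> = (\<Prod>p\<in>S. 1 - 1 / real p)" using m psubset(1) by (simp add: prod.remove)
    finally show ?thesis .
  qed simp
qed

lemma two_power_card_prime_factors_le:
  assumes "n > 0" shows "2 ^ card (prime_factors n) \<le> (n :: nat)"
proof -
  have "2 ^ card (prime_factors n) = (\<Prod>p\<in>prime_factors n. 2)" by simp
  also have "\<dots> \<le> (\<Prod>p\<in>prime_factors n. p ^ multiplicity p n)"
  proof (rule prod_mono)
    fix p assume p: "p \<in> prime_factors n"
    then have "2 ^ 1 \<le> p ^ 1" using prime_ge_2_nat by auto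
    also have "\<dots> \<le> p ^ multiplicity p n"
      using p by (intro power_increasing) (auto simp: prime_factors_multiplicity prime_gt_0_nat Suc_le_eq)
    finally show "0 \<le> (2 :: nat) \<and> 2 \<le> p ^ multiplicity p n" by simp
  qed
  also have "\<dots> = n" using assms by (simp add: prime_factorization_nat[symmetric])
  finally show ?thesis .
qed

lemma card_prime_factors_le_ln:
  assumes "n > 0" shows "real (card (prime_factors n)) \<le> 2 * ln (real n)"
proof -
  have "real (card (prime_factors n)) * (1 / 2) \<le> real (card (prime_factors n)) * ln 2"
    using ln_le_minus_one[of "1/2"] by (intro mult_left_mono) (auto simp: ln_div)
  also have "\<dots> = ln (real (2 ^ card (prime_factors n)))" by (simp add: ln_realpow)
  also have "\<dots> \<le> ln (real n)"
    using two_power_card_prime_factors_le[OF assms] assms by (subst ln_le_cancel_iff) (auto simp flip: of_nat_power)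
  finally show ?thesis by simp
qed

lemma lfun_chi_square_mult_ge:
  assumes "D > 0" "\<not> is_square D" "f > 0"
  shows "lfun (chi D) 1 / (2 * ln (real f) + 1) \<le> lfun (chi (f\<^sup>2 * D)) 1"
proof -
  have L: "0 \<le> lfun (chi D) 1" using lfun_1_nonneg[OF quad_char_chi bounded_char_chi[OF assms(1,2)]] .
  have "1 / (2 * ln (real f) + 1) \<le> 1 / (real (card (prime_factors f)) + 1)"
    using card_prime_factors_le_ln[OF assms(3)] by (intro divide_left_mono) (auto intro!: mult_pos_pos add_nonneg_pos)
  also have "\<dots> \<le> (\<Prod>p\<in>prime_factors f. 1 - 1 / real p)"
    by (rule prod_one_minus_inverse_ge) (auto intro: prime_ge_2_nat)
  also have "\<dots> \<le> (\<Prod>p\<in>prime_factors f. 1 - chi D p / real p)"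
  proof (rule prod_mono)
    fix p assume "p \<in> prime_factors f"
    then have p: "1 \<le> p" using prime_ge_1_nat[of p] by auto
    have "chi D p \<le> 1" using quad_char_chi[of D] by (auto simp: quad_char_def elim!: allE[of _ p])
    then have "chi D p / real p \<le> 1 / real p" by (intro divide_right_mono) auto
    then show "0 \<le> 1 - 1 / real p \<and> 1 - 1 / real p \<le> 1 - chi D p / real p" using p by simp
  qed
  finally have "lfun (chi D) 1 * (1 / (2 * ln (real f) + 1)) \<le> lfun (chi D) 1 * (\<Prod>p\<in>prime_factors f. 1 - chi D p / real p)"
    using L by (intro mult_left_mono)
  then show ?thesis unfolding lfun_chi_square_mult[OF assms] by simp
qed

text \<open>Every Euler factor is at most 2, and 2 to the number of primes dividing \<open>f\<close>
  is at most \<open>f\<close>. The crude factor is acceptable because \<open>f\<close> is a fixed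
  discriminant where the bound is applied.\<close>

lemma lfun_chi_square_mult_le:
  assumes "D > 0" "\<not> is_square D" "f > 0"
  shows "lfun (chi (f\<^sup>2 * D)) 1 \<le> lfun (chi D) 1 * real f"
proof -
  have L: "0 \<le> lfun (chi D) 1" using lfun_1_nonneg[OF quad_char_chi bounded_char_chi[OF assms(1,2)]] .
  have "(\<Prod>p\<in>prime_factors f. 1 - chi D p / real p) \<le> (\<Prod>p\<in>prime_factors f. 2)"
  proof (rule prod_mono)
    fix p assume "p \<in> prime_factors f"
    then have p: "1 \<le> p" using prime_ge_1_nat[of p] by auto
    have "\<bar>chi D p\<bar> \<le> 1" using quad_char_chi[of D] by (auto simp: quad_char_def elim!: allE[of _ p])
    then have "\<bar>chi D p / real p\<bar> \<le> 1" using p by (simp add: abs_divide divide_le_eq)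
    then show "0 \<le> 1 - chi D p / real p \<and> 1 - chi D p / real p \<le> 2" by linarith
  qed
  also have "\<dots> = real (2 ^ card (prime_factors f))" by simp
  also have "\<dots> \<le> real f" using two_power_card_prime_factors_le[OF assms(3)] by (simp only: of_nat_le_iff)
  finally show ?thesis unfolding lfun_chi_square_mult[OF assms] using L by (intro mult_left_mono)
qed

section \<open>Continuity and size of the L-function, and the cases of Siegel's theorem\<close>

lemma continuous_on_lfun:
  assumes w: "bounded_char w B" and "0 < a"
  shows "continuous_on {a..b} (lfun w)"
proof (rule uniform_limit_theorem)
  show "\<forall>\<^sub>F N in sequentially. continuous_on {a..b} (\<lambda>s. dirichlet_sum w s N)"
    unfolding dirichlet_sum_def by (intro always_eventually allI continuous_intros) auto
  show "uniform_limit {a..b} (\<lambda>N s. dirichlet_sum w s N) (lfun w) sequentially"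
  proof (rule uniform_limitI)
    fix e :: real assume e: "0 < e"
    have "(\<lambda>N. 2 * B * real (Suc N) powr -a) \<longlonglongrightarrow> 2 * B * 0"
      using \<open>0 < a\<close> by (intro tendsto_mult tendsto_const tendsto_neg_powr filterlim_compose[OF filterlim_real_sequentially filterlim_Suc]) auto
    then have "\<forall>\<^sub>F N in sequentially. 2 * B * real (Suc N) powr -a < e" using e by (intro order_tendstoD(2)) auto
    then show "\<forall>\<^sub>F N in sequentially. \<forall>s\<in>{a..b}. dist (dirichlet_sum w s N) (lfun w s) < e"
    proof (rule eventually_mono, intro ballI)
      fix N s assume N: "2 * B * real (Suc N) powr -a < e" and s: "s \<in> {a..b}"
      have "\<bar>lfun w s - dirichlet_sum w s N\<bar> \<le> 2 * B * real (Suc N) powr -s" using s \<open>0 < a\<close> by (intro lfun_tail[OF w]) auto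
      also have "\<dots> \<le> 2 * B * real (Suc N) powr -a"
        using s w by (intro mult_left_mono powr_mono) (auto simp: bounded_char_def)
      finally show "dist (dirichlet_sum w s N) (lfun w s) < e" using N by (simp add: dist_real_def)
    qed
  qed
qed simp

text \<open>Truncation after about \<open>B\<close> terms: the harmonic sum accounts for the
  logarithm and the tail is at most 2.\<close>

lemma lfun_1_le_ln:
  assumes w: "bounded_char w B"
  shows "lfun w 1 \<le> ln B + 4"
proof -
  have B: "1 \<le> B" using w by (simp add: bounded_char_def)
  obtain M where M: "1 \<le> M" "B \<le> real M" "real M \<le> 2 * B" using nat_ceiling_bounds[OF B] by blast
  have "lfun w 1 \<le> dirichlet_sum w 1 M + 2 * B * real (Suc M) powr -1" using lfun_tail[OF w, of 1 M] by simp
  also have "dirichlet_sum w 1 M \<le> (\<Sum>m=1..M. 1 / real m)"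
    unfolding dirichlet_sum_def
  proof (rule sum_mono)
    fix m assume "m \<in> {1..M}"
    have "w m \<le> 1" using w by (auto simp: bounded_char_def abs_le_iff)
    then have "w m * (1 / real m) \<le> 1 * (1 / real m)" by (intro mult_right_mono) auto
    then show "w m * real m powr -1 \<le> 1 / real m" by (simp add: powr_minus_divide)
  qed
  also have "\<dots> \<le> 1 + ln (real M)" by (rule harmonic_le_ln[OF M(1)])
  also have "ln (real M) \<le> ln (2 * B)" using M B by (subst ln_le_cancel_iff) auto
  also have "\<dots> \<le> 1 + ln B" using B ln_2_less_1 by (simp add: ln_mult)
  also have "2 * B * real (Suc M) powr -1 \<le> 2"
    using M B by (simp add: powr_minus_divide field_simps)
  finally show ?thesis by simp
qed

text \<open>With \<open>B = 8 * D\<close>, \<open>lfun_1_ge_of_nonneg\<close> gives a constant times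
  \<open>D\<close> to the power -4 \<delta>.\<close>

lemma siegel_chi_nonneg_case:
  assumes \<delta>: "0 < \<delta>" "\<delta> \<le> 1 / 32" "4 * \<delta> \<le> \<eta>"
    and D: "D > 0" "\<not> is_square D" and L: "0 \<le> lfun (chi D) (1 - \<delta>)"
  shows "\<delta> / 2 * (2 * (128 / \<delta>) ^ 4) powr -\<delta> * real D powr -\<eta> \<le> lfun (chi D) 1"
proof -
  have "2 * (16 * (8 * real D) / \<delta>) ^ 4 = (2 * (128 / \<delta>) ^ 4) * real D ^ 4"
    by (simp add: power_divide power_mult_distrib)
  then have "(2 * (16 * (8 * real D) / \<delta>) ^ 4) powr -\<delta> = (2 * (128 / \<delta>) ^ 4) powr -\<delta> * (real D ^ 4) powr -\<delta>"
    by (simp add: powr_mult)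
  also have "(real D ^ 4) powr -\<delta> = (real D powr 4) powr -\<delta>" using D by (simp add: powr_numeral)
  also have "\<dots> = real D powr (-4 * \<delta>)" unfolding powr_powr by simp
  finally have eq: "(2 * (16 * (8 * real D) / \<delta>) ^ 4) powr -\<delta> = (2 * (128 / \<delta>) ^ 4) powr -\<delta> * real D powr (-4 * \<delta>)" .
  have "\<delta> / 2 * (2 * (128 / \<delta>) ^ 4) powr -\<delta> * real D powr -\<eta> \<le> \<delta> / 2 * (2 * (128 / \<delta>) ^ 4) powr -\<delta> * real D powr (-4 * \<delta>)"
    using \<delta> D by (intro mult_left_mono powr_mono) auto
  also have "\<dots> = (1 - (1 - \<delta>)) / 2 * (2 * (16 * (8 * real D) / (1 - (1 - \<delta>))) ^ 4) powr -(1 - (1 - \<delta>))"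
    using eq by simp
  also have "\<dots> \<le> lfun (chi D) 1"
    using \<delta> L by (intro lfun_1_ge_of_nonneg[OF quad_char_chi bounded_char_chi[OF D]]) auto
  finally show ?thesis .
qed

text \<open>Here t^2 D1 = D1^2 D2, so the two characters agree after removing finitely many primes.
  The L-value of this common discriminant is bounded below through \<open>D1\<close>, with a loss of
  log t, and above through \<open>D2\<close>, with the factor \<open>D1\<close>.\<close>

lemma siegel_chi_square_case:
  assumes \<eta>: "0 < \<eta>" and D1: "D1 > 0" "\<not> is_square D1" and D2: "D2 > 0" "\<not> is_square D2"
    and sq: "D1 * D2 = t\<^sup>2"
  shows "lfun (chi D1) 1 / (real D1 * (1 / \<eta> + 1) * real D1 powr \<eta>) * real D2 powr -\<eta> \<le> lfun (chi D2) 1"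
proof -
  have t: "t > 0" using sq D1(1) D2(1) by (intro Nat.gr0I) auto
  have pos: "0 < real D1 * real D2" using D1 D2 by simp
  have L1: "0 \<le> lfun (chi D1) 1" using lfun_1_nonneg[OF quad_char_chi bounded_char_chi[OF D1]] .
  have "(real t)\<^sup>2 = real D1 * real D2" using sq by (metis of_nat_mult of_nat_power)
  then have "2 * ln (real t) = ln (real D1 * real D2)" using t by (metis ln_realpow of_nat_0_less_iff of_nat_numeral)
  also have "\<dots> \<le> (real D1 * real D2) powr \<eta> / \<eta>"
  proof (rule ln_powr_bound)
    have "1 \<le> D1 * D2" using D1 D2 by simp
    then show "1 \<le> real D1 * real D2" by (metis of_nat_1 of_nat_le_iff of_nat_mult)
  qed (rule \<eta>)
  finally have ln: "2 * ln (real t) + 1 \<le> (1 / \<eta> + 1) * (real D1 * real D2) powr \<eta>"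
  proof -
    have "1 \<le> D1 * D2" using D1 D2 by simp
    then have "1 \<le> real D1 * real D2" by (metis of_nat_1 of_nat_le_iff of_nat_mult)
    then have "1 \<le> (real D1 * real D2) powr \<eta>" using \<eta> by (intro ge_one_powr_ge_zero) auto
    moreover assume "2 * ln (real t) \<le> (real D1 * real D2) powr \<eta> / \<eta>"
    ultimately show ?thesis by (simp add: algebra_simps)
  qed
  have lt: "0 < 2 * ln (real t) + 1" using t by (intro add_nonneg_pos) auto
  have "lfun (chi D1) 1 / ((1 / \<eta> + 1) * (real D1 * real D2) powr \<eta>) \<le> lfun (chi D1) 1 / (2 * ln (real t) + 1)"
    using ln lt L1 by (intro divide_left_mono) (auto intro!: mult_pos_pos)
  also have "\<dots> \<le> lfun (chi (t\<^sup>2 * D1)) 1" by (rule lfun_chi_square_mult_ge[OF D1 t])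
  also have "t\<^sup>2 * D1 = D1\<^sup>2 * D2" unfolding sq[symmetric] by (simp add: power2_eq_square algebra_simps)
  also have "lfun (chi (D1\<^sup>2 * D2)) 1 \<le> lfun (chi D2) 1 * real D1" by (rule lfun_chi_square_mult_le[OF D2 D1(1)])
  finally have "lfun (chi D1) 1 / ((1 / \<eta> + 1) * (real D1 * real D2) powr \<eta>) \<le> lfun (chi D2) 1 * real D1" .
  then have "lfun (chi D1) 1 / ((1 / \<eta> + 1) * (real D1 * real D2) powr \<eta>) / real D1 \<le> lfun (chi D2) 1"
    by (rule pos_divide_le_eq[THEN iffD2, rotated]) (use D1(1) in simp)
  moreover have "lfun (chi D1) 1 / ((1 / \<eta> + 1) * (real D1 * real D2) powr \<eta>) / real D1
      = lfun (chi D1) 1 / (real D1 * (1 / \<eta> + 1) * real D1 powr \<eta>) * real D2 powr -\<eta>"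
    by (simp add: powr_mult powr_minus_divide)
  ultimately show ?thesis by simp
qed

text \<open>\<open>siegel_pair\<close> with the zero at \<open>chi D1\<close> bounds L(1, chi D2)
  L(1, chi (D1 D2)) below by a constant times \<open>D2\<close> to the power -96 \<delta>, where 96
  = 3 * 32 comes from \<open>(B ^ 3) ^ 32\<close>. This costs at most half of \<eta>; the other half
  pays for the logarithmic upper bound of the second factor.\<close>

lemma siegel_chi_zero_case:
  assumes \<eta>: "0 < \<eta>" and \<delta>: "0 < \<delta>" "\<delta> \<le> 1 / 32" "192 * \<delta> \<le> \<eta>"
    and D1: "D1 > 0" "\<not> is_square D1" and D2: "D2 > 0" "\<not> is_square D2"
    and nsq: "\<not> is_square (D1 * D2)" and \<beta>: "1 - \<delta> \<le> \<beta>" "\<beta> < 1" and zero: "lfun (chi D1) \<beta> = 0"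
  shows "(2 * (8820 * (8 * real D1) ^ 3) ^ 32) powr -\<delta> / (32 * real D1) / ((2 / \<eta> + 4) * (8 * real D1) powr (\<eta> / 2))
      * real D2 powr -\<eta> \<le> lfun (chi D2) 1"
proof -
  define B where "B = 8 * real D1 * real D2"
  define K where "K = 2 * (8820 * (8 * real D1) ^ 3) ^ 32"
  have r1: "1 \<le> real D1" "1 \<le> real D2" using D1 D2 by simp_all
  have K0: "0 < K" using r1 by (simp add: K_def)
  have B1: "1 \<le> B"
  proof -
    have "1 * 1 \<le> (8 * real D1) * real D2" using r1 by (intro mult_mono) auto
    then show ?thesis by (simp add: B_def)
  qed
  have w_eq: "(\<lambda>n. chi D1 n * chi D2 n) = chi (D1 * D2)" by (simp add: chi_mult_left fun_eq_iff)
  have w: "bounded_char (\<lambda>n. chi D1 n * chi D2 n) B"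
    using bounded_char_chi[OF _ nsq] D1 D2 unfolding w_eq B_def by (simp add: mult.assoc)
  have v: "bounded_char (chi D2) B"
    using r1 by (intro bounded_char_mono[OF bounded_char_chi[OF D2]]) (simp add: B_def)
  have le: "8 * real D1 \<le> B" using r1 by (simp add: B_def)
  have \<beta>': "31 / 32 \<le> \<beta>" using \<beta> \<delta> by simp
  define l12 where "l12 = lfun (\<lambda>n. chi D1 n * chi D2 n) 1"
  have main: "(2 * (8820 * B ^ 3) ^ 32) powr -(1 - \<beta>) / (4 * (8 * real D1)) \<le> lfun (chi D2) 1 * l12"
    unfolding l12_def
    by (rule siegel_pair[OF quad_char_chi quad_char_chi bounded_char_chi[OF D1] v w le zero \<beta>' \<beta>(2)])
  have base: "2 * (8820 * B ^ 3) ^ 32 = K * real D2 ^ 96"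
    unfolding B_def K_def by (simp only: power_mult_distrib power_mult[symmetric]) simp
  have "1 \<le> 8820 * B ^ 3" using one_le_power[OF B1, of 3] by simp
  then have ge1: "1 \<le> 2 * (8820 * B ^ 3) ^ 32" using one_le_power[of "8820 * B ^ 3" 32] by linarith
  have "K powr -\<delta> * real D2 powr -(\<eta> / 2) \<le> K powr -\<delta> * real D2 powr (-96 * \<delta>)"
    using \<delta> r1 by (intro mult_left_mono powr_mono) auto
  also have "\<dots> = K powr -\<delta> * (real D2 powr 96) powr -\<delta>" unfolding powr_powr by simp
  also have "\<dots> = (K * real D2 ^ 96) powr -\<delta>"
    using K0 r1 by (simp add: powr_mult powr_numeral)
  also have "\<dots> \<le> (K * real D2 ^ 96) powr -(1 - \<beta>)"
    using ge1 \<beta> unfolding base by (intro powr_mono) auto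
  finally have num: "K powr -\<delta> * real D2 powr -(\<eta> / 2) / (32 * real D1) \<le> lfun (chi D2) 1 * l12"
    using main r1 unfolding base by (simp add: divide_right_mono order_trans[OF divide_right_mono])
  have "l12 \<le> ln B + 4" unfolding l12_def by (rule lfun_1_le_ln[OF w])
  also have "ln B \<le> B powr (\<eta> / 2) / (\<eta> / 2)" using B1 \<eta> by (intro ln_powr_bound) auto
  also have "B powr (\<eta> / 2) / (\<eta> / 2) + 4 \<le> B powr (\<eta> / 2) / (\<eta> / 2) + 4 * B powr (\<eta> / 2)"
    using ge_one_powr_ge_zero[OF B1, of "\<eta> / 2"] \<eta> by simp
  also have "\<dots> = (2 / \<eta> + 4) * B powr (\<eta> / 2)" by (simp add: algebra_simps)
  also have "B powr (\<eta> / 2) = (8 * real D1) powr (\<eta> / 2) * real D2 powr (\<eta> / 2)" unfolding B_def by (simp add: powr_mult)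
  finally have den: "l12 \<le> (2 / \<eta> + 4) * (8 * real D1) powr (\<eta> / 2) * real D2 powr (\<eta> / 2)" (is "_ \<le> ?R") by simp
  have L2: "0 \<le> lfun (chi D2) 1" using lfun_1_nonneg[OF quad_char_chi bounded_char_chi[OF D2]] .
  have "0 < (2 / \<eta> + 4) * (8 * real D1) powr (\<eta> / 2)" using \<eta> r1 by (intro mult_pos_pos add_pos_pos) auto
  then have R: "0 < ?R" using r1 by (intro mult_pos_pos[of "(2 / \<eta> + 4) * (8 * real D1) powr (\<eta> / 2)"]) auto
  have "K powr -\<delta> * real D2 powr -(\<eta> / 2) / (32 * real D1) \<le> lfun (chi D2) 1 * ?R"
    using num mult_left_mono[OF den L2] by linarith
  then have "K powr -\<delta> * real D2 powr -(\<eta> / 2) / (32 * real D1) / ?R \<le> lfun (chi D2) 1"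
    using R by (simp only: pos_divide_le_eq)
  moreover have "K powr -\<delta> * real D2 powr -(\<eta> / 2) / (32 * real D1) / ?R
     = K powr -\<delta> / (32 * real D1) / ((2 / \<eta> + 4) * (8 * real D1) powr (\<eta> / 2)) * (real D2 powr -(\<eta> / 2) / real D2 powr (\<eta> / 2))"
    by simp
  moreover have "real D2 powr -(\<eta> / 2) / real D2 powr (\<eta> / 2) = real D2 powr -\<eta>"
    unfolding powr_diff[symmetric] by simp
  ultimately show ?thesis by (simp only: K_def)
qed

text \<open>Either every L-function is nonnegative at 1 - \<delta>, or some \<open>chi D1\<close> is
  negative there and, being positive at 1, has a zero between. That one character then controls all
  others. The constant depends on an unspecified \<open>D1\<close>, which is the source of
  ineffectivity.\<close>

theorem siegel_chi:
  assumes \<eta>: "0 < \<eta>"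
  obtains c where "0 < c" "\<And>D. D > 0 \<Longrightarrow> \<not> is_square D \<Longrightarrow> c * real D powr -\<eta> \<le> lfun (chi D) 1"
proof -
  define \<delta> where "\<delta> = min (1 / 32) (\<eta> / 192)"
  have \<delta>: "0 < \<delta>" "\<delta> \<le> 1 / 32" "192 * \<delta> \<le> \<eta>" using \<eta> by (auto simp: \<delta>_def min_def)
  show ?thesis
  proof (cases "\<forall>D. D > 0 \<longrightarrow> \<not> is_square D \<longrightarrow> 0 \<le> lfun (chi D) (1 - \<delta>)")
    case True
    show ?thesis
    proof (rule that[of "\<delta> / 2 * (2 * (128 / \<delta>) ^ 4) powr -\<delta>"])
      show "0 < \<delta> / 2 * (2 * (128 / \<delta>) ^ 4) powr -\<delta>" using \<delta> by simp
      show "\<delta> / 2 * (2 * (128 / \<delta>) ^ 4) powr -\<delta> * real D powr -\<eta> \<le> lfun (chi D) 1"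
        if "D > 0" "\<not> is_square D" for D
        using \<delta> True that by (intro siegel_chi_nonneg_case) auto
    qed
  next
    case False
    then obtain D1 where D1: "D1 > 0" "\<not> is_square D1" and neg: "lfun (chi D1) (1 - \<delta>) < 0" by (auto simp: not_le)
    note b1 = bounded_char_chi[OF D1]
    have "0 < exp (- (23 * (8 * real D1)))" by simp
    also have "\<dots> \<le> lfun (chi D1) 1" by (rule lfun_1_ge_exp[OF quad_char_chi b1])
    finally have L1: "0 < lfun (chi D1) 1" .
    have "\<exists>\<beta>\<ge>1 - \<delta>. \<beta> \<le> 1 \<and> lfun (chi D1) \<beta> = 0"
      using neg L1 \<delta> by (intro IVT' continuous_on_lfun[OF b1]) auto
    then obtain \<beta> where \<beta>: "1 - \<delta> \<le> \<beta>" "\<beta> \<le> 1" "lfun (chi D1) \<beta> = 0" by blast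
    have "\<beta> \<noteq> 1" using \<beta>(3) L1 by auto
    then have \<beta>1: "\<beta> < 1" using \<beta> by simp
    define c1 where "c1 = (2 * (8820 * (8 * real D1) ^ 3) ^ 32) powr -\<delta> / (32 * real D1) / ((2 / \<eta> + 4) * (8 * real D1) powr (\<eta> / 2))"
    define c2 where "c2 = lfun (chi D1) 1 / (real D1 * (1 / \<eta> + 1) * real D1 powr \<eta>)"
    show ?thesis
    proof (rule that[of "min c1 c2"])
      have "0 < c1" unfolding c1_def using \<eta> D1 by (intro divide_pos_pos mult_pos_pos add_pos_pos) auto
      moreover have "0 < c2" unfolding c2_def using \<eta> D1 L1 by (intro divide_pos_pos mult_pos_pos add_pos_pos) auto
      ultimately show "0 < min c1 c2" by simp
      fix D2 :: nat assume D2: "D2 > 0" "\<not> is_square D2"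
      show "min c1 c2 * real D2 powr -\<eta> \<le> lfun (chi D2) 1"
      proof (cases "is_square (D1 * D2)")
        case True
        then obtain t where "D1 * D2 = t\<^sup>2" by (auto elim: is_nth_powerE)
        then have "c2 * real D2 powr -\<eta> \<le> lfun (chi D2) 1"
          unfolding c2_def by (rule siegel_chi_square_case[OF \<eta> D1 D2])
        moreover have "min c1 c2 * real D2 powr -\<eta> \<le> c2 * real D2 powr -\<eta>" by (intro mult_right_mono) auto
        ultimately show ?thesis by linarith
      next
        case False
        have "c1 * real D2 powr -\<eta> \<le> lfun (chi D2) 1"
          unfolding c1_def by (rule siegel_chi_zero_case[OF \<eta> \<delta> D1 D2 False \<beta>(1) \<beta>1 \<beta>(3)])
        moreover have "min c1 c2 * real D2 powr -\<eta> \<le> c1 * real D2 powr -\<eta>" by (intro mult_right_mono) auto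
        ultimately show ?thesis by linarith
      qed
    qed
  qed
qed

section \<open>Counting square roots of \<open>\<Delta>\<close> modulo \<open>4a\<close>\<close>

text \<open>For \<open>b \<in> root_set \<Delta> a\<close> the lattice spanned by \<open>1\<close> and \<open>(b + \<surd>\<Delta>) / (2 a)\<close> is a fractional ideal of
  the order of discriminant \<open>\<Delta>\<close>.\<close>

definition root_set :: "int \<Rightarrow> nat \<Rightarrow> int set" where
  "root_set \<Delta> a = {b. 0 \<le> b \<and> b < 2 * int a \<and> 4 * int a dvd b\<^sup>2 - \<Delta>}"

lemma finite_root_set [simp]: "finite (root_set \<Delta> a)"
  by (rule finite_subset[of _ "{0..<2 * int a}"]) (auto simp: root_set_def)

lemma card_residue_classes_le:
  fixes S :: "int set"
  assumes l: "0 < l" and S: "\<And>b. b \<in> S \<Longrightarrow> 0 \<le> b \<and> b < l * int g"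
    and cong: "\<And>b b'. b \<in> S \<Longrightarrow> b' \<in> S \<Longrightarrow> l dvd b - b'"
  shows "finite S \<and> card S \<le> g"
proof -
  have inj: "inj_on (\<lambda>b. b div l) S"
  proof
    fix b b' assume b: "b \<in> S" "b' \<in> S" "b div l = b' div l"
    have "b mod l = b' mod l" using cong[OF b(1,2)] by (simp add: mod_eq_dvd_iff)
    then show "b = b'" using b(3) by (metis div_mult_mod_eq)
  qed
  have sub: "(\<lambda>b. b div l) ` S \<subseteq> {0..<int g}"
  proof
    fix x assume "x \<in> (\<lambda>b. b div l) ` S"
    then obtain b where b: "b \<in> S" "x = b div l" by blast
    have "l * (b div l) \<le> b" using l pos_mod_sign[of l b] mult_div_mod_eq[of l b] by linarith
    then have "l * (b div l) < l * int g" using S[OF b(1)] by linarith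
    then have "b div l < int g" using l by simp
    then show "x \<in> {0..<int g}" using b S[OF b(1)] l by (simp add: pos_imp_zdiv_nonneg_iff)
  qed
  have "finite S" using inj sub finite_subset[OF sub] finite_image_iff by blast
  moreover have "card S \<le> card {0..<int g}" using inj sub by (intro card_inj_on_le[of "\<lambda>b. b div l"]) auto
  ultimately show ?thesis by simp
qed

text \<open>Compare each root b with one fixed root b0. With u = (b - b0) / 2, \<open>a\<close>
  divides u (u + b0); if d is the gcd of u and \<open>a\<close>, then a / d divides u + b0. For
  given d this fixes u modulo the lcm of d and a / d, which leaves at most gcd(d, a / d) values
  modulo \<open>a\<close>.\<close>

lemma card_root_set_le:
  assumes "1 \<le> a"
  shows "card (root_set \<Delta> a) \<le> (\<Sum>d | d dvd a. gcd d (a div d))"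
proof (cases "root_set \<Delta> a = {}")
  case False
  then obtain b0 where b0: "b0 \<in> root_set \<Delta> a" by blast
  define F where "F d = {b \<in> root_set \<Delta> a. even (b - b0) \<and> int d dvd (b - b0) div 2 \<and> int (a div d) dvd (b - b0) div 2 + b0}" for d
  have fin: "finite {d. d dvd a}" using assms by simp
  have "root_set \<Delta> a \<subseteq> (\<Union>d\<in>{d. d dvd a}. F d)"
  proof
    fix b assume b: "b \<in> root_set \<Delta> a"
    have d4: "4 * int a dvd b\<^sup>2 - b0\<^sup>2"
      using b b0 dvd_diff[of "4 * int a" "b\<^sup>2 - \<Delta>" "b0\<^sup>2 - \<Delta>"] by (auto simp: root_set_def)
    then have "even (b\<^sup>2 - b0\<^sup>2)" by (metis dvd_mult_left dvd_trans even_numeral)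
    then have even: "even (b - b0)" by simp
    define u where "u = (b - b0) div 2"
    have bu: "b = 2 * u + b0" using even by (simp add: u_def)
    have "4 * int a dvd 4 * (u * (u + b0))" using d4 unfolding bu by (simp add: power2_eq_square algebra_simps)
    then have au: "int a dvd u * (u + b0)" by simp
    define d where "d = nat (gcd u (int a))"
    have d: "int d = gcd u (int a)" by (simp add: d_def)
    have da: "d dvd a" by (metis d gcd_dvd2 int_dvd_int_iff)
    have "d > 0" using da assms by (intro Nat.gr0I) auto
    obtain e where e: "a = d * e" using da by blast
    obtain u' where u': "u = int d * u'" by (metis d gcd_dvd1 dvdE)
    have "gcd (int d * u') (int d * int e) = int d" using d unfolding u' e by simp
    then have "gcd u' (int e) = 1" using \<open>d > 0\<close> by (simp add: gcd_mult_distrib_int[symmetric])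
    then have "coprime (int e) u'" by (simp add: coprime_iff_gcd_eq_1 gcd.commute)
    moreover have "int d * int e dvd int d * (u' * (u + b0))" using au unfolding e u' by (simp add: mult.assoc)
    then have "int e dvd u' * (u + b0)" using \<open>d > 0\<close> by simp
    ultimately have "int e dvd u + b0" by (simp add: coprime_dvd_mult_right_iff)
    moreover have "a div d = e" using e \<open>d > 0\<close> by simp
    ultimately have "b \<in> F d" using b even u' unfolding F_def u_def by auto
    then show "b \<in> (\<Union>d\<in>{d. d dvd a}. F d)" using da by blast
  qed
  then have "card (root_set \<Delta> a) \<le> card (\<Union>d\<in>{d. d dvd a}. F d)"
    using fin by (intro card_mono finite_UN_I) (auto simp: F_def)
  also have "\<dots> \<le> (\<Sum>d | d dvd a. card (F d))" by (rule card_UN_le[OF fin])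
  also have "\<dots> \<le> (\<Sum>d | d dvd a. gcd d (a div d))"
  proof (rule sum_mono)
    fix d assume "d \<in> {d. d dvd a}"
    then obtain e where e: "a = d * e" by blast
    then have de: "d > 0" "e > 0" "a div d = e" using assms by (auto intro!: Nat.gr0I)
    have "finite (F d) \<and> card (F d) \<le> gcd d e"
    proof (rule card_residue_classes_le)
      show "0 < 2 * int (lcm d e)" using de by (simp add: lcm_pos_nat)
      have "a = lcm d e * gcd d e" unfolding e by (metis prod_gcd_lcm_nat mult.commute)
      then have "int a = int (lcm d e) * int (gcd d e)" by (metis of_nat_mult)
      then show "0 \<le> b \<and> b < 2 * int (lcm d e) * int (gcd d e)" if "b \<in> F d" for b
        using that by (auto simp: F_def root_set_def)
      fix b b' assume "b \<in> F d" "b' \<in> F d"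
      moreover define v v' where "v = (b - b0) div 2" and "v' = (b' - b0) div 2"
      ultimately have v: "b - b0 = 2 * v" "b' - b0 = 2 * v'" "int d dvd v" "int d dvd v'" "int e dvd v + b0" "int e dvd v' + b0"
        unfolding F_def de(3) by auto
      then have "int d dvd v - v'" "int e dvd v - v'"
        using dvd_diff[of "int d" v v'] dvd_diff[of "int e" "v + b0" "v' + b0"] by simp_all
      then have "lcm (int d) (int e) dvd v - v'" by (rule lcm_least)
      then have "2 * lcm (int d) (int e) dvd 2 * (v - v')" by (rule mult_dvd_mono[OF dvd_refl])
      moreover have "b - b' = 2 * (v - v')" using v by simp
      ultimately show "2 * int (lcm d e) dvd b - b'" by (simp add: lcm_int_int_eq)
    qed
    then show "card (F d) \<le> gcd d (a div d)" using de by simp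
  qed
  finally show ?thesis .
qed simp

text \<open>Sort the pairs by their gcd s and divide it out: at most Y / (s^2 d) second entries
  remain for each d. With the weight s, the sums over s and d are both harmonic.\<close>

lemma sum_gcd_hyp_pairs_le:
  assumes "1 \<le> Y"
  shows "real (\<Sum>(d, e)\<in>hyp_pairs Y. gcd d e) \<le> real Y * (1 + ln (real Y))\<^sup>2"
proof -
  define P where "P s = {p \<in> hyp_pairs Y. (case p of (d, e) \<Rightarrow> gcd d e) = s}" for s
  have gcd_le: "gcd d e \<in> {1..Y}" if "(d, e) \<in> hyp_pairs Y" for d e
  proof -
    have "1 \<le> d" "1 \<le> e" "d * e \<le> Y" using that by (auto simp: hyp_pairs_def)
    moreover have "d * 1 \<le> d * e" using \<open>1 \<le> e\<close> by (rule mult_le_mono2)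
    moreover have "gcd d e \<le> d" "gcd d e > 0" using \<open>1 \<le> d\<close> by (auto intro: dvd_imp_le)
    ultimately have "1 \<le> gcd d e" "gcd d e \<le> Y" by linarith+
    then show ?thesis by simp
  qed
  have "(\<Sum>(d, e)\<in>hyp_pairs Y. gcd d e) = (\<Sum>s=1..Y. \<Sum>(d, e)\<in>P s. gcd d e)"
    unfolding P_def using gcd_le by (intro sum.group[symmetric]) auto
  also have "\<dots> = (\<Sum>s=1..Y. \<Sum>p\<in>P s. s)" by (intro sum.cong) (auto simp: P_def)
  also have "\<dots> = (\<Sum>s=1..Y. s * card (P s))" by (simp add: mult.commute)
  finally have 1: "real (\<Sum>(d, e)\<in>hyp_pairs Y. gcd d e) = (\<Sum>s=1..Y. real s * real (card (P s)))" by simp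
  have "real s * real (card (P s)) \<le> real Y * (1 / real s) * (\<Sum>d=1..Y. 1 / real d)" if s: "s \<in> {1..Y}" for s
  proof -
    have s1: "1 \<le> s" using s by simp
    have "P s \<subseteq> (\<lambda>(d, e). (s * d, s * e)) ` (SIGMA d:{1..Y}. {1..Y div (s\<^sup>2 * d)})"
    proof
      fix p assume p: "p \<in> P s"
      obtain x y where xy: "p = (x, y)" by fastforce
      with p have h: "1 \<le> x" "1 \<le> y" "x * y \<le> Y" "gcd x y = s" by (auto simp: P_def hyp_pairs_def)
      then obtain d e where de: "x = s * d" "y = s * e" by (metis gcd_dvd1 gcd_dvd2 dvdE)
      have "1 \<le> d" "1 \<le> e" using h de by (auto intro!: Nat.gr0I simp: Suc_le_eq)
      have prod: "e * (s\<^sup>2 * d) \<le> Y" using h(3) unfolding de by (simp add: power2_eq_square algebra_simps)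
      moreover have "d \<le> e * (s\<^sup>2 * d)"
        using \<open>1 \<le> e\<close> s1 by (simp add: Suc_le_eq)
      ultimately have "d \<le> Y" by (rule order_trans[rotated])
      moreover have "e \<le> Y div (s\<^sup>2 * d)" using prod s1 \<open>1 \<le> d\<close> by (simp add: less_eq_div_iff_mult_less_eq)
      ultimately show "p \<in> (\<lambda>(d, e). (s * d, s * e)) ` (SIGMA d:{1..Y}. {1..Y div (s\<^sup>2 * d)})"
        using xy de \<open>1 \<le> d\<close> \<open>1 \<le> e\<close> by force
    qed
    then have "card (P s) \<le> card ((\<lambda>(d, e). (s * d, s * e)) ` (SIGMA d:{1..Y}. {1..Y div (s\<^sup>2 * d)}))"
      by (intro card_mono) auto
    also have "\<dots> \<le> card (SIGMA d:{1..Y}. {1..Y div (s\<^sup>2 * d)})" by (rule card_image_le) auto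
    also have "\<dots> = (\<Sum>d=1..Y. Y div (s\<^sup>2 * d))" by simp
    finally have "real (card (P s)) \<le> (\<Sum>d=1..Y. real (Y div (s\<^sup>2 * d)))" by (simp flip: of_nat_sum)
    also have "\<dots> \<le> (\<Sum>d=1..Y. real Y / real (s\<^sup>2 * d))"
      using s1 by (intro sum_mono real_div_bounds) (auto simp: Suc_le_eq)
    also have "\<dots> = real Y / (real s)\<^sup>2 * (\<Sum>d=1..Y. 1 / real d)" by (simp add: sum_distrib_left)
    finally have "real s * real (card (P s)) \<le> real s * (real Y / (real s)\<^sup>2 * (\<Sum>d=1..Y. 1 / real d))"
      by (intro mult_left_mono) auto
    also have "\<dots> = real Y * (1 / real s) * (\<Sum>d=1..Y. 1 / real d)" using s1 by (simp add: power2_eq_square)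
    finally show ?thesis .
  qed
  then have "real (\<Sum>(d, e)\<in>hyp_pairs Y. gcd d e) \<le> (\<Sum>s=1..Y. real Y * (1 / real s) * (\<Sum>d=1..Y. 1 / real d))"
    unfolding 1 by (intro sum_mono)
  also have "\<dots> = real Y * (\<Sum>d=1..Y. 1 / real d)\<^sup>2"
    unfolding sum_distrib_right[symmetric] sum_distrib_left[symmetric] power2_eq_square mult.assoc ..
  also have "\<dots> \<le> real Y * (1 + ln (real Y))\<^sup>2"
    using harmonic_le_ln[OF assms] by (intro mult_left_mono power_mono sum_nonneg) auto
  finally show ?thesis .
qed

lemma sum_card_root_set_le:
  assumes "1 \<le> Y"
  shows "real (\<Sum>a=1..Y. card (root_set \<Delta> a)) \<le> real Y * (1 + ln (real Y))\<^sup>2"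
proof -
  have "(\<Sum>a=1..Y. card (root_set \<Delta> a)) \<le> (\<Sum>a=1..Y. \<Sum>d | d dvd a. gcd d (a div d))"
    by (intro sum_mono card_root_set_le) auto
  also have "\<dots> = (\<Sum>(d, e)\<in>hyp_pairs Y. gcd d e)" by (rule sum_divisors_eq_sum_hyp_pairs)
  finally show ?thesis using sum_gcd_hyp_pairs_le[OF assms] by (meson of_nat_mono order_trans)
qed

section \<open>Lattice points in boxes\<close>

lemma card_spaced_le:
  fixes S :: "real set"
  assumes S: "finite S" "0 \<le> l" and gap: "\<And>x y. x \<in> S \<Longrightarrow> y \<in> S \<Longrightarrow> x \<noteq> y \<Longrightarrow> 1 \<le> \<bar>x - y\<bar> \<and> \<bar>x - y\<bar> \<le> l"
  shows "real (card S) \<le> 1 + l"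
proof (cases "S = {}")
  case False
  define m where "m = Min S"
  have m: "m \<in> S" "\<And>x. x \<in> S \<Longrightarrow> m \<le> x" using False S by (auto simp: m_def)
  have "inj_on (\<lambda>x. \<lfloor>x - m\<rfloor>) S"
  proof
    fix x y assume xy: "x \<in> S" "y \<in> S" "\<lfloor>x - m\<rfloor> = \<lfloor>y - m\<rfloor>"
    have "\<bar>x - y\<bar> < 1" using xy(3) by linarith
    then show "x = y" using gap[OF xy(1,2)] by force
  qed
  moreover have "(\<lambda>x. \<lfloor>x - m\<rfloor>) ` S \<subseteq> {0..\<lfloor>l\<rfloor>}"
  proof
    fix z assume "z \<in> (\<lambda>x. \<lfloor>x - m\<rfloor>) ` S"
    then obtain x where x: "x \<in> S" "z = \<lfloor>x - m\<rfloor>" by blast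
    have "x - m \<le> l" using gap[OF x(1) m(1)] m(2)[OF x(1)] S(2) by (cases "x = m") auto
    then show "z \<in> {0..\<lfloor>l\<rfloor>}" using x m(2)[OF x(1)] by (auto intro: floor_mono)
  qed
  ultimately have "card S \<le> card {0..\<lfloor>l\<rfloor>}" by (intro card_inj_on_le) auto
  then have "card S \<le> nat (\<lfloor>l\<rfloor> + 1)" by simp
  then show ?thesis using S(2) by linarith
qed (use S in simp)

text \<open>The forms \<open>lin s1\<close> and \<open>lin s2\<close> embed the lattice of integer pairs into the plane.
  The points of the box lie on lines parallel to a shortest difference \<open>v\<close> of two of them.\<close>

definition lin :: "real \<Rightarrow> int \<times> int \<Rightarrow> real" where
  "lin s p = of_int (fst p) + of_int (snd p) * s"

lemma lin_diff: "lin s (p - q) = lin s p - lin s q"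
  by (simp add: lin_def algebra_simps)

lemma lin_det:
  "lin s1 v * lin s2 w - lin s2 v * lin s1 w = (s2 - s1) * of_int (fst v * snd w - snd v * fst w)"
  by (simp add: lin_def algebra_simps)

text \<open>Let \<mu> be the minimal size, in the norm scaled by A and B, of a difference of two
  points. There are at most 1 + 4 A B \<mu> / |s2 - s1| parallel lines with at most 1 + 2 / \<mu>
  points each. In the product, \<mu> \<le> 2 handles the linear term, and the lower bound \<nu> for
  the product of the two forms bounds 1 / \<mu>, which prevents points from crowding on a
  line.\<close>

lemma card_lattice_box_le:
  fixes F :: "(int \<times> int) set"
  assumes F: "finite F" and \<nu>: "0 < \<nu>" and V: "0 < \<bar>s2 - s1\<bar>"
    and norm: "\<And>p. p \<noteq> 0 \<Longrightarrow> \<nu> \<le> \<bar>lin s1 p * lin s2 p\<bar>"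
    and AB: "0 < A" "0 < B" and box: "\<And>p. p \<in> F \<Longrightarrow> \<bar>lin s1 p\<bar> \<le> A \<and> \<bar>lin s2 p\<bar> \<le> B"
  shows "real (card F) \<le> 1 + 2 * sqrt (A * B / \<nu>) + 16 * (A * B) / \<bar>s2 - s1\<bar>"
proof (cases "card F \<le> 1")
  case True
  have "0 \<le> sqrt (A * B / \<nu>)" "0 \<le> 16 * (A * B) / \<bar>s2 - s1\<bar>" using AB \<nu> V by simp_all
  then show ?thesis using True by linarith
next
  case False
  define W where "W = \<bar>s2 - s1\<bar>"
  have W: "0 < W" using V by (simp add: W_def)
  define E where "E = {p - q | p q. p \<in> F \<and> q \<in> F \<and> p \<noteq> q}"
  define M where "M v = max (\<bar>lin s1 v\<bar> / A) (\<bar>lin s2 v\<bar> / B)" for v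
  have "E = (\<lambda>(p, q). p - q) ` {x \<in> F \<times> F. fst x \<noteq> snd x}" unfolding E_def by force
  then have finE: "finite E" using F by simp
  obtain p0 q0 where "p0 \<in> F" "q0 \<in> F" "p0 \<noteq> q0"
    using False F by (metis card_le_Suc0_iff_eq One_nat_def)
  then have neE: "E \<noteq> {}" unfolding E_def by blast
  obtain v where v: "v \<in> E" and vmin: "\<And>w. w \<in> E \<Longrightarrow> M v \<le> M w"
    using arg_min_if_finite(1)[OF finE neE, of M] arg_min_least[OF finE neE, of _ M] by blast
  define \<mu> where "\<mu> = M v"
  have v0: "v \<noteq> 0" using v by (auto simp: E_def zero_prod_def)
  have lv: "\<nu> \<le> \<bar>lin s1 v\<bar> * \<bar>lin s2 v\<bar>" using norm[OF v0] by (simp add: abs_mult)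
  then have lv0: "lin s1 v \<noteq> 0" "lin s2 v \<noteq> 0" using \<nu> by auto
  have M2: "M w \<le> 2" if "w \<in> E" for w
  proof -
    from that obtain p q where w: "w = p - q" "p \<in> F" "q \<in> F" by (auto simp: E_def)
    have "\<bar>lin s1 w\<bar> \<le> 2 * A" "\<bar>lin s2 w\<bar> \<le> 2 * B"
      using box[OF w(2)] box[OF w(3)] unfolding w(1) lin_diff by linarith+
    then show ?thesis using AB by (simp add: M_def divide_le_eq)
  qed
  have \<mu>b: "\<bar>lin s1 v\<bar> \<le> \<mu> * A" "\<bar>lin s2 v\<bar> \<le> \<mu> * B"
    using AB unfolding \<mu>_def M_def by (simp_all add: field_simps max_def)
  have \<mu>0: "0 < \<mu>"
  proof -
    have "0 < \<bar>lin s1 v\<bar>" using lv0 by simp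
    then have "0 < \<mu> * A" using \<mu>b(1) by linarith
    then show ?thesis using AB by (simp add: zero_less_mult_iff)
  qed
  have \<mu>2: "\<mu> \<le> 2" using M2[OF v] by (simp add: \<mu>_def)
  have inv\<mu>: "1 / \<mu> \<le> sqrt (A * B / \<nu>)"
  proof (rule real_le_rsqrt)
    have "\<nu> \<le> (\<mu> * A) * (\<mu> * B)" using lv \<mu>b \<mu>0 AB by (meson abs_ge_zero mult_mono order_trans mult_nonneg_nonneg less_imp_le)
    then show "(1 / \<mu>)\<^sup>2 \<le> A * B / \<nu>" using \<mu>0 \<nu> by (simp add: power2_eq_square field_simps)
  qed
  \<comment> \<open>The determinant of \<open>p\<close> and \<open>v\<close>: constant along lines
    parallel to \<open>v\<close>, and integral, so distinct lines have values at distance at least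
    1.\<close>
  define cr where "cr p = fst p * snd v - snd p * fst v" for p :: "int \<times> int"
  have card_lines: "real (card (cr ` F)) \<le> 1 + 4 * (A * B) * \<mu> / W"
  proof -
    have cr_bound: "\<bar>real_of_int (cr p)\<bar> * W \<le> 2 * (A * B) * \<mu>" if "p \<in> F" for p
    proof -
      have "\<bar>real_of_int (cr p)\<bar> * W = \<bar>lin s1 p * lin s2 v - lin s2 p * lin s1 v\<bar>"
        unfolding lin_det cr_def W_def by (simp add: abs_mult mult.commute)
      also have "\<dots> \<le> \<bar>lin s1 p\<bar> * \<bar>lin s2 v\<bar> + \<bar>lin s2 p\<bar> * \<bar>lin s1 v\<bar>"
        by (metis abs_mult abs_triangle_ineq4)
      also have "\<dots> \<le> A * (\<mu> * B) + B * (\<mu> * A)"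
        using box[OF that] \<mu>b AB by (intro add_mono mult_mono) auto
      finally show ?thesis by (simp add: algebra_simps)
    qed
    have "real (card (real_of_int ` cr ` F)) \<le> 1 + 4 * (A * B) * \<mu> / W"
    proof (rule card_spaced_le)
      show "0 \<le> 4 * (A * B) * \<mu> / W" using AB \<mu>0 W by simp
      fix x y assume "x \<in> real_of_int ` cr ` F" "y \<in> real_of_int ` cr ` F" and ne: "x \<noteq> y"
      then obtain p q where pq: "x = real_of_int (cr p)" "y = real_of_int (cr q)" "p \<in> F" "q \<in> F" by blast
      have "\<bar>x - y\<bar> * W \<le> (\<bar>x\<bar> + \<bar>y\<bar>) * W" using W by (intro mult_right_mono) auto
      also have "\<dots> \<le> 4 * (A * B) * \<mu>" using cr_bound[OF pq(3)] cr_bound[OF pq(4)] pq by (simp add: algebra_simps)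
      finally have "\<bar>x - y\<bar> \<le> 4 * (A * B) * \<mu> / W" using W by (simp add: pos_le_divide_eq)
      moreover have "1 \<le> \<bar>x - y\<bar>" using ne pq by (simp flip: of_int_diff of_int_abs)
      ultimately show "1 \<le> \<bar>x - y\<bar> \<and> \<bar>x - y\<bar> \<le> 4 * (A * B) * \<mu> / W" by simp
    qed (use F in simp)
    then show ?thesis by (simp add: card_image inj_on_def)
  qed
  have card_line: "real (card {p \<in> F. cr p = c}) \<le> 1 + 2 / \<mu>" for c
  proof -
    define \<tau> where "\<tau> p = lin s1 p / lin s1 v" for p
    \<comment> \<open>The difference of two points on one line is a real multiple of
      \<open>v\<close>; minimality of \<open>v\<close> makes the factor at least 1 in absolute
      value, and the size of the box makes it at most 2 / \<mu>.\<close>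
    have diff: "1 \<le> \<bar>\<tau> p - \<tau> q\<bar> \<and> \<bar>\<tau> p - \<tau> q\<bar> \<le> 2 / \<mu>"
      if pq: "p \<in> F" "q \<in> F" "cr p = c" "cr q = c" "p \<noteq> q" for p q
    proof -
      define w where "w = p - q"
      define t where "t = \<tau> p - \<tau> q"
      have w: "w \<in> E" using pq unfolding E_def w_def by blast
      have "cr w = 0" using pq by (simp add: cr_def w_def algebra_simps)
      then have "lin s1 w * lin s2 v - lin s2 w * lin s1 v = 0" unfolding lin_det cr_def by simp
      then have t: "lin s1 w = t * lin s1 v" "lin s2 w = t * lin s2 v"
        using lv0 by (simp_all add: t_def \<tau>_def w_def lin_diff field_simps)
      have "M w = \<bar>t\<bar> * \<mu>" unfolding M_def \<mu>_def t
        by (simp add: abs_mult max_mult_distrib_left flip: times_divide_eq_right)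
      then show ?thesis using vmin[OF w] M2[OF w] \<mu>0 unfolding t_def[symmetric] \<mu>_def[symmetric]
        by (simp add: pos_le_divide_eq)
    qed
    have "inj_on \<tau> {p \<in> F. cr p = c}" using diff by (force intro!: inj_onI)
    then have "card {p \<in> F. cr p = c} = card (\<tau> ` {p \<in> F. cr p = c})" by (simp add: card_image)
    also have "real \<dots> \<le> 1 + 2 / \<mu>"
    proof (rule card_spaced_le)
      fix x y assume "x \<in> \<tau> ` {p \<in> F. cr p = c}" "y \<in> \<tau> ` {p \<in> F. cr p = c}" "x \<noteq> y"
      then show "1 \<le> \<bar>x - y\<bar> \<and> \<bar>x - y\<bar> \<le> 2 / \<mu>" using diff by auto
    qed (use F \<mu>0 in auto)
    finally show ?thesis .
  qed
  have "card F = card (\<Union>c\<in>cr ` F. {p \<in> F. cr p = c})" by (rule arg_cong) blast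
  also have "\<dots> \<le> (\<Sum>c\<in>cr ` F. card {p \<in> F. cr p = c})" using F by (intro card_UN_le) simp
  finally have "card F \<le> (\<Sum>c\<in>cr ` F. card {p \<in> F. cr p = c})" .
  then have "real (card F) \<le> (\<Sum>c\<in>cr ` F. real (card {p \<in> F. cr p = c}))" by (simp flip: of_nat_sum)
  also have "\<dots> \<le> (\<Sum>c\<in>cr ` F. 1 + 2 / \<mu>)" by (intro sum_mono card_line)
  also have "\<dots> = real (card (cr ` F)) * (1 + 2 / \<mu>)" by simp
  also have "\<dots> \<le> (1 + 4 * (A * B) * \<mu> / W) * (1 + 2 / \<mu>)"
    using card_lines \<mu>0 by (intro mult_right_mono) auto
  also have "\<dots> = 1 + 2 * (1 / \<mu>) + 4 * (A * B) * \<mu> / W + 8 * (A * B) / W"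
    using \<mu>0 by (simp add: algebra_simps add_divide_distrib)
  also have "\<dots> \<le> 1 + 2 * sqrt (A * B / \<nu>) + 4 * (A * B) * 2 / W + 8 * (A * B) / W"
    using inv\<mu> \<mu>2 AB W by (intro add_mono mult_left_mono divide_right_mono) auto
  also have "\<dots> = 1 + 2 * sqrt (A * B / \<nu>) + 16 * (A * B) / W" by (simp add: field_simps)
  finally show ?thesis by (simp add: W_def)
qed

text \<open>The ratio of the two forms is cut into \<open>J\<close> dyadic ranges. In range j the
  bound \<open>Q\<close> on the product confines the forms to sqrt(2^(j+1) Q) and sqrt(Q / 2^j), so
  each range is a box with A B \<le> 2 Q, whatever j is.\<close>

lemma card_lattice_annulus_le:
  fixes F :: "(int \<times> int) set"
  assumes F: "finite F" and \<nu>: "0 < \<nu>" and V: "0 < \<bar>s2 - s1\<bar>" and Q: "0 < Q"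
    and norm: "\<And>p. p \<noteq> 0 \<Longrightarrow> \<nu> \<le> \<bar>lin s1 p * lin s2 p\<bar>"
    and box: "\<And>p. p \<in> F \<Longrightarrow> \<bar>lin s2 p\<bar> \<le> \<bar>lin s1 p\<bar> \<and> \<bar>lin s1 p\<bar> < 2 ^ J * \<bar>lin s2 p\<bar> \<and> \<bar>lin s1 p * lin s2 p\<bar> \<le> Q"
  shows "real (card F) \<le> real J * (1 + 2 * sqrt (2 * Q / \<nu>) + 32 * Q / \<bar>s2 - s1\<bar>)"
proof -
  define G where "G j = {p \<in> F. 2 ^ j * \<bar>lin s2 p\<bar> \<le> \<bar>lin s1 p\<bar> \<and> \<bar>lin s1 p\<bar> < 2 ^ Suc j * \<bar>lin s2 p\<bar>}" for j :: nat
  have cover: "F \<subseteq> (\<Union>j\<in>{..<J}. G j)"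
  proof
    fix p assume p: "p \<in> F"
    let ?P = "\<lambda>j. \<bar>lin s1 p\<bar> < 2 ^ j * \<bar>lin s2 p\<bar>"
    define j where "j = (LEAST j. ?P j)"
    have PJ: "?P J" using box[OF p] by blast
    have Pj: "?P j" unfolding j_def by (rule LeastI[of ?P, OF PJ])
    have "j \<noteq> 0" using Pj box[OF p] by (intro notI) auto
    then obtain i where i: "j = Suc i" using not0_implies_Suc by blast
    have "\<not> ?P i" using not_less_Least[of i ?P] i unfolding j_def by simp
    moreover have "j \<le> J" unfolding j_def by (rule Least_le[of ?P, OF PJ])
    ultimately show "p \<in> (\<Union>j\<in>{..<J}. G j)" using p Pj i by (auto simp: G_def not_less)
  qed
  have Gj: "real (card (G j)) \<le> 1 + 2 * sqrt (2 * Q / \<nu>) + 32 * Q / \<bar>s2 - s1\<bar>" for j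
  proof -
    define A where "A = sqrt (2 ^ Suc j * Q)"
    define B where "B = sqrt (Q / 2 ^ j)"
    have AB0: "0 < A" "0 < B" using Q by (simp_all add: A_def B_def)
    have "A * B = sqrt ((2 ^ Suc j * Q) * (Q / 2 ^ j))" unfolding A_def B_def by (simp only: real_sqrt_mult)
    also have "(2 ^ Suc j * Q) * (Q / 2 ^ j) = 2 * Q\<^sup>2" by (simp add: power2_eq_square)
    also have "sqrt (2 * Q\<^sup>2) \<le> 2 * Q" using Q by (intro real_le_lsqrt) (auto simp: power2_eq_square)
    finally have AB: "A * B \<le> 2 * Q" .
    have "real (card (G j)) \<le> 1 + 2 * sqrt (A * B / \<nu>) + 16 * (A * B) / \<bar>s2 - s1\<bar>"
    proof (rule card_lattice_box_le[OF _ \<nu> V norm AB0])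
      show "finite (G j)" using F by (simp add: G_def)
      fix p assume p: "p \<in> G j"
      let ?x = "\<bar>lin s1 p\<bar>" and ?y = "\<bar>lin s2 p\<bar>"
      have g: "2 ^ j * ?y \<le> ?x" "?x < 2 ^ Suc j * ?y" "?x * ?y \<le> Q" using p box[of p] by (auto simp: G_def abs_mult)
      have "?x * ?x \<le> ?x * (2 ^ Suc j * ?y)" using g by (intro mult_left_mono) auto
      also have "\<dots> = 2 ^ Suc j * (?x * ?y)" by simp
      also have "\<dots> \<le> 2 ^ Suc j * Q" using g(3) by (intro mult_left_mono) auto
      finally have "?x \<le> A" unfolding A_def by (intro real_le_rsqrt) (simp add: power2_eq_square)
      moreover have "2 ^ j * (?y * ?y) \<le> Q"
        using mult_right_mono[OF g(1), of ?y] g(3) by (simp add: mult.assoc)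
      then have "?y * ?y \<le> Q / 2 ^ j" by (simp add: pos_le_divide_eq mult.commute)
      then have "?y \<le> B" unfolding B_def by (intro real_le_rsqrt) (simp add: power2_eq_square)
      ultimately show "?x \<le> A \<and> ?y \<le> B" ..
    qed
    also have "\<dots> \<le> 1 + 2 * sqrt (2 * Q / \<nu>) + 16 * (2 * Q) / \<bar>s2 - s1\<bar>"
      using AB \<nu> by (intro add_mono mult_left_mono divide_right_mono real_sqrt_le_mono) auto
    finally show ?thesis by simp
  qed
  have "card F \<le> card (\<Union>j\<in>{..<J}. G j)" using F by (intro card_mono[OF _ cover]) (auto simp: G_def)
  also have "\<dots> \<le> (\<Sum>j<J. card (G j))" by (rule card_UN_le) simp
  finally have "real (card F) \<le> (\<Sum>j<J. real (card (G j)))" by (simp flip: of_nat_sum)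
  also have "\<dots> \<le> (\<Sum>j<J. 1 + 2 * sqrt (2 * Q / \<nu>) + 32 * Q / \<bar>s2 - s1\<bar>)" by (intro sum_mono Gj)
  finally show ?thesis by simp
qed

section \<open>Counting ideals of norm coprime to \<open>2\<Delta>\<close>\<close>

text \<open>Roots modulo \<open>a\<close> itself are suited to the Chinese remainder theorem; for
  odd \<open>a\<close> they inject into \<open>root_set\<close>, by
  \<open>card_sqrts_mod_le_root_set\<close>.\<close>

definition sqrts_mod :: "int \<Rightarrow> nat \<Rightarrow> nat set" where
  "sqrts_mod \<Delta> a = {t. t < a \<and> int a dvd (int t)\<^sup>2 - \<Delta>}"

lemma finite_sqrts_mod [simp]: "finite (sqrts_mod \<Delta> a)"
  by (rule finite_subset[of _ "{..<a}"]) (auto simp: sqrts_mod_def)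

lemma card_sqrts_mod_coprime_mult:
  assumes "a > 0" "b > 0" "coprime a b"
  shows "card (sqrts_mod \<Delta> a) * card (sqrts_mod \<Delta> b) \<le> card (sqrts_mod \<Delta> (a * b))"
proof -
  have "sqrts_mod \<Delta> a \<times> sqrts_mod \<Delta> b \<subseteq> (\<lambda>x. (x mod a, x mod b)) ` sqrts_mod \<Delta> (a * b)"
  proof
    fix p assume "p \<in> sqrts_mod \<Delta> a \<times> sqrts_mod \<Delta> b"
    then obtain t u where tu: "p = (t, u)" "t \<in> sqrts_mod \<Delta> a" "u \<in> sqrts_mod \<Delta> b" by auto
    obtain x where x: "x < a * b" "[x = t] (mod a)" "[x = u] (mod b)"
      using binary_chinese_remainder_unique_nat[OF assms(3), of t u] assms by auto
    have xm: "x mod a = t" "x mod b = u" using x tu by (auto simp: sqrts_mod_def unique_euclidean_semiring_class.cong_def)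
    have "[int x = int t] (mod int a)" "[int x = int u] (mod int b)" using x by (simp_all add: cong_int_iff)
    then have "[(int x)\<^sup>2 - \<Delta> = (int t)\<^sup>2 - \<Delta>] (mod int a)" "[(int x)\<^sup>2 - \<Delta> = (int u)\<^sup>2 - \<Delta>] (mod int b)"
      by (auto intro!: cong_diff cong_pow)
    then have "int a dvd (int x)\<^sup>2 - \<Delta>" "int b dvd (int x)\<^sup>2 - \<Delta>"
      using tu by (simp_all add: sqrts_mod_def cong_dvd_iff)
    then have "int (a * b) dvd (int x)\<^sup>2 - \<Delta>" using assms(3) by (simp add: divides_mult)
    then have "x \<in> sqrts_mod \<Delta> (a * b)" using x by (simp add: sqrts_mod_def)
    then show "p \<in> (\<lambda>x. (x mod a, x mod b)) ` sqrts_mod \<Delta> (a * b)" using xm tu by force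
  qed
  then have "card (sqrts_mod \<Delta> a \<times> sqrts_mod \<Delta> b) \<le> card (sqrts_mod \<Delta> (a * b))"
    by (intro surj_card_le) auto
  then show ?thesis by (simp add: card_cartesian_product)
qed

lemma sqrts_mod_1: "card (sqrts_mod \<Delta> 1) = 1" "card (sqrts_mod \<Delta> (Suc 0)) = 1"
proof -
  have "sqrts_mod \<Delta> 1 = {0}" by (auto simp: sqrts_mod_def)
  then show "card (sqrts_mod \<Delta> 1) = 1" "card (sqrts_mod \<Delta> (Suc 0)) = 1" by simp_all
qed

text \<open>Hensel lifting: if z inverts 2 x modulo p and x^2 - \<Delta> = p^k c, then x - p^k c z
  is a root modulo p^(k+1).\<close>

lemma sqrt_mod_prime_power:
  assumes p: "prime p" "odd p" and j: "jacobi \<Delta> p = 1" and k: "1 \<le> k"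
  obtains x where "int p ^ k dvd x\<^sup>2 - \<Delta>" "\<not> int p dvd x"
proof -
  have "Legendre \<Delta> (int p) = 1" using j p by (simp add: jacobi_prime)
  then have "QuadRes (int p) \<Delta>" and nd: "\<not> int p dvd \<Delta>" by (auto simp: Legendre_def cong_0_iff split: if_splits)
  then obtain y where y: "int p dvd y\<^sup>2 - \<Delta>" unfolding QuadRes_def by (auto simp: cong_iff_dvd_diff)
  have "\<exists>x. int p ^ k dvd x\<^sup>2 - \<Delta>"
    using k
  proof (induction k rule: dec_induct)
    case base
    then show ?case using y by auto
  next
    case (step k)
    then obtain x c where x: "x\<^sup>2 - \<Delta> = int p ^ k * c" by (auto elim!: dvdE)
    have "\<not> int p dvd x"
    proof
      assume "int p dvd x"
      then have "int p dvd x\<^sup>2" by (simp add: power2_eq_square)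
      moreover have "int p dvd x\<^sup>2 - \<Delta>" using x step(1) by (simp add: dvd_power)
      ultimately have "int p dvd x\<^sup>2 - (x\<^sup>2 - \<Delta>)" by (rule dvd_diff)
      then show False using nd by simp
    qed
    moreover have "\<not> int p dvd 2"
    proof
      assume "int p dvd 2"
      then have "int p \<le> 2" by (intro zdvd_imp_le) auto
      then show False using odd_prime_gt_2[OF p] by simp
    qed
    ultimately have "\<not> int p dvd 2 * x" using p(1) by (simp add: prime_dvd_mult_iff)
    then have "coprime (2 * x) (int p)" using p(1) by (metis coprime_commute prime_imp_coprime prime_nat_int_transfer)
    then obtain z where z: "[(2 * x) * z = 1] (mod int p)" using cong_solve_coprime_int by blast
    then have "int p dvd 2 * x * z - 1" by (simp add: cong_iff_dvd_diff)
    then have "int p dvd c + 2 * x * (- c * z)"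
      using dvd_mult2[of "int p" "2 * x * z - 1" "- c"] by (simp add: algebra_simps)
    then obtain e where e: "c + 2 * x * (- c * z) = int p * e" by blast
    have "(x + int p ^ k * (- c * z))\<^sup>2 - \<Delta> = (x\<^sup>2 - \<Delta>) + int p ^ k * (2 * x * (- c * z)) + int p ^ k * (int p ^ k * (- c * z)\<^sup>2)"
      by (simp add: power2_eq_square algebra_simps)
    also have "\<dots> = int p ^ k * (c + 2 * x * (- c * z)) + int p ^ k * (int p ^ k * (- c * z)\<^sup>2)"
      unfolding x by (simp add: algebra_simps)
    also have "\<dots> = int p ^ k * int p * (e + int p ^ (k - 1) * (- c * z)\<^sup>2)"
      using step(1) unfolding e by (cases k) (simp_all add: algebra_simps)
    finally have "int p ^ Suc k dvd (x + int p ^ k * (- c * z))\<^sup>2 - \<Delta>" by (simp add: mult.commute)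
    then show ?case by blast
  qed
  then obtain x where x: "int p ^ k dvd x\<^sup>2 - \<Delta>" by blast
  have "\<not> int p dvd x"
  proof
    assume "int p dvd x"
    then have "int p dvd x\<^sup>2" by (simp add: power2_eq_square)
    moreover have "int p dvd x\<^sup>2 - \<Delta>" using x k by (metis dvd_power dvd_trans less_eq_Suc_le One_nat_def)
    ultimately have "int p dvd x\<^sup>2 - (x\<^sup>2 - \<Delta>)" by (rule dvd_diff)
    then show False using nd by simp
  qed
  then show ?thesis using x that by blast
qed

text \<open>A root and its negative are distinct, because the odd prime p does not divide the
  root.\<close>

lemma card_sqrts_mod_prime_power:
  assumes p: "prime p" "odd p" and j: "jacobi \<Delta> p = 1" and k: "1 \<le> k"
  shows "2 \<le> card (sqrts_mod \<Delta> (p ^ k))"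
proof -
  obtain x where x: "int p ^ k dvd x\<^sup>2 - \<Delta>" "\<not> int p dvd x" by (rule sqrt_mod_prime_power[OF assms])
  define q where "q = p ^ k"
  have q0: "0 < q" using prime_gt_0_nat[OF p(1)] by (simp add: q_def)
  have root: "nat (z mod int q) \<in> sqrts_mod \<Delta> q" if "int q dvd z\<^sup>2 - \<Delta>" for z
  proof -
    have e: "int (nat (z mod int q)) = z mod int q" using q0 by simp
    have "[(z mod int q)\<^sup>2 - \<Delta> = z\<^sup>2 - \<Delta>] (mod int q)" by (intro cong_diff cong_pow) (auto simp: unique_euclidean_semiring_class.cong_def)
    then have "int q dvd (z mod int q)\<^sup>2 - \<Delta>" using that by (simp add: cong_dvd_iff)
    moreover have "nat (z mod int q) < q" using q0 by (simp add: nat_less_iff)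
    ultimately show ?thesis by (simp add: sqrts_mod_def e)
  qed
  have "nat (x mod int q) \<noteq> nat (- x mod int q)"
  proof
    assume "nat (x mod int q) = nat (- x mod int q)"
    then have "x mod int q = - x mod int q" using q0 by (simp add: eq_nat_nat_iff)
    then have "int q dvd 2 * x" by (simp add: mod_eq_dvd_iff)
    moreover have "int p dvd int q" using k unfolding q_def by (simp add: dvd_power)
    ultimately have "int p dvd 2 * x" by (rule dvd_trans[rotated])
    then have "int p dvd 2" using x(2) p(1) by (simp add: prime_dvd_mult_iff)
    then have "int p \<le> 2" by (intro zdvd_imp_le) auto
    then show False using odd_prime_gt_2[OF p] by simp
  qed
  moreover have "{nat (x mod int q), nat (- x mod int q)} \<subseteq> sqrts_mod \<Delta> q"
    using root[of x] root[of "-x"] x(1) by (simp add: q_def)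
  ultimately show ?thesis unfolding q_def[symmetric]
    using card_mono[OF finite_sqrts_mod, of "{nat (x mod int q), nat (- x mod int q)}" \<Delta> q] by simp
qed

text \<open>For \<open>m\<close> prime to 2 \<Delta> this stands for the number of integral ideals
  of norm \<open>m\<close>: such an ideal is g times a primitive one of norm m / g^2, and the
  primitive ones correspond to square roots of \<Delta>.\<close>

definition norm_count :: "int \<Rightarrow> nat \<Rightarrow> nat" where
  "norm_count \<Delta> m = (\<Sum>g | g\<^sup>2 dvd m. card (sqrts_mod \<Delta> (m div g\<^sup>2)))"

lemma finite_square_divisors: "m > 0 \<Longrightarrow> finite {g :: nat. g\<^sup>2 dvd m}"
proof (rule finite_subset)
  assume "m > 0"
  have "g \<le> m" if "g\<^sup>2 dvd m" for g
  proof -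
    have "g dvd m" using that by (metis dvd_mult_left power2_eq_square)
    then show ?thesis using \<open>m > 0\<close> by (rule dvd_imp_le)
  qed
  then show "{g. g\<^sup>2 dvd m} \<subseteq> {..m}" by auto
qed simp

text \<open>The products of p^i with the g for which g^2 divides \<open>m\<close> are distinct, and
  their squares divide p^k m; at each of them the Chinese remainder theorem combines the two root
  counts.\<close>

lemma norm_count_prime_power_mult:
  assumes p: "prime p" "\<not> p dvd m" and m: "m > 0"
  shows "(\<Sum>i\<le>k div 2. card (sqrts_mod \<Delta> (p ^ (k - 2 * i)))) * norm_count \<Delta> m \<le> norm_count \<Delta> (p ^ k * m)"
proof -
  define S where "S = {..k div 2} \<times> {g. g\<^sup>2 dvd m}"
  have p0: "p > 0" using prime_gt_0_nat[OF p(1)] .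
  have ng: "\<not> p dvd g" if "g\<^sup>2 dvd m" for g
  proof
    assume "p dvd g"
    then have "p dvd g\<^sup>2" by (simp add: power2_eq_square)
    then show False using that p(2) dvd_trans by blast
  qed
  have less: False if "p ^ i * g = p ^ j * h" "i < j" "\<not> p dvd g" for i j g h
  proof -
    have "p ^ j = p ^ i * p ^ (j - i)" using that by (simp flip: power_add)
    then have "g = p ^ (j - i) * h" using that(1) p0 by (simp add: mult.assoc)
    then show False using that by (simp add: dvd_power)
  qed
  have inj: "inj_on (\<lambda>(i, g). p ^ i * g) S"
  proof
    fix x y assume xy: "x \<in> S" "y \<in> S" "(case x of (i, g) \<Rightarrow> p ^ i * g) = (case y of (i, g) \<Rightarrow> p ^ i * g)"
    obtain i g j h where e: "x = (i, g)" "y = (j, h)" by fastforce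
    have eq: "p ^ i * g = p ^ j * h" using xy e by simp
    have "\<not> p dvd g" "\<not> p dvd h" using xy e ng by (auto simp: S_def)
    then have "i = j" using less[OF eq] less[OF eq[symmetric]] by (meson linorder_neqE_nat)
    then show "x = y" using eq p0 e by simp
  qed
  have sub: "(\<lambda>(i, g). p ^ i * g) ` S \<subseteq> {g. g\<^sup>2 dvd p ^ k * m}"
  proof
    fix h assume "h \<in> (\<lambda>(i, g). p ^ i * g) ` S"
    then obtain i g where h: "h = p ^ i * g" "i \<le> k div 2" "g\<^sup>2 dvd m" by (auto simp: S_def)
    have "p ^ (2 * i) dvd p ^ k" using h(2) by (intro le_imp_power_dvd) linarith
    then have "p ^ (2 * i) * g\<^sup>2 dvd p ^ k * m" using h(3) by (rule mult_dvd_mono)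
    then show "h \<in> {g. g\<^sup>2 dvd p ^ k * m}" unfolding h(1) by (simp add: power_mult_distrib mult.commute flip: power_mult)
  qed
  have "(\<Sum>i\<le>k div 2. card (sqrts_mod \<Delta> (p ^ (k - 2 * i)))) * norm_count \<Delta> m
      = (\<Sum>(i, g)\<in>S. card (sqrts_mod \<Delta> (p ^ (k - 2 * i))) * card (sqrts_mod \<Delta> (m div g\<^sup>2)))"
    unfolding norm_count_def S_def by (simp add: sum_product sum.cartesian_product)
  also have "\<dots> \<le> (\<Sum>(i, g)\<in>S. card (sqrts_mod \<Delta> (p ^ k * m div (p ^ i * g)\<^sup>2)))"
  proof (rule sum_mono)
    fix x assume "x \<in> S"
    then obtain i g where x: "x = (i, g)" "i \<le> k div 2" "g\<^sup>2 dvd m" by (auto simp: S_def)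
    obtain c where c: "m = g\<^sup>2 * c" using x(3) by blast
    have g0: "g > 0" "c > 0" using c m by (auto intro!: Nat.gr0I)
    have "p ^ k = p ^ (2 * i) * p ^ (k - 2 * i)" using x(2) by (simp flip: power_add)
    then have "p ^ k * m = (p ^ i * g)\<^sup>2 * (p ^ (k - 2 * i) * c)"
      unfolding c by (simp add: power_mult_distrib power_mult mult.commute mult.left_commute)
    then have e: "p ^ k * m div (p ^ i * g)\<^sup>2 = p ^ (k - 2 * i) * c" using p0 g0 by simp
    have "\<not> p dvd c" using c p(2) by auto
    then have "coprime (p ^ (k - 2 * i)) c" by (rule coprime_prime_power[OF p(1)])
    then have "card (sqrts_mod \<Delta> (p ^ (k - 2 * i))) * card (sqrts_mod \<Delta> c) \<le> card (sqrts_mod \<Delta> (p ^ (k - 2 * i) * c))"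
      using p0 g0 by (intro card_sqrts_mod_coprime_mult) auto
    moreover have "m div g\<^sup>2 = c" using c g0 by simp
    ultimately show "(case x of (i, g) \<Rightarrow> card (sqrts_mod \<Delta> (p ^ (k - 2 * i))) * card (sqrts_mod \<Delta> (m div g\<^sup>2)))
        \<le> (case x of (i, g) \<Rightarrow> card (sqrts_mod \<Delta> (p ^ k * m div (p ^ i * g)\<^sup>2)))"
      unfolding x(1) by (simp add: e)
  qed
  also have "\<dots> = (\<Sum>h\<in>(\<lambda>(i, g). p ^ i * g) ` S. card (sqrts_mod \<Delta> (p ^ k * m div h\<^sup>2)))"
    by (subst sum.reindex[OF inj]) (auto intro!: sum.cong)
  also have "\<dots> \<le> norm_count \<Delta> (p ^ k * m)"
    unfolding norm_count_def using m p0 by (intro sum_mono2[OF finite_square_divisors sub]) auto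
  finally show ?thesis .
qed

text \<open>If the symbol is 1, each positive exponent k - 2 i contributes two roots and exponent 0
  contributes one, k + 1 in total. If it is -1, the single root at exponent 0, present for even k,
  is already enough.\<close>

lemma sum_sqrts_mod_prime_powers_ge:
  assumes p: "prime p" "odd p" "coprime D p"
  shows "one_conv (chi D) (p ^ k) \<le> real (\<Sum>i\<le>k div 2. card (sqrts_mod (int D) (p ^ (k - 2 * i))))"
proof -
  let ?R = "\<lambda>n. card (sqrts_mod (int D) (p ^ n))"
  have val: "jacobi (int D) p = 1 \<or> jacobi (int D) p = -1"
    using jacobi_values[of "int D" p] jacobi_eq_0_iff[of "int D" p] p by auto
  have last: "(\<Sum>i\<le>k div 2. ?R (k - 2 * i)) = ?R (k mod 2) + (\<Sum>i<k div 2. ?R (k - 2 * i))"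
  proof -
    have "k - 2 * (k div 2) = k mod 2" by presburger
    then show ?thesis by (simp add: lessThan_Suc_atMost[symmetric])
  qed
  show ?thesis
  proof (cases "jacobi (int D) p = 1")
    case True
    have two: "2 \<le> ?R n" if "1 \<le> n" for n by (rule card_sqrts_mod_prime_power[OF p(1,2) True that])
    have "(\<Sum>i<k div 2. 2) \<le> (\<Sum>i<k div 2. ?R (k - 2 * i))" by (intro sum_mono two) auto
    then have "2 * (k div 2) \<le> (\<Sum>i<k div 2. ?R (k - 2 * i))" by simp
    moreover have "1 + k mod 2 \<le> ?R (k mod 2)"
    proof (cases "k mod 2 = 0")
      case False
      then have "k mod 2 = 1" by simp
      then show ?thesis using two[of 1] by simp
    qed (simp add: sqrts_mod_1)
    moreover have "k = k mod 2 + 2 * (k div 2)" by simp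
    ultimately have "k + 1 \<le> (\<Sum>i\<le>k div 2. ?R (k - 2 * i))" unfolding last by linarith
    then have "real k + 1 \<le> real (\<Sum>i\<le>k div 2. ?R (k - 2 * i))" by (metis of_nat_mono of_nat_1 of_nat_add)
    then show ?thesis using True by (simp add: one_conv_prime_power_cases[OF quad_char_chi p(1)] chi_def)
  next
    case False
    then have "one_conv (chi D) (p ^ k) = (if even k then 1 else 0)"
      using val by (simp add: one_conv_prime_power_cases[OF quad_char_chi p(1)] chi_def)
    moreover have "1 \<le> (\<Sum>i\<le>k div 2. ?R (k - 2 * i))" if "even k"
      unfolding last using that by (simp add: sqrts_mod_1)
    ultimately show ?thesis by (metis (no_types, lifting) of_nat_0_le_iff of_nat_1 of_nat_mono)
  qed
qed

lemma one_conv_le_norm_count: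
  assumes "m > 0" "coprime m (2 * D)"
  shows "one_conv (chi D) m \<le> real (norm_count (int D) m)"
  using assms
proof (induction m rule: prime_power_induct)
  case one
  have "{g :: nat. g\<^sup>2 dvd 1} = {1}" by auto
  then show ?case by (simp add: norm_count_def sqrts_mod_1 dconv_def chi_def)
next
  case (mult p k m)
  have cop: "coprime p (2 * D)" "coprime m (2 * D)" using mult by auto
  then have p: "odd p" "coprime D p" by (auto simp: coprime_commute)
  have "one_conv (chi D) (p ^ k * m) = one_conv (chi D) (p ^ k) * one_conv (chi D) m"
    using one_conv_multiplicative[OF quad_char_chi] coprime_prime_power[OF mult(1,4), of k] mult(1,3) prime_gt_0_nat[of p]
    by (simp add: multiplicative_def)
  also have "\<dots> \<le> real (\<Sum>i\<le>k div 2. card (sqrts_mod (int D) (p ^ (k - 2 * i)))) * real (norm_count (int D) m)"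
    using sum_sqrts_mod_prime_powers_ge[OF mult(1) p] mult.IH[OF cop(2)] one_conv_nonneg[OF quad_char_chi]
    by (intro mult_mono) (auto intro: sum_nonneg)
  also have "\<dots> \<le> real (norm_count (int D) (p ^ k * m))"
    using norm_count_prime_power_mult[OF mult(1,4,3), where \<Delta> = "int D" and k = k] by (metis of_nat_mono of_nat_mult)
  finally show ?case .
qed

text \<open>Adding the odd number \<open>a\<close> where necessary gives t the parity of \<Delta>,
  and then t^2 = \<Delta> modulo 4 is automatic.\<close>

lemma card_sqrts_mod_le_root_set:
  assumes "odd a" "\<Delta> mod 4 = 0 \<or> \<Delta> mod 4 = 1"
  shows "card (sqrts_mod \<Delta> a) \<le> card (root_set \<Delta> a)"
proof (rule card_inj_on_le)
  define f where "f t = (if even (int t - \<Delta>) then int t else int t + int a)" for t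
  show "inj_on f (sqrts_mod \<Delta> a)"
    by (rule inj_onI) (auto simp: f_def sqrts_mod_def split: if_splits)
  show "f ` sqrts_mod \<Delta> a \<subseteq> root_set \<Delta> a"
  proof
    fix b assume "b \<in> f ` sqrts_mod \<Delta> a"
    then obtain t where t: "b = f t" "t < a" "int a dvd (int t)\<^sup>2 - \<Delta>" by (auto simp: sqrts_mod_def)
    have ev: "even (b - \<Delta>)" using assms(1) unfolding t f_def by auto
    have da: "int a dvd b\<^sup>2 - \<Delta>"
    proof -
      have "b\<^sup>2 - \<Delta> = (int t)\<^sup>2 - \<Delta> \<or> b\<^sup>2 - \<Delta> = ((int t)\<^sup>2 - \<Delta>) + int a * (2 * int t + int a)"
        unfolding t f_def by (auto simp: power2_eq_square algebra_simps)
      then show ?thesis using t(3) by (metis dvd_add dvd_triv_left)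
    qed
    have d4: "4 dvd b\<^sup>2 - \<Delta>"
    proof (cases "even b")
      case True
      then obtain c where "b = 2 * c" by blast
      then have "b\<^sup>2 mod 4 = 0" by (simp add: power2_eq_square)
      moreover have "\<Delta> mod 4 = 0" using ev True assms(2) by presburger
      ultimately show ?thesis by (simp add: mod_eq_dvd_iff[symmetric])
    next
      case False
      then obtain c where "b = 2 * c + 1" using oddE by blast
      then have "b\<^sup>2 = 4 * (c\<^sup>2 + c) + 1" by (simp add: power2_eq_square algebra_simps)
      then have "b\<^sup>2 mod 4 = 1" by presburger
      moreover have "\<Delta> mod 4 = 1" using ev False assms(2) by presburger
      ultimately show ?thesis by (simp add: mod_eq_dvd_iff[symmetric])
    qed
    have "coprime 4 (int a)"
      using assms(1) coprime_power_left_iff[of 2 2 "int a"] by simp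
    with d4 da have "4 * int a dvd b\<^sup>2 - \<Delta>" by (rule divides_mult)
    moreover have "0 \<le> b" "b < 2 * int a" using t by (auto simp: f_def)
    ultimately show "b \<in> root_set \<Delta> a" by (simp add: root_set_def)
  qed
qed simp

section \<open>The density of ideals with norm coprime to 2D\<close>

lemma sum_coprime_indicator:
  assumes "q > 1"
  shows "\<bar>(\<Sum>n=1..z. if coprime n q then 1 else 0) - real (totient q) / real q * real z\<bar> \<le> real q"
proof -
  define f :: "nat \<Rightarrow> int" where "f n = (if coprime n q then 1 else 0)" for n
  define k r where "k = Suc z div q" and "r = Suc z mod q"
  have zkr: "Suc z = q * k + r" by (simp add: k_def r_def)
  have r: "r < q" using assms by (simp add: r_def)
  have per: "f (n + q) = f n" for n
  proof -
    have "gcd (n + q) q = gcd n q" by simp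
    then have "coprime (n + q) q \<longleftrightarrow> coprime n q" by (simp only: coprime_iff_gcd_eq_1)
    then show ?thesis by (simp add: f_def)
  qed
  have f0: "f 0 = 0" using assms by (simp add: f_def)
  have full: "sum f {..<q} = int (totient q)"
  proof -
    have "sum f {..<q} = int (card {n \<in> {..<q}. coprime n q})"
      unfolding f_def by (simp add: sum.inter_filter[symmetric] flip: of_nat_sum)
    also have "{n \<in> {..<q}. coprime n q} = totatives q"
    proof -
      have "n > 0" if "coprime n q" for n using that assms by (intro Nat.gr0I) auto
      moreover have "n \<noteq> q" if "coprime n q" for n using that assms by auto
      ultimately show ?thesis by (fastforce simp: totatives_def)
    qed
    finally show ?thesis by (simp add: totient_def)
  qed
  have "sum f {..<Suc z} = int k * sum f {..<q} + sum f {..<r}"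
    unfolding zkr using sum_periodic[of f q k r] per by simp
  moreover have "sum f {..<Suc z} = (\<Sum>n=1..z. f n)"
  proof -
    have "{..<Suc z} = insert 0 {1..z}" by auto
    then show ?thesis using f0 by simp
  qed
  ultimately have eq: "(\<Sum>n=1..z. f n) = int k * int (totient q) + sum f {..<r}" using full by simp
  have sr: "0 \<le> sum f {..<r}" "sum f {..<r} \<le> int r"
  proof -
    show "0 \<le> sum f {..<r}" by (intro sum_nonneg) (simp add: f_def)
    have "sum f {..<r} \<le> (\<Sum>i<r. 1)" by (intro sum_mono) (simp add: f_def)
    then show "sum f {..<r} \<le> int r" by simp
  qed
  define \<alpha> where "\<alpha> = real (totient q) / real q"
  have \<alpha>: "0 \<le> \<alpha>" "\<alpha> \<le> 1" using assms totient_le[of q] by (auto simp: \<alpha>_def)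
  have z: "real z = real q * real k + real r - 1"
  proof -
    have "real (Suc z) = real (q * k + r)" by (simp only: zkr)
    then show ?thesis by simp
  qed
  have "\<alpha> * real z = real k * real (totient q) + \<alpha> * (real r - 1)"
    using assms unfolding z by (simp add: \<alpha>_def field_simps)
  moreover have "(\<Sum>n=1..z. if coprime n q then 1 else 0) = real_of_int (\<Sum>n=1..z. f n)"
    unfolding f_def of_int_sum by (intro sum.cong) auto
  ultimately have d: "(\<Sum>n=1..z. if coprime n q then 1 else 0) - \<alpha> * real z = real_of_int (sum f {..<r}) - \<alpha> * (real r - 1)"
    unfolding eq by simp
  have "\<alpha> * (real r - 1) \<le> real q - 1" "- 1 \<le> \<alpha> * (real r - 1)"
  proof -
    have "0 \<le> \<alpha> * real r" using \<alpha> by simp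
    moreover have "\<alpha> * (real r - 1) = \<alpha> * real r - \<alpha>" by (simp add: algebra_simps)
    ultimately show "- 1 \<le> \<alpha> * (real r - 1)" using \<alpha> by linarith
    have "\<alpha> * (real r - 1) \<le> \<alpha> * (real q - 1)" using r \<alpha> by (intro mult_left_mono) auto
    also have "\<dots> \<le> 1 * (real q - 1)" using \<alpha> assms by (intro mult_right_mono) auto
    finally show "\<alpha> * (real r - 1) \<le> real q - 1" by simp
  qed
  moreover have "real_of_int (sum f {..<r}) \<le> real q - 1"
  proof -
    have "sum f {..<r} \<le> int q - 1" using sr r by linarith
    then have "real_of_int (sum f {..<r}) \<le> real_of_int (int q - 1)" by (simp only: of_int_le_iff)
    then show ?thesis by simp
  qed
  moreover have "0 \<le> real_of_int (sum f {..<r})" using sr(1) by (simp only: of_int_0_le_iff)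
  ultimately show ?thesis unfolding \<alpha>_def[symmetric] d by linarith
qed

lemma totient_ratio_ge:
  assumes "q > 0" shows "1 / (2 * ln (real q) + 1) \<le> real (totient q) / real q"
proof -
  have l: "0 \<le> ln (real q)" using assms by simp
  have "1 / (2 * ln (real q) + 1) \<le> 1 / (real (card (prime_factors q)) + 1)"
    using card_prime_factors_le_ln[OF assms] l by (intro divide_left_mono) (auto intro!: mult_pos_pos add_nonneg_pos)
  also have "\<dots> \<le> (\<Prod>p\<in>prime_factors q. 1 - 1 / real p)"
    by (rule prod_one_minus_inverse_ge) (auto intro: prime_ge_2_nat)
  also have "\<dots> = real (totient q) / real q" using assms by (simp add: totient_formula2)
  finally show ?thesis .
qed

text \<open>Since \<open>chi D\<close> vanishes off the integers prime to 2 D, a condition on the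
  divisor d alone becomes a condition on n. The restricted sums thus have the shape required by
  \<open>hyperbola_asymp\<close>.\<close>

lemma dconv_coprime_indicator_chi:
  assumes "n > 0"
  shows "dconv (\<lambda>n. if coprime n (2 * D) then 1 else 0) (chi D) n = (if coprime n (2 * D) then one_conv (chi D) n else 0)"
proof (cases "coprime n (2 * D)")
  case True
  have "coprime d (2 * D)" if "d dvd n" for d using coprime_divisors[OF that dvd_refl True] .
  then show ?thesis using True unfolding dconv_def by (auto intro!: sum.cong)
next
  case False
  have "(if coprime d (2 * D) then 1 else 0) * chi D (n div d) = 0" if "d dvd n" for d
  proof (cases "coprime d (2 * D)")
    case True
    obtain e where e: "n = d * e" using \<open>d dvd n\<close> by blast
    have "d > 0" using e assms by (intro Nat.gr0I) auto
    then have "n div d = e" using e by simp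
    moreover have "\<not> coprime e (2 * D)" using False True unfolding e by simp
    then have "jacobi (int D) e = 0" by (auto simp: jacobi_eq_0_iff coprime_commute)
    ultimately show ?thesis by (simp add: chi_def)
  qed auto
  then show ?thesis using False unfolding dconv_def by (auto intro!: sum.neutral)
qed

text \<open>The mean value of \<open>one_conv (chi D)\<close> over integers prime to 2 D is L(1, chi
  D) times the totient ratio of 2 D, and it cannot exceed an upper density of the norm counts.
  \<open>D\<close> is fixed while X tends to infinity, so errors depending on \<open>D\<close>
  disappear.\<close>

lemma lfun_chi_le_norm_count_density:
  assumes D: "D > 0" "\<not> is_square D"
    and c: "\<And>X. X0 \<le> X \<Longrightarrow> real (\<Sum>m\<in>{m \<in> {1..X}. coprime m (2 * D)}. norm_count (int D) m) \<le> c * real X"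
  shows "lfun (chi D) 1 / (2 * ln (2 * real D) + 1) \<le> c"
proof -
  define q where "q = 2 * D"
  define \<alpha> where "\<alpha> = real (totient q) / real q"
  define B where "B = 8 * real D"
  have q: "q > 1" using D by (simp add: q_def)
  have w: "bounded_char (chi D) B" unfolding B_def by (rule bounded_char_chi[OF D])
  have B: "1 \<le> B" using D by (simp add: B_def)
  have L: "0 \<le> lfun (chi D) 1" by (rule lfun_1_nonneg[OF quad_char_chi w])
  have \<alpha>: "0 \<le> \<alpha>" by (simp add: \<alpha>_def)
  define K where "K = (\<alpha> + real q) * (1 + 4 * B)"
  have K: "0 \<le> K" using \<alpha> B by (simp add: K_def)
  have low: "\<alpha> * lfun (chi D) 1 - c \<le> K * real X powr (-1/2)" if X: "max 1 X0 \<le> X" for X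
  proof -
    have X1: "1 \<le> X" "X0 \<le> X" using X by auto
    define y where "y = nat \<lfloor>real X powr (1/2)\<rfloor>"
    note y = floor_powr_bounds[OF X1(1), of "1/2", folded y_def, simplified]
    let ?v = "\<lambda>n. if coprime n q then 1 else (0 :: real)"
    have "\<bar>(\<Sum>n=1..X. dconv ?v (chi D) n) - \<alpha> * lfun (chi D) 1 * real X\<bar>
        \<le> (\<alpha> + real q) * (real y * real X powr 0 + 4 * B * real X / real (Suc y))"
      using y sum_coprime_indicator[OF q] q unfolding \<alpha>_def
      by (intro hyperbola_asymp[OF w]) auto
    also have "\<dots> = (\<alpha> + real q) * (real y + 4 * B * (real X / real (Suc y)))" using X1 by simp
    also have "\<dots> \<le> (\<alpha> + real q) * (real X powr (1/2) + 4 * B * real X powr (1/2))"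
      using y div_Suc_floor_powr[OF X1(1), of "1/2" y] B \<alpha> by (intro mult_left_mono add_mono) auto
    also have "\<dots> = K * real X powr (1/2)" by (simp add: K_def algebra_simps)
    finally have "\<alpha> * lfun (chi D) 1 * real X \<le> (\<Sum>n=1..X. dconv ?v (chi D) n) + K * real X powr (1/2)" by linarith
    also have "(\<Sum>n=1..X. dconv ?v (chi D) n) = (\<Sum>n=1..X. if coprime n (2 * D) then one_conv (chi D) n else 0)"
      unfolding q_def by (intro sum.cong dconv_coprime_indicator_chi) auto
    also have "\<dots> = (\<Sum>n\<in>{m \<in> {1..X}. coprime m (2 * D)}. one_conv (chi D) n)"
      by (rule sum.inter_filter[symmetric]) simp
    also have "\<dots> \<le> (\<Sum>n\<in>{m \<in> {1..X}. coprime m (2 * D)}. real (norm_count (int D) n))"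
      by (intro sum_mono one_conv_le_norm_count) auto
    also have "\<dots> \<le> c * real X" using c[OF X1(2)] by simp
    finally have "(\<alpha> * lfun (chi D) 1 - c) * real X \<le> K * real X powr (1/2)" by (simp add: algebra_simps)
    also have "real X powr (1/2) = real X powr (-1/2) * real X"
      using X1 powr_add[of "real X" "-1/2" 1] by simp
    finally have "(\<alpha> * lfun (chi D) 1 - c) * real X \<le> (K * real X powr (-1/2)) * real X" by (simp add: mult.assoc)
    then show ?thesis by (rule mult_right_le_imp_le) (use X1 in simp)
  qed
  have "(\<lambda>X. K * real X powr (-1/2)) \<longlonglongrightarrow> K * 0"
    by (intro tendsto_intros tendsto_neg_powr filterlim_real_sequentially) auto
  then have "\<alpha> * lfun (chi D) 1 - c \<le> K * 0"
    using low by (intro LIMSEQ_le_const) blast+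
  then have "\<alpha> * lfun (chi D) 1 \<le> c" by simp
  moreover have "1 / (2 * ln (2 * real D) + 1) * lfun (chi D) 1 \<le> \<alpha> * lfun (chi D) 1"
    using totient_ratio_ge[of q] q L unfolding \<alpha>_def q_def by (intro mult_right_mono) auto
  ultimately show ?thesis by simp
qed

section \<open>The arithmetic of the quadratic field\<close>

locale quad_disc =
  fixes D :: nat
  assumes pos: "D > 0" and nonsquare: "\<not> is_square D" and mod4: "D mod 4 = 0 \<or> D mod 4 = 1"
begin

definition s :: real where "s = sqrt (real D)"

lemma s_pos: "0 < s" using pos by (simp add: s_def)

lemma s_sq: "s * s = real D" by (simp add: s_def)

lemma s_sq2: "s\<^sup>2 = real D" by (simp add: s_def)

lemma s_irrational: "s \<notin> \<rat>"
proof
  assume "s \<in> \<rat>"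
  then obtain m n :: nat where mn: "n \<noteq> 0" "\<bar>s\<bar> = real m / real n" by (rule Rats_abs_nat_div_natE)
  have "s * s = (real m / real n) * (real m / real n)" using mn(2) s_pos by simp
  then have "real D * (real n * real n) = real m * real m" using mn(1) s_sq by (simp add: field_simps)
  then have "D * n\<^sup>2 = m\<^sup>2" by (simp add: power2_eq_square flip: of_nat_mult)
  then have "is_square (D * n\<^sup>2)" by simp
  moreover have "is_square (n\<^sup>2)" by simp
  ultimately have "is_square D" using mn(1) is_nth_power_mult_cancel_right[of 2 "n\<^sup>2" D] by simp
  then show False using nonsquare by simp
qed

lemma rat_coords_unique:
  assumes "x \<in> \<rat>" "y \<in> \<rat>" "x' \<in> \<rat>" "y' \<in> \<rat>" "x + y * s = x' + y' * s"
  shows "x = x' \<and> y = y'"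
proof (cases "y = y'")
  case False
  have "s = (x' - x) / (y - y')" using assms(5) False by (simp add: field_simps)
  moreover have "(x' - x) / (y - y') \<in> \<rat>" using assms by auto
  ultimately show ?thesis using s_irrational by simp
qed (use assms in auto)

text \<open>The quadratic field inside the reals. Arithmetic and inequalities are done here; the
  complex sets of the statement are images under \<open>complex_of_real\<close>.\<close>

definition KR :: "real set" where "KR = {x + y * s | x y. x \<in> \<rat> \<and> y \<in> \<rat>}"

lemma KRI: "x \<in> \<rat> \<Longrightarrow> y \<in> \<rat> \<Longrightarrow> x + y * s \<in> KR"
  by (auto simp: KR_def)

lemma KRE:
  assumes "z \<in> KR"
  obtains x y where "x \<in> \<rat>" "y \<in> \<rat>" "z = x + y * s"
  using assms by (auto simp: KR_def)

text \<open>The nontrivial automorphism of the field, read off from the unique rational coordinates;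
  it has meaning on \<open>KR\<close> alone.\<close>

definition cj :: "real \<Rightarrow> real" where
  "cj z = (THE c. \<exists>x y. x \<in> \<rat> \<and> y \<in> \<rat> \<and> z = x + y * s \<and> c = x - y * s)"

lemma cj_eq:
  assumes "x \<in> \<rat>" "y \<in> \<rat>"
  shows "cj (x + y * s) = x - y * s"
  unfolding cj_def
proof (rule the_equality)
  fix c assume "\<exists>x' y'. x' \<in> \<rat> \<and> y' \<in> \<rat> \<and> x + y * s = x' + y' * s \<and> c = x' - y' * s"
  then obtain x' y' where "x' \<in> \<rat>" "y' \<in> \<rat>" "x + y * s = x' + y' * s" "c = x' - y' * s" by blast
  then show "c = x - y * s" using rat_coords_unique[OF assms] by blast
qed (use assms in blast)

lemma mult_coords: "(x + y * s) * (x' + y' * s) = (x * x' + y * y' * real D) + (x * y' + y * x') * s"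
proof -
  have "(x + y * s) * (x' + y' * s) = (x * x' + y * y' * (s * s)) + (x * y' + y * x') * s" by (simp add: algebra_simps)
  then show ?thesis by (simp only: s_sq)
qed

lemma KR_mult: "z \<in> KR \<Longrightarrow> z' \<in> KR \<Longrightarrow> z * z' \<in> KR"
  by (elim KRE) (auto simp: mult_coords intro!: KRI)

lemma KR_add: "z \<in> KR \<Longrightarrow> z' \<in> KR \<Longrightarrow> z + z' \<in> KR"
proof (elim KRE)
  fix x y x' y' assume h: "x \<in> \<rat>" "y \<in> \<rat>" "x' \<in> \<rat>" "y' \<in> \<rat>" "z = x + y * s" "z' = x' + y' * s"
  have "z + z' = (x + x') + (y + y') * s" unfolding h by (simp add: algebra_simps)
  then show ?thesis using KRI[OF Rats_add[OF h(1,3)] Rats_add[OF h(2,4)]] by (simp only:)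
qed

lemma KR_rat: "r \<in> \<rat> \<Longrightarrow> r \<in> KR"
  using KRI[of r 0] by simp

lemma cj_mult: "z \<in> KR \<Longrightarrow> z' \<in> KR \<Longrightarrow> cj (z * z') = cj z * cj z'"
proof (elim KRE)
  fix x y x' y' assume h: "x \<in> \<rat>" "y \<in> \<rat>" "x' \<in> \<rat>" "y' \<in> \<rat>" "z = x + y * s" "z' = x' + y' * s"
  have "cj (z * z') = (x * x' + y * y' * real D) - (x * y' + y * x') * s"
    unfolding h mult_coords by (rule cj_eq) (use h in auto)
  also have "\<dots> = (x + (- y) * s) * (x' + (- y') * s)" unfolding mult_coords by (simp add: algebra_simps)
  finally show ?thesis using h by (simp add: cj_eq)
qed

lemma cj_add: "z \<in> KR \<Longrightarrow> z' \<in> KR \<Longrightarrow> cj (z + z') = cj z + cj z'"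
proof (elim KRE)
  fix x y x' y' assume h: "x \<in> \<rat>" "y \<in> \<rat>" "x' \<in> \<rat>" "y' \<in> \<rat>" "z = x + y * s" "z' = x' + y' * s"
  have "z + z' = (x + x') + (y + y') * s" unfolding h by (simp add: algebra_simps)
  then have "cj (z + z') = (x + x') - (y + y') * s"
    using cj_eq[OF Rats_add[OF h(1,3)] Rats_add[OF h(2,4)]] by (simp only:)
  then show ?thesis using h by (simp add: cj_eq algebra_simps)
qed

lemma cj_rat: "r \<in> \<rat> \<Longrightarrow> cj r = r"
  using cj_eq[of r 0] by simp

lemma cj_KR: "z \<in> KR \<Longrightarrow> cj z \<in> KR"
  by (elim KRE) (auto simp: cj_eq KRI[of _ "- _", simplified])

lemma cj_cj: "z \<in> KR \<Longrightarrow> cj (cj z) = z"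
proof (elim KRE)
  fix x y assume h: "x \<in> \<rat>" "y \<in> \<rat>" "z = x + y * s"
  then have "cj z = x + (- y) * s" by (simp add: cj_eq)
  then show ?thesis using h cj_eq[of x "- y"] by simp
qed

lemma cj_nonzero: "z \<in> KR \<Longrightarrow> z \<noteq> 0 \<Longrightarrow> cj z \<noteq> 0"
  using cj_cj[of z] cj_rat[of 0] by auto

definition nrm :: "real \<Rightarrow> real" where "nrm z = z * cj z"

lemma nrm_eq: "x \<in> \<rat> \<Longrightarrow> y \<in> \<rat> \<Longrightarrow> nrm (x + y * s) = x\<^sup>2 - real D * y\<^sup>2"
proof -
  assume h: "x \<in> \<rat>" "y \<in> \<rat>"
  have "nrm (x + y * s) = (x + y * s) * (x + (- y) * s)" using h by (simp add: nrm_def cj_eq)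
  also have "\<dots> = x\<^sup>2 - real D * y\<^sup>2" unfolding mult_coords by (simp add: power2_eq_square)
  finally show ?thesis .
qed

lemma nrm_mult: "z \<in> KR \<Longrightarrow> z' \<in> KR \<Longrightarrow> nrm (z * z') = nrm z * nrm z'"
  by (simp add: nrm_def cj_mult)

lemma nrm_nonzero: "z \<in> KR \<Longrightarrow> z \<noteq> 0 \<Longrightarrow> nrm z \<noteq> 0"
  by (simp add: nrm_def cj_nonzero)

lemma nrm_rat: "z \<in> KR \<Longrightarrow> nrm z \<in> \<rat>"
  by (elim KRE) (simp add: nrm_eq)

lemma KR_inverse: "z \<in> KR \<Longrightarrow> 1 / z \<in> KR"
proof (cases "z = 0")
  case False
  assume z: "z \<in> KR"
  have "1 / z = (1 / nrm z) * cj z" using False cj_nonzero[OF z False] by (simp add: nrm_def)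
  moreover have "1 / nrm z \<in> \<rat>" using nrm_rat[OF z] by simp
  then have "(1 / nrm z) * cj z \<in> KR" by (intro KR_mult KR_rat cj_KR[OF z])
  ultimately show ?thesis by (simp only:)
qed simp

lemma KR_divide: "z \<in> KR \<Longrightarrow> z' \<in> KR \<Longrightarrow> z / z' \<in> KR"
  using KR_mult[OF _ KR_inverse, of z z'] by simp

definition w :: real where "w = (real D + s) / 2"

lemma w_eq: "w = real D / 2 + (1 / 2) * s" by (simp add: w_def add_divide_distrib)

definition OR :: "real set" where "OR = {of_int m + of_int n * w | m n. True}"

lemma ORI: "of_int m + of_int n * w \<in> OR" by (auto simp: OR_def)

lemma ORE:
  assumes "z \<in> OR"
  obtains m n where "z = of_int m + of_int n * w"
  using assms by (auto simp: OR_def)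

lemma D_int: obtains c :: int where "int D * int D - int D = 4 * c"
proof -
  have "4 dvd int D * int D - int D"
  proof (cases "D mod 4 = 0")
    case True
    then have "4 dvd int D" by presburger
    then show ?thesis by simp
  next
    case False
    then have "int D mod 4 = 1" using mod4 by presburger
    then have "4 dvd int D - 1" by presburger
    then have "4 dvd int D * (int D - 1)" by simp
    then show ?thesis by (simp add: algebra_simps)
  qed
  then show ?thesis using that by blast
qed

lemma w_sq: obtains c :: int where "w * w = real D * w - of_int c"
proof -
  obtain c where c: "int D * int D - int D = 4 * c" by (rule D_int)
  have "real_of_int (int D * int D - int D) = real_of_int (4 * c)" by (simp only: c)
  then have "real D * real D - real D = 4 * of_int c" by simp
  moreover have "w * w = real D * w - (real D * real D - s * s) / 4" by (simp add: w_def field_simps)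
  ultimately have "w * w = real D * w - of_int c" unfolding s_sq by simp
  then show ?thesis using that by blast
qed

lemma OR_mult: "z \<in> OR \<Longrightarrow> z' \<in> OR \<Longrightarrow> z * z' \<in> OR"
proof (elim ORE)
  fix m n m' n' assume z: "z = of_int m + of_int n * w" "z' = of_int m' + of_int n' * w"
  obtain c where c: "w * w = real D * w - of_int c" by (rule w_sq)
  have "z * z' = of_int m * of_int m' + (of_int m * of_int n' + of_int n * of_int m') * w + of_int n * of_int n' * (w * w)"
    unfolding z by (simp add: algebra_simps)
  also have "\<dots> = of_int (m * m' - n * n' * c) + of_int (m * n' + n * m' + n * n' * int D) * w"
    unfolding c by (simp add: algebra_simps)
  finally show ?thesis using ORI by metis
qed

lemma OR_add: "z \<in> OR \<Longrightarrow> z' \<in> OR \<Longrightarrow> z + z' \<in> OR"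
proof (elim ORE)
  fix m n m' n' assume z: "z = of_int m + of_int n * w" "z' = of_int m' + of_int n' * w"
  have "z + z' = of_int (m + m') + of_int (n + n') * w" unfolding z by (simp add: algebra_simps)
  then show ?thesis using ORI by metis
qed

lemma OR_int: "of_int m \<in> OR" using ORI[of m 0] by simp

lemma OR_w: "w \<in> OR" using ORI[of 0 1] by simp

lemma OR_subset_KR: "z \<in> OR \<Longrightarrow> z \<in> KR"
proof (elim ORE)
  fix m n assume "z = of_int m + of_int n * w"
  then have "z = (of_int m + of_int n * real D / 2) + (of_int n / 2) * s" unfolding w_eq by (simp add: algebra_simps)
  then show ?thesis using KRI by (metis Rats_add Rats_divide Rats_mult Rats_number_of Rats_of_int Rats_of_nat)
qed

lemma cj_w: "cj w = real D - w"
proof -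
  have "cj w = real D / 2 - (1 / 2) * s" unfolding w_eq by (rule cj_eq) auto
  then show ?thesis by (simp add: w_def field_simps)
qed

lemma cj_OR: "z \<in> OR \<Longrightarrow> cj z \<in> OR"
proof (elim ORE)
  fix m n assume z: "z = of_int m + of_int n * w"
  have wK: "w \<in> KR" by (rule OR_subset_KR[OF OR_w])
  have "cj z = of_int m + of_int n * (real D - w)"
    unfolding z by (simp add: cj_add cj_mult KR_mult KR_rat wK cj_rat cj_w)
  also have "\<dots> = of_int (m + n * int D) + of_int (- n) * w" by (simp add: algebra_simps)
  finally show ?thesis using ORI by metis
qed

lemma OR_rat_int: "z \<in> OR \<Longrightarrow> z \<in> \<rat> \<Longrightarrow> \<exists>m. z = of_int m"
proof (elim ORE)
  fix m n assume "z \<in> \<rat>" and z: "z = of_int m + of_int n * w"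
  have "z + 0 * s = (of_int m + of_int n * real D / 2) + (of_int n / 2) * s" unfolding z w_eq by (simp add: algebra_simps)
  then have "0 = (of_int n / 2 :: real)" 
    using \<open>z \<in> \<rat>\<close> rat_coords_unique[of z 0 "of_int m + of_int n * real D / 2" "of_int n / 2"] by simp
  then show ?thesis using z by auto
qed

lemma nrm_OR: "z \<in> OR \<Longrightarrow> \<exists>m. nrm z = of_int m"
  using OR_rat_int[of "nrm z"] OR_mult[OF _ cj_OR, of z z] nrm_rat[OF OR_subset_KR] by (simp add: nrm_def)

section \<open>Identification with the order and its quotient field inside the complex
  numbers\<close>

lemma csqrt_D: "csqrt (of_int (int D)) = complex_of_real s"
proof -
  have "(of_int (int D) :: complex) = complex_of_real (real D)" by simp
  then show ?thesis using csqrt_of_real_nonneg[of "complex_of_real (real D)"] by (simp add: s_def)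
qed

lemma generator_eq: "quadratic_generator (int D) = complex_of_real w"
  unfolding quadratic_generator_def csqrt_D by (simp add: w_def)

lemma quadratic_order_eq: "quadratic_order (int D) = complex_of_real ` OR"
proof
  show "complex_of_real ` OR \<subseteq> quadratic_order (int D)"
  proof
    fix z assume "z \<in> complex_of_real ` OR"
    then obtain m n where z: "z = complex_of_real (of_int m + of_int n * w)" by (auto simp: OR_def)
    have "z = poly (map_poly of_int [:m, n:]) (quadratic_generator (int D))"
      unfolding z generator_eq by (simp add: map_poly_pCons mult.commute)
    then show "z \<in> quadratic_order (int D)" unfolding quadratic_order_def by blast
  qed
  show "quadratic_order (int D) \<subseteq> complex_of_real ` OR"
  proof
    fix z assume "z \<in> quadratic_order (int D)"
    then obtain p :: "int poly" where z: "z = poly (map_poly of_int p) (complex_of_real w)"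
      unfolding quadratic_order_def generator_eq by blast
    have "poly (map_poly of_int p) (complex_of_real w) \<in> complex_of_real ` OR"
    proof (induction p)
      case 0
      then show ?case using OR_int[of 0] by simp
    next
      case (pCons a p)
      then obtain u where u: "u \<in> OR" "poly (map_poly of_int p) (complex_of_real w) = complex_of_real u" by blast
      have "poly (map_poly of_int (pCons a p)) (complex_of_real w) = complex_of_real (of_int a + w * u)"
        using u by (simp add: map_poly_pCons)
      moreover have "of_int a + w * u \<in> OR" by (intro OR_add OR_mult OR_int OR_w u)
      ultimately show ?case by blast
    qed
    then show "z \<in> complex_of_real ` OR" by (simp add: z)
  qed
qed

lemma quotient_field_eq: "quotient_field (quadratic_order (int D)) = complex_of_real ` KR"
proof
  show "quotient_field (quadratic_order (int D)) \<subseteq> complex_of_real ` KR"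
  proof
    fix z assume "z \<in> quotient_field (quadratic_order (int D))"
    then obtain a b where "a \<in> OR" "b \<in> OR" "z = complex_of_real (a / b)"
      unfolding quotient_field_def quadratic_order_eq by auto
    then show "z \<in> complex_of_real ` KR" using KR_divide[OF OR_subset_KR OR_subset_KR] by blast
  qed
  show "complex_of_real ` KR \<subseteq> quotient_field (quadratic_order (int D))"
  proof
    fix z assume "z \<in> complex_of_real ` KR"
    then obtain x y where xy: "x \<in> \<rat>" "y \<in> \<rat>" "z = complex_of_real (x + y * s)" by (auto simp: KR_def)
    obtain a b c d :: int where ab: "b > 0" "x = of_int a / of_int b" "d > 0" "y = of_int c / of_int d"
      using Rats_cases'[OF xy(1)] Rats_cases'[OF xy(2)] by metis
    have "x + y * s = (of_int (a * d - c * b * int D) + of_int (2 * c * b) * w) / of_int (b * d)"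
      using ab(1,3) unfolding ab(2,4) by (simp add: w_def field_simps)
    then have "z = complex_of_real (of_int (a * d - c * b * int D) + of_int (2 * c * b) * w) / complex_of_real (of_int (b * d))"
      unfolding xy(3) by (simp only: of_real_divide)
    moreover have "complex_of_real (of_int (b * d)) \<noteq> 0" using ab by simp
    ultimately show "z \<in> quotient_field (quadratic_order (int D))"
      unfolding quotient_field_def quadratic_order_eq using ORI OR_int by blast
  qed
qed

end

section \<open>Normal form of fractional ideals and finiteness of the class group\<close>

lemma int_module: "Modules.module (\<lambda>(n :: int) (x :: 'a :: comm_ring_1). of_int n * x)"
  by unfold_locales (auto simp: algebra_simps)

lemma int_span_superset: "S \<subseteq> int_span S"
  unfolding int_span_def by (rule Modules.module.span_superset[OF int_module])

lemma int_span_minimal: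
  assumes "S \<subseteq> T" "0 \<in> T" "\<And>x y. x \<in> T \<Longrightarrow> y \<in> T \<Longrightarrow> x + y \<in> T"
    "\<And>n x. x \<in> T \<Longrightarrow> of_int n * x \<in> T"
  shows "int_span S \<subseteq> T"
  unfolding int_span_def using assms
  by (intro Modules.module.span_minimal[OF int_module]) (auto simp: Modules.module.subspace_def[OF int_module])

lemma int_span_closed:
  shows "0 \<in> int_span S" "x \<in> int_span S \<Longrightarrow> y \<in> int_span S \<Longrightarrow> x + y \<in> int_span S"
    "x \<in> int_span S \<Longrightarrow> of_int n * x \<in> int_span S"
  unfolding int_span_def
  by (auto intro: Modules.module.span_zero[OF int_module] Modules.module.span_add[OF int_module] Modules.module.span_scale[OF int_module])

context quad_disc
begin

abbreviation QO :: "complex set" where "QO \<equiv> quadratic_order (int D)"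

lemma QO_iff: "complex_of_real z \<in> QO \<longleftrightarrow> z \<in> OR"
  by (auto simp: quadratic_order_eq)

definition scaled :: "complex set \<Rightarrow> real \<Rightarrow> complex set" where
  "scaled I g = (\<lambda>z. complex_of_real g * z) ` I"

definition ideal_class :: "complex set \<Rightarrow> complex set set" where
  "ideal_class I = {scaled I g | g. g \<in> KR \<and> g \<noteq> 0}"

lemma fractional_idealD:
  assumes "fractional_ideal QO I"
  shows "I \<subseteq> complex_of_real ` KR" "0 \<in> I" "x \<in> I \<Longrightarrow> y \<in> I \<Longrightarrow> x + y \<in> I"
    "r \<in> OR \<Longrightarrow> x \<in> I \<Longrightarrow> complex_of_real r * x \<in> I"
    "\<exists>z\<in>KR. z \<noteq> 0 \<and> complex_of_real z \<in> I"
    "\<exists>d\<in>OR. d \<noteq> 0 \<and> (\<forall>x\<in>I. complex_of_real d * x \<in> QO)"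
proof -
  note f = assms[unfolded fractional_ideal_def quotient_field_eq]
  show "I \<subseteq> complex_of_real ` KR" "0 \<in> I" "x \<in> I \<Longrightarrow> y \<in> I \<Longrightarrow> x + y \<in> I" using f by auto
  show "r \<in> OR \<Longrightarrow> x \<in> I \<Longrightarrow> complex_of_real r * x \<in> I" using f by (auto simp: quadratic_order_eq)
  obtain z where z: "z \<in> I" "z \<noteq> 0" using f by auto
  then obtain x where "x \<in> KR" "z = complex_of_real x" using f by auto
  then show "\<exists>z\<in>KR. z \<noteq> 0 \<and> complex_of_real z \<in> I" using z by auto
  show "\<exists>d\<in>OR. d \<noteq> 0 \<and> (\<forall>x\<in>I. complex_of_real d * x \<in> QO)" using f by (auto simp: quadratic_order_eq)
qed

text \<open>The product of the principal ideal of g with I is g I, so a coset of the principal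
  ideals is the set of all field multiples of I. Counting the quotient group becomes counting ideals
  up to scaling.\<close>

lemma coset_eq_ideal_class:
  assumes I: "fractional_ideal QO I"
  shows "principal_ideals QO #>\<^bsub>ideal_group QO\<^esub> I = ideal_class I"
proof -
  note f = fractional_idealD[OF I]
  have int: "of_int n * x \<in> I" if "x \<in> I" for n x
    using f(4)[OF OR_int that] by simp
  have prod: "ideal_product ((\<lambda>r. complex_of_real g * r) ` QO) I = scaled I g" for g
  proof
    show "ideal_product ((\<lambda>r. complex_of_real g * r) ` QO) I \<subseteq> scaled I g"
      unfolding ideal_product_def
    proof (rule int_span_minimal)
      show "{x * y |x y. x \<in> (\<lambda>r. complex_of_real g * r) ` QO \<and> y \<in> I} \<subseteq> scaled I g"
        using f(4) by (auto simp: scaled_def quadratic_order_eq mult.assoc)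
      show "0 \<in> scaled I g" using f(2) unfolding scaled_def by force
      show "x + y \<in> scaled I g" if "x \<in> scaled I g" "y \<in> scaled I g" for x y
        using that f(3) unfolding scaled_def by (auto simp flip: distrib_left)
      show "of_int n * x \<in> scaled I g" if "x \<in> scaled I g" for n x
        using that int unfolding scaled_def by (auto simp: mult.left_commute)
    qed
    have "complex_of_real 1 \<in> QO" unfolding QO_iff using OR_int[of 1] by simp
    then have "complex_of_real g * y \<in> {x * y |x y. x \<in> (\<lambda>r. complex_of_real g * r) ` QO \<and> y \<in> I}" if "y \<in> I" for y
      using that by force
    then show "scaled I g \<subseteq> ideal_product ((\<lambda>r. complex_of_real g * r) ` QO) I"
      unfolding ideal_product_def scaled_def using int_span_superset by blast
  qed
  have "principal_ideals QO = {(\<lambda>r. complex_of_real g * r) ` QO | g. g \<in> KR \<and> g \<noteq> 0}"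
    unfolding principal_ideals_def quotient_field_eq by auto
  then show ?thesis
    unfolding r_coset_def ideal_class_def ideal_group_def using prod by auto
qed

lemma class_group_carrier:
  "carrier (class_group QO) = ideal_class ` {I. invertible_ideal QO I}"
proof -
  have "carrier (class_group QO) = (\<lambda>I. principal_ideals QO #>\<^bsub>ideal_group QO\<^esub> I) ` carrier (ideal_group QO)"
    by (auto simp: class_group_def FactGroup_def RCOSETS_def)
  also have "\<dots> = ideal_class ` {I. invertible_ideal QO I}"
    unfolding ideal_group_def partial_object.simps monoid.simps
    by (intro image_cong refl) (auto simp: invertible_ideal_def coset_eq_ideal_class simp flip: ideal_group_def)
  finally show ?thesis .
qed

lemma scaled_scaled: "scaled (scaled I g) h = scaled I (g * h)"
  unfolding scaled_def image_image by (simp add: mult.assoc mult.left_commute)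

lemma scaled_1: "scaled I 1 = I"
  by (simp add: scaled_def)

lemma ideal_class_self: "I \<in> ideal_class I"
proof -
  have "I = scaled I 1 \<and> 1 \<in> KR \<and> (1 :: real) \<noteq> 0" using KR_rat[of 1] by (simp add: scaled_1)
  then show ?thesis unfolding ideal_class_def by blast
qed

lemma ideal_class_scaled:
  assumes "g \<in> KR" "g \<noteq> 0"
  shows "ideal_class (scaled I g) = ideal_class I"
proof
  show "ideal_class (scaled I g) \<subseteq> ideal_class I"
    unfolding ideal_class_def scaled_scaled using assms KR_mult by fastforce
  show "ideal_class I \<subseteq> ideal_class (scaled I g)"
  proof
    fix J assume "J \<in> ideal_class I"
    then obtain h where h: "h \<in> KR" "h \<noteq> 0" "J = scaled I h" by (auto simp: ideal_class_def)
    have "J = scaled (scaled I g) (h / g)" using assms h by (simp add: scaled_scaled)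
    then show "J \<in> ideal_class (scaled I g)"
      unfolding ideal_class_def using KR_divide[OF h(1) assms(1)] h assms by force
  qed
qed

definition \<theta> :: "nat \<Rightarrow> int \<Rightarrow> real" where
  "\<theta> a b = (of_int b + s) / (2 * real a)"

definition ideal_lat :: "nat \<Rightarrow> int \<Rightarrow> complex set" where
  "ideal_lat a b = complex_of_real ` {of_int m + of_int n * \<theta> a b | m n. True}"

lemma \<theta>_coords: "\<theta> a b = of_int b / (2 * real a) + (1 / (2 * real a)) * s"
  by (simp add: \<theta>_def add_divide_distrib)

lemma \<theta>_KR: "\<theta> a b \<in> KR"
  unfolding \<theta>_coords by (rule KRI) auto

lemma \<theta>_shift: "a > 0 \<Longrightarrow> \<theta> a (b + 2 * int a * k) = \<theta> a b + of_int k"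
  by (simp add: \<theta>_def field_simps)

lemma ideal_lat_shift:
  assumes "a > 0"
  shows "ideal_lat a (b + 2 * int a * k) = ideal_lat a b"
proof -
  have "(\<exists>m' n'. of_int m + of_int n * \<theta> a (b + 2 * int a * k) = (of_int m' + of_int n' * \<theta> a b :: real))" for m n
    by (rule exI[of _ "m + n * k"], rule exI[of _ n]) (simp only: \<theta>_shift[OF assms], simp add: algebra_simps)
  moreover have "(\<exists>m' n'. of_int m + of_int n * \<theta> a b = (of_int m' + of_int n' * \<theta> a (b + 2 * int a * k) :: real))" for m n
    by (rule exI[of _ "m - n * k"], rule exI[of _ n]) (simp only: \<theta>_shift[OF assms], simp add: algebra_simps)
  ultimately have "{of_int m + of_int n * \<theta> a (b + 2 * int a * k) | m n. True} = {of_int m + of_int n * \<theta> a b | m n. True}"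
    by blast
  then show ?thesis by (simp add: ideal_lat_def)
qed

lemma floor_group_element:
  fixes Y :: "real set"
  assumes "\<And>x y. x \<in> Y \<Longrightarrow> y \<in> Y \<Longrightarrow> x + y \<in> Y" "\<And>x. x \<in> Y \<Longrightarrow> - x \<in> Y" "0 \<in> Y" "y1 \<in> Y" "y \<in> Y"
  shows "y - of_int k * y1 \<in> Y"
proof -
  have nat: "of_nat n * y1 \<in> Y" for n
  proof (induction n)
    case (Suc n)
    have "of_nat (Suc n) * y1 = of_nat n * y1 + y1" by (simp add: algebra_simps)
    then show ?case using assms(1)[OF Suc assms(4)] by (simp only:)
  qed (use assms in simp)
  have "of_int k * y1 \<in> Y"
  proof (cases "0 \<le> k")
    case True
    then show ?thesis using nat[of "nat k"] by simp
  next
    case False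
    then have "of_int k * y1 = - (of_nat (nat (- k)) * y1)" by simp
    then show ?thesis using assms(2)[OF nat] by (simp only:)
  qed
  then show ?thesis using assms(1)[OF assms(5) assms(2)] by fastforce
qed

text \<open>Dividing by an element of minimal norm gives an ideal that contains 1 as a primitive element
  of minimal norm.\<close>

lemma fractional_ideal_normal_form:
  assumes I: "fractional_ideal QO I"
  obtains g a b where "g \<in> KR" "g \<noteq> 0" "I = scaled (ideal_lat a b) g" "1 \<le> a" "2 * real a \<le> s" "b \<in> root_set (int D) a"
proof -
  note f = fractional_idealD[OF I]
  define IR where "IR = {z. complex_of_real z \<in> I}"
  have IR_KR: "z \<in> KR" if "z \<in> IR" for z using f(1) that by (auto simp: IR_def)
  have I_eq: "I = complex_of_real ` IR" using f(1) by (auto simp: IR_def)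
  have IR_add: "x + y \<in> IR" if "x \<in> IR" "y \<in> IR" for x y using f(3) that by (simp add: IR_def)
  have IR_mult: "r * x \<in> IR" if "r \<in> OR" "x \<in> IR" for r x using f(4)[OF that(1)] that(2) by (simp add: IR_def)
  obtain d where d: "d \<in> OR" "d \<noteq> 0" and "\<forall>x\<in>I. complex_of_real d * x \<in> QO" using f(6) by blast
  then have dIR: "d * x \<in> OR" if "x \<in> IR" for x using that by (auto simp: IR_def QO_iff simp flip: of_real_mult)
  have dK: "d \<in> KR" using OR_subset_KR d by blast
  \<comment> \<open>The common denominator \<open>d\<close> turns norms into integers, so a nonzero
    element of least absolute norm exists.\<close>
  define ht where "ht x = nat \<lfloor>\<bar>nrm (d * x)\<bar>\<rfloor>" for x
  have ht: "real (ht x) = \<bar>nrm d\<bar> * \<bar>nrm x\<bar>" if x: "x \<in> IR" for x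
  proof -
    obtain m where "nrm (d * x) = of_int m" using nrm_OR[OF dIR[OF x]] by blast
    then have "real (ht x) = \<bar>nrm (d * x)\<bar>" by (simp add: ht_def flip: of_int_abs)
    then show ?thesis using nrm_mult[OF dK IR_KR[OF x]] by (simp add: abs_mult)
  qed
  obtain u where "u \<noteq> 0 \<and> u \<in> IR" using f(5) by (auto simp: IR_def)
  then obtain v where v: "v \<noteq> 0" "v \<in> IR" and vmin: "\<And>x. x \<noteq> 0 \<Longrightarrow> x \<in> IR \<Longrightarrow> ht v \<le> ht x"
    using ex_has_least_nat[of "\<lambda>x. x \<noteq> 0 \<and> x \<in> IR" u ht] by blast
  have vK: "v \<in> KR" using IR_KR v by blast
  have nd: "0 < \<bar>nrm d\<bar>" using nrm_nonzero[OF dK d(2)] by simp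
  \<comment> \<open>The ideal divided by \<open>v\<close>. It contains the order, and each nonzero
    element has absolute norm at least 1.\<close>
  define Q where "Q = {z. z * v \<in> IR}"
  have Q_KR: "z \<in> KR" if "z \<in> Q" for z
  proof -
    have "z * v \<in> KR" using that IR_KR by (simp add: Q_def)
    then have "z * v / v \<in> KR" using vK by (rule KR_divide)
    then show ?thesis using v by simp
  qed
  have Q_add: "x + y \<in> Q" if "x \<in> Q" "y \<in> Q" for x y using that IR_add by (simp add: Q_def distrib_right)
  have Q_mult: "r * x \<in> Q" if "r \<in> OR" "x \<in> Q" for r x using that IR_mult by (simp add: Q_def mult.assoc)
  have Q_1: "1 \<in> Q" using v by (simp add: Q_def)
  have Q_OR: "r \<in> Q" if "r \<in> OR" for r using Q_mult[OF that Q_1] by simp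
  have Q_neg: "- x \<in> Q" if "x \<in> Q" for x using Q_mult[OF OR_int[of "-1"] that] by simp
  have Q_0: "0 \<in> Q" using Q_OR[OF OR_int[of 0]] by simp
  have Q_norm: "1 \<le> \<bar>nrm z\<bar>" if z: "z \<in> Q" "z \<noteq> 0" for z
  proof -
    have "ht v \<le> ht (z * v)" using z v by (intro vmin) (auto simp: Q_def)
    then have "real (ht v) \<le> real (ht (z * v))" by simp
    then have "\<bar>nrm d\<bar> * \<bar>nrm v\<bar> \<le> \<bar>nrm d\<bar> * \<bar>nrm (z * v)\<bar>" using ht v z by (simp add: Q_def)
    then have "\<bar>nrm v\<bar> \<le> \<bar>nrm z\<bar> * \<bar>nrm v\<bar>" using nd nrm_mult[OF Q_KR[OF z(1)] vK] by (simp add: abs_mult)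
    moreover have "0 < \<bar>nrm v\<bar>" using nrm_nonzero[OF vK v(1)] by simp
    ultimately show ?thesis by simp
  qed
  \<comment> \<open>The fractional part of a rational element lies in \<open>Q\<close> and has norm
    below 1, so it is 0.\<close>
  have Q_rat: "\<exists>m. r = of_int m" if r: "r \<in> Q" "r \<in> \<rat>" for r
  proof -
    define t where "t = r - of_int \<lfloor>r\<rfloor> * 1"
    have tQ: "t \<in> Q" unfolding t_def by (rule floor_group_element[OF Q_add Q_neg Q_0 Q_1 r(1)])
    have t01: "0 \<le> t" "t < 1" unfolding t_def by linarith+
    have "t \<in> \<rat>" unfolding t_def using r by auto
    then have "nrm t = t\<^sup>2" by (simp add: nrm_def cj_rat power2_eq_square)
    moreover have "t\<^sup>2 < 1" using t01 by (simp add: power_less_one_iff abs_square_less_1)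
    ultimately have "t = 0" using Q_norm[OF tQ] by fastforce
    then show ?thesis unfolding t_def by auto
  qed
  \<comment> \<open>The coordinates along \<open>s\<close> of elements of \<open>Q\<close>.
    Multiplication by \<open>n0\<close> carries \<open>Q\<close> into the order, so this group is
    discrete, and its least positive element \<open>y1\<close> provides the second basis
    vector.\<close>
  define Y where "Y = {y. y \<in> \<rat> \<and> (\<exists>x\<in>\<rat>. x + y * s \<in> Q)}"
  have Y_add: "x + y \<in> Y" if "x \<in> Y" "y \<in> Y" for x y
  proof -
    from that obtain x1 x2 where h: "x \<in> \<rat>" "y \<in> \<rat>" "x1 \<in> \<rat>" "x2 \<in> \<rat>" "x1 + x * s \<in> Q" "x2 + y * s \<in> Q" by (auto simp: Y_def)
    have "(x1 + x2) + (x + y) * s \<in> Q" using Q_add[OF h(5,6)] by (simp add: algebra_simps)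
    then show ?thesis using h by (auto simp: Y_def)
  qed
  have Y_neg: "- x \<in> Y" if "x \<in> Y" for x
  proof -
    from that obtain x1 where h: "x \<in> \<rat>" "x1 \<in> \<rat>" "x1 + x * s \<in> Q" by (auto simp: Y_def)
    have "(- x1) + (- x) * s \<in> Q" using Q_neg[OF h(3)] by simp
    moreover have "- x1 \<in> \<rat>" "- x \<in> \<rat>" using h by simp_all
    ultimately show ?thesis unfolding Y_def by blast
  qed
  have Y_half: "1 / 2 \<in> Y" using Q_OR[OF OR_w] unfolding w_eq Y_def by (auto intro!: bexI[of _ "real D / 2"])
  have Y_0: "0 \<in> Y" using Q_0 unfolding Y_def by (auto intro!: bexI[of _ 0])
  define n0 where "n0 = nrm (d * v)"
  have dvO: "d * v \<in> OR" using dIR v by blast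
  have n0: "n0 \<noteq> 0" unfolding n0_def using nrm_nonzero[OF OR_subset_KR[OF dvO]] d v by simp
  obtain n1 where n1: "n0 = of_int n1" using nrm_OR[OF dvO] unfolding n0_def by blast
  have Y_disc: "\<exists>k::int. 2 * n0 * y = of_int k" if y: "y \<in> Y" for y
  proof -
    obtain x where x: "y \<in> \<rat>" "x \<in> \<rat>" "x + y * s \<in> Q" using y by (auto simp: Y_def)
    have "d * ((x + y * s) * v) \<in> OR" using x dIR by (simp add: Q_def)
    then have "cj (d * v) * (d * ((x + y * s) * v)) \<in> OR" by (rule OR_mult[OF cj_OR[OF dvO]])
    also have "cj (d * v) * (d * ((x + y * s) * v)) = n0 * (x + y * s)" by (simp add: n0_def nrm_def)
    finally obtain p q where "n0 * (x + y * s) = of_int p + of_int q * w" by (rule ORE)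
    then have "n0 * x + (n0 * y) * s = (of_int p + of_int q * real D / 2) + (of_int q / 2) * s" unfolding w_eq by (simp add: algebra_simps)
    then have "n0 * y = of_int q / 2" using x n1 rat_coords_unique[of "n0 * x" "n0 * y" "of_int p + of_int q * real D / 2" "of_int q / 2"] by auto
    then show ?thesis by (intro exI[of _ q]) simp
  qed
  define hy where "hy y = nat \<lfloor>2 * \<bar>n0\<bar> * y\<rfloor>" for y
  have hy: "real (hy y) = 2 * \<bar>n0\<bar> * y" if y: "y \<in> Y" "0 < y" for y
  proof -
    obtain k where k: "2 * n0 * y = of_int k" using Y_disc[OF y(1)] by blast
    have "2 * \<bar>n0\<bar> * y = \<bar>2 * n0 * y\<bar>" using y by (simp add: abs_mult)
    then have "2 * \<bar>n0\<bar> * y = of_int \<bar>k\<bar>" using k by simp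
    then show ?thesis by (simp add: hy_def)
  qed
  have "\<exists>y1. (y1 \<in> Y \<and> 0 < y1) \<and> (\<forall>y. y \<in> Y \<and> 0 < y \<longrightarrow> hy y1 \<le> hy y)"
    using Y_half ex_has_least_nat[of "\<lambda>y. y \<in> Y \<and> 0 < y" "1/2" hy] by auto
  then obtain y1 where y1: "y1 \<in> Y" "0 < y1" and y1min: "\<And>y. y \<in> Y \<Longrightarrow> 0 < y \<Longrightarrow> hy y1 \<le> hy y" by blast
  have Y_mult: "\<exists>k::int. y = of_int k * y1" if y: "y \<in> Y" for y
  proof -
    define t where "t = y - of_int \<lfloor>y / y1\<rfloor> * y1"
    have tY: "t \<in> Y" unfolding t_def by (rule floor_group_element[OF Y_add Y_neg Y_0 y1(1) y])
    have t: "0 \<le> t" "t < y1"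
      using floor_divide_lower[OF y1(2), of y] floor_divide_upper[OF y1(2), of y]
      unfolding t_def by (simp_all add: algebra_simps)
    have "t = 0"
    proof (rule ccontr)
      assume "t \<noteq> 0"
      then have t0: "0 < t" using t by simp
      have "real (hy y1) \<le> real (hy t)" using y1min[OF tY t0] by simp
      then have "2 * \<bar>n0\<bar> * y1 \<le> 2 * \<bar>n0\<bar> * t" using hy[OF y1] hy[OF tY t0] by simp
      then show False using t n0 by simp
    qed
    then show ?thesis unfolding t_def by auto
  qed
  \<comment> \<open>As \<open>w\<close> lies in \<open>Q\<close>, its coordinate 1/2 is a multiple
    of \<open>y1\<close>, which is therefore 1 / (2 a) for a natural number a.\<close>
  obtain a0 where a0: "1 / 2 = of_int a0 * y1" using Y_mult[OF Y_half] by blast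
  then have "0 < of_int a0 * y1" by simp
  then have "0 < a0" using y1 by (simp add: zero_less_mult_iff)
  then obtain a where a: "a0 = int a" "1 \<le> a" by (metis zero_less_imp_eq_int Suc_leI One_nat_def)
  have y1_eq: "y1 = 1 / (2 * real a)" using a0 a by (simp add: field_simps)
  obtain x1 where x1: "x1 \<in> \<rat>" "x1 + y1 * s \<in> Q" using y1 by (auto simp: Y_def)
  have "w - of_int (int a) * (x1 + y1 * s) \<in> Q" by (rule floor_group_element[OF Q_add Q_neg Q_0 x1(2) Q_OR[OF OR_w]])
  moreover have e1: "w - of_int (int a) * (x1 + y1 * s) = real D / 2 - real a * x1"
    using a unfolding y1_eq w_def by (simp add: field_simps)
  ultimately obtain k where k: "real D / 2 - real a * x1 = of_int k" using Q_rat[of "real D / 2 - real a * x1"] x1 by auto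
  define b where "b = int D - 2 * k"
  have x1_eq: "x1 = of_int b / (2 * real a)" using k a by (simp add: b_def field_simps)
  have th: "x1 + y1 * s = \<theta> a b" unfolding x1_eq y1_eq \<theta>_coords ..
  have thQ: "\<theta> a b \<in> Q" using x1 th by simp
  have Q_eq: "Q = {of_int m + of_int n * \<theta> a b | m n. True}"
  proof
    show "{of_int m + of_int n * \<theta> a b | m n. True} \<subseteq> Q"
      using Q_add[OF Q_OR[OF OR_int] Q_mult[OF OR_int thQ]] by blast
    show "Q \<subseteq> {of_int m + of_int n * \<theta> a b | m n. True}"
    proof
      fix z assume z: "z \<in> Q"
      obtain x y where xy: "x \<in> \<rat>" "y \<in> \<rat>" "z = x + y * s" using Q_KR[OF z] by (rule KRE)
      then have "y \<in> Y" using z by (auto simp: Y_def)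
      then obtain n where n: "y = of_int n * y1" using Y_mult by blast
      have "z - of_int n * \<theta> a b \<in> Q" by (rule floor_group_element[OF Q_add Q_neg Q_0 thQ z])
      moreover have "z - of_int n * \<theta> a b = x - of_int n * x1" unfolding xy n th[symmetric] by (simp add: algebra_simps)
      moreover have "x - of_int n * x1 \<in> \<rat>" using xy x1 by simp
      ultimately obtain m where "z - of_int n * \<theta> a b = of_int m" using Q_rat by metis
      then have "z = of_int m + of_int n * \<theta> a b" by simp
      then show "z \<in> {of_int m + of_int n * \<theta> a b | m n. True}" by blast
    qed
  qed
  \<comment> \<open>\<open>w\<close> times the second basis vector stays in \<open>Q\<close>;
    subtracting a suitable integral multiple of that vector leaves the rational number (D - b^2) /
    (4 a), which is then an integer.\<close>
  have dvd: "4 * int a dvd b\<^sup>2 - int D"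
  proof -
    have "w * \<theta> a b - of_int (int D - k) * \<theta> a b \<in> Q"
      by (rule floor_group_element[OF Q_add Q_neg Q_0 thQ Q_mult[OF OR_w thQ]])
    moreover have "w * \<theta> a b - of_int (int D - k) * \<theta> a b = (real D - (of_int b)\<^sup>2) / (4 * real a)"
    proof -
      have "w - of_int (int D - k) = (s - of_int b) / 2" by (simp add: w_def b_def field_simps)
      then have "w * \<theta> a b - of_int (int D - k) * \<theta> a b = (s - of_int b) / 2 * \<theta> a b"
        by (simp only: left_diff_distrib[symmetric])
      also have "\<dots> = (s\<^sup>2 - (of_int b)\<^sup>2) / (4 * real a)" by (simp add: \<theta>_def power2_eq_square algebra_simps)
      finally show ?thesis by (simp add: s_sq2)
    qed
    ultimately have "(real D - (of_int b)\<^sup>2) / (4 * real a) \<in> Q" by simp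
    then obtain c where "(real D - (of_int b)\<^sup>2) / (4 * real a) = of_int c"
      using Q_rat[of "(real D - (of_int b)\<^sup>2) / (4 * real a)"] by auto
    then have "real D - (of_int b)\<^sup>2 = of_int c * (4 * real a)" using a by (simp add: field_simps)
    then have "real_of_int (int D - b\<^sup>2) = real_of_int (c * (4 * int a))" by simp
    then have "int D - b\<^sup>2 = c * (4 * int a)" by (simp only: of_int_eq_iff)
    then have "b\<^sup>2 - int D = (4 * int a) * (- c)" by (simp add: algebra_simps)
    then show ?thesis by simp
  qed
  \<comment> \<open>Shift b by a multiple of 2 a so that |b'| \<le> a. The second basis vector has
    absolute norm at least 1, that is, 4 a^2 \<le> |b'^2 - D|; as b'^2 \<le> a^2, this forces 4 a^2
    \<le> D.\<close>
  have bound: "2 * real a \<le> s"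
  proof -
    define n where "n = (b + int a) div (2 * int a)"
    define b' where "b' = b - 2 * int a * n"
    have b': "\<bar>b'\<bar> \<le> int a"
    proof -
      have "b' + int a = (b + int a) mod (2 * int a)" unfolding b'_def n_def by (simp add: minus_mult_div_eq_mod[symmetric])
      moreover have "0 \<le> (b + int a) mod (2 * int a)" "(b + int a) mod (2 * int a) < 2 * int a" using a by simp_all
      ultimately show ?thesis by linarith
    qed
    have "\<theta> a b' = \<theta> a b + of_int (- n)" using \<theta>_shift[of a b "- n"] a by (simp add: b'_def)
    then have "\<theta> a b' \<in> Q" using Q_add[OF thQ Q_OR[OF OR_int[of "- n"]]] by simp
    moreover have nr: "nrm (\<theta> a b') = ((of_int b')\<^sup>2 - real D) / (4 * (real a)\<^sup>2)"
    proof -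
      have "nrm (\<theta> a b') = (of_int b' / (2 * real a))\<^sup>2 - real D * (1 / (2 * real a))\<^sup>2"
        unfolding \<theta>_coords by (rule nrm_eq) auto
      then show ?thesis by (simp add: power2_eq_square diff_divide_distrib)
    qed
    moreover have "\<theta> a b' \<noteq> 0"
    proof
      assume "\<theta> a b' = 0"
      then have "s = - of_int b'" using a by (simp add: \<theta>_def)
      then show False using s_irrational by simp
    qed
    ultimately have "1 \<le> \<bar>(of_int b')\<^sup>2 - real D\<bar> / (4 * (real a)\<^sup>2)" using Q_norm[of "\<theta> a b'"] by (simp add: abs_divide)
    then have ge: "4 * (real a)\<^sup>2 \<le> \<bar>(of_int b')\<^sup>2 - real D\<bar>" using a by (simp add: pos_le_divide_eq)
    have "(real_of_int b')\<^sup>2 \<le> (real a)\<^sup>2"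
    proof (rule abs_le_square_iff[THEN iffD1])
      have "real_of_int \<bar>b'\<bar> \<le> real_of_int (int a)" using b' by (simp only: of_int_le_iff)
      then show "\<bar>real_of_int b'\<bar> \<le> \<bar>real a\<bar>" by simp
    qed
    moreover have "0 < (real a)\<^sup>2" "0 \<le> (real_of_int b')\<^sup>2" using a by simp_all
    ultimately have "4 * (real a)\<^sup>2 \<le> real D" using ge by linarith
    then have "(2 * real a)\<^sup>2 \<le> s\<^sup>2" by (simp add: s_sq2 power_mult_distrib)
    then show ?thesis by (rule power2_le_imp_le) (use s_pos in simp)
  qed
  define b2 where "b2 = b mod (2 * int a)"
  obtain m where m: "b = b2 + 2 * int a * m" unfolding b2_def by (metis mod_mult_div_eq)
  have "b2 \<in> root_set (int D) a"
  proof -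
    have "b\<^sup>2 - int D = (b2\<^sup>2 - int D) + 4 * int a * (b2 * m + int a * m\<^sup>2)"
      unfolding m by (simp add: power2_eq_square algebra_simps)
    then have "4 * int a dvd b2\<^sup>2 - int D" using dvd by (metis dvd_add_left_iff dvd_triv_left)
    then show ?thesis using a by (simp add: root_set_def b2_def)
  qed
  moreover have "I = scaled (ideal_lat a b2) v"
  proof -
    have "ideal_lat a b2 = ideal_lat a b" using ideal_lat_shift[of a b2 m] m a by simp
    also have "\<dots> = complex_of_real ` Q" by (simp add: ideal_lat_def Q_eq)
    finally have "scaled (ideal_lat a b2) v = complex_of_real ` ((\<lambda>z. v * z) ` Q)" by (simp add: scaled_def image_image)
    also have "(\<lambda>z. v * z) ` Q = IR"
    proof
      show "(\<lambda>z. v * z) ` Q \<subseteq> IR" by (auto simp: Q_def mult.commute)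
      show "IR \<subseteq> (\<lambda>z. v * z) ` Q"
      proof
        fix z assume "z \<in> IR"
        then have "z / v \<in> Q" using v by (simp add: Q_def)
        then show "z \<in> (\<lambda>z. v * z) ` Q" using v by (intro image_eqI[of _ _ "z / v"]) auto
      qed
    qed
    finally show ?thesis by (simp add: I_eq)
  qed
  ultimately show ?thesis using that vK v(1) a(2) bound by blast
qed

theorem class_group_finite_card_le:
  defines "Y \<equiv> nat \<lfloor>s / 2\<rfloor>"
  shows "finite (carrier (class_group QO))" "card (carrier (class_group QO)) \<le> (\<Sum>a=1..Y. card (root_set (int D) a))"
proof -
  define P where "P = (SIGMA a:{1..Y}. root_set (int D) a)"
  have finP: "finite P" by (simp add: P_def)
  have sub: "carrier (class_group QO) \<subseteq> (\<lambda>(a, b). ideal_class (ideal_lat a b)) ` P"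
  proof
    fix c assume "c \<in> carrier (class_group QO)"
    then obtain I where I: "invertible_ideal QO I" "c = ideal_class I" unfolding class_group_carrier by blast
    then have "fractional_ideal QO I" by (simp add: invertible_ideal_def)
    then obtain g a b where g: "g \<in> KR" "g \<noteq> 0" "I = scaled (ideal_lat a b) g" "1 \<le> a" "2 * real a \<le> s" "b \<in> root_set (int D) a"
      by (rule fractional_ideal_normal_form)
    have "a \<le> Y" using g(5) unfolding Y_def by (simp add: le_nat_iff le_floor_iff)
    then have "(a, b) \<in> P" using g by (simp add: P_def)
    moreover have "c = ideal_class (ideal_lat a b)" using I(2) g ideal_class_scaled by simp
    ultimately show "c \<in> (\<lambda>(a, b). ideal_class (ideal_lat a b)) ` P" by force
  qed
  show "finite (carrier (class_group QO))" by (rule finite_surj[OF finP sub])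
  have "card (carrier (class_group QO)) \<le> card ((\<lambda>(a, b). ideal_class (ideal_lat a b)) ` P)"
    using finP by (intro card_mono sub) auto
  also have "\<dots> \<le> card P" by (rule card_image_le[OF finP])
  also have "\<dots> = (\<Sum>a=1..Y. card (root_set (int D) a))" unfolding P_def by simp
  finally show "card (carrier (class_group QO)) \<le> (\<Sum>a=1..Y. card (root_set (int D) a))" .
qed

end

section \<open>A lower bound for the class number\<close>

context quad_disc
begin

lemma root_parity:
  assumes "4 * int a dvd b\<^sup>2 - int D"
  obtains k where "int D - b = 2 * k"
proof -
  have "2 dvd b\<^sup>2 - int D" using assms by (metis dvd_mult_left dvd_trans even_numeral)
  then have "even (int D - b)" by simp
  then show ?thesis using that by blast
qed

lemma a_\<theta>: "a > 0 \<Longrightarrow> real a * \<theta> a b = (of_int b + s) / 2"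
  by (simp add: \<theta>_def)

lemma w_eq_\<theta>:
  assumes "a > 0" "int D - b = 2 * k"
  shows "w = real a * \<theta> a b + of_int k"
proof -
  have "real_of_int (int D - b) = real_of_int (2 * k)" by (simp only: assms(2))
  then have "real D - of_int b = 2 * of_int k" by simp
  then show ?thesis unfolding a_\<theta>[OF assms(1)] by (simp add: w_def field_simps)
qed

lemma w_mult_\<theta>:
  assumes "a > 0" "int D - b = 2 * k" "b\<^sup>2 - int D = 4 * int a * c"
  shows "w * \<theta> a b = of_int (b + k) * \<theta> a b - of_int c"
proof -
  have "real_of_int (int D - b) = real_of_int (2 * k)" by (simp only: assms(2))
  then have k: "real D = of_int b + 2 * of_int k" by simp
  have "real_of_int (b\<^sup>2 - int D) = real_of_int (4 * int a * c)" by (simp only: assms(3))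
  then have c: "(of_int b)\<^sup>2 - s\<^sup>2 = 4 * real a * of_int c" by (simp add: s_sq2)
  have "w - of_int (b + k) = (s - of_int b) / 2" unfolding w_def k by (simp add: field_simps)
  then have "(w - of_int (b + k)) * \<theta> a b = (s - of_int b) / 2 * \<theta> a b" by (simp only:)
  also have "\<dots> = - (((of_int b)\<^sup>2 - s\<^sup>2) / (4 * real a))" using assms(1) by (simp add: \<theta>_def power2_eq_square field_simps)
  also have "\<dots> = - of_int c" unfolding c using assms(1) by simp
  finally show ?thesis by (simp add: algebra_simps)
qed

lemma fractional_ideal_lat:
  assumes a: "a > 0" and dvd: "4 * int a dvd b\<^sup>2 - int D"
  shows "fractional_ideal QO (ideal_lat a b)"
  unfolding fractional_ideal_def
proof (intro conjI ballI)
  obtain k where k: "int D - b = 2 * k" using root_parity[OF dvd] .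
  obtain c where c: "b\<^sup>2 - int D = 4 * int a * c" using dvd by blast
  show "ideal_lat a b \<subseteq> quotient_field QO"
  proof
    fix x assume "x \<in> ideal_lat a b"
    then obtain m n where x: "x = complex_of_real (of_int m + of_int n * \<theta> a b)" unfolding ideal_lat_def by blast
    have "of_int m + of_int n * \<theta> a b \<in> KR" by (intro KR_add KR_mult KR_rat \<theta>_KR) auto
    then show "x \<in> quotient_field QO" unfolding quotient_field_eq x by blast
  qed
  have "complex_of_real (of_int 1 + of_int 0 * \<theta> a b) \<in> ideal_lat a b" unfolding ideal_lat_def by blast
  then have "1 \<in> ideal_lat a b" by simp
  then show "ideal_lat a b \<noteq> {0}" by force
  have "complex_of_real (of_int 0 + of_int 0 * \<theta> a b) \<in> ideal_lat a b" unfolding ideal_lat_def by blast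
  then show "0 \<in> ideal_lat a b" by simp
  show "x + y \<in> ideal_lat a b" if xy: "x \<in> ideal_lat a b" "y \<in> ideal_lat a b" for x y
  proof -
    obtain m n m' n' where h: "x = complex_of_real (of_int m + of_int n * \<theta> a b)" "y = complex_of_real (of_int m' + of_int n' * \<theta> a b)"
      using xy unfolding ideal_lat_def by blast
    have "x + y = complex_of_real (of_int (m + m') + of_int (n + n') * \<theta> a b)" unfolding h by (simp add: algebra_simps)
    then show ?thesis unfolding ideal_lat_def by blast
  qed
  show "r * x \<in> ideal_lat a b" if r: "r \<in> QO" and x: "x \<in> ideal_lat a b" for r x
  proof -
    obtain p q m n where h: "r = complex_of_real (of_int p + of_int q * w)" "x = complex_of_real (of_int m + of_int n * \<theta> a b)"
      using r x unfolding ideal_lat_def quadratic_order_eq OR_def by blast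
    have "(of_int p + of_int q * w) * (of_int m + of_int n * \<theta> a b)
       = of_int (p * m) + of_int (p * n) * \<theta> a b + of_int (q * m) * w + of_int (q * n) * (w * \<theta> a b)"
      by (simp add: algebra_simps)
    also have "\<dots> = of_int (p * m + q * m * k - q * n * c) + of_int (p * n + q * m * int a + q * n * (b + k)) * \<theta> a b"
      unfolding w_mult_\<theta>[OF a k c] by (subst w_eq_\<theta>[OF a k]) (simp add: algebra_simps)
    finally have "r * x = complex_of_real (of_int (p * m + q * m * k - q * n * c) + of_int (p * n + q * m * int a + q * n * (b + k)) * \<theta> a b)"
      unfolding h by (simp only: of_real_mult[symmetric])
    then show ?thesis unfolding ideal_lat_def by blast
  qed
  show "\<exists>d\<in>QO. d \<noteq> 0 \<and> (\<forall>x\<in>ideal_lat a b. d * x \<in> QO)"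
  proof (intro bexI conjI ballI)
    show "complex_of_real (of_int (int a)) \<in> QO" unfolding QO_iff by (rule OR_int)
    show "complex_of_real (of_int (int a)) \<noteq> 0" using a by simp
    fix x assume "x \<in> ideal_lat a b"
    then obtain m n where x: "x = complex_of_real (of_int m + of_int n * \<theta> a b)" unfolding ideal_lat_def by blast
    have "of_int (int a) * (of_int m + of_int n * \<theta> a b) = of_int (int a * m - n * k) + of_int n * (w :: real)"
      by (subst w_eq_\<theta>[OF a k]) (simp add: algebra_simps)
    then have "complex_of_real (of_int (int a)) * x = complex_of_real (of_int (int a * m - n * k) + of_int n * w)"
      unfolding x by (simp only: of_real_mult[symmetric])
    then show "complex_of_real (of_int (int a)) * x \<in> QO" by (simp only: QO_iff ORI)
  qed
qed

lemma fractional_ideal_scaled: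
  assumes I: "fractional_ideal QO I" and n: "n > 0"
  shows "fractional_ideal QO (scaled I (real n))"
proof -
  note f = fractional_idealD[OF I]
  have nO: "real n \<in> OR" using OR_int[of "int n"] by simp
  show ?thesis
    unfolding fractional_ideal_def
  proof (intro conjI ballI)
    have sub: "scaled I (real n) \<subseteq> I" unfolding scaled_def using f(4)[OF nO] by auto
    then show "scaled I (real n) \<subseteq> quotient_field QO" using f(1) by (auto simp: quotient_field_eq)
    obtain z where "z \<noteq> 0" "complex_of_real z \<in> I" using f(5) by blast
    then have "complex_of_real (real n) * complex_of_real z \<in> scaled I (real n)" "complex_of_real (real n) * complex_of_real z \<noteq> 0"
      using n by (auto simp: scaled_def)
    then show "scaled I (real n) \<noteq> {0}" by blast
    show "0 \<in> scaled I (real n)" using f(2) unfolding scaled_def by force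
    show "x + y \<in> scaled I (real n)" if "x \<in> scaled I (real n)" "y \<in> scaled I (real n)" for x y
      using that f(3) unfolding scaled_def by (auto simp flip: distrib_left)
    show "r * x \<in> scaled I (real n)" if "r \<in> QO" "x \<in> scaled I (real n)" for r x
      using that f(4) unfolding scaled_def quadratic_order_eq by (auto simp: mult.left_commute)
    show "\<exists>d\<in>QO. d \<noteq> 0 \<and> (\<forall>x\<in>scaled I (real n). d * x \<in> QO)"
    proof -
      obtain d where "d \<in> OR" "d \<noteq> 0" "\<forall>x\<in>I. complex_of_real d * x \<in> QO" using f(6) by blast
      then show ?thesis using sub by (intro bexI[of _ "complex_of_real d"]) (auto simp: QO_iff)
    qed
  qed
qed

text \<open>The inverse is \<open>a\<close> times the conjugate lattice. The product contains a, and
  also b as the difference of the two conjugate generators multiplied by a; coprimality of a and b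
  puts 1 into it.\<close>

lemma invertible_ideal_lat:
  assumes a: "a > 0" and dvd: "4 * int a dvd b\<^sup>2 - int D" and cop: "coprime (int a) b"
  shows "invertible_ideal QO (ideal_lat a b)"
  unfolding invertible_ideal_def
proof (intro conjI exI)
  obtain k where k: "int D - b = 2 * k" using root_parity[OF dvd] .
  obtain c where c: "b\<^sup>2 - int D = 4 * int a * c" using dvd by blast
  have dvd': "4 * int a dvd (- b)\<^sup>2 - int D" using dvd by simp
  let ?J = "scaled (ideal_lat a (- b)) (real a)"
  show "fractional_ideal QO (ideal_lat a b)" by (rule fractional_ideal_lat[OF a dvd])
  show "fractional_ideal QO ?J" by (rule fractional_ideal_scaled[OF fractional_ideal_lat[OF a dvd'] a])
  let ?S = "{x * y |x y. x \<in> ideal_lat a b \<and> y \<in> ?J}"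
  have prod_eq: "real a * (\<theta> a b * \<theta> a (- b)) = - of_int c"
  proof -
    have "real_of_int (b\<^sup>2 - int D) = real_of_int (4 * int a * c)" by (simp only: c)
    then have c': "s\<^sup>2 - (of_int b)\<^sup>2 = - (4 * real a * of_int c)" by (simp add: s_sq2)
    have "real a * (\<theta> a b * \<theta> a (- b)) = (s\<^sup>2 - (of_int b)\<^sup>2) / (4 * real a)"
      using a by (simp add: \<theta>_def power2_eq_square field_simps)
    then show ?thesis unfolding c' using a by simp
  qed
  have conj_eq: "real a * \<theta> a (- b) = real a * \<theta> a b - of_int b"
    using a by (simp add: \<theta>_def field_simps)
  have \<theta>O: "real a * \<theta> a b = w - of_int k" using w_eq_\<theta>[OF a k] by simp
  show "ideal_product (ideal_lat a b) ?J = QO"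
  proof
    show "ideal_product (ideal_lat a b) ?J \<subseteq> QO"
      unfolding ideal_product_def
    proof (rule int_span_minimal)
      show "?S \<subseteq> QO"
      proof
        fix z assume "z \<in> ?S"
        then obtain x y where xy: "z = x * y" "x \<in> ideal_lat a b" "y \<in> ?J" by blast
        obtain m n where x: "x = complex_of_real (of_int m + of_int n * \<theta> a b)" using xy(2) unfolding ideal_lat_def by blast
        obtain m' n' where y: "y = complex_of_real (real a) * complex_of_real (of_int m' + of_int n' * \<theta> a (- b))"
          using xy(3) unfolding scaled_def ideal_lat_def by blast
        have z: "z = complex_of_real ((of_int m + of_int n * \<theta> a b) * (real a * (of_int m' + of_int n' * \<theta> a (- b))))"
          unfolding xy(1) x y by (simp only: of_real_mult)
        have "(of_int m + of_int n * \<theta> a b) * (real a * (of_int m' + of_int n' * \<theta> a (- b)))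
          = of_int m * of_int m' * real a + of_int n * of_int m' * (real a * \<theta> a b) + of_int m * of_int n' * (real a * \<theta> a (- b))
            + of_int n * of_int n' * (real a * (\<theta> a b * \<theta> a (- b)))"
          by (simp add: algebra_simps)
        also have "\<dots> = of_int (m * m' * int a - n * m' * k - m * n' * (k + b) - n * n' * c) + of_int (n * m' + m * n') * w"
          unfolding prod_eq conj_eq \<theta>O by (simp add: algebra_simps)
        finally show "z \<in> QO" unfolding z by (simp only: QO_iff ORI)
      qed
      show "0 \<in> QO" using QO_iff[of 0] OR_int[of 0] by simp
      show "x + y \<in> QO" if "x \<in> QO" "y \<in> QO" for x y
        using that OR_add unfolding quadratic_order_eq by (auto simp flip: of_real_add)
      show "of_int n * x \<in> QO" if "x \<in> QO" for n x
      proof -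
        obtain r where r: "r \<in> OR" "x = complex_of_real r" using \<open>x \<in> QO\<close> unfolding quadratic_order_eq by blast
        have "of_int n * x = complex_of_real (of_int n * r)" using r by simp
        then show ?thesis using OR_mult[OF OR_int r(1)] by (simp only: QO_iff)
      qed
    qed
    note cl = int_span_closed[where S = ?S] and sup = int_span_superset[of ?S]
    have gen: "complex_of_real ((of_int m + of_int n * \<theta> a b) * (real a * (of_int m' + of_int n' * \<theta> a (- b)))) \<in> int_span ?S" for m n m' n'
    proof -
      have "complex_of_real (of_int m + of_int n * \<theta> a b) \<in> ideal_lat a b"
        "complex_of_real (real a) * complex_of_real (of_int m' + of_int n' * \<theta> a (- b)) \<in> ?J"
        unfolding ideal_lat_def scaled_def by blast+
      then have "complex_of_real (of_int m + of_int n * \<theta> a b) * (complex_of_real (real a) * complex_of_real (of_int m' + of_int n' * \<theta> a (- b))) \<in> ?S"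
        by blast
      then have "complex_of_real (of_int m + of_int n * \<theta> a b) * (complex_of_real (real a) * complex_of_real (of_int m' + of_int n' * \<theta> a (- b))) \<in> int_span ?S"
        using sup by blast
      then show ?thesis by (simp only: of_real_mult)
    qed
    have ga: "complex_of_real (real a) \<in> int_span ?S" using gen[of 1 0 1 0] by simp
    have g\<theta>: "complex_of_real (real a * \<theta> a b) \<in> int_span ?S" using gen[of 0 1 1 0] by (simp add: mult.commute)
    have g\<theta>': "complex_of_real (real a * \<theta> a (- b)) \<in> int_span ?S" using gen[of 1 0 0 1] by simp
    have gb: "complex_of_real (of_int b) \<in> int_span ?S"
    proof -
      have "complex_of_real (of_int b) = complex_of_real (real a * \<theta> a b) + of_int (- 1) * complex_of_real (real a * \<theta> a (- b))"
        unfolding conj_eq by simp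
      then show ?thesis using cl(2)[OF g\<theta> cl(3)[OF g\<theta>', of "- 1"]] by (simp only:)
    qed
    have g1: "complex_of_real 1 \<in> int_span ?S"
    proof -
      obtain x y where xy: "x * int a + y * b = 1"
        using bezout_int[of "int a" b] cop by (auto simp: coprime_iff_gcd_eq_1)
      have "real_of_int (x * int a + y * b) = 1" unfolding xy by simp
      then have "complex_of_real 1 = complex_of_real (of_int x * real a + of_int y * of_int b)" by simp
      also have "\<dots> = of_int x * complex_of_real (real a) + of_int y * complex_of_real (of_int b)" by simp
      finally show ?thesis using cl(2)[OF cl(3)[OF ga, of x] cl(3)[OF gb, of y]] by (simp only:)
    qed
    show "QO \<subseteq> ideal_product (ideal_lat a b) ?J"
    proof
      fix z assume "z \<in> QO"
      then obtain m n where z: "z = complex_of_real (of_int m + of_int n * w)" unfolding quadratic_order_eq OR_def by blast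
      have "w = real a * \<theta> a b + of_int k" by (rule w_eq_\<theta>[OF a k])
      then have "z = of_int (m + n * k) * complex_of_real 1 + of_int n * complex_of_real (real a * \<theta> a b)"
        unfolding z by (simp add: algebra_simps)
      then show "z \<in> ideal_product (ideal_lat a b) ?J"
        unfolding ideal_product_def using cl(2)[OF cl(3)[OF g1, of "m + n * k"] cl(3)[OF g\<theta>, of n]] by (simp only:)
    qed
  qed
qed

section \<open>Covolumes and coordinates of integral ideals\<close>

lemma cj_\<theta>: "cj (\<theta> a b) = (of_int b - s) / (2 * real a)"
proof -
  have "cj (\<theta> a b) = of_int b / (2 * real a) - (1 / (2 * real a)) * s" unfolding \<theta>_coords by (rule cj_eq) auto
  then show ?thesis by (simp add: diff_divide_distrib)
qed

lemma \<theta>_det: "\<theta> a b - cj (\<theta> a b) = s / real a"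
proof -
  have "\<theta> a b - cj (\<theta> a b) = ((of_int b + s) - (of_int b - s)) / (2 * real a)"
    unfolding cj_\<theta> unfolding \<theta>_def by (simp only: diff_divide_distrib)
  then show ?thesis by simp
qed

lemma scaled_ideal_lat_iff:
  "complex_of_real z \<in> scaled (ideal_lat a b) r \<longleftrightarrow> (\<exists>m n. z = r * (of_int m + of_int n * \<theta> a b))"
proof
  assume "complex_of_real z \<in> scaled (ideal_lat a b) r"
  then obtain m n where "complex_of_real z = complex_of_real r * complex_of_real (of_int m + of_int n * \<theta> a b)"
    unfolding scaled_def ideal_lat_def by blast
  then have "z = r * (of_int m + of_int n * \<theta> a b)" by (simp only: of_real_mult[symmetric] of_real_eq_iff)
  then show "\<exists>m n. z = r * (of_int m + of_int n * \<theta> a b)" by blast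
next
  assume "\<exists>m n. z = r * (of_int m + of_int n * \<theta> a b)"
  then obtain m n where "z = r * (of_int m + of_int n * \<theta> a b)" by blast
  then have "complex_of_real z = complex_of_real r * complex_of_real (of_int m + of_int n * \<theta> a b)"
    by (simp only: of_real_mult)
  then show "complex_of_real z \<in> scaled (ideal_lat a b) r" unfolding scaled_def ideal_lat_def by blast
qed

text \<open>The determinant of the two embeddings of (z, z \<theta>) is evaluated in two ways,
  directly and through the basis (r, r \<theta>); the transition matrix contributes its
  determinant.\<close>

lemma basis_det:
  assumes r: "r \<in> KR" and z: "z = r * (of_int m1 + of_int n1 * \<theta> a b)" "z * \<theta> a0 b0 = r * (of_int m2 + of_int n2 * \<theta> a b)" and zK: "z \<in> KR"
  shows "nrm z * (s / real a0) = nrm r * of_int (m1 * n2 - n1 * m2) * (s / real a)"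
proof -
  have c1: "cj z = cj r * (of_int m1 + of_int n1 * cj (\<theta> a b))"
    unfolding z(1) by (simp add: r cj_mult cj_add KR_add KR_mult KR_rat \<theta>_KR cj_rat)
  have c2: "cj (z * \<theta> a0 b0) = cj r * (of_int m2 + of_int n2 * cj (\<theta> a b))"
    unfolding z(2) by (simp add: r cj_mult cj_add KR_add KR_mult KR_rat \<theta>_KR cj_rat)
  have "nrm z * (\<theta> a0 b0 - cj (\<theta> a0 b0)) = cj z * (z * \<theta> a0 b0) - z * cj (z * \<theta> a0 b0)"
    by (simp add: nrm_def cj_mult zK \<theta>_KR algebra_simps)
  also have "\<dots> = cj r * (of_int m1 + of_int n1 * cj (\<theta> a b)) * (r * (of_int m2 + of_int n2 * \<theta> a b))
      - r * (of_int m1 + of_int n1 * \<theta> a b) * (cj r * (of_int m2 + of_int n2 * cj (\<theta> a b)))"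
    unfolding c1 c2 by (simp only: z(2) z(1)[symmetric])
  also have "\<dots> = nrm r * of_int (m1 * n2 - n1 * m2) * (\<theta> a b - cj (\<theta> a b))"
    by (simp add: nrm_def algebra_simps)
  finally show ?thesis unfolding \<theta>_det .
qed

text \<open>Equal lattices have equal covolume. The transition matrices in both directions are
  integral, so their determinants are mutually inverse integers, hence both 1 or both -1.\<close>

lemma nrm_of_scaled_eq:
  assumes r: "r \<in> KR" "r \<noteq> 0" and z: "z \<in> KR" "z \<noteq> 0" and a: "a > 0" "a0 > 0"
    and eq: "scaled (ideal_lat a b) r = scaled (ideal_lat a0 b0) z"
  shows "\<bar>nrm z\<bar> / real a0 = \<bar>nrm r\<bar> / real a"
proof -
  have one: "complex_of_real x \<in> scaled (ideal_lat a' b') x" "complex_of_real (x * \<theta> a' b') \<in> scaled (ideal_lat a' b') x" for x a' b'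
    unfolding scaled_ideal_lat_iff by (rule exI[of _ 1], rule exI[of _ 0], simp, rule exI[of _ 0], rule exI[of _ 1], simp)
  obtain m1 n1 m2 n2 where zb: "z = r * (of_int m1 + of_int n1 * \<theta> a b)" "z * \<theta> a0 b0 = r * (of_int m2 + of_int n2 * \<theta> a b)"
    using one[of z a0 b0] unfolding eq[symmetric] scaled_ideal_lat_iff by blast
  obtain m3 n3 m4 n4 where rb: "r = z * (of_int m3 + of_int n3 * \<theta> a0 b0)" "r * \<theta> a b = z * (of_int m4 + of_int n4 * \<theta> a0 b0)"
    using one[of r a b] unfolding eq scaled_ideal_lat_iff by blast
  define d d' where "d = m1 * n2 - n1 * m2" and "d' = m3 * n4 - n3 * m4"
  have "nrm z * (s / real a0) = nrm r * of_int d * (s / real a)" unfolding d_def by (rule basis_det[OF r(1) zb z(1)])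
  then have "s * (nrm z / real a0) = s * (of_int d * (nrm r / real a))" by (simp add: algebra_simps)
  then have 1: "nrm z / real a0 = of_int d * (nrm r / real a)" using s_pos by (simp only: mult_cancel_left) simp
  have "nrm r * (s / real a) = nrm z * of_int d' * (s / real a0)" unfolding d'_def by (rule basis_det[OF z(1) rb r(1)])
  then have "s * (nrm r / real a) = s * (of_int d' * (nrm z / real a0))" by (simp add: algebra_simps)
  then have 2: "nrm r / real a = of_int d' * (nrm z / real a0)" using s_pos by (simp only: mult_cancel_left) simp
  have "nrm z / real a0 = of_int (d * d') * (nrm z / real a0)" using 1 2 by simp
  moreover have "nrm z / real a0 \<noteq> 0" using nrm_nonzero[OF z] a by simp
  ultimately have "real_of_int (d * d') = 1" by (metis mult_cancel_right2)
  then have "d * d' = 1" by linarith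
  then have "d = 1 \<or> d = -1" by (auto simp: zmult_eq_1_iff)
  then have "\<bar>nrm z / real a0\<bar> = \<bar>nrm r / real a\<bar>" unfolding 1 by (auto simp: abs_mult)
  then show ?thesis by simp
qed

text \<open>The hypotheses say that \<open>z I\<close> lies in the order, where \<open>I = ideal_lat a0 b0\<close>; such \<open>z\<close> lie in
  \<open>a0 I'\<close>, where \<open>I' = ideal_lat a0 (- b0)\<close> is the conjugate of \<open>I\<close>.\<close>

lemma scaled_subset_order_coords:
  assumes a0: "a0 > 0" and dvd: "4 * int a0 dvd b0\<^sup>2 - int D"
    and z: "z \<in> OR" "z * \<theta> a0 b0 \<in> OR"
  obtains p where "z = real a0 * lin (\<theta> a0 (- b0)) p" "cj z = real a0 * lin (cj (\<theta> a0 (- b0))) p"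
proof -
  obtain k where k: "int D - b0 = 2 * k" using root_parity[OF dvd] .
  obtain c where c: "b0\<^sup>2 - int D = 4 * int a0 * c" using dvd by blast
  obtain m n where zmn: "z = of_int m + of_int n * w" using z(1) by (rule ORE)
  have we: "w = real a0 * \<theta> a0 b0 + of_int k" by (rule w_eq_\<theta>[OF a0 k])
  have "z * \<theta> a0 b0 = of_int m * \<theta> a0 b0 + of_int n * (w * \<theta> a0 b0)" unfolding zmn by (simp add: algebra_simps)
  also have "\<dots> = of_int (m + n * (b0 + k)) * \<theta> a0 b0 - of_int (n * c)" unfolding w_mult_\<theta>[OF a0 k c] by (simp add: algebra_simps)
  finally have zt: "z * \<theta> a0 b0 = of_int (m + n * (b0 + k)) * \<theta> a0 b0 - of_int (n * c)" .
  obtain p q where pq: "z * \<theta> a0 b0 = of_int p + of_int q * w" using z(2) by (rule ORE)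
  \<comment> \<open>Comparing the coordinates along \<open>s\<close> shows that \<open>a0\<close>
    divides m + n (b0 + k), which is the condition for z to lie in \<open>a0\<close> times the
    conjugate lattice.\<close>
  have "of_int (m + n * (b0 + k)) * \<theta> a0 b0 - of_int (n * c) = of_int p + of_int q * (real a0 * \<theta> a0 b0 + of_int k)"
    using zt pq we by simp
  then have "(of_int (m + n * (b0 + k)) * (of_int b0 / (2 * real a0)) - of_int (n * c)) + (of_int (m + n * (b0 + k)) * (1 / (2 * real a0))) * s
     = (of_int p + of_int q * of_int k + of_int q * real a0 * (of_int b0 / (2 * real a0))) + (of_int q * real a0 * (1 / (2 * real a0))) * s"
    unfolding \<theta>_coords by (simp only: algebra_simps)
  from rat_coords_unique[OF _ _ _ _ this]
  have "of_int (m + n * (b0 + k)) * (1 / (2 * real a0)) = of_int q * real a0 * (1 / (2 * real a0))"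
    by simp
  then have "of_int (m + n * (b0 + k)) = of_int q * real a0"
    by (rule mult_right_cancel[THEN iffD1, rotated]) (use a0 in simp)
  then have "real_of_int (m + n * (b0 + k)) = real_of_int (q * int a0)" by simp
  then have mn: "m + n * (b0 + k) = q * int a0" by (simp only: of_int_eq_iff)
  define P where "P = (q, n)"
  have z_eq: "z = real a0 * lin (\<theta> a0 (- b0)) P"
  proof -
    have "z = of_int m + of_int n * (real a0 * \<theta> a0 b0 + of_int k)" unfolding zmn we ..
    also have "\<dots> = of_int (m + n * (b0 + k)) + of_int n * (real a0 * \<theta> a0 b0 - of_int b0)" by (simp add: algebra_simps)
    also have "real a0 * \<theta> a0 b0 - of_int b0 = real a0 * \<theta> a0 (- b0)" using a0 by (simp add: \<theta>_def field_simps)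
    finally show ?thesis unfolding mn by (simp add: lin_def P_def algebra_simps)
  qed
  have "cj z = real a0 * lin (cj (\<theta> a0 (- b0))) P"
    unfolding z_eq lin_def by (simp add: cj_mult cj_add KR_add KR_mult KR_rat \<theta>_KR cj_rat)
  then show ?thesis using z_eq that by blast
qed

end

context quad_disc
begin

section \<open>Units, and the number of ideals in one class\<close>

lemma unit_cj: "u \<in> OR \<Longrightarrow> \<bar>nrm u\<bar> = 1 \<Longrightarrow> \<bar>cj u\<bar> = 1 / \<bar>u\<bar>"
  by (metis abs_mult divide_eq_eq nrm_def mult.commute abs_zero mult_zero_left zero_neq_one)

lemma unit_inverse:
  assumes "u \<in> OR" "\<bar>nrm u\<bar> = 1"
  shows "1 / u \<in> OR" "\<bar>nrm (1 / u)\<bar> = 1"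
proof -
  have u0: "u \<noteq> 0" using assms(2) by (auto simp: nrm_def)
  have uK: "u \<in> KR" by (rule OR_subset_KR[OF assms(1)])
  have "nrm u = 1 \<or> nrm u = -1" using assms(2) by linarith
  then have "1 / u = cj u \<or> 1 / u = of_int (-1) * cj u" using u0 by (auto simp: nrm_def field_simps)
  then show "1 / u \<in> OR" using cj_OR[OF assms(1)] OR_mult[OF OR_int[of "-1"] cj_OR[OF assms(1)]] by metis
  have "nrm (1 / u) * nrm u = nrm (1 / u * u)" using nrm_mult[OF KR_inverse[OF uK] uK] by simp
  also have "\<dots> = 1" using u0 cj_rat[of 1] by (simp add: nrm_def)
  finally have "\<bar>nrm (1 / u)\<bar> * \<bar>nrm u\<bar> = 1" by (simp flip: abs_mult)
  then show "\<bar>nrm (1 / u)\<bar> = 1" using assms(2) by simp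
qed

lemma unit_power:
  assumes "u \<in> OR" "\<bar>nrm u\<bar> = 1"
  shows "u ^ n \<in> OR \<and> \<bar>nrm (u ^ n)\<bar> = 1"
proof (induction n)
  case 0
  then show ?case using OR_int[of 1] cj_rat[of 1] by (simp add: nrm_def)
next
  case (Suc n)
  then show ?case using OR_mult[OF assms(1)] nrm_mult[OF OR_subset_KR OR_subset_KR, OF assms(1)] assms(2)
    by (simp add: abs_mult)
qed

lemma unit_power_int:
  assumes "u \<in> OR" "\<bar>nrm u\<bar> = 1"
  shows "u powi k \<in> OR \<and> \<bar>nrm (u powi k)\<bar> = 1"
  using unit_power[OF assms] unit_power[OF unit_inverse[OF assms]]
  by (simp add: power_int_def inverse_eq_divide)

lemma scaled_unit:
  assumes I: "fractional_ideal QO I" and u: "u \<in> OR" "\<bar>nrm u\<bar> = 1"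
  shows "scaled I u = I"
proof
  note f = fractional_idealD[OF I]
  have u0: "u \<noteq> 0" using u(2) by (auto simp: nrm_def)
  show "scaled I u \<subseteq> I" unfolding scaled_def using f(4)[OF u(1)] by auto
  show "I \<subseteq> scaled I u"
  proof
    fix x assume "x \<in> I"
    then have "complex_of_real (1 / u) * x \<in> I" using f(4)[OF unit_inverse(1)[OF u]] by blast
    moreover have "x = complex_of_real u * (complex_of_real (1 / u) * x)" using u0 by simp
    ultimately show "x \<in> scaled I u" unfolding scaled_def by blast
  qed
qed

text \<open>A positive unit u changes the ratio |z| / |cj z| by u^2. A power of \<open>e\<close>
  moves the logarithm of the ratio into the interval from 0 to 2 ln e; the floor in \<open>k\<close>
  selects it.\<close>

lemma unit_normalize:
  assumes e: "e \<in> OR" "\<bar>nrm e\<bar> = 1" "1 < e" and z: "z \<in> KR" "z \<noteq> 0"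
  obtains u where "u \<in> OR" "\<bar>nrm u\<bar> = 1" "u \<noteq> 0" "\<bar>cj (z * u)\<bar> \<le> \<bar>z * u\<bar>" "\<bar>z * u\<bar> < e\<^sup>2 * \<bar>cj (z * u)\<bar>"
proof -
  have cz: "cj z \<noteq> 0" by (rule cj_nonzero[OF z])
  define L where "L = 2 * ln e"
  have L: "0 < L" using e by (simp add: L_def)
  define \<rho> where "\<rho> = \<bar>z\<bar> / \<bar>cj z\<bar>"
  have \<rho>: "0 < \<rho>" using z cz by (simp add: \<rho>_def)
  define k where "k = - \<lfloor>ln \<rho> / L\<rfloor>"
  define u where "u = e powi k"
  have u: "u \<in> OR" "\<bar>nrm u\<bar> = 1" using unit_power_int[OF e(1,2), of k] by (simp_all add: u_def)
  have u0: "0 < u" using e(3) by (simp add: u_def)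
  have lnu: "ln u = of_int k * ln e"
    using e(3) by (simp add: u_def ln_powr flip: powr_real_of_int')
  have k: "0 \<le> ln \<rho> + of_int k * L" "ln \<rho> + of_int k * L < L"
    using floor_divide_lower[OF L, of "ln \<rho>"] floor_divide_upper[OF L, of "ln \<rho>"] unfolding k_def by (simp_all add: algebra_simps)
  have ln: "ln (\<rho> * u\<^sup>2) = ln \<rho> + of_int k * L"
    using \<rho> u0 by (simp add: ln_mult ln_realpow lnu L_def)
  have pos: "0 < \<rho> * u\<^sup>2" using \<rho> u0 by simp
  have "ln 1 \<le> ln (\<rho> * u\<^sup>2)" using k(1) ln by simp
  then have lo: "1 \<le> \<rho> * u\<^sup>2" using pos by (subst (asm) ln_le_cancel_iff) auto
  have "ln (\<rho> * u\<^sup>2) < ln (e\<^sup>2)" using k(2) ln e(3) by (simp add: ln_realpow L_def)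
  then have hi: "\<rho> * u\<^sup>2 < e\<^sup>2" using pos e(3) by (subst (asm) ln_less_cancel_iff) auto
  have c: "\<bar>cj (z * u)\<bar> = \<bar>cj z\<bar> / u"
    using cj_mult[OF z(1) OR_subset_KR[OF u(1)]] unit_cj[OF u] u0 by (simp add: abs_mult)
  have r: "\<bar>z * u\<bar> = \<rho> * u\<^sup>2 * \<bar>cj (z * u)\<bar>"
    unfolding c using u0 cz by (simp add: \<rho>_def abs_mult power2_eq_square)
  have c0: "0 < \<bar>cj (z * u)\<bar>" unfolding c using u0 cz by simp
  show ?thesis
  proof (rule that[OF u])
    show "u \<noteq> 0" using u0 by simp
    show "\<bar>cj (z * u)\<bar> \<le> \<bar>z * u\<bar>" unfolding r using mult_right_mono[OF lo, of "\<bar>cj (z * u)\<bar>"] by simp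
    show "\<bar>z * u\<bar> < e\<^sup>2 * \<bar>cj (z * u)\<bar>" unfolding r using hi c0 by (rule mult_strict_right_mono)
  qed
qed

text \<open>Times \<open>a0\<close>, the product is the value at (x, y) of the integral form a0 x^2
  - b0 x y + c y^2, and it is nonzero since \<open>s\<close> is irrational.\<close>

lemma lin_norm_lower_bound:
  assumes a0: "a0 > 0" and dvd: "4 * int a0 dvd b0\<^sup>2 - int D" and p: "p \<noteq> 0"
  shows "1 / real a0 \<le> \<bar>lin (\<theta> a0 (- b0)) p * lin (cj (\<theta> a0 (- b0))) p\<bar>"
proof -
  obtain x y where xy: "p = (x, y)" by fastforce
  obtain c where c: "b0\<^sup>2 - int D = 4 * int a0 * c" using dvd by blast
  let ?z = "of_int x + of_int y * \<theta> a0 (- b0)"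
  have zK: "?z \<in> KR" by (intro KR_add KR_mult KR_rat \<theta>_KR) auto
  have cz: "cj ?z = of_int x + of_int y * cj (\<theta> a0 (- b0))"
    by (simp add: cj_mult cj_add KR_mult KR_rat \<theta>_KR cj_rat)
  have z0: "?z \<noteq> 0"
  proof
    assume "?z = 0"
    then have "(of_int x + of_int y * (of_int (- b0) / (2 * real a0))) + (of_int y * (1 / (2 * real a0))) * s = 0 + 0 * s"
      unfolding \<theta>_coords by (simp add: algebra_simps)
    from rat_coords_unique[OF _ _ _ _ this]
    have "of_int x + of_int y * (of_int (- b0) / (2 * real a0)) = 0 \<and> of_int y * (1 / (2 * real a0)) = 0" by simp
    then have "y = 0" "x = 0" using a0 by auto
    then show False using p xy by (simp add: zero_prod_def)
  qed
  have ab: "\<theta> a0 (- b0) + cj (\<theta> a0 (- b0)) = - of_int b0 / real a0"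
    unfolding cj_\<theta> using a0 by (simp add: \<theta>_def field_simps)
  have bc: "real a0 * (\<theta> a0 (- b0) * cj (\<theta> a0 (- b0))) = of_int c"
  proof -
    have "real_of_int (b0\<^sup>2 - int D) = real_of_int (4 * int a0 * c)" by (simp only: c)
    then have c': "(of_int b0)\<^sup>2 - s\<^sup>2 = 4 * real a0 * of_int c" by (simp add: s_sq2)
    have "real a0 * (\<theta> a0 (- b0) * cj (\<theta> a0 (- b0))) = ((of_int b0)\<^sup>2 - s\<^sup>2) / (4 * real a0)"
      unfolding cj_\<theta> using a0 by (simp add: \<theta>_def power2_eq_square field_simps)
    then show ?thesis unfolding c' using a0 by simp
  qed
  have "real a0 * nrm ?z = real a0 * (of_int x)\<^sup>2 + of_int x * of_int y * (real a0 * (\<theta> a0 (- b0) + cj (\<theta> a0 (- b0)))) + (of_int y)\<^sup>2 * (real a0 * (\<theta> a0 (- b0) * cj (\<theta> a0 (- b0))))"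
    unfolding nrm_def cz by (simp add: power2_eq_square algebra_simps)
  also have "\<dots> = of_int (int a0 * x\<^sup>2 - x * y * b0 + y\<^sup>2 * c)"
    unfolding bc ab using a0 by (simp add: algebra_simps)
  finally have i: "real a0 * nrm ?z = of_int (int a0 * x\<^sup>2 - x * y * b0 + y\<^sup>2 * c)" .
  moreover have "real a0 * nrm ?z \<noteq> 0" using nrm_nonzero[OF zK z0] a0 by simp
  ultimately have "int a0 * x\<^sup>2 - x * y * b0 + y\<^sup>2 * c \<noteq> 0" by (metis of_int_0)
  then have "1 \<le> \<bar>int a0 * x\<^sup>2 - x * y * b0 + y\<^sup>2 * c\<bar>" by simp
  then have "1 \<le> \<bar>real a0 * nrm ?z\<bar>" unfolding i by (simp only: of_int_abs[symmetric] of_int_1_le_iff)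
  then have "1 / real a0 \<le> \<bar>nrm ?z\<bar>" using a0 by (simp add: abs_mult divide_le_eq mult.commute)
  then show ?thesis by (simp add: nrm_def cz lin_def xy)
qed

text \<open>The coordinates along \<open>s\<close> of the second basis vectors are g / 2 and g' / 2,
  so g and g' divide each other. After that b and b' agree modulo 2 a and lie in the same
  period.\<close>

lemma ideal_lat_determines:
  assumes g: "g > 0" "g' > 0" and a: "a > 0" "a' > 0" and m: "g\<^sup>2 * a = g'\<^sup>2 * a'"
    and b: "0 \<le> b" "b < 2 * int a" "0 \<le> b'" "b' < 2 * int a'"
    and eq: "scaled (ideal_lat a b) (real (g * a)) = scaled (ideal_lat a' b') (real (g' * a'))"
  shows "g = g' \<and> b = b'"
proof -
  have half: "\<exists>m n. real g * real a * \<theta> a b = real g' * real a' * (of_int m + of_int n * \<theta> a' b')"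
    if "scaled (ideal_lat a b) (real (g * a)) = scaled (ideal_lat a' b') (real (g' * a'))" for g g' a a' b b'
  proof -
    have "complex_of_real (real (g * a) * \<theta> a b) \<in> scaled (ideal_lat a b) (real (g * a))"
      unfolding scaled_ideal_lat_iff by (rule exI[of _ 0], rule exI[of _ 1]) simp
    then show ?thesis unfolding that scaled_ideal_lat_iff by simp
  qed
  have coords: "\<exists>m n. int g = int g' * n \<and> int g * b = 2 * int g' * int a' * m + int g' * n * b'"
    if a: "a > 0" "a' > 0" and h: "\<exists>m n. real g * real a * \<theta> a b = real g' * real a' * (of_int m + of_int n * \<theta> a' b')" for g g' a a' :: nat and b b'
  proof -
    from h obtain m n where h: "real g * real a * \<theta> a b = real g' * real a' * (of_int m + of_int n * \<theta> a' b')" by blast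
    have "real g * real a * \<theta> a b = real g * of_int b / 2 + (real g / 2) * s"
      using a by (simp add: \<theta>_def field_simps)
    moreover have "real g' * real a' * (of_int m + of_int n * \<theta> a' b')
        = (real g' * real a' * of_int m + real g' * of_int n * of_int b' / 2) + (real g' * of_int n / 2) * s"
      using a by (simp add: \<theta>_def field_simps)
    ultimately have "real g * of_int b / 2 + (real g / 2) * s = (real g' * real a' * of_int m + real g' * of_int n * of_int b' / 2) + (real g' * of_int n / 2) * s"
      using h by simp
    then have e: "real g * of_int b / 2 = real g' * real a' * of_int m + real g' * of_int n * of_int b' / 2 \<and> real g / 2 = real g' * of_int n / 2"
      by (rule rat_coords_unique[rotated 4]) auto
    have "real_of_int (int g) = real_of_int (int g' * n)" using e by simp
    then have 1: "int g = int g' * n" by (simp only: of_int_eq_iff)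
    have "real_of_int (int g * b) = real_of_int (2 * int g' * int a' * m + int g' * n * b')" using conjunct1[OF e] by (simp add: field_simps)
    then have "int g * b = 2 * int g' * int a' * m + int g' * n * b'" by (simp only: of_int_eq_iff)
    then show ?thesis using 1 by blast
  qed
  obtain m1 n1 where c1: "int g = int g' * n1" "int g * b = 2 * int g' * int a' * m1 + int g' * n1 * b'"
    using coords[OF a half[OF eq]] by blast
  obtain m2 n2 where c2: "int g' = int g * n2" using coords[OF a(2,1) half[OF eq[symmetric]]] by blast
  have "int g' dvd int g" using c1(1) by (rule dvdI)
  moreover have "int g dvd int g'" using c2 by (rule dvdI)
  ultimately have gg: "g = g'" by (simp add: dvd_antisym)
  then have aa: "a = a'" using m g by simp
  have n1: "n1 = 1" using c1(1) gg g by simp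
  have "int g * b = int g * (2 * int a * m1 + b')" using c1(2) unfolding n1 gg[symmetric] aa[symmetric] by (simp add: algebra_simps)
  then have bb: "b = 2 * int a * m1 + b'" using g by simp
  have "b mod (2 * int a) = b' mod (2 * int a)" unfolding bb by simp
  then have "b = b'" using b aa by simp
  then show ?thesis using gg by simp
qed

text \<open>The ideals of norm at most \<open>X\<close> in one class inject into the points of a lattice annulus.\<close>

lemma card_class_le:
  assumes e: "e \<in> OR" "\<bar>nrm e\<bar> = 1" "1 < e" "e\<^sup>2 \<le> 2 ^ J"
    and T: "finite T" "\<And>m g b. (m, g, b) \<in> T \<Longrightarrow> m > 0 \<and> m \<le> X \<and> g\<^sup>2 dvd m \<and> b \<in> root_set (int D) (m div g\<^sup>2)"
    and cls: "\<And>m g b m' g' b'. (m, g, b) \<in> T \<Longrightarrow> (m', g', b') \<in> T \<Longrightarrow>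
        ideal_class (ideal_lat (m div g\<^sup>2) b) = ideal_class (ideal_lat (m' div g'\<^sup>2) b')"
    and X: "X > 0"
  shows "real (card T) \<le> real J * (1 + 2 * sqrt (2 * real X) + 32 * real X / s)"
proof (cases "T = {}")
  case True
  have "0 \<le> real J * (1 + 2 * sqrt (2 * real X) + 32 * real X / s)"
    using s_pos by (intro mult_nonneg_nonneg add_nonneg_nonneg) auto
  then show ?thesis using True by simp
next
  case False
  then obtain m0 g0 b0 where t0: "(m0, g0, b0) \<in> T" by auto
  define a0 where "a0 = m0 div g0\<^sup>2"
  have apos: "m div g\<^sup>2 > 0 \<and> g > 0 \<and> g\<^sup>2 * (m div g\<^sup>2) = m" if "(m, g, b) \<in> T" for m g b
  proof -
    have h: "m > 0" "g\<^sup>2 dvd m" using T(2)[OF that] by auto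
    then have "g\<^sup>2 * (m div g\<^sup>2) = m" by simp
    then show ?thesis using h(1) by (metis gr0I mult_is_0 less_irrefl zero_power2)
  qed
  have a0: "a0 > 0" using apos[OF t0] by (simp add: a0_def)
  have dvd0: "4 * int a0 dvd b0\<^sup>2 - int D" using T(2)[OF t0] by (auto simp: root_set_def a0_def)
  have fI0: "fractional_ideal QO (ideal_lat a0 b0)" by (rule fractional_ideal_lat[OF a0 dvd0])
  \<comment> \<open>A triple (m, g, b) encodes the integral ideal g (a Z + ((b + s) / 2) Z) of norm
    m, where a = m / g^2.\<close>
  let ?I = "\<lambda>(m, g, b). scaled (ideal_lat (m div g\<^sup>2) b) (real (g * (m div g\<^sup>2)))"
  \<comment> \<open>Relates a triple to the coordinates \<open>p\<close> of a multiplier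
    \<open>z\<close> that carries the reference ideal to the ideal of the triple, \<open>z\<close>
    being normalised by a unit.\<close>
  define Q where "Q t p \<longleftrightarrow> (\<exists>z. ?I t = scaled (ideal_lat a0 b0) z \<and> z = real a0 * lin (\<theta> a0 (- b0)) p \<and> cj z = real a0 * lin (cj (\<theta> a0 (- b0))) p
      \<and> \<bar>cj z\<bar> \<le> \<bar>z\<bar> \<and> \<bar>z\<bar> < 2 ^ J * \<bar>cj z\<bar> \<and> \<bar>nrm z\<bar> = real a0 * real (fst t))" for t p
  have ex: "\<exists>p. Q t p" if t: "t \<in> T" for t
  proof -
    obtain m g b where tm: "t = (m, g, b)" by (cases t)
    define a where "a = m div g\<^sup>2"
    have a: "a > 0" "g > 0" "g\<^sup>2 * a = m" using apos[of m g b] t tm by (auto simp: a_def)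
    have dvd: "4 * int a dvd b\<^sup>2 - int D" using T(2)[of m g b] t tm by (auto simp: root_set_def a_def)
    have "ideal_lat a b \<in> ideal_class (ideal_lat a0 b0)"
      using ideal_class_self[of "ideal_lat a b"] cls[OF t[unfolded tm] t0] by (simp add: a_def a0_def)
    then obtain \<gamma> where \<gamma>: "\<gamma> \<in> KR" "\<gamma> \<noteq> 0" "ideal_lat a b = scaled (ideal_lat a0 b0) \<gamma>" unfolding ideal_class_def by blast
    define r where "r = real (g * a)"
    have r: "r \<noteq> 0" "r \<in> KR" using a by (auto simp: r_def intro!: KR_rat)
    obtain u where u: "u \<in> OR" "\<bar>nrm u\<bar> = 1" "u \<noteq> 0" "\<bar>cj (\<gamma> * r * u)\<bar> \<le> \<bar>\<gamma> * r * u\<bar>" "\<bar>\<gamma> * r * u\<bar> < e\<^sup>2 * \<bar>cj (\<gamma> * r * u)\<bar>"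
      using unit_normalize[OF e(1-3) KR_mult[OF \<gamma>(1) r(2)]] \<gamma>(2) r(1) by (metis mult_eq_0_iff)
    define z where "z = \<gamma> * r * u"
    have uK: "u \<in> KR" by (rule OR_subset_KR[OF u(1)])
    have z: "z \<in> KR" "z \<noteq> 0" using \<gamma> r u uK by (auto simp: z_def intro!: KR_mult)
    have It: "?I t = scaled (ideal_lat a b) r" by (simp add: tm a_def r_def)
    have "scaled (ideal_lat a0 b0) z = scaled (scaled (ideal_lat a0 b0) u) (\<gamma> * r)"
      unfolding scaled_scaled z_def by (simp add: mult.commute)
    also have "\<dots> = scaled (scaled (ideal_lat a0 b0) \<gamma>) r" unfolding scaled_unit[OF fI0 u(1,2)] by (simp add: scaled_scaled)
    finally have Iz: "?I t = scaled (ideal_lat a0 b0) z" unfolding It by (simp add: \<gamma>(3))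
    have nz: "\<bar>nrm z\<bar> = real a0 * real m"
    proof -
      have "\<bar>nrm z\<bar> / real a0 = \<bar>nrm r\<bar> / real a"
        by (rule nrm_of_scaled_eq[OF r(2,1) z a(1) a0, where b = b and ?b0.0 = b0]) (use Iz It in simp)
      moreover have "nrm r = r\<^sup>2" unfolding nrm_def using cj_rat[of r] by (simp add: r_def power2_eq_square)
      moreover have "r\<^sup>2 / real a = real m" unfolding r_def a(3)[symmetric] using a(1) by (simp add: power2_eq_square)
      ultimately show ?thesis using a0 by (simp add: divide_eq_eq mult.commute)
    qed
    have in_OR: "x \<in> OR" if x: "complex_of_real x \<in> scaled (ideal_lat a b) r" for x
    proof -
      obtain k where k: "int D - b = 2 * k" using root_parity[OF dvd] .
      obtain p q where "x = r * (of_int p + of_int q * \<theta> a b)" using x unfolding scaled_ideal_lat_iff by blast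
      also have "\<dots> = of_int (int g * int a * p) + of_int (int g * q) * (real a * \<theta> a b)" by (simp add: r_def algebra_simps)
      also have "real a * \<theta> a b = w - of_int k" using w_eq_\<theta>[OF a(1) k] by simp
      also have "of_int (int g * int a * p) + of_int (int g * q) * (w - of_int k) = of_int (int g * int a * p - int g * q * k) + of_int (int g * q) * w"
        by (simp add: algebra_simps)
      finally show ?thesis using ORI by metis
    qed
    have "complex_of_real z \<in> scaled (ideal_lat a0 b0) z" "complex_of_real (z * \<theta> a0 b0) \<in> scaled (ideal_lat a0 b0) z"
      unfolding scaled_ideal_lat_iff by (rule exI[of _ 1], rule exI[of _ 0], simp, rule exI[of _ 0], rule exI[of _ 1], simp)
    then have "z \<in> OR" "z * \<theta> a0 b0 \<in> OR" using in_OR Iz It by auto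
    then obtain p where p: "z = real a0 * lin (\<theta> a0 (- b0)) p" "cj z = real a0 * lin (cj (\<theta> a0 (- b0))) p"
      by (rule scaled_subset_order_coords[OF a0 dvd0])
    have "\<bar>z\<bar> < e\<^sup>2 * \<bar>cj z\<bar>" using u(5) by (simp add: z_def)
    also have "\<dots> \<le> 2 ^ J * \<bar>cj z\<bar>" using e(4) by (intro mult_right_mono) auto
    finally show ?thesis unfolding Q_def using Iz p u(4) nz by (intro exI[of _ p] exI[of _ z]) (auto simp: z_def tm)
  qed
  define P where "P t = (SOME p. Q t p)" for t
  have P: "Q t (P t)" if "t \<in> T" for t unfolding P_def by (rule someI_ex[OF ex[OF that]])
  \<comment> \<open>The coordinates give back z; its norm gives m, and the ideal it generates from
    the reference ideal gives g and b by \<open>ideal_lat_determines\<close>.\<close>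
  have inj: "inj_on P T"
  proof
    fix t t' assume t: "t \<in> T" "t' \<in> T" "P t = P t'"
    obtain z where z: "?I t = scaled (ideal_lat a0 b0) z" "z = real a0 * lin (\<theta> a0 (- b0)) (P t)" "\<bar>nrm z\<bar> = real a0 * real (fst t)"
      using P[OF t(1)] unfolding Q_def by blast
    obtain z' where z': "?I t' = scaled (ideal_lat a0 b0) z'" "z' = real a0 * lin (\<theta> a0 (- b0)) (P t')" "\<bar>nrm z'\<bar> = real a0 * real (fst t')"
      using P[OF t(2)] unfolding Q_def by blast
    have zz: "z = z'" using z(2) z'(2) t(3) by simp
    have "real (fst t) = real (fst t')" using z(3) z'(3) zz a0 by simp
    then have ff: "fst t = fst t'" by simp
    obtain m g b where tm: "t = (m, g, b)" by (cases t)
    obtain g' b' where tm': "t' = (m, g', b')" using ff tm by (cases t') auto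
    have ap: "m div g\<^sup>2 > 0" "g > 0" "g\<^sup>2 * (m div g\<^sup>2) = m" "m div g'\<^sup>2 > 0" "g' > 0" "g'\<^sup>2 * (m div g'\<^sup>2) = m"
      using apos[of m g b] apos[of m g' b'] t tm tm' by auto
    have "b \<in> root_set (int D) (m div g\<^sup>2)" "b' \<in> root_set (int D) (m div g'\<^sup>2)" using T(2) t tm tm' by blast+
    then have bb: "0 \<le> b" "b < 2 * int (m div g\<^sup>2)" "0 \<le> b'" "b' < 2 * int (m div g'\<^sup>2)" by (simp_all only: root_set_def mem_Collect_eq)
    have "?I t = ?I t'" using z(1) z'(1) zz by simp
    then have "scaled (ideal_lat (m div g\<^sup>2) b) (real (g * (m div g\<^sup>2))) = scaled (ideal_lat (m div g'\<^sup>2) b') (real (g' * (m div g'\<^sup>2)))"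
      unfolding tm tm' by simp
    then have "g = g' \<and> b = b'"
      using ap bb by (intro ideal_lat_determines[of g g' "m div g\<^sup>2" "m div g'\<^sup>2"]) auto
    then show "t = t'" by (simp add: tm tm')
  qed
  have dif: "\<bar>cj (\<theta> a0 (- b0)) - \<theta> a0 (- b0)\<bar> = s / real a0"
    using \<theta>_det[of a0 "- b0"] s_pos by (simp add: abs_minus_commute)
  have "real (card (P ` T)) \<le> real J * (1 + 2 * sqrt (2 * (real X / real a0) / (1 / real a0)) + 32 * (real X / real a0) / \<bar>cj (\<theta> a0 (- b0)) - \<theta> a0 (- b0)\<bar>)"
  proof (rule card_lattice_annulus_le)
    show "finite (P ` T)" using T(1) by simp
    show "0 < 1 / real a0" "0 < real X / real a0" using a0 X by simp_all
    show "0 < \<bar>cj (\<theta> a0 (- b0)) - \<theta> a0 (- b0)\<bar>" unfolding dif using s_pos a0 by simp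
    show "1 / real a0 \<le> \<bar>lin (\<theta> a0 (- b0)) p * lin (cj (\<theta> a0 (- b0))) p\<bar>" if "p \<noteq> 0" for p
      by (rule lin_norm_lower_bound[OF a0 dvd0 that])
    fix p assume "p \<in> P ` T"
    then obtain t where t: "t \<in> T" "p = P t" by blast
    obtain z where z: "z = real a0 * lin (\<theta> a0 (- b0)) p" "cj z = real a0 * lin (cj (\<theta> a0 (- b0))) p"
      "\<bar>cj z\<bar> \<le> \<bar>z\<bar>" "\<bar>z\<bar> < 2 ^ J * \<bar>cj z\<bar>" "\<bar>nrm z\<bar> = real a0 * real (fst t)"
      using P[OF t(1)] unfolding Q_def t(2) by blast
    have "real a0 * \<bar>lin (cj (\<theta> a0 (- b0))) p\<bar> \<le> real a0 * \<bar>lin (\<theta> a0 (- b0)) p\<bar>"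
      using z(3) unfolding z(2) by (subst (asm) z(1)) (simp add: abs_mult)
    moreover have "real a0 * \<bar>lin (\<theta> a0 (- b0)) p\<bar> < real a0 * (2 ^ J * \<bar>lin (cj (\<theta> a0 (- b0))) p\<bar>)"
      using z(4) unfolding z(2) by (subst (asm) z(1)) (simp add: abs_mult mult.left_commute)
    moreover have "\<bar>lin (\<theta> a0 (- b0)) p * lin (cj (\<theta> a0 (- b0))) p\<bar> \<le> real X / real a0"
    proof -
      have "\<bar>z * cj z\<bar> = real a0 * real (fst t)" using z(5) by (simp add: nrm_def)
      then have "real a0 * (real a0 * \<bar>lin (\<theta> a0 (- b0)) p * lin (cj (\<theta> a0 (- b0))) p\<bar>) = real a0 * real (fst t)"
        unfolding z(2) by (subst (asm) z(1)) (simp add: abs_mult mult.left_commute mult.assoc)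
      then have "real a0 * \<bar>lin (\<theta> a0 (- b0)) p * lin (cj (\<theta> a0 (- b0))) p\<bar> = real (fst t)" using a0 by simp
      also have "\<dots> \<le> real X" using T(2) t(1) by (cases t) auto
      finally show ?thesis using a0 by (simp add: pos_le_divide_eq mult.commute)
    qed
    ultimately show "\<bar>lin (cj (\<theta> a0 (- b0))) p\<bar> \<le> \<bar>lin (\<theta> a0 (- b0)) p\<bar> \<and>
        \<bar>lin (\<theta> a0 (- b0)) p\<bar> < 2 ^ J * \<bar>lin (cj (\<theta> a0 (- b0))) p\<bar> \<and>
        \<bar>lin (\<theta> a0 (- b0)) p * lin (cj (\<theta> a0 (- b0))) p\<bar> \<le> real X / real a0"
      using a0 by simp
  qed
  also have "2 * (real X / real a0) / (1 / real a0) = 2 * real X" using a0 by simp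
  also have "32 * (real X / real a0) / \<bar>cj (\<theta> a0 (- b0)) - \<theta> a0 (- b0)\<bar> = 32 * real X / s"
    unfolding dif using a0 s_pos by simp
  finally show ?thesis using card_image[OF inj] by simp
qed

text \<open>Ideals of norm at most X and prime to 2 D are sorted by class. Once X \<ge> D, both 1
  and sqrt X are at most X / s, so the bound of \<open>card_class_le\<close> is at most J (1 + 3 +
  32) X / s per class; this is the 36. Comparison with the density of such ideals gives the
  claim.\<close>

theorem class_number_ge:
  assumes e: "e \<in> OR" "\<bar>nrm e\<bar> = 1" "1 < e" "e\<^sup>2 \<le> 2 ^ J"
  shows "lfun (chi D) 1 / (2 * ln (2 * real D) + 1) \<le> real (card (carrier (class_group QO))) * (36 * real J / s)"
proof (rule lfun_chi_le_norm_count_density[OF pos nonsquare, where ?X0.0 = D])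
  fix X assume XD: "D \<le> X"
  have X: "X > 0" using XD pos by simp
  define S where "S = {m \<in> {1..X}. coprime m (2 * D)}"
  define T where "T = (SIGMA m:S. SIGMA g:{g. g\<^sup>2 dvd m}. root_set (int D) (m div g\<^sup>2))"
  have mS: "m > 0" "m \<le> X" "coprime m (2 * D)" if "m \<in> S" for m using that by (auto simp: S_def)
  have finT: "finite T" unfolding T_def
    by (intro finite_SigmaI) (auto simp: S_def intro!: finite_square_divisors)
  have "real (\<Sum>m\<in>S. norm_count (int D) m) \<le> real (card T)"
  proof -
    have "(\<Sum>m\<in>S. norm_count (int D) m) \<le> (\<Sum>m\<in>S. card (SIGMA g:{g. g\<^sup>2 dvd m}. root_set (int D) (m div g\<^sup>2)))"
    proof (rule sum_mono)
      fix m assume m: "m \<in> S"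
      have "norm_count (int D) m \<le> (\<Sum>g | g\<^sup>2 dvd m. card (root_set (int D) (m div g\<^sup>2)))"
        unfolding norm_count_def
      proof (rule sum_mono)
        fix g assume "g \<in> {g. g\<^sup>2 dvd m}"
        then obtain a where a: "m = g\<^sup>2 * a" by blast
        have "odd m" using mS(3)[OF m] by simp
        then have "odd (m div g\<^sup>2)" unfolding a using a mS(1)[OF m] by auto
        moreover have "int D mod 4 = 0 \<or> int D mod 4 = 1" using mod4 by presburger
        ultimately show "card (sqrts_mod (int D) (m div g\<^sup>2)) \<le> card (root_set (int D) (m div g\<^sup>2))"
          by (rule card_sqrts_mod_le_root_set)
      qed
      then show "norm_count (int D) m \<le> card (SIGMA g:{g. g\<^sup>2 dvd m}. root_set (int D) (m div g\<^sup>2))"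
        using finite_square_divisors[OF mS(1)[OF m]] by simp
    qed
    also have "\<dots> = card T" unfolding T_def
      by (subst card_SigmaI) (auto simp: S_def intro!: finite_SigmaI finite_square_divisors)
    finally show ?thesis by (simp only: of_nat_le_iff)
  qed
  also have "real (card T) \<le> real (card (carrier (class_group QO))) * (real J * (1 + 2 * sqrt (2 * real X) + 32 * real X / s))"
  proof -
    define \<kappa> where "\<kappa> = (\<lambda>(m, g, b). ideal_class (ideal_lat (m div g\<^sup>2) b))"
    have \<kappa>_in: "\<kappa> ` T \<subseteq> carrier (class_group QO)"
    proof
      fix c assume "c \<in> \<kappa> ` T"
      then obtain m g b where t: "(m, g, b) \<in> T" "c = ideal_class (ideal_lat (m div g\<^sup>2) b)" by (auto simp: \<kappa>_def)
      have m: "m \<in> S" "g\<^sup>2 dvd m" "b \<in> root_set (int D) (m div g\<^sup>2)" using t(1) by (auto simp: T_def)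
      obtain a where a: "m = g\<^sup>2 * a" using m(2) by blast
      have a0: "a > 0" "g > 0" using a mS(1)[OF m(1)] by (auto intro!: Nat.gr0I)
      have ma: "m div g\<^sup>2 = a" using a a0 by simp
      have dvd: "4 * int a dvd b\<^sup>2 - int D" using m(3) unfolding ma root_set_def by simp
      have "coprime a (2 * D)" using mS(3)[OF m(1)] unfolding a by simp
      then have aD: "coprime (int a) (int D)" by simp
      \<comment> \<open>A common divisor of a and b divides D by the congruence for b, while a is
        prime to D.\<close>
      have "coprime (int a) b"
      proof (rule coprimeI)
        fix d assume d: "d dvd int a" "d dvd b"
        have "int a dvd b\<^sup>2 - int D" using dvd by (rule dvd_trans[rotated]) simp
        then have "d dvd b\<^sup>2 - int D" using d(1) dvd_trans by blast
        moreover have "d dvd b\<^sup>2" using d(2) by (simp add: power2_eq_square)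
        ultimately have "d dvd b\<^sup>2 - (b\<^sup>2 - int D)" by (rule dvd_diff[rotated])
        then have "d dvd int D" by simp
        then show "is_unit d" using aD d(1) by (rule coprime_common_divisor[rotated 2])
      qed
      then show "c \<in> carrier (class_group QO)"
        unfolding class_group_carrier t(2) ma using invertible_ideal_lat[OF a0(1) dvd] by blast
    qed
    have "card T = card (\<Union>c\<in>\<kappa> ` T. {t \<in> T. \<kappa> t = c})" by (rule arg_cong) blast
    also have "\<dots> \<le> (\<Sum>c\<in>\<kappa> ` T. card {t \<in> T. \<kappa> t = c})" using finT by (intro card_UN_le) simp
    finally have "card T \<le> (\<Sum>c\<in>\<kappa> ` T. card {t \<in> T. \<kappa> t = c})" .
    then have "real (card T) \<le> (\<Sum>c\<in>\<kappa> ` T. real (card {t \<in> T. \<kappa> t = c}))" by (simp flip: of_nat_sum)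
    also have "\<dots> \<le> (\<Sum>c\<in>\<kappa> ` T. real J * (1 + 2 * sqrt (2 * real X) + 32 * real X / s))"
    proof (rule sum_mono)
      fix c
      show "real (card {t \<in> T. \<kappa> t = c}) \<le> real J * (1 + 2 * sqrt (2 * real X) + 32 * real X / s)"
      proof (rule card_class_le[OF e _ _ _ X])
        show "finite {t \<in> T. \<kappa> t = c}" using finT by simp
        show "m > 0 \<and> m \<le> X \<and> g\<^sup>2 dvd m \<and> b \<in> root_set (int D) (m div g\<^sup>2)" if "(m, g, b) \<in> {t \<in> T. \<kappa> t = c}" for m g b
          using that mS by (auto simp: T_def)
        show "ideal_class (ideal_lat (m div g\<^sup>2) b) = ideal_class (ideal_lat (m' div g'\<^sup>2) b')"
          if "(m, g, b) \<in> {t \<in> T. \<kappa> t = c}" "(m', g', b') \<in> {t \<in> T. \<kappa> t = c}" for m g b m' g' b'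
          using that by (simp add: \<kappa>_def)
      qed
    qed
    also have "\<dots> = real (card (\<kappa> ` T)) * (real J * (1 + 2 * sqrt (2 * real X) + 32 * real X / s))" by simp
    also have "\<dots> \<le> real (card (carrier (class_group QO))) * (real J * (1 + 2 * sqrt (2 * real X) + 32 * real X / s))"
      using card_mono[OF class_group_finite_card_le(1) \<kappa>_in] s_pos
      by (intro mult_right_mono mult_nonneg_nonneg add_nonneg_nonneg) auto
    finally show ?thesis .
  qed
  also have "\<dots> \<le> real (card (carrier (class_group QO))) * (real J * (36 * (real X / s)))"
  proof (intro mult_left_mono)
    have sD: "s * s \<le> real X" unfolding s_sq using XD by simp
    have D1: "1 \<le> real D" using pos by simp
    have s1: "1 \<le> s" unfolding s_def using D1 by simp
    have "s \<le> s * s" using s1 by simp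
    then have "s \<le> real X" using sD by linarith
    then have 1: "1 \<le> real X / s" using s_pos by simp
    have "s \<le> sqrt (real X)" using sD by (intro real_le_rsqrt) (simp add: power2_eq_square)
    then have "sqrt (real X) * s \<le> sqrt (real X) * sqrt (real X)" by (intro mult_left_mono) auto
    then have 2: "sqrt (real X) \<le> real X / s" using s_pos by (simp add: pos_le_divide_eq)
    have "sqrt 2 \<le> 3 / 2" by (intro real_le_lsqrt) (auto simp: power2_eq_square)
    then have "sqrt (2 * real X) \<le> 3 / 2 * sqrt (real X)" unfolding real_sqrt_mult by (intro mult_right_mono) auto
    then have "1 + 2 * sqrt (2 * real X) + 32 * (real X / s) \<le> 36 * (real X / s)" using 1 2 by linarith
    then show "1 + 2 * sqrt (2 * real X) + 32 * real X / s \<le> 36 * (real X / s)" by simp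
  qed auto
  also have "\<dots> = real (card (carrier (class_group QO))) * (36 * real J / s) * real X" by simp
  finally show "real (\<Sum>m\<in>{m \<in> {1..X}. coprime m (2 * D)}. norm_count (int D) m) \<le> real (card (carrier (class_group QO))) * (36 * real J / s) * real X"
    by (simp add: S_def)
qed

end

section \<open>The class numbers of discriminant \<open>n\<^sup>2 \<plusminus> 4\<close>\<close>

lemma ln_2_ge_half: "1 / 2 \<le> ln (2::real)"
proof -
  have "exp (1 / 2) ^ 2 = exp (1::real)" by (simp flip: exp_of_nat_mult)
  also have "\<dots> \<le> 2 ^ 2" using exp_le by simp
  finally have "exp (1 / 2) \<le> (2::real)" by (rule power2_le_imp_le) simp
  then show ?thesis by (subst ln_ge_iff) auto
qed

context quad_disc
begin

lemma ge_5: "5 \<le> D"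
proof (rule ccontr)
  assume "\<not> 5 \<le> D"
  then have "D = 1 \<or> D = 2 \<or> D = 3 \<or> D = 4" using pos by linarith
  moreover have "D \<noteq> 2\<^sup>2" "D \<noteq> 1\<^sup>2" using nonsquare is_nth_power_nth_power by metis+
  ultimately show False using mod4 by auto
qed

text \<open>(n + s) / 2 has norm (n^2 - D) / 4 = -\<epsilon> / 4, and it lies in the order because n
  and D have the same parity.\<close>

lemma near_square_unit:
  assumes n: "n > 0" and D: "int D = (int n)\<^sup>2 + \<epsilon>" and \<epsilon>: "\<bar>\<epsilon>\<bar> = 4"
  obtains e where "e \<in> OR" "\<bar>nrm e\<bar> = 1" "1 < e" "e \<le> real n + 2" "real n / 2 \<le> s" "s \<le> real n + 2"
proof -
  have \<epsilon>4: "\<epsilon> = 4 \<or> \<epsilon> = -4" using \<epsilon> by linarith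
  have rD: "real D = (real n)\<^sup>2 + of_int \<epsilon>" using arg_cong[OF D, of real_of_int] by simp
  have s_up: "s \<le> real n + 2"
    unfolding s_def rD using \<epsilon>4 by (intro real_le_lsqrt) (auto simp: power2_eq_square algebra_simps)
  have s_lo: "real n / 2 \<le> s"
  proof -
    have "(real n / 2)\<^sup>2 \<le> real D"
    proof (cases "n \<ge> 3")
      case True
      then have "3 * 3 \<le> real n * real n" by (intro mult_mono) auto
      then show ?thesis unfolding rD using \<epsilon>4 by (auto simp: power2_eq_square)
    next
      case False
      then have "(real n / 2)\<^sup>2 \<le> 1\<^sup>2" by (intro power_mono) auto
      then show ?thesis using pos by simp
    qed
    then show ?thesis unfolding s_def by (rule real_le_rsqrt)
  qed
  have s2: "2 < s" unfolding s_def using ge_5 by (intro real_less_rsqrt) auto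
  define e where "e = (real n + s) / 2"
  have "even (int n - int D)" using D \<epsilon>4 by auto
  then obtain k where k: "int n - int D = 2 * k" by blast
  have "real n - real D = 2 * of_int k" using arg_cong[OF k, of real_of_int] by simp
  then have "e = of_int k + of_int 1 * w" by (simp add: e_def w_def field_simps)
  then have "e \<in> OR" using ORI by metis
  moreover have "\<bar>nrm e\<bar> = 1"
  proof -
    have "nrm e = nrm (real n / 2 + (1 / 2) * s)" by (simp add: e_def add_divide_distrib)
    also have "\<dots> = (real n / 2)\<^sup>2 - real D * (1 / 2)\<^sup>2" by (rule nrm_eq) auto
    also have "\<dots> = - of_int \<epsilon> / 4" unfolding rD by (simp add: power2_eq_square field_simps)
    finally show ?thesis using \<epsilon>4 by auto
  qed
  moreover have "1 < e" "e \<le> real n + 2" using s2 s_up n by (auto simp: e_def)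
  ultimately show ?thesis using that s_lo s_up by blast
qed

text \<open>The shift 20 makes L \<ge> 2, so that additive constants can be absorbed into multiples
  of L. In the lower bound 2160 = 6 * 360: 2 ln (2 D) + 1 \<le> 6 L, and J \<le> 5 L with s \<ge> n
  / 2 gives 36 * 5 * 2 = 360. In the upper bound Y \<le> 2 n and 1 + ln Y \<le> 2 L.\<close>

theorem near_square_class_number_bounds:
  assumes n: "n > 0" and D: "int D = (int n)\<^sup>2 + \<epsilon>" and \<epsilon>: "\<bar>\<epsilon>\<bar> = 4"
  defines "h \<equiv> real (card (carrier (class_group QO)))" and "L \<equiv> ln (real n + 20)"
  shows "lfun (chi D) 1 * real n / (2160 * L\<^sup>2) \<le> h" "h \<le> 8 * real n * L\<^sup>2"
    and "real D \<le> (real n + 2)\<^sup>2" "2 \<le> L" "ln (real n + 2) \<le> L"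
proof -
  obtain e where e: "e \<in> OR" "\<bar>nrm e\<bar> = 1" "1 < e" "e \<le> real n + 2" and s: "real n / 2 \<le> s" "s \<le> real n + 2"
    using near_square_unit[OF n D \<epsilon>] .
  have "exp 1 ^ 2 \<le> (3::real) ^ 2" using exp_le by (intro power_mono) auto
  then have "exp 2 \<le> real n + 20" by (simp flip: exp_of_nat_mult)
  then show L: "2 \<le> L" unfolding L_def by (subst ln_ge_iff) auto
  show lnL: "ln (real n + 2) \<le> L" unfolding L_def by simp
  have "s\<^sup>2 \<le> (real n + 2)\<^sup>2" using s(2) s_pos by (intro power_mono) auto
  then show DL: "real D \<le> (real n + 2)\<^sup>2" unfolding s_sq2 .
  have l2': "ln (2::real) \<le> 1" using ln_le_minus_one[of "2::real"] by simp
  define J where "J = nat \<lceil>2 * log 2 (real n + 2)\<rceil>"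
  have J: "2 * log 2 (real n + 2) \<le> real J" by (simp add: J_def real_nat_ceiling_ge)
  have "0 < log 2 (real n + 2)" using n by simp
  then have "real J \<le> 2 * log 2 (real n + 2) + 1" unfolding J_def by linarith
  also have "log 2 (real n + 2) \<le> L / ln 2" unfolding log_def using lnL by (intro divide_right_mono) auto
  also have "L / ln 2 \<le> L / (1 / 2)" using ln_2_ge_half L by (intro divide_left_mono) auto
  finally have J4: "real J \<le> 5 * L" using L by simp
  have "e\<^sup>2 \<le> (real n + 2)\<^sup>2" using e by (intro power_mono) auto
  also have "\<dots> = 2 powr (2 * log 2 (real n + 2))"
  proof -
    have "2 powr (2 * log 2 (real n + 2)) = (2 powr log 2 (real n + 2)) powr 2" by (simp only: powr_powr mult.commute)
    then show ?thesis by simp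
  qed
  also have "\<dots> \<le> 2 powr real J" using J by (intro powr_mono) auto
  finally have eJ: "e\<^sup>2 \<le> 2 ^ J" by (simp add: powr_realpow)
  have lower: "lfun (chi D) 1 / (2 * ln (2 * real D) + 1) \<le> h * (36 * real J / s)"
    unfolding h_def by (rule class_number_ge[OF e(1-3) eJ])
  have l0: "0 \<le> lfun (chi D) 1" by (rule lfun_1_nonneg[OF quad_char_chi bounded_char_chi[OF pos nonsquare]])
  have lD: "ln (2 * real D) \<le> 1 + 2 * L"
  proof -
    have "ln (real D) \<le> ln ((real n + 2)\<^sup>2)" using DL pos by simp
    also have "\<dots> = 2 * ln (real n + 2)" by (simp add: ln_realpow)
    finally show ?thesis using pos l2' lnL by (simp add: ln_mult)
  qed
  have lD0: "0 \<le> ln (2 * real D)" using pos by simp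
  have "lfun (chi D) 1 / (6 * L) \<le> lfun (chi D) 1 / (2 * ln (2 * real D) + 1)"
    using l0 lD lD0 L by (intro divide_left_mono mult_pos_pos) auto
  also note lower
  also have "h * (36 * real J / s) \<le> h * (36 * (5 * L) / (real n / 2))"
    using J4 s n L s_pos by (intro mult_left_mono frac_le) (auto simp: h_def)
  finally show "lfun (chi D) 1 * real n / (2160 * L\<^sup>2) \<le> h"
    using L n by (simp add: field_simps power2_eq_square)
  define Y where "Y = nat \<lfloor>s / 2\<rfloor>"
  have "2 < s" unfolding s_def using ge_5 by (intro real_less_rsqrt) auto
  then have Y1: "1 \<le> Y" unfolding Y_def by (simp add: le_nat_iff le_floor_iff)
  have "real Y \<le> s / 2" unfolding Y_def using s_pos of_int_floor_le[of "s / 2"] by simp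
  then have Yn: "real Y \<le> 2 * real n" "real Y \<le> real n + 20" using s n by auto
  have "ln (real Y) \<le> L" unfolding L_def using Yn(2) Y1 by simp
  then have lY: "1 + ln (real Y) \<le> 2 * L" using L by simp
  have "h \<le> real (\<Sum>a=1..Y. card (root_set (int D) a))"
    unfolding h_def Y_def of_nat_le_iff by (rule class_group_finite_card_le(2))
  also have "\<dots> \<le> real Y * (1 + ln (real Y))\<^sup>2" by (rule sum_card_root_set_le[OF Y1])
  also have "\<dots> \<le> (2 * real n) * (2 * L)\<^sup>2" using Yn lY Y1 by (intro mult_mono power_mono) auto
  finally show "h \<le> 8 * real n * L\<^sup>2" by (simp add: power2_eq_square)
qed

text \<open>Common to both parts of the theorem: \<open>l\<close> is either Siegel's bound or the
  explicit one. The 12 bounds ln 2160, since 2160 \<le> 2^12 \<le> exp 12.\<close>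

corollary near_square_ln_class_number:
  assumes n: "n > 0" and D: "int D = (int n)\<^sup>2 + \<epsilon>" and \<epsilon>: "\<bar>\<epsilon>\<bar> = 4"
    and l: "0 < l" "l \<le> lfun (chi D) 1"
  shows "\<bar>ln (real (card (carrier (class_group QO)))) - ln (real n)\<bar> \<le> 12 + 2 * ln (ln (real n + 20)) + \<bar>ln l\<bar>"
proof -
  note B = near_square_class_number_bounds[OF n D \<epsilon>]
  define h where "h = real (card (carrier (class_group QO)))"
  define L where "L = ln (real n + 20)"
  have L: "2 \<le> L" using B(4) by (simp add: L_def)
  have n0: "0 < real n" using n by simp
  have "l * real n / (2160 * L\<^sup>2) \<le> lfun (chi D) 1 * real n / (2160 * L\<^sup>2)"
    using l by (intro divide_right_mono mult_right_mono) auto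
  also have "\<dots> \<le> h" using B(1) by (simp add: h_def L_def)
  finally have lo: "l * real n / (2160 * L\<^sup>2) \<le> h" .
  have p: "0 < l * real n / (2160 * L\<^sup>2)" using l n0 L by simp
  have h0: "0 < h" using p lo by linarith
  have hi: "h \<le> 8 * real n * L\<^sup>2" using B(2) by (simp add: h_def L_def)
  have "2 ^ 12 \<le> exp (1::real) ^ 12" using exp_ge_add_one_self[of "1::real"] by (intro power_mono) auto
  also have "\<dots> = exp 12" by (simp flip: exp_of_nat_mult)
  finally have "ln (2160::real) \<le> ln (exp 12)" by (subst ln_le_cancel_iff) auto
  then have c: "ln (2160::real) \<le> 12" by simp
  have c': "ln (8::real) \<le> ln 2160" by simp
  have "ln (l * real n / (2160 * L\<^sup>2)) \<le> ln h" using p lo h0 by simp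
  moreover have "ln (l * real n / (2160 * L\<^sup>2)) = ln l + ln (real n) - ln 2160 - 2 * ln L"
    using l n0 L by (simp add: ln_div ln_mult ln_realpow)
  moreover have "ln h \<le> ln (8 * real n * L\<^sup>2)" using hi h0 n0 L by simp
  moreover have "ln (8 * real n * L\<^sup>2) = ln 8 + ln (real n) + 2 * ln L"
    using n0 L by (simp add: ln_mult ln_realpow)
  moreover have "- \<bar>ln l\<bar> \<le> ln l" "0 \<le> \<bar>ln l\<bar>" by simp_all
  ultimately have "\<bar>ln h - ln (real n)\<bar> \<le> 12 + 2 * ln L + \<bar>ln l\<bar>" using c c' unfolding abs_le_iff by linarith
  then show ?thesis by (simp add: h_def L_def)
qed

end

section \<open>The discriminants next to squares\<close>

lemma not_is_square_near_square:
  fixes \<epsilon> :: int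
  assumes n: "n \<ge> 3" and \<epsilon>: "\<bar>\<epsilon>\<bar> = 4"
  shows "\<not> is_square ((int n)\<^sup>2 + \<epsilon>)"
proof
  assume "is_square ((int n)\<^sup>2 + \<epsilon>)"
  then obtain t where "(int n)\<^sup>2 + \<epsilon> = t\<^sup>2" by (rule is_nth_powerE)
  then have m: "(int n)\<^sup>2 + \<epsilon> = \<bar>t\<bar>\<^sup>2" by simp
  have "\<bar>t\<bar> \<noteq> int n"
  proof
    assume "\<bar>t\<bar> = int n"
    then have "(int n)\<^sup>2 + \<epsilon> = (int n)\<^sup>2" using m by (simp only:)
    then show False using \<epsilon> by simp
  qed
  \<comment> \<open>The neighbouring squares are at distance at least 2 n - 1 \<ge> 5 from n^2, more
    than 4.\<close>
  then consider "\<bar>t\<bar> + 1 \<le> int n" | "int n + 1 \<le> \<bar>t\<bar>" by linarith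
  then show False
  proof cases
    case 1
    then have "\<bar>t\<bar>\<^sup>2 \<le> (int n - 1)\<^sup>2" by (intro power_mono) auto
    also have "\<dots> = (int n)\<^sup>2 - 2 * int n + 1" by (simp add: power2_eq_square algebra_simps)
    finally show False using m \<epsilon> n by linarith
  next
    case 2
    then have "(int n + 1)\<^sup>2 \<le> \<bar>t\<bar>\<^sup>2" by (intro power_mono) auto
    moreover have "(int n + 1)\<^sup>2 = (int n)\<^sup>2 + 2 * int n + 1" by (simp add: power2_eq_square algebra_simps)
    ultimately show False using m \<epsilon> n by linarith
  qed
qed

lemma is_square_int_iff: "is_square (int m) \<longleftrightarrow> is_square m"
proof
  assume "is_square (int m)"
  then obtain t where "int m = t\<^sup>2" by (rule is_nth_powerE)
  then have "int m = int ((nat \<bar>t\<bar>)\<^sup>2)" by simp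
  then have "m = (nat \<bar>t\<bar>)\<^sup>2" by (simp only: of_nat_eq_iff)
  then show "is_square m" by simp
next
  assume "is_square m"
  then obtain t where "m = t\<^sup>2" by (rule is_nth_powerE)
  then have "int m = (int t)\<^sup>2" by simp
  then show "is_square (int m)" by simp
qed

lemma quad_disc_nat:
  assumes "quadratic_discriminant \<Delta>" "\<Delta> > 0"
  shows "quad_disc (nat \<Delta>)"
proof
  show "nat \<Delta> > 0" using assms by simp
  show "\<not> is_square (nat \<Delta>)" using assms is_square_int_iff[of "nat \<Delta>"] by (simp add: quadratic_discriminant_def)
  define D where "D = nat \<Delta>"
  have "int D mod 4 = 0 \<or> int D mod 4 = 1" using assms by (simp add: D_def quadratic_discriminant_def)
  then have "D mod 4 = 0 \<or> D mod 4 = 1" by presburger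
  then show "nat \<Delta> mod 4 = 0 \<or> nat \<Delta> mod 4 = 1" by (simp add: D_def)
qed

lemma quadratic_discriminant_near_square:
  fixes \<epsilon> :: int
  assumes n: "n \<ge> 3" and \<epsilon>: "\<bar>\<epsilon>\<bar> = 4"
  shows "quadratic_discriminant ((int n)\<^sup>2 + \<epsilon>)" "(int n)\<^sup>2 + \<epsilon> > 0"
proof -
  have \<epsilon>4: "\<epsilon> = 4 \<or> \<epsilon> = -4" using \<epsilon> by linarith
  have "(int n)\<^sup>2 mod 4 = 0 \<or> (int n)\<^sup>2 mod 4 = 1"
  proof (cases "even n")
    case True
    then obtain k where "n = 2 * k" by blast
    then show ?thesis by (simp add: power_mult_distrib)
  next
    case False
    then show ?thesis using odd_square_times_mod_4[of "int n" 1] by simp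
  qed
  then have "((int n)\<^sup>2 + \<epsilon>) mod 4 = 0 \<or> ((int n)\<^sup>2 + \<epsilon>) mod 4 = 1" using \<epsilon>4 by presburger
  then show "quadratic_discriminant ((int n)\<^sup>2 + \<epsilon>)"
    using not_is_square_near_square[OF assms] by (simp add: quadratic_discriminant_def)
  have "3\<^sup>2 \<le> (int n)\<^sup>2" using n by (intro power_mono) auto
  then show "(int n)\<^sup>2 + \<epsilon> > 0" using \<epsilon>4 by auto
qed

text \<open>Siegel's exponent is taken as \<delta> / 4 because D is about n^2: the bound for L(1)
  then costs (\<delta> / 2) ln (n + 2) plus a constant, and the log log term fits into the remaining
  half for large n.\<close>

lemma near_square_asymptotics:
  fixes \<epsilon> :: int
  assumes \<epsilon>: "\<bar>\<epsilon>\<bar> = 4"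
  shows "(\<lambda>n::nat. ln (real (card (carrier (class_group (quadratic_order ((int n)\<^sup>2 + \<epsilon>)))))) - ln (real n))
            \<in> o(\<lambda>n. ln (real n))"
proof (rule landau_o.smallI)
  fix \<delta> :: real assume \<delta>: "0 < \<delta>"
  obtain c where c: "0 < c" "\<And>D. D > 0 \<Longrightarrow> \<not> is_square D \<Longrightarrow> c * real D powr -(\<delta> / 4) \<le> lfun (chi D) 1"
    using siegel_chi[of "\<delta> / 4"] \<delta> by auto
  have "((\<lambda>n::nat. (12 + 2 * ln (ln (real n + 20)) + \<bar>ln c\<bar> + \<delta> / 2 * ln (real n + 2)) / ln (real n)) \<longlongrightarrow> \<delta> / 2) at_top"
    by real_asymp
  then have "eventually (\<lambda>n::nat. (12 + 2 * ln (ln (real n + 20)) + \<bar>ln c\<bar> + \<delta> / 2 * ln (real n + 2)) / ln (real n) < \<delta>) at_top"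
    by (rule order_tendstoD) (use \<delta> in simp)
  then show "\<forall>\<^sub>F n in sequentially. norm (ln (real (card (carrier (class_group (quadratic_order ((int n)\<^sup>2 + \<epsilon>)))))) - ln (real n)) \<le> \<delta> * norm (ln (real n))"
    using eventually_ge_at_top[of 3]
  proof eventually_elim
    case (elim n)
    define \<Delta> where "\<Delta> = (int n)\<^sup>2 + \<epsilon>"
    note q = quadratic_discriminant_near_square[OF elim(2) \<epsilon>, folded \<Delta>_def]
    interpret quad_disc "nat \<Delta>" by (rule quad_disc_nat[OF q])
    have n: "n > 0" using elim(2) by simp
    have D: "int (nat \<Delta>) = (int n)\<^sup>2 + \<epsilon>" using q(2) by (simp add: \<Delta>_def)
    define l where "l = c * real (nat \<Delta>) powr -(\<delta> / 4)"
    have D0: "0 < real (nat \<Delta>)" using q(2) by simp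
    have l: "0 < l" "l \<le> lfun (chi (nat \<Delta>)) 1" using c(1) D0 c(2)[OF pos nonsquare] unfolding l_def by simp_all
    have "ln l = ln c - \<delta> / 4 * ln (real (nat \<Delta>))" using c(1) D0 by (simp add: l_def ln_mult ln_powr)
    moreover have "ln (real (nat \<Delta>)) \<le> ln ((real n + 2)\<^sup>2)"
      using near_square_class_number_bounds(3)[OF n D \<epsilon>] D0 by simp
    then have "\<delta> / 4 * ln (real (nat \<Delta>)) \<le> \<delta> / 4 * (2 * ln (real n + 2))"
      using \<delta> by (intro mult_left_mono) (auto simp: ln_realpow)
    moreover have "0 \<le> \<delta> / 4 * ln (real (nat \<Delta>))" using \<delta> pos by simp
    ultimately have "\<bar>ln l\<bar> \<le> \<bar>ln c\<bar> + \<delta> / 2 * ln (real n + 2)" by linarith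
    then have "\<bar>ln (real (card (carrier (class_group QO)))) - ln (real n)\<bar>
        \<le> 12 + 2 * ln (ln (real n + 20)) + \<bar>ln c\<bar> + \<delta> / 2 * ln (real n + 2)"
      using near_square_ln_class_number[OF n D \<epsilon> l] by linarith
    also have "\<dots> \<le> \<delta> * ln (real n)" using elim by (simp add: divide_less_eq split: if_splits)
    also have "int (nat \<Delta>) = (int n)\<^sup>2 + \<epsilon>" by (rule D)
    finally show ?case using n by simp
  qed
qed

text \<open>With \<Delta> = F^2 d and d \<le> N, \<open>lfun_1_ge_exp\<close> for B = 8 d costs 184
  d = 23 * 8 d after taking logarithms, and the factor F^2 costs ln (2 ln F + 1) \<le> 2 + ln L. The
  total 184 N + 14 + 3 ln L becomes a multiple of ln L because ln L \<ge> 1/2, which doubles the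
  constants and gives 368 N + 31.\<close>

lemma near_square_bounded_fundamental:
  assumes q: "quadratic_discriminant \<Delta>" "\<Delta> > 0" and D: "\<Delta> = (int n)\<^sup>2 + \<epsilon>" and \<epsilon>: "\<bar>\<epsilon>\<bar> = 4"
    and N: "associated_fundamental_discriminant \<Delta> \<le> int N"
  shows "\<bar>ln (real (card (carrier (class_group (quadratic_order \<Delta>))))) - ln (real n)\<bar>
      \<le> real (368 * N + 31) * ln (ln (real n + 20))"
proof -
  interpret quad_disc "nat \<Delta>" by (rule quad_disc_nat[OF q])
  have Dn: "int (nat \<Delta>) = (int n)\<^sup>2 + \<epsilon>" using q(2) D by simp
  have n: "n > 0"
  proof (rule ccontr)
    assume "\<not> n > 0"
    then have "\<Delta> = 2\<^sup>2" using D \<epsilon> q(2) by auto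
    then show False using q(1) is_nth_power_nth_power[of 2 "2::int"] unfolding quadratic_discriminant_def by metis
  qed
  define E where "E = associated_fundamental_discriminant \<Delta>"
  have "fundamental_discriminant E \<and> (\<exists>f. f > 0 \<and> \<Delta> = f\<^sup>2 * E)"
    unfolding E_def associated_fundamental_discriminant_def
    by (rule theI'[OF ex1_associated_fundamental_discriminant[OF q(1)]])
  then obtain f where f: "f > 0" "\<Delta> = f\<^sup>2 * E" by blast
  have E0: "E > 0" using f q(2) by (simp add: zero_less_mult_iff)
  define d where "d = nat E"
  define F where "F = nat f"
  have dF: "d > 0" "F > 0" using E0 f by (simp_all add: d_def F_def)
  have "int (nat \<Delta>) = int (F\<^sup>2 * d)" using f E0 q(2) by (simp add: d_def F_def)
  then have DF: "nat \<Delta> = F\<^sup>2 * d" by (simp only: of_nat_eq_iff)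
  have dsq: "\<not> is_square d"
  proof
    assume "is_square d"
    then obtain t where "d = t\<^sup>2" by (rule is_nth_powerE)
    then have "nat \<Delta> = (F * t)\<^sup>2" by (simp add: DF power_mult_distrib)
    then show False using nonsquare by simp
  qed
  have dN: "d \<le> N" using N by (simp add: d_def E_def)
  note B = near_square_class_number_bounds[OF n Dn \<epsilon>]
  define L where "L = ln (real n + 20)"
  have L: "2 \<le> L" using B(4) by (simp add: L_def)
  define l where "l = exp (- (23 * (8 * real d))) / (2 * ln (real F) + 1)"
  have F0: "0 \<le> ln (real F)" using dF by simp
  have l0: "0 < l" using F0 by (simp add: l_def)
  have "l \<le> lfun (chi d) 1 / (2 * ln (real F) + 1)"
    unfolding l_def using lfun_1_ge_exp[OF quad_char_chi bounded_char_chi[OF dF(1) dsq]] F0 by (intro divide_right_mono) auto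
  also have "\<dots> \<le> lfun (chi (nat \<Delta>)) 1" unfolding DF by (rule lfun_chi_square_mult_ge[OF dF(1) dsq dF(2)])
  finally have l: "l \<le> lfun (chi (nat \<Delta>)) 1" .
  have "(real F)\<^sup>2 \<le> (real F)\<^sup>2 * real d" using dF by simp
  also have "\<dots> = real (nat \<Delta>)" by (simp add: DF)
  also have "\<dots> \<le> (real n + 2)\<^sup>2" by (rule B(3))
  finally have "real F \<le> real n + 2" by (rule power2_le_imp_le) simp
  then have "ln (real F) \<le> L" using B(5) dF unfolding L_def by (smt (verit) ln_mono of_nat_0_less_iff)
  then have "2 * ln (real F) + 1 \<le> 3 * L" using L by simp
  then have "ln (2 * ln (real F) + 1) \<le> ln (3 * L)" using F0 L by simp
  also have "\<dots> = ln 3 + ln L" using L by (simp add: ln_mult)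
  also have "ln (3::real) \<le> 2" using ln_le_minus_one[of "3::real"] by simp
  finally have "ln (2 * ln (real F) + 1) \<le> 2 + ln L" by simp
  moreover have "0 \<le> ln (2 * ln (real F) + 1)" using F0 by simp
  moreover have "ln l = - (184 * real d) - ln (2 * ln (real F) + 1)" using F0 by (simp add: l_def ln_div)
  ultimately have "\<bar>ln l\<bar> \<le> 184 * real N + 2 + ln L" using dN by simp
  then have A: "\<bar>ln (real (card (carrier (class_group QO)))) - ln (real n)\<bar> \<le> 184 * real N + 14 + 3 * ln L"
    using near_square_ln_class_number[OF n Dn \<epsilon> l0 l] unfolding L_def by simp
  have "ln 2 \<le> ln L" using L by simp
  then have l1: "1 / 2 \<le> ln L" using ln_2_ge_half by simp
  then have "(368 * real N + 28) * (1 / 2) \<le> (368 * real N + 28) * ln L" by (intro mult_left_mono) auto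
  then have "184 * real N + 14 + 3 * ln L \<le> real (368 * N + 31) * ln L" by (simp add: algebra_simps)
  with A show ?thesis using q(2) unfolding L_def by simp
qed

section \<open>Computability of the constant, and the theorem\<close>

lemma rec_eval_funpow_Succ:
  assumes "rec_eval g xs y"
  shows "rec_eval (((\<lambda>e. Rec_Comp Rec_Succ [e]) ^^ m) g) xs (y + m)"
proof (induction m)
  case 0
  then show ?case using assms by simp
next
  case (Suc m)
  have "rec_eval (Rec_Comp Rec_Succ [((\<lambda>e. Rec_Comp Rec_Succ [e]) ^^ m) g]) xs (Suc (y + m))"
    by (rule rec_eval.intros(4)[where ys = "[y + m]"]) (use Suc in \<open>auto intro: rec_eval.intros(2)\<close>)
  then show ?case by simp
qed

text \<open>Primitive recursion that starts at b and adds a to the previous value; the step receives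
  the counter and that value in this order, so \<open>Rec_Proj 1\<close> selects the value.\<close>

lemma computable_affine: "computable (\<lambda>N. a * N + b)"
proof -
  let ?add = "\<lambda>m. (\<lambda>e. Rec_Comp Rec_Succ [e]) ^^ m"
  have "rec_eval (Rec_Prim (?add b Rec_Zero) (?add a (Rec_Proj 1))) [N] (a * N + b)" for N
  proof (induction N)
    case 0
    show ?case using rec_eval_funpow_Succ[OF rec_eval.intros(1), of b "[]"] by (auto intro: rec_eval.intros(5))
  next
    case (Suc N)
    have "rec_eval (Rec_Proj 1) [N, a * N + b] (a * N + b)" using rec_eval.intros(3)[of 1 "[N, a * N + b]"] by simp
    from rec_eval_funpow_Succ[OF this, of a] have "rec_eval (?add a (Rec_Proj 1)) [N, a * N + b] (a * Suc N + b)"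
      by (simp add: algebra_simps)
    with Suc show ?case by (rule rec_eval.intros(6))
  qed
  then show ?thesis unfolding computable_def by blast
qed

theorem theorem3p3:
  shows "(\<lambda>n::nat. ln (real (card (carrier (class_group (quadratic_order ((int n)\<^sup>2 - 4)))))) - ln (real n))
            \<in> o(\<lambda>n. ln (real n)) \<and>
         (\<lambda>n::nat. ln (real (card (carrier (class_group (quadratic_order ((int n)\<^sup>2 + 4)))))) - ln (real n))
            \<in> o(\<lambda>n. ln (real n)) \<and>
         (\<exists>C :: nat \<Rightarrow> nat. computable C \<and>
           (\<forall>(N :: nat) (\<Delta> :: nat \<Rightarrow> int) (n :: nat \<Rightarrow> nat).
             (\<forall>i\<ge>1. quadratic_discriminant (\<Delta> i) \<and> \<Delta> i > 0 \<and>
                     unit_generated (quadratic_order (\<Delta> i)) \<and>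
                     (\<Delta> i = (int (n i))\<^sup>2 - 4 \<or> \<Delta> i = (int (n i))\<^sup>2 + 4) \<and>
                     associated_fundamental_discriminant (\<Delta> i) \<le> int N) \<and>
             filterlim n at_top sequentially \<longrightarrow>
             (\<forall>i\<ge>1. \<bar>ln (real (card (carrier (class_group (quadratic_order (\<Delta> i)))))) - ln (real (n i))\<bar>
                      \<le> real (C N) * ln (ln (real (n i) + 20)))))"
\<comment> \<open>The witness is the explicit constant of
  \<open>near_square_bounded_fundamental\<close>, an affine function of N.\<close>
proof (intro conjI exI[of _ "\<lambda>N. 368 * N + 31"] allI impI)
  show "(\<lambda>n::nat. ln (real (card (carrier (class_group (quadratic_order ((int n)\<^sup>2 - 4)))))) - ln (real n)) \<in> o(\<lambda>n. ln (real n))"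
    using near_square_asymptotics[of "-4"] by simp
  show "(\<lambda>n::nat. ln (real (card (carrier (class_group (quadratic_order ((int n)\<^sup>2 + 4)))))) - ln (real n)) \<in> o(\<lambda>n. ln (real n))"
    by (rule near_square_asymptotics) simp
  show "computable (\<lambda>N. 368 * N + 31)" by (rule computable_affine)
next
  fix N :: nat and \<Delta> :: "nat \<Rightarrow> int" and n :: "nat \<Rightarrow> nat" and i :: nat
  assume h: "(\<forall>i\<ge>1. quadratic_discriminant (\<Delta> i) \<and> \<Delta> i > 0 \<and>
                     unit_generated (quadratic_order (\<Delta> i)) \<and>
                     (\<Delta> i = (int (n i))\<^sup>2 - 4 \<or> \<Delta> i = (int (n i))\<^sup>2 + 4) \<and>
                     associated_fundamental_discriminant (\<Delta> i) \<le> int N) \<and> filterlim n at_top sequentially" and i: "1 \<le> i"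
  obtain \<epsilon> :: int where "\<Delta> i = (int (n i))\<^sup>2 + \<epsilon>" "\<bar>\<epsilon>\<bar> = 4"
  proof (cases "\<Delta> i = (int (n i))\<^sup>2 + 4")
    case True
    then show ?thesis using that[of 4] by simp
  next
    case False
    then show ?thesis using h i that[of "-4"] by auto
  qed
  then show "\<bar>ln (real (card (carrier (class_group (quadratic_order (\<Delta> i)))))) - ln (real (n i))\<bar>
      \<le> real (368 * N + 31) * ln (ln (real (n i) + 20))"
    using h i by (intro near_square_bounded_fundamental) auto
qed

end
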